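(* Let $(\mathsf H,\infty)$ be a canonical system on the semiaxis satisfying the compatibility condition (L) and such that $(b,\infty)$ is not contained in a singular interval for any $b>0$. Let $m$ be its Weyl–Titchmarsh function, and let $\mu$ be the measure in the Herglotz integral representation of $m$. For compactly supported $f\in H$ let $(\mathcal U f)(w)=\pi^{-1/2}\langle f,\Theta(\cdot,\overline w)\rangle_H$, $w\in\mathbb C$. Then the mapping $\mathcal U$ defines an isomorphism between $H$ and $L^2(\mathbb R,d\mu)$, that is, for any compactly supported $f\in H$ one has $\mathcal U f\in L^2(\mathbb R,d\mu)$ and $$\|f\|_H=\|\mathcal U f\|_{L^2(\mathbb R,d\mu)},$$ and the range of $\mathcal U$ is dense in $L^2(\mathbb R,d\mu)$. Moreover, let $A$ be the operator of multiplication by the independent variable in $L^2(\mathbb R,d\mu)$ and let $\overline{\mathcal U}$ be the closure of $\mathcal U$. Then $D=(\overline{\mathcal U})^*A\,\overline{\mathcal U}$.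
   Context: $J=\begin{pmatrix}0&-1\\1&0\end{pmatrix}$; for $Y\in\mathbb C^2$ write $Y=(Y_+,Y_-)^T$. A canonical system $(\mathsf H,\infty)$ is the equation $JY'=z\mathsf HY$ on $(0,\infty)$, where the Hamiltonian $\mathsf H$ is a measurable function on $(0,\infty)$ with values in real $2\times2$ matrices, $\mathsf H(x)\ge0$ a.e., normalized by $\operatorname{tr}\mathsf H(x)=1$ a.e. $\Theta(x,z)$ and $\Phi(x,z)$ are its solutions with $\Theta(0,z)=(1,0)^T$, $\Phi(0,z)=(0,1)^T$. An open interval $I\subset\mathbb R_+$ (possibly a semiaxis) is called singular ($\mathsf H$-indivisible) if there is $e\in\mathbb R^2$ with $\mathsf H(x)=\langle\cdot,e\rangle e$ for a.e. $x\in I$ and $I$ is maximal with this property. $L^2(\mathbb R_+;\mathsf H)$ is the Hilbert space (of equivalence classes) of $\mathbb C^2$-valued functions with scalar product $\langle f,g\rangle=\int_0^\infty\langle f(x),\mathsf H(x)g(x)\rangle_{\mathbb C^2}dx$, and $H$ is the closed subspace of those $f$ which on every singular interval coincide, as elements of the weighted space, with a constant vector. Compatibility condition (L): there is no $\varepsilon>0$ such that $\mathsf H(x)=\begin{pmatrix}0&0\\0&1\end{pmatrix}$ for a.e. $x\in(0,\varepsilon)$. $\mathcal D$ is the set of $f\in H$ having a (locally) absolutely continuous representative $f$ with $f_-(0)=0$ for which there is $g\in H$ with $Jf'=\mathsf Hg$. Under (L) and the assumption on the absence of a singular semiaxis, $D\colon f\mapsto g$ with domain $\mathcal D$ is a well-defined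 selfadjoint operator in $H$. Weyl–Titchmarsh function: for each $z\in\mathbb C\setminus\mathbb R$, $m(z)$ is the unique complex number such that $\Phi(\cdot,z)-m(z)\Theta(\cdot,z)\in H$; $m$ is a Herglotz function (analytic in $\mathbb C_+$ with nonnegative imaginary part). The measure $\mu$ is the one for which $\operatorname{Im}m(z)=\frac{\operatorname{Im}z}{\pi}\int_{\mathbb R}\frac{d\mu(t)}{(t-\operatorname{Re}z)^2+(\operatorname{Im}z)^2}+c\operatorname{Im}z$, $z\in\mathbb C_+$, with a constant $c\ge0$. *)

theory Defs
  imports "HOL-Analysis.Analysis"
begin

(* A vector (Y_+, Y_-) is Y :: complex^2 with Y_+ = Y $ 1 and Y_- = Y $ 2.  Functions on the
   half-line are total functions on real; their values outside {0..} are irrelevant. *)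

definition symplectic_J :: "complex^2^2" where
  "symplectic_J = vector [vector [0, -1], vector [1, 0]]"

(* A real 2x2 matrix acting on C^2. *)
definition mact :: "real^2^2 \<Rightarrow> complex^2 \<Rightarrow> complex^2" where
  "mact A v = map_matrix complex_of_real A *v v"

(* Scalar product of C^2, linear in the first argument. *)
definition cdot :: "complex^2 \<Rightarrow> complex^2 \<Rightarrow> complex" where
  "cdot u v = (\<Sum>i\<in>UNIV. u $ i * cnj (v $ i))"

definition hamiltonian :: "(real \<Rightarrow> real^2^2) \<Rightarrow> bool" where
  "hamiltonian Ham \<longleftrightarrow>
     Ham \<in> borel_measurable (lebesgue_on {0<..}) \<and>
     (AE x in lebesgue_on {0<..}.
        transpose (Ham x) = Ham x \<and> (\<forall>v. v \<bullet> (Ham x *v v) \<ge> 0)) \<and>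
     (AE x in lebesgue_on {0<..}. trace (Ham x) = 1)"

(* The usual epsilon-delta definition: the finitely many pairwise non-overlapping subintervals
   of {a..b} are the members of d, and {Inf k..Sup k} = k for k in d. *)
definition abs_continuous_on_interval :: "real \<Rightarrow> real \<Rightarrow> (real \<Rightarrow> complex^2) \<Rightarrow> bool" where
  "abs_continuous_on_interval a b f \<longleftrightarrow>
     (\<forall>\<epsilon>>0. \<exists>\<delta>>0. \<forall>d. d division_of \<Union>d \<and> \<Union>d \<subseteq> {a..b} \<and> (\<Sum>k\<in>d. Sup k - Inf k) < \<delta>
        \<longrightarrow> (\<Sum>k\<in>d. norm (f (Sup k) - f (Inf k))) < \<epsilon>)"

(* Local absolute continuity on the closed half-line, i.e. up to and including 0. *)
definition loc_abs_continuous :: "(real \<Rightarrow> complex^2) \<Rightarrow> bool" where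
  "loc_abs_continuous f \<longleftrightarrow> (\<forall>b\<ge>0. abs_continuous_on_interval 0 b f)"

(* Y solves J Y' = h on the half-line. *)
definition solves_J :: "(real \<Rightarrow> complex^2) \<Rightarrow> (real \<Rightarrow> complex^2) \<Rightarrow> bool" where
  "solves_J Y h \<longleftrightarrow> loc_abs_continuous Y \<and>
     (AE x in lebesgue_on {0<..}.
        \<exists>Y'. (Y has_vector_derivative Y') (at x) \<and> symplectic_J *v Y' = h x)"

definition canonical_solution ::
  "(real \<Rightarrow> real^2^2) \<Rightarrow> complex \<Rightarrow> complex^2 \<Rightarrow> (real \<Rightarrow> complex^2) \<Rightarrow> bool" where
  "canonical_solution Ham z v Y \<longleftrightarrow> Y 0 = v \<and> solves_J Y (\<lambda>x. z *s mact (Ham x) (Y x))"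

definition indivisible_on :: "(real \<Rightarrow> real^2^2) \<Rightarrow> real set \<Rightarrow> bool" where
  "indivisible_on Ham I \<longleftrightarrow>
     open I \<and> is_interval I \<and> I \<noteq> {} \<and> I \<subseteq> {0<..} \<and>
     (\<exists>e. AE x in lebesgue_on I. \<forall>v. Ham x *v v = (v \<bullet> e) *\<^sub>R e)"

definition singular_interval :: "(real \<Rightarrow> real^2^2) \<Rightarrow> real set \<Rightarrow> bool" where
  "singular_interval Ham I \<longleftrightarrow>
     indivisible_on Ham I \<and> (\<forall>K. indivisible_on Ham K \<and> I \<subseteq> K \<longrightarrow> K = I)"

(* Elements of the weighted space are represented by functions; f and g represent the same
   element over the set I iff this holds (for H(x) >= 0, the seminorm of f - g vanishes iff
   H (f - g) = 0 a.e.). *)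
definition weighted_eq ::
  "(real \<Rightarrow> real^2^2) \<Rightarrow> real set \<Rightarrow> (real \<Rightarrow> complex^2) \<Rightarrow> (real \<Rightarrow> complex^2) \<Rightarrow> bool" where
  "weighted_eq Ham I f g \<longleftrightarrow> (AE x in lebesgue_on I. mact (Ham x) (f x - g x) = 0)"

definition hinner ::
  "(real \<Rightarrow> real^2^2) \<Rightarrow> (real \<Rightarrow> complex^2) \<Rightarrow> (real \<Rightarrow> complex^2) \<Rightarrow> complex" where
  "hinner Ham f g = (LINT x|lebesgue_on {0<..}. cdot (f x) (mact (Ham x) (g x)))"

definition hnorm :: "(real \<Rightarrow> real^2^2) \<Rightarrow> (real \<Rightarrow> complex^2) \<Rightarrow> real" where
  "hnorm Ham f = sqrt (Re (hinner Ham f f))"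

definition weighted_L2 :: "(real \<Rightarrow> real^2^2) \<Rightarrow> (real \<Rightarrow> complex^2) set" where
  "weighted_L2 Ham = {f. f \<in> borel_measurable (lebesgue_on {0<..}) \<and>
     integrable (lebesgue_on {0<..}) (\<lambda>x. cdot (f x) (mact (Ham x) (f x)))}"

definition H_space :: "(real \<Rightarrow> real^2^2) \<Rightarrow> (real \<Rightarrow> complex^2) set" where
  "H_space Ham = {f \<in> weighted_L2 Ham.
     \<forall>I. singular_interval Ham I \<longrightarrow> (\<exists>c. weighted_eq Ham I f (\<lambda>x. c))}"

(* Compact support is understood in the closed half-line and for elements of the weighted space:
   some representative vanishes outside a bounded interval [0,b]. *)
definition H_compact :: "(real \<Rightarrow> real^2^2) \<Rightarrow> (real \<Rightarrow> complex^2) set" where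
  "H_compact Ham = {f \<in> H_space Ham. \<exists>b>0. weighted_eq Ham {b<..} f (\<lambda>x. 0)}"

definition condition_L :: "(real \<Rightarrow> real^2^2) \<Rightarrow> bool" where
  "condition_L Ham \<longleftrightarrow>
     \<not> (\<exists>\<epsilon>>0. AE x in lebesgue_on {0<..<\<epsilon>}. Ham x = vector [vector [0, 0], vector [0, 1]])"

(* Operators are represented by their graphs, as relations between representatives that are
   closed under passing to other representatives of the same elements. *)
definition canonical_operator ::
  "(real \<Rightarrow> real^2^2) \<Rightarrow> ((real \<Rightarrow> complex^2) \<times> (real \<Rightarrow> complex^2)) set" where
  "canonical_operator Ham = {(f, g). f \<in> H_space Ham \<and> g \<in> H_space Ham \<and>
     (\<exists>f0. weighted_eq Ham {0<..} f f0 \<and> f0 0 $ 2 = 0 \<and>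
       solves_J f0 (\<lambda>x. mact (Ham x) (g x)))}"

definition weyl_titchmarsh ::
  "(real \<Rightarrow> real^2^2) \<Rightarrow> (real \<Rightarrow> complex \<Rightarrow> complex^2) \<Rightarrow> (real \<Rightarrow> complex \<Rightarrow> complex^2) \<Rightarrow>
     (complex \<Rightarrow> complex) \<Rightarrow> bool" where
  "weyl_titchmarsh Ham \<Theta> \<Phi> m \<longleftrightarrow>
     (\<forall>z. z \<notin> \<real> \<longrightarrow> (\<forall>w. (\<lambda>x. \<Phi> x z - w *s \<Theta> x z) \<in> H_space Ham \<longleftrightarrow> w = m z))"

(* Integrability is required explicitly because a divergent integral would have the value 0. *)
definition herglotz_measure :: "(complex \<Rightarrow> complex) \<Rightarrow> real measure \<Rightarrow> bool" where
  "herglotz_measure m \<mu> \<longleftrightarrow> sets \<mu> = sets borel \<and>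
     (\<exists>c\<ge>0. \<forall>z. Im z > 0 \<longrightarrow>
        integrable \<mu> (\<lambda>t. 1 / ((t - Re z)\<^sup>2 + (Im z)\<^sup>2)) \<and>
        Im (m z) = Im z / pi * (LINT t|\<mu>. 1 / ((t - Re z)\<^sup>2 + (Im z)\<^sup>2)) + c * Im z)"

definition L2 :: "real measure \<Rightarrow> (real \<Rightarrow> complex) set" where
  "L2 \<mu> = {F. F \<in> borel_measurable \<mu> \<and> integrable \<mu> (\<lambda>t. (cmod (F t))\<^sup>2)}"

definition L2_inner :: "real measure \<Rightarrow> (real \<Rightarrow> complex) \<Rightarrow> (real \<Rightarrow> complex) \<Rightarrow> complex" where
  "L2_inner \<mu> F G = (LINT t|\<mu>. F t * cnj (G t))"

definition L2_norm :: "real measure \<Rightarrow> (real \<Rightarrow> complex) \<Rightarrow> real" where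
  "L2_norm \<mu> F = sqrt (LINT t|\<mu>. (cmod (F t))\<^sup>2)"

definition transform ::
  "(real \<Rightarrow> real^2^2) \<Rightarrow> (real \<Rightarrow> complex \<Rightarrow> complex^2) \<Rightarrow> (real \<Rightarrow> complex^2) \<Rightarrow> complex \<Rightarrow> complex"
  where
  "transform Ham \<Theta> f w = complex_of_real (1 / sqrt pi) * hinner Ham f (\<lambda>x. \<Theta> x (cnj w))"

definition transform_graph ::
  "(real \<Rightarrow> real^2^2) \<Rightarrow> (real \<Rightarrow> complex \<Rightarrow> complex^2) \<Rightarrow> real measure \<Rightarrow>
     ((real \<Rightarrow> complex^2) \<times> (real \<Rightarrow> complex)) set" where
  "transform_graph Ham \<Theta> \<mu> = {(f, F). f \<in> H_compact Ham \<and> F \<in> L2 \<mu> \<and>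
     (AE t in \<mu>. F t = transform Ham \<Theta> f (complex_of_real t))}"

(* The remaining notions are for relations T between H and L2(mu). *)

definition graph_closure ::
  "(real \<Rightarrow> real^2^2) \<Rightarrow> real measure \<Rightarrow> ((real \<Rightarrow> complex^2) \<times> (real \<Rightarrow> complex)) set \<Rightarrow>
     ((real \<Rightarrow> complex^2) \<times> (real \<Rightarrow> complex)) set" where
  "graph_closure Ham \<mu> T = {(f, F). f \<in> H_space Ham \<and> F \<in> L2 \<mu> \<and>
     (\<exists>g G. (\<forall>n::nat. (g n, G n) \<in> T) \<and>
        (\<lambda>n. hnorm Ham (\<lambda>x. g n x - f x)) \<longlonglongrightarrow> 0 \<and>
        (\<lambda>n. L2_norm \<mu> (\<lambda>t. G n t - F t)) \<longlonglongrightarrow> 0)}"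

definition graph_adjoint ::
  "(real \<Rightarrow> real^2^2) \<Rightarrow> real measure \<Rightarrow> ((real \<Rightarrow> complex^2) \<times> (real \<Rightarrow> complex)) set \<Rightarrow>
     ((real \<Rightarrow> complex) \<times> (real \<Rightarrow> complex^2)) set" where
  "graph_adjoint Ham \<mu> T = {(F, f). F \<in> L2 \<mu> \<and> f \<in> H_space Ham \<and>
     (\<forall>(g, G) \<in> T. L2_inner \<mu> G F = hinner Ham g f)}"

definition multiplication_operator ::
  "real measure \<Rightarrow> ((real \<Rightarrow> complex) \<times> (real \<Rightarrow> complex)) set" where
  "multiplication_operator \<mu> = {(F, G). F \<in> L2 \<mu> \<and> G \<in> L2 \<mu> \<and>
     (AE t in \<mu>. G t = complex_of_real t * F t)}"

(* T is the graph of a linear isometric map of H onto L2(mu), both modulo null functions. *)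
definition hilbert_isomorphism ::
  "(real \<Rightarrow> real^2^2) \<Rightarrow> real measure \<Rightarrow> ((real \<Rightarrow> complex^2) \<times> (real \<Rightarrow> complex)) set \<Rightarrow> bool" where
  "hilbert_isomorphism Ham \<mu> T \<longleftrightarrow>
     T \<subseteq> H_space Ham \<times> L2 \<mu> \<and>
     (\<forall>f\<in>H_space Ham. \<exists>F. (f, F) \<in> T) \<and>
     (\<forall>f F G. (f, F) \<in> T \<and> (f, G) \<in> T \<longrightarrow> (AE t in \<mu>. F t = G t)) \<and>
     (\<forall>f F g G. (f, F) \<in> T \<and> (g, G) \<in> T \<longrightarrow> (\<lambda>x. f x + g x, \<lambda>t. F t + G t) \<in> T) \<and>
     (\<forall>f F c. (f, F) \<in> T \<longrightarrow> (\<lambda>x. c *s f x, \<lambda>t. c * F t) \<in> T) \<and>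
     (\<forall>(f, F)\<in>T. hnorm Ham f = L2_norm \<mu> F) \<and>
     (\<forall>F\<in>L2 \<mu>. \<exists>f. (f, F) \<in> T)"

end

theory Submission
  imports Defs "HOL-Complex_Analysis.Conformal_Mappings" "HOL-Real_Asymp.Real_Asymp"
begin

text \<open>The Weyl solutions $\psi_z = \Phi_z - m(z) \Theta_z$ satisfy
  $(z - \bar w) \langle \psi_z, \psi_w \rangle = m(z) - \overline{m(w)}$ by Green's identity, whose boundary term at
  infinity vanishes. The Herglotz representation turns the right-hand side into
  $(z - \bar w) \langle k_z, k_w \rangle$ in $L^2(\mu)$ with $k_z(t) = 1 / (\sqrt\pi (z - t))$; a linear term in $m$ is
  excluded by condition (L). Both families are total, so $\psi_z \mapsto k_z$ extends to a unitary map
  between the two spaces. It carries the resolvent of $D$ to multiplication by $1 / (t - z)$, hence $D$ to $A$.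
  For compactly supported $f$ and real $\lambda$, solving $J w' = \mathsf{H} (\lambda w + f)$ from the right gives
  $F - \mathcal{U} f (\lambda) = (t - \lambda) F_w$ for the images $F$, $F_w$ of $f$, $w$; since the norm of $w$ is
  bounded for bounded $\lambda$, summation over a fine grid of points $\lambda$ yields $F = \mathcal{U} f$.\<close>

section \<open>Absolute continuity and indefinite integrals\<close>

text \<open>The transform is given for compactly supported functions, not for the Weyl solutions, so
  no Parseval identity can be read off its formula: the unitary map is built abstractly and
  recognised as the transform only at the end. A real lambda has no resolvent at its disposal, but
  the solution vanishing to the right of the support of f always lies in H, and its lower component
  at 0 is the transform at lambda up to the factor 1 / sqrt pi. On a cell of length 1/n this gives
  |F - U f(lambda)|^2 <= |F_w|^2 / n^2. There are O(n) cells, so the error is O(1/n) even though the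
  norms of all the F_w are added up. Condition (L) enters only through \<open>kernel_zero\<close>:
  an element of the domain with H u = 0 is identically zero. This makes the resolvent injective,
  which is needed for the totality of the Weyl solutions and for c = 0. The absence of a singular
  semiaxis is used there and in the choice of truncation points that do not leave H. What makes the
  boundary term at infinity vanish is that Theta is not in H for nonreal z; this is contained in the
  uniqueness of m(z).\<close>

lemma negligible_bad_indefinite_integral:
  fixes f :: "real \<Rightarrow> 'a::euclidean_space"
  assumes int: "f integrable_on {a..b}" and "c > 0"
  defines "F \<equiv> \<lambda>x. integral {a..x} f"
  defines "S \<equiv> {x \<in> {a..b}. \<forall>d>0. \<exists>y\<in>{a..b}. y \<noteq> x \<and> \<bar>y - x\<bar> < d \<and>
                  norm (F y - F x - (y - x) *\<^sub>R f x) > c * \<bar>y - x\<bar>}"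
  shows "negligible S"
  unfolding negligible_outer_le
proof (intro allI impI)
  fix e :: real assume "e > 0"
  then have ec: "e * c > 0" using \<open>c > 0\<close> by simp
  obtain \<gamma> where "gauge \<gamma>" and \<gamma>: "\<And>p. \<lbrakk>p tagged_partial_division_of (cbox a b); \<gamma> fine p\<rbrakk> \<Longrightarrow>
      sum (\<lambda>(x,k). norm(measure lborel k *\<^sub>R f x - integral k f)) p < e * c"
    using Henstock_lemma[of f a b, OF _ ec] int by auto
  \<comment> \<open>An interval from x to y on which the increment of F misses its linear prediction
    by more than c per unit length contributes more than c times its length to the Henstock sum,
    which is below e * c. So disjoint intervals of this kind have total length at most e, and
    Vitali's theorem selects disjoint ones covering almost all of S.\<close>
  define K where "K = {(x, y). x \<in> {a..b} \<and> y \<in> {a..b} \<and> y \<noteq> x \<and>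
      {min x y..max x y} \<subseteq> \<gamma> x \<and> norm (F y - F x - (y - x) *\<^sub>R f x) > c * \<bar>y - x\<bar>}"
  define ce where "ce = (\<lambda>(x::real, y::real). (x + y) / 2)"
  define ra where "ra = (\<lambda>(x::real, y::real). \<bar>y - x\<bar> / 2)"
  have cb: "cball (ce i) (ra i) = {min (fst i) (snd i)..max (fst i) (snd i)}" for i
    by (cases i) (auto simp: ce_def ra_def cball_eq_atLeastAtMost min_def max_def field_simps abs_if)
  have "0 < ra i" if "i \<in> K" for i
    using that by (auto simp: K_def ra_def)
  moreover have "\<exists>i. i \<in> K \<and> x \<in> cball (ce i) (ra i) \<and> ra i < d" if "x \<in> S" "0 < d" for x d
  proof -
    obtain r where r: "r > 0" "ball x r \<subseteq> \<gamma> x"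
      using \<open>gauge \<gamma>\<close> by (metis gauge_def openE)
    with \<open>0 < d\<close> have "min d r > 0" by simp
    with that obtain y where y: "y \<in> {a..b}" "y \<noteq> x" "\<bar>y - x\<bar> < min d r"
        "norm (F y - F x - (y - x) *\<^sub>R f x) > c * \<bar>y - x\<bar>"
      unfolding S_def by blast
    have "{min x y..max x y} \<subseteq> ball x r"
      using y(3) by (auto simp: dist_real_def)
    then have "(x, y) \<in> K"
      using y that r unfolding K_def S_def by auto
    moreover have "ra (x, y) < d" using y(2,3) by (auto simp: ra_def)
    moreover have "x \<in> cball (ce (x, y)) (ra (x, y))" unfolding cb by auto
    ultimately show ?thesis by blast
  qed
  ultimately obtain C where C: "countable C" "C \<subseteq> K"
     "pairwise (\<lambda>i j. disjnt (cball (ce i) (ra i)) (cball (ce j) (ra j))) C"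
     "negligible(S - (\<Union>i \<in> C. cball (ce i) (ra i)))"
    by (rule Vitali_covering_theorem_cballs[of K ra S ce]) blast+
  have intF: "integral {x..y} f = F y - F x" if "a \<le> x" "x \<le> y" "y \<le> b" for x y
    using Henstock_Kurzweil_Integration.integral_combine[of a x y f] int that
    unfolding F_def by (simp add: algebra_simps integrable_on_subinterval)
  have fin: "measure lebesgue (\<Union>i\<in>D. cball (ce i) (ra i)) \<le> e" if D: "D \<subseteq> C" "finite D" for D
  proof -
    define p where "p = (\<lambda>i. (fst i, cball (ce i) (ra i))) ` D"
    have inj: "inj_on (\<lambda>i. (fst i, cball (ce i) (ra i))) D"
    proof (rule inj_onI)
      fix i j assume ij: "i \<in> D" "j \<in> D" "(fst i, cball (ce i) (ra i)) = (fst j, cball (ce j) (ra j))"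
      show "i = j"
      proof (rule ccontr)
        assume "i \<noteq> j"
        then have "disjnt (cball (ce i) (ra i)) (cball (ce j) (ra j))"
          using pairwiseD[OF C(3), of i j] ij(1,2) D \<open>i \<noteq> j\<close> by blast
        moreover have "fst i \<in> cball (ce i) (ra i)" unfolding cb by auto
        ultimately show False using ij(3) unfolding disjnt_def by (metis IntI empty_iff prod.inject)
      qed
    qed
    have tp: "p tagged_partial_division_of cbox a b"
      unfolding tagged_partial_division_of_def
    proof (intro conjI allI impI)
      show "finite p" unfolding p_def using D by simp
    next
      fix x k assume "(x, k) \<in> p"
      then obtain i where i: "i \<in> D" "x = fst i" "k = cball (ce i) (ra i)" by (auto simp: p_def)
      then have "i \<in> K" using D C by auto
      then show "x \<in> k" "k \<subseteq> cbox a b" "\<exists>u v. k = cbox u v"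
        using i unfolding cb K_def by auto
    next
      fix x1 k1 x2 k2
      assume h: "(x1, k1) \<in> p \<and> (x2, k2) \<in> p \<and> (x1, k1) \<noteq> (x2, k2)"
      then obtain i j where i: "i \<in> D" "x1 = fst i" "k1 = cball (ce i) (ra i)"
        and j: "j \<in> D" "x2 = fst j" "k2 = cball (ce j) (ra j)" by (auto simp: p_def)
      then have "i \<noteq> j" using h by auto
      then have "disjnt k1 k2" using C(3) i j D by (auto simp: pairwise_def)
      then show "interior k1 \<inter> interior k2 = {}"
        using interior_subset by (force simp: disjnt_def)
    qed
    have "\<gamma> fine p"
    proof (rule fineI)
      fix x k assume "(x, k) \<in> p"
      then obtain i where i: "i \<in> D" "x = fst i" "k = cball (ce i) (ra i)" by (auto simp: p_def)
      then have "i \<in> K" using D C by auto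
      then show "k \<subseteq> \<gamma> x" using i unfolding cb K_def by auto
    qed
    from \<gamma>[OF tp this] have lt: "(\<Sum>(x,k)\<in>p. norm (measure lborel k *\<^sub>R f x - integral k f)) < e * c" .
    have tm: "c * measure lborel (cball (ce i) (ra i)) \<le>
        norm (measure lborel (cball (ce i) (ra i)) *\<^sub>R f (fst i) - integral (cball (ce i) (ra i)) f)"
      if "i \<in> D" for i
    proof -
      have "i \<in> K" using that D C by auto
      obtain x y where i: "i = (x, y)" by (cases i)
      have xy: "x \<in> {a..b}" "y \<in> {a..b}" "c * \<bar>y - x\<bar> < norm (F y - F x - (y - x) *\<^sub>R f x)"
        using \<open>i \<in> K\<close> by (auto simp: i K_def)
      show ?thesis
      proof (cases "x \<le> y")
        case True
        then have "cball (ce i) (ra i) = {x..y}" unfolding cb i by (simp add: min_def max_def)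
        then show ?thesis using xy True intF[of x y] by (simp add: i norm_minus_commute)
      next
        case False
        then have "cball (ce i) (ra i) = {y..x}" unfolding cb i by (simp add: min_def max_def)
        moreover have "(x - y) *\<^sub>R f x - (F x - F y) = F y - F x - (y - x) *\<^sub>R f x"
          by (simp add: algebra_simps)
        then have "norm ((x - y) *\<^sub>R f x - (F x - F y)) = norm (F y - F x - (y - x) *\<^sub>R f x)"
          by (rule arg_cong)
        ultimately show ?thesis using xy False
          by (simp add: i intF[of y x] abs_minus_commute less_imp_le del: scaleR_left_diff_distrib)
      qed
    qed
    have "c * measure lebesgue (\<Union>i\<in>D. cball (ce i) (ra i)) \<le> c * (\<Sum>i\<in>D. measure lebesgue (cball (ce i) (ra i)))"
      using \<open>c > 0\<close> D by (intro mult_left_mono measure_UNION_le) auto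
    also have "\<dots> = (\<Sum>i\<in>D. c * measure lborel (cball (ce i) (ra i)))"
      by (simp add: sum_distrib_left)
    also have "\<dots> \<le> (\<Sum>i\<in>D. norm (measure lborel (cball (ce i) (ra i)) *\<^sub>R f (fst i) - integral (cball (ce i) (ra i)) f))"
      by (rule sum_mono) (rule tm)
    also have "\<dots> = (\<Sum>(x,k)\<in>p. norm (measure lborel k *\<^sub>R f x - integral k f))"
      unfolding p_def by (subst sum.reindex[OF inj]) (simp add: o_def case_prod_beta)
    also have "\<dots> \<le> c * e" using lt by (simp add: mult.commute)
    finally show ?thesis using \<open>c > 0\<close> by simp
  qed
  have m: "(\<Union>i\<in>C. cball (ce i) (ra i)) \<in> lmeasurable" "measure lebesgue (\<Union>i\<in>C. cball (ce i) (ra i)) \<le> e"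
    using fin by (intro fmeasurable_UN_bound[OF \<open>countable C\<close>] measure_UN_bound[OF \<open>countable C\<close>]; auto)+
  show "\<exists>T. S \<subseteq> T \<and> T \<in> lmeasurable \<and> measure lebesgue T \<le> e"
  proof (intro exI conjI)
    let ?U = "\<Union>i\<in>C. cball (ce i) (ra i)"
    show "S \<subseteq> ?U \<union> (S - ?U)" by auto
    show "?U \<union> (S - ?U) \<in> lmeasurable"
      using m C(4) negligible_imp_measurable by (intro fmeasurable.Un) auto
    show "measure lebesgue (?U \<union> (S - ?U)) \<le> e"
      using measure_Un_le[of ?U lebesgue "S - ?U"] m C(4)
      by (simp add: negligible_imp_measure0 fmeasurableD negligible_imp_sets)
  qed
qed

text \<open>Failure of the derivative at x is witnessed by some c = 1 / (n + 1), so countably many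
  of the null sets above suffice.\<close>

theorem lebesgue_differentiation:
  fixes f :: "real \<Rightarrow> 'a::euclidean_space"
  assumes int: "f integrable_on {a..b}"
  shows "negligible {x \<in> {a<..<b}. \<not> ((\<lambda>x. integral {a..x} f) has_vector_derivative f x) (at x)}"
proof -
  define F where "F = (\<lambda>x. integral {a..x} f)"
  define S where "S c = {x \<in> {a..b}. \<forall>d>0. \<exists>y\<in>{a..b}. y \<noteq> x \<and> \<bar>y - x\<bar> < d \<and>
                  norm (F y - F x - (y - x) *\<^sub>R f x) > c * \<bar>y - x\<bar>}" for c
  have "negligible (\<Union>n::nat. S (1 / Suc n))"
  proof (rule negligible_Union_nat)
    show "negligible (S (1 / real (Suc n)))" for n
      using negligible_bad_indefinite_integral[OF int, of "1 / Suc n"] unfolding S_def F_def by simp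
  qed
  moreover have "{x \<in> {a<..<b}. \<not> (F has_vector_derivative f x) (at x)} \<subseteq> (\<Union>n::nat. S (1 / Suc n))"
  proof clarify
    fix x assume x: "x \<in> {a<..<b}" "\<not> (F has_vector_derivative f x) (at x)"
    show "x \<in> (\<Union>n::nat. S (1 / Suc n))"
    proof (rule ccontr)
      assume "\<not> ?thesis"
      then have notS: "x \<notin> S (1 / Suc n)" for n by blast
      have "\<exists>d>0. \<forall>y\<in>{a..b}. y \<noteq> x \<and> \<bar>y - x\<bar> < d \<longrightarrow>
          norm (F y - F x - (y - x) *\<^sub>R f x) \<le> 1 / Suc n * \<bar>y - x\<bar>" for n
        using notS[of n] x(1) unfolding S_def mem_Collect_eq by (simp only: not_less[symmetric]) force
      then obtain d where d: "\<And>n::nat. d n > 0" "\<And>n y. y\<in>{a..b} \<Longrightarrow> y \<noteq> x \<Longrightarrow> \<bar>y - x\<bar> < d n \<Longrightarrow>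
          norm (F y - F x - (y - x) *\<^sub>R f x) \<le> 1 / Suc n * \<bar>y - x\<bar>" by metis
      have "(F has_vector_derivative f x) (at x)"
        unfolding has_vector_derivative_def has_derivative_at_alt
      proof (intro conjI allI impI bounded_linear_scaleR_left)
        fix e :: real assume "e > 0"
        then obtain n :: nat where n: "1 / Suc n < e" using nat_approx_posE by metis
        define r where "r = Min {d n, x - a, b - x}"
        have "r > 0" using x d unfolding r_def by auto
        moreover have "norm (F y - F x - (y - x) *\<^sub>R f x) \<le> e * norm (y - x)" if "norm (y - x) < r" for y
        proof (cases "y = x")
          case False
          have "y \<in> {a..b}" "\<bar>y - x\<bar> < d n" using that unfolding r_def by auto
          then have "norm (F y - F x - (y - x) *\<^sub>R f x) \<le> 1 / Suc n * \<bar>y - x\<bar>"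
            using d False by blast
          also have "\<dots> \<le> e * norm (y - x)" using mult_right_mono[OF less_imp_le[OF n], of "\<bar>y - x\<bar>"] by simp
          finally show ?thesis .
        qed simp
        ultimately show "\<exists>d>0. \<forall>y. norm (y - x) < d \<longrightarrow>
            norm (F y - F x - (y - x) *\<^sub>R f x) \<le> e * norm (y - x)" by blast
      qed
      with x(2) show False by simp
    qed
  qed
  ultimately show ?thesis unfolding F_def by (rule negligible_subset)
qed

text \<open>The condition of \<open>abs_continuous_on_interval\<close> for values in any normed
  space, so that it applies to scalar components as well as to vectors.\<close>

definition acont :: "real \<Rightarrow> real \<Rightarrow> (real \<Rightarrow> 'a::real_normed_vector) \<Rightarrow> bool" where
  "acont a b f \<longleftrightarrow>
     (\<forall>\<epsilon>>0. \<exists>\<delta>>0. \<forall>d. d division_of \<Union>d \<and> \<Union>d \<subseteq> {a..b} \<and> (\<Sum>k\<in>d. Sup k - Inf k) < \<delta>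
        \<longrightarrow> (\<Sum>k\<in>d. norm (f (Sup k) - f (Inf k))) < \<epsilon>)"

lemma acontD:
  assumes "acont a b f" "\<epsilon> > 0"
  obtains \<delta> where "\<delta> > 0" "\<And>d. d division_of \<Union>d \<Longrightarrow> \<Union>d \<subseteq> {a..b} \<Longrightarrow> (\<Sum>k\<in>d. Sup k - Inf k) < \<delta> \<Longrightarrow>
     (\<Sum>k\<in>d. norm (f (Sup k) - f (Inf k))) < \<epsilon>"
proof -
  have "\<exists>\<delta>>0. \<forall>d. d division_of \<Union>d \<and> \<Union>d \<subseteq> {a..b} \<and> (\<Sum>k\<in>d. Sup k - Inf k) < \<delta>
        \<longrightarrow> (\<Sum>k\<in>d. norm (f (Sup k) - f (Inf k))) < \<epsilon>"
    using assms unfolding acont_def by (elim allE[of _ \<epsilon>]) simp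
  then show ?thesis using that by (elim exE conjE) simp
qed

lemma division_interval_real:
  assumes "d division_of \<Union>d" "\<Union>d \<subseteq> {a..b::real}" "k \<in> d"
  obtains u v where "k = {u..v}" "u \<le> v" "a \<le> u" "v \<le> b" "Inf k = u" "Sup k = v"
proof -
  obtain u v where uv: "k = cbox u v" "k \<noteq> {}"
    using division_ofD(4)[OF assms(1,3)] division_ofD(3)[OF assms(1,3)] by blast
  moreover have "k \<subseteq> {a..b}" using assms by auto
  ultimately show ?thesis using that[of u v] by (auto simp: box_real)
qed

text \<open>At tags outside N the derivative controls each cell up to e / 2 times its length. At
  tags in N the integrand is set to 0 and the gauge forces the cells into an open set T around N of
  measure below \<delta>, where absolute continuity makes the sum of the increments of f
  small.\<close>

theorem acont_fundamental_theorem: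
  fixes f :: "real \<Rightarrow> 'a::euclidean_space"
  assumes ac: "acont a b f" and "a \<le> b" and "negligible N"
    and der: "\<And>x. x \<in> {a..b} - N \<Longrightarrow> (f has_vector_derivative g x) (at x)"
  shows "(g has_integral (f b - f a)) {a..b}"
proof (cases "a = b")
  case True then show ?thesis using has_integral_null_real[of a b g] by simp
next
  case False
  then have "a < b" using \<open>a \<le> b\<close> by simp
  define h where "h x = (if x \<in> N then 0 else g x)" for x
  have "(h has_integral (f b - f a)) {a..b}"
    unfolding has_integral_factor_content_real
  proof (intro allI impI)
    fix e :: real assume "e > 0"
    \<comment> \<open>The allowed error e * (b - a) is halved: one half for the cells tagged in N,
      the other spread over all cells in proportion to their lengths.\<close>
    define e' where "e' = e * (b - a) / 2"
    have "e' > 0" using \<open>e > 0\<close> \<open>a < b\<close> by (simp add: e'_def)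
    obtain \<delta> where \<delta>: "\<delta> > 0" "\<And>d. d division_of \<Union>d \<Longrightarrow> \<Union>d \<subseteq> {a..b} \<Longrightarrow> (\<Sum>k\<in>d. Sup k - Inf k) < \<delta> \<Longrightarrow>
       (\<Sum>k\<in>d. norm (f (Sup k) - f (Inf k))) < e'"
      using acontD[OF ac \<open>e' > 0\<close>] by blast
    obtain T where T: "open T" "N \<subseteq> T" "T - N \<in> lmeasurable" "emeasure lebesgue (T - N) < ennreal \<delta>"
      using sets_lebesgue_outer_open[of N \<delta>] \<delta> \<open>negligible N\<close> negligible_imp_sets by metis
    have lmT: "T \<in> lmeasurable"
    proof -
      have "T = N \<union> (T - N)" using T by auto
      then show ?thesis using \<open>negligible N\<close> negligible_imp_measurable T(3) by (metis fmeasurable.Un)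
    qed
    have mT: "measure lebesgue T < \<delta>"
    proof -
      have "T = N \<union> (T - N)" using T by auto
      then have "measure lebesgue T \<le> measure lebesgue N + measure lebesgue (T - N)"
        using measure_Un_le[of N lebesgue "T - N"] \<open>negligible N\<close> T(3) by (metis fmeasurableD negligible_imp_sets)
      also have "\<dots> < \<delta>"
        using negligible_imp_measure0[OF \<open>negligible N\<close>] T(3,4) \<delta>(1)
        by (simp add: emeasure_eq_measure2 ennreal_less_iff)
      finally show ?thesis .
    qed
    have "\<exists>r>0. \<forall>y. \<bar>y - x\<bar> < r \<longrightarrow> norm (f y - f x - (y - x) *\<^sub>R g x) \<le> e / 2 * \<bar>y - x\<bar>"
      if "x \<in> {a..b} - N" for x
      using der[OF that] \<open>e > 0\<close> half_gt_zero[OF \<open>e > 0\<close>]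
      unfolding has_vector_derivative_def has_derivative_at_alt real_norm_def by blast
    then obtain r where r: "\<And>x. x \<in> {a..b} - N \<Longrightarrow> r x > 0"
      "\<And>x y. x \<in> {a..b} - N \<Longrightarrow> \<bar>y - x\<bar> < r x \<Longrightarrow> norm (f y - f x - (y - x) *\<^sub>R g x) \<le> e / 2 * \<bar>y - x\<bar>"
      by metis
    define \<gamma> where "\<gamma> x = (if x \<in> N then T else if x \<in> {a..b} then ball x (r x) else ball x 1)" for x
    have "gauge \<gamma>" unfolding gauge_def \<gamma>_def using T r by auto
    moreover have "norm ((\<Sum>(x,k)\<in>p. measure lborel k *\<^sub>R h x) - (f b - f a)) \<le> e * measure lborel {a..b}"
      if p: "p tagged_division_of {a..b}" "\<gamma> fine p" for p
    proof -
      note pd = tagged_division_ofD[OF p(1)]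
      have pk: "\<exists>u v. k = {u..v} \<and> u \<le> x \<and> x \<le> v \<and> a \<le> u \<and> v \<le> b \<and> Inf k = u \<and> Sup k = v"
        if xk: "(x, k) \<in> p" for x k
      proof -
        obtain u v where "k = {u..v}" using pd(4)[OF xk] by (auto simp: box_real)
        then show ?thesis using pd(2,3)[OF xk] by (intro exI[of _ u] exI[of _ v]) auto
      qed
      have "norm ((\<Sum>(x,k)\<in>p. measure lborel k *\<^sub>R h x) - (f b - f a)) =
          norm (\<Sum>(x,k)\<in>p. measure lborel k *\<^sub>R h x - (f (Sup k) - f (Inf k)))"
        using additive_tagged_division_1[OF \<open>a \<le> b\<close> p(1), of f]
        by (simp add: sum_subtractf case_prod_beta)
      also have "\<dots> \<le> (\<Sum>(x,k)\<in>p. norm (measure lborel k *\<^sub>R h x - (f (Sup k) - f (Inf k))))"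
        by (rule order_trans[OF norm_sum]) (auto simp: case_prod_beta)
      also have "\<dots> \<le> (\<Sum>(x,k)\<in>p. (if x \<in> N then norm (f (Sup k) - f (Inf k)) else 0) + e / 2 * measure lborel k)"
      proof (rule sum_mono, clarify)
        fix x k assume xk: "(x, k) \<in> p"
        obtain u v where k: "k = {u..v}" "u \<le> x" "x \<le> v" "a \<le> u" "v \<le> b" "Inf k = u" "Sup k = v"
          using pk[OF xk] by auto
        show "norm (measure lborel k *\<^sub>R h x - (f (Sup k) - f (Inf k))) \<le>
           (if x \<in> N then norm (f (Sup k) - f (Inf k)) else 0) + e / 2 * measure lborel k"
        proof (cases "x \<in> N")
          case True then show ?thesis using \<open>e > 0\<close> by (simp add: h_def norm_minus_commute)
        next
          case False
          then have xx: "x \<in> {a..b} - N" using k by auto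
          have "k \<subseteq> ball x (r x)" using p(2) xk False xx unfolding fine_def \<gamma>_def by fastforce
          moreover have "u \<in> k" "v \<in> k" using k(2-5) unfolding k(1) by auto
          ultimately have "u \<in> ball x (r x)" "v \<in> ball x (r x)" by blast+
          then have "\<bar>u - x\<bar> < r x" "\<bar>v - x\<bar> < r x" by (auto simp: dist_real_def)
          then have 1: "norm (f u - f x - (u - x) *\<^sub>R g x) \<le> e / 2 * (x - u)"
            and 2: "norm (f v - f x - (v - x) *\<^sub>R g x) \<le> e / 2 * (v - x)"
            using r(2)[OF xx, of u] r(2)[OF xx, of v] k by auto
          have "measure lborel k *\<^sub>R h x - (f (Sup k) - f (Inf k)) =
             (f u - f x - (u - x) *\<^sub>R g x) - (f v - f x - (v - x) *\<^sub>R g x)"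
            using k False by (simp add: h_def algebra_simps)
          then have "norm (measure lborel k *\<^sub>R h x - (f (Sup k) - f (Inf k))) \<le> e / 2 * (x - u) + e / 2 * (v - x)"
            using 1 2 norm_triangle_ineq4 by (smt (verit))
          also have "\<dots> = e / 2 * measure lborel k" using k(1-3) by (simp add: field_simps)
          finally show ?thesis using False by simp
        qed
      qed
      also have "\<dots> = (\<Sum>(x,k)\<in>p. (if x \<in> N then norm (f (Sup k) - f (Inf k)) else 0)) + e / 2 * (\<Sum>(x,k)\<in>p. measure lborel k)"
        by (simp add: sum.distrib sum_distrib_left case_prod_beta)
      also have "(\<Sum>(x,k)\<in>p. measure lborel k) = b - a"
        using additive_content_tagged_division[of p a b] p(1) \<open>a \<le> b\<close> by (simp add: box_real)
      also have "(\<Sum>(x,k)\<in>p. (if x \<in> N then norm (f (Sup k) - f (Inf k)) else 0)) \<le> e'"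
      proof -
        define q where "q = {(x, k). (x, k) \<in> p \<and> x \<in> N}"
        have qp: "q \<subseteq> p" by (auto simp: q_def)
        have ne: "k \<noteq> {}" if "(x, k) \<in> q" for x k
          using qp pd(2) that by blast
        have qt: "q tagged_partial_division_of {a..b}"
          using p(1) qp by (metis tagged_division_of_def tagged_partial_division_subset)
        have qU: "q tagged_division_of (\<Union>(snd ` q))"
          by (rule tagged_partial_division_of_Union_self[OF qt])
        have dq: "snd ` q division_of \<Union>(snd ` q)"
          by (rule division_of_tagged_division[OF qU])
        have "(\<Sum>(x,k)\<in>p. (if x \<in> N then norm (f (Sup k) - f (Inf k)) else 0)) = (\<Sum>(x,k)\<in>q. norm (f (Sup k) - f (Inf k)))"
          unfolding q_def using pd(1)
          by (intro sum.mono_neutral_cong_right) (auto split: if_splits)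
        \<comment> \<open>Passing from tagged cells to cells requires a summand that vanishes on
          degenerate boxes. The empty box needs an explicit 0, since \<open>Sup {}\<close> and
          \<open>Inf {}\<close> are unspecified reals.\<close>
        also have "\<dots> = (\<Sum>(x,k)\<in>q. if k = {} then 0 else norm (f (Sup k) - f (Inf k)))"
          using ne by (intro sum.cong refl) (auto split: if_splits)
        also have "\<dots> = (\<Sum>k\<in>snd ` q. if k = {} then 0 else norm (f (Sup k) - f (Inf k)))"
          by (rule sum.over_tagged_division_lemma[OF qU]) (auto simp: box_real)
        also have "\<dots> = (\<Sum>k\<in>snd ` q. norm (f (Sup k) - f (Inf k)))"
          using ne by (intro sum.cong refl) (auto split: if_splits)
        also have "\<dots> < e'"
        proof (rule \<delta>(2)[OF dq])
          show "\<Union>(snd ` q) \<subseteq> {a..b}" using qp pd(3) by force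
          have "(\<Sum>k\<in>snd ` q. Sup k - Inf k) = (\<Sum>k\<in>snd ` q. measure lebesgue k)"
          proof (rule sum.cong)
            fix k assume "k \<in> snd ` q"
            then obtain x where "(x, k) \<in> p" using qp by force
            from pk[OF this] obtain u v where "k = {u..v}" "u \<le> v" by (metis order_trans)
            then show "Sup k - Inf k = measure lebesgue k" by simp
          qed simp
          also have "\<dots> = measure lebesgue (\<Union>(snd ` q))"
            using content_division[OF dq] .
          also have "\<dots> \<le> measure lebesgue T"
          proof (rule measure_mono_fmeasurable)
            show "\<Union>(snd ` q) \<subseteq> T"
              using p(2) unfolding q_def fine_def \<gamma>_def by force
            show "\<Union>(snd ` q) \<in> sets lebesgue"
              using division_of_finite[OF dq] division_ofD(4)[OF dq] by (intro sets.finite_Union) force+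
          qed (rule lmT)
          finally show "(\<Sum>k\<in>snd ` q. Sup k - Inf k) < \<delta>" using mT by simp
        qed
        finally show ?thesis by simp
      qed
      finally show ?thesis using \<open>a \<le> b\<close> by (simp add: e'_def algebra_simps)
    qed
    ultimately show "\<exists>d. gauge d \<and> (\<forall>p. p tagged_division_of {a..b} \<and> d fine p \<longrightarrow>
       norm ((\<Sum>(x,k)\<in>p. measure lborel k *\<^sub>R h x) - (f b - f a)) \<le> e * measure lborel {a..b})" by (intro exI[of _ \<gamma>]) simp
  qed
  then show ?thesis
    by (rule has_integral_spike[OF \<open>negligible N\<close>, rotated]) (auto simp: h_def)
qed

lemma acont_subset:
  assumes "acont a b f" "a \<le> c" "d \<le> b"
  shows "acont c d f"
proof -
  have "{c..d} \<subseteq> {a..b}" using assms by auto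
  then show ?thesis using assms(1) unfolding acont_def by (meson order_trans)
qed

text \<open>One comparison serves primitives, products, inverses and vector components. If a single
  dominating function is enough, the other one is taken constant.\<close>

lemma acont_dominated:
  assumes f: "acont a b f" and h: "acont a b h" and "L > 0"
    and le: "\<And>s t. \<lbrakk>a \<le> s; s \<le> t; t \<le> b\<rbrakk> \<Longrightarrow> norm (g t - g s) \<le> L * (norm (f t - f s) + norm (h t - h s))"
  shows "acont a b g"
  unfolding acont_def
proof (intro allI impI)
  fix \<epsilon> :: real assume "\<epsilon> > 0"
  then have e: "\<epsilon> / (2 * L) > 0" using \<open>L > 0\<close> by simp
  obtain \<delta>1 where 1: "\<delta>1 > 0" "\<And>d. d division_of \<Union>d \<Longrightarrow> \<Union>d \<subseteq> {a..b} \<Longrightarrow> (\<Sum>k\<in>d. Sup k - Inf k) < \<delta>1 \<Longrightarrow>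
     (\<Sum>k\<in>d. norm (f (Sup k) - f (Inf k))) < \<epsilon> / (2 * L)" using acontD[OF f e] by blast
  obtain \<delta>2 where 2: "\<delta>2 > 0" "\<And>d. d division_of \<Union>d \<Longrightarrow> \<Union>d \<subseteq> {a..b} \<Longrightarrow> (\<Sum>k\<in>d. Sup k - Inf k) < \<delta>2 \<Longrightarrow>
     (\<Sum>k\<in>d. norm (h (Sup k) - h (Inf k))) < \<epsilon> / (2 * L)" using acontD[OF h e] by blast
  show "\<exists>\<delta>>0. \<forall>d. d division_of \<Union>d \<and> \<Union>d \<subseteq> {a..b} \<and> (\<Sum>k\<in>d. Sup k - Inf k) < \<delta>
        \<longrightarrow> (\<Sum>k\<in>d. norm (g (Sup k) - g (Inf k))) < \<epsilon>"
  proof (intro exI[of _ "min \<delta>1 \<delta>2"] conjI allI impI)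
    fix d assume d: "d division_of \<Union>d \<and> \<Union>d \<subseteq> {a..b} \<and> (\<Sum>k\<in>d. Sup k - Inf k) < min \<delta>1 \<delta>2"
    have "(\<Sum>k\<in>d. norm (g (Sup k) - g (Inf k))) \<le>
        (\<Sum>k\<in>d. L * (norm (f (Sup k) - f (Inf k)) + norm (h (Sup k) - h (Inf k))))"
    proof (rule sum_mono)
      fix k assume k: "k \<in> d"
      obtain u v where "u \<le> v" "a \<le> u" "v \<le> b" "Inf k = u" "Sup k = v"
        using division_interval_real[of d a b k] d k by metis
      then show "norm (g (Sup k) - g (Inf k)) \<le> L * (norm (f (Sup k) - f (Inf k)) + norm (h (Sup k) - h (Inf k)))"
        using le by simp
    qed
    also have "\<dots> = L * ((\<Sum>k\<in>d. norm (f (Sup k) - f (Inf k))) + (\<Sum>k\<in>d. norm (h (Sup k) - h (Inf k))))"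
      by (simp only: sum_distrib_left sum.distrib distrib_left)
    also have "\<dots> < L * (\<epsilon> / (2 * L) + \<epsilon> / (2 * L))"
      using 1(2)[of d] 2(2)[of d] d \<open>L > 0\<close> by (intro mult_strict_left_mono add_strict_mono) auto
    also have "\<dots> = \<epsilon>" using \<open>L > 0\<close> by (simp add: field_simps)
    finally show "(\<Sum>k\<in>d. norm (g (Sup k) - g (Inf k))) < \<epsilon>" .
  qed (use 1 2 in auto)
qed

lemma acont_const: "acont a b (\<lambda>x. c)"
  unfolding acont_def by (auto intro: exI[of _ 1])

text \<open>Cut |g| at a height n. The part above n has integral below \<epsilon> / 2 for large n,
  whatever the cells are, and the part below n contributes at most n times their total length. The
  denominator n + 1 in the choice of \<delta> covers n = 0.\<close>

lemma acont_indefinite_integral: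
  fixes g :: "real \<Rightarrow> 'a::euclidean_space"
  assumes g: "g absolutely_integrable_on {a..b}"
  shows "acont a b (\<lambda>x. integral {a..x} g)"
  unfolding acont_def
proof (intro allI impI)
  fix \<epsilon> :: real assume "\<epsilon> > 0"
  define N where "N x = norm (g x)" for x
  have N: "N integrable_on {a..b}" and gi: "g integrable_on {a..b}"
    using g unfolding N_def absolutely_integrable_on_def by auto
  have Nm: "(\<lambda>x. min (N x) (real n)) absolutely_integrable_on {a..b}" for n
    using g unfolding N_def
    by (intro absolutely_integrable_min_1 absolutely_integrable_on_const)
       (auto simp: absolutely_integrable_on_def)
  then have Nmi: "(\<lambda>x. min (N x) (real n)) integrable_on {a..b}" for n
    using absolutely_integrable_on_def by blast
  have "(\<lambda>n. integral {a..b} (\<lambda>x. min (N x) (real n))) \<longlonglongrightarrow> integral {a..b} N"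
  proof (rule dominated_convergence(2)[OF Nmi N])
    fix x
    have "eventually (\<lambda>n. min (N x) (real n) = N x) sequentially"
      using eventually_ge_at_top[of "nat \<lceil>N x\<rceil>"] by eventually_elim linarith
    then show "(\<lambda>n. min (N x) (real n)) \<longlonglongrightarrow> N x" by (rule tendsto_eventually)
  qed (auto simp: N_def)
  then obtain n where "norm (integral {a..b} (\<lambda>x. min (N x) (real n)) - integral {a..b} N) < \<epsilon> / 2"
    using \<open>\<epsilon> > 0\<close> by (metis (no_types, lifting) LIMSEQ_D half_gt_zero order_refl)
  then have n: "integral {a..b} (\<lambda>x. N x - min (N x) (real n)) < \<epsilon> / 2"
    using N Nmi[of n] unfolding real_norm_def by (subst integral_diff) linarith+
  have Nd: "(\<lambda>x. N x - min (N x) (real n)) integrable_on {a..b}"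
    using N Nmi by (intro integrable_diff)
  show "\<exists>\<delta>>0. \<forall>d. d division_of \<Union>d \<and> \<Union>d \<subseteq> {a..b} \<and> (\<Sum>k\<in>d. Sup k - Inf k) < \<delta>
        \<longrightarrow> (\<Sum>k\<in>d. norm (integral {a..Sup k} g - integral {a..Inf k} g)) < \<epsilon>"
  proof (intro exI[of _ "\<epsilon> / (2 * (real n + 1))"] conjI allI impI)
    fix d assume d: "d division_of \<Union>d \<and> \<Union>d \<subseteq> {a..b} \<and> (\<Sum>k\<in>d. Sup k - Inf k) < \<epsilon> / (2 * (real n + 1))"
    have "(\<Sum>k\<in>d. norm (integral {a..Sup k} g - integral {a..Inf k} g)) \<le>
       (\<Sum>k\<in>d. integral k (\<lambda>x. N x - min (N x) (real n)) + real n * (Sup k - Inf k))"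
    proof (rule sum_mono)
      fix k assume k: "k \<in> d"
      obtain u v where uv: "k = {u..v}" "u \<le> v" "a \<le> u" "v \<le> b" "Inf k = u" "Sup k = v"
        using division_interval_real[of d a b k] d k by metis
      have sub: "{u..v} \<subseteq> {a..b}" using uv by auto
      have ik: "g integrable_on {u..v}" "N integrable_on {u..v}" "(\<lambda>x. min (N x) (real n)) integrable_on {u..v}"
        using integrable_on_subinterval[OF _ sub] gi N Nmi by blast+
      have "integral {a..v} g - integral {a..u} g = integral {u..v} g"
        using Henstock_Kurzweil_Integration.integral_combine[of a u v g] uv gi
        by (simp add: algebra_simps integrable_on_subinterval)
      also have "norm \<dots> \<le> integral {u..v} N"
        using ik by (intro integral_norm_bound_integral) (auto simp: N_def)
      also have "\<dots> = integral {u..v} (\<lambda>x. N x - min (N x) (real n)) + integral {u..v} (\<lambda>x. min (N x) (real n))"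
        using ik by (simp add: integral_diff)
      also have "integral {u..v} (\<lambda>x. min (N x) (real n)) \<le> integral {u..v} (\<lambda>x. real n)"
        using ik by (intro integral_le) auto
      also have "\<dots> = real n * (v - u)" using uv by simp
      finally show "norm (integral {a..Sup k} g - integral {a..Inf k} g) \<le>
          integral k (\<lambda>x. N x - min (N x) (real n)) + real n * (Sup k - Inf k)"
        using uv by simp
    qed
    also have "\<dots> = (\<Sum>k\<in>d. integral k (\<lambda>x. N x - min (N x) (real n))) + real n * (\<Sum>k\<in>d. Sup k - Inf k)"
      by (simp add: sum.distrib sum_distrib_left)
    also have "(\<Sum>k\<in>d. integral k (\<lambda>x. N x - min (N x) (real n))) = integral (\<Union>d) (\<lambda>x. N x - min (N x) (real n))"
    proof (rule integral_combine_division_topdown[symmetric])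
      show "(\<lambda>x. N x - min (N x) (real n)) integrable_on \<Union>d"
        using d by (intro integrable_on_subdivision[OF _ Nd]) auto
    qed (use d in auto)
    also have "\<dots> \<le> integral {a..b} (\<lambda>x. N x - min (N x) (real n))"
      using d by (intro integral_subset_le integrable_on_subdivision[OF _ Nd] Nd) auto
    also have "\<dots> < \<epsilon> / 2" by (rule n)
    also have "real n * (\<Sum>k\<in>d. Sup k - Inf k) \<le> (real n + 1) * (\<epsilon> / (2 * (real n + 1)))"
    proof (intro mult_mono)
      show "0 \<le> (\<Sum>k\<in>d. Sup k - Inf k)"
        using division_interval_real[of d a b] d by (intro sum_nonneg) (metis diff_ge_0_iff_ge)
    qed (use d in auto)
    also have "(real n + 1) * (\<epsilon> / (2 * (real n + 1))) = \<epsilon> / 2"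
      by (simp add: field_simps)
    finally show "(\<Sum>k\<in>d. norm (integral {a..Sup k} g - integral {a..Inf k} g)) < \<epsilon>" by simp
  qed (use \<open>\<epsilon> > 0\<close> in auto)
qed

text \<open>The working form of absolute continuity: y is a primitive of g in integrated form. For b
  < a it holds vacuously, which lets \<open>ode\<close> quantify over all b.\<close>

definition iprim :: "real \<Rightarrow> real \<Rightarrow> (real \<Rightarrow> complex) \<Rightarrow> (real \<Rightarrow> complex) \<Rightarrow> bool" where
  "iprim a b y g \<longleftrightarrow> g absolutely_integrable_on {a..b} \<and>
     (\<forall>x\<in>{a..b}. y x = y a + integral {a..x} g)"

lemma iprim_integrable: "iprim a b y g \<Longrightarrow> g absolutely_integrable_on {a..b}"
  unfolding iprim_def by (rule conjunct1)

lemma iprim_eq: "iprim a b y g \<Longrightarrow> x \<in> {a..b} \<Longrightarrow> y x = y a + integral {a..x} g"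
  unfolding iprim_def by blast

lemma iprim_cong:
  assumes "iprim a b y g" "\<And>x. x \<in> {a..b} \<Longrightarrow> y x = y' x"
    and "negligible N" "\<And>x. x \<in> {a..b} - N \<Longrightarrow> g x = g' x"
  shows "iprim a b y' g'"
proof (cases "a \<le> b")
  case True
  have "integral {a..x} g' = integral {a..x} g" if "x \<in> {a..b}" for x
    using that assms(4) by (intro integral_spike[OF assms(3)]) auto
  moreover have "g' absolutely_integrable_on {a..b}"
    using absolutely_integrable_spike[OF iprim_integrable[OF assms(1)] assms(3)] assms(4) by metis
  ultimately show ?thesis
    using assms(1,2) True unfolding iprim_def by (metis atLeastAtMost_iff order_refl)
next
  case False
  then show ?thesis unfolding iprim_def by (simp add: absolutely_integrable_on_def)
qed

lemma iprim_diff_eq: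
  assumes "iprim a b y g" "a \<le> c" "c \<le> d" "d \<le> b"
  shows "y d - y c = integral {c..d} g"
proof -
  have "g integrable_on {a..d}"
    using iprim_integrable[OF assms(1)] assms
    by (auto simp: absolutely_integrable_on_def intro: integrable_on_subinterval)
  then have "integral {a..c} g + integral {c..d} g = integral {a..d} g"
    using assms Henstock_Kurzweil_Integration.integral_combine by blast
  then show ?thesis
    using iprim_eq[OF assms(1), of c] iprim_eq[OF assms(1), of d] assms by (simp add: algebra_simps)
qed

lemma iprim_subinterval:
  assumes "iprim a b y g" "a \<le> c" "d \<le> b"
  shows "iprim c d y g"
  unfolding iprim_def
proof (intro conjI ballI)
  show "g absolutely_integrable_on {c..d}"
    using iprim_integrable[OF assms(1)] assms
    by (auto intro: absolutely_integrable_on_subinterval)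
  show "y x = y c + integral {c..x} g" if "x \<in> {c..d}" for x
    using iprim_diff_eq[OF assms(1), of c x] that assms by (simp add: algebra_simps)
qed

lemma iprim_continuous:
  assumes "iprim a b y g"
  shows "continuous_on {a..b} y"
proof -
  have "continuous_on {a..b} (\<lambda>x. y a + integral {a..x} g)"
    using iprim_integrable[OF assms]
    by (intro continuous_intros indefinite_integral_continuous_1) (simp add: absolutely_integrable_on_def)
  then show ?thesis using iprim_eq[OF assms] by (metis (no_types, lifting) continuous_on_cong)
qed

lemma iprim_acont:
  assumes "iprim a b y g"
  shows "acont a b y"
proof (rule acont_dominated[OF acont_indefinite_integral[OF iprim_integrable[OF assms]] acont_const[of a b 0], of 1])
  fix s t assume "a \<le> s" "s \<le> t" "t \<le> b"
  then show "norm (y t - y s) \<le> 1 * (norm (integral {a..t} g - integral {a..s} g) + norm (0 - 0 :: complex))"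
    using iprim_eq[OF assms, of t] iprim_eq[OF assms, of s] by simp
qed simp

lemma iprim_has_vector_derivative:
  assumes "iprim a b y g"
  shows "negligible {x \<in> {a<..<b}. \<not> (y has_vector_derivative g x) (at x)}"
proof (rule negligible_subset[OF lebesgue_differentiation[of g a b]])
  show "g integrable_on {a..b}" using iprim_integrable[OF assms] by (simp add: absolutely_integrable_on_def)
  show "{x \<in> {a<..<b}. \<not> (y has_vector_derivative g x) (at x)} \<subseteq>
    {x \<in> {a<..<b}. \<not> ((\<lambda>x. integral {a..x} g) has_vector_derivative g x) (at x)}"
  proof (clarify)
    fix x assume x: "x \<in> {a<..<b}" "\<not> (y has_vector_derivative g x) (at x)"
      and d: "((\<lambda>x. integral {a..x} g) has_vector_derivative g x) (at x)"
    have "((\<lambda>x. y a + integral {a..x} g) has_vector_derivative g x) (at x)"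
      using has_vector_derivative_add[OF has_vector_derivative_const d] by simp
    then have "(y has_vector_derivative g x) (at x)"
      by (rule has_vector_derivative_transform_within_open[where S = "{a<..<b}"])
         (use x(1) iprim_eq[OF assms, symmetric] in auto)
    with x show False by simp
  qed
qed

text \<open>The way back from the epsilon-delta definition: with \<open>iprim_acont\<close> and
  \<open>iprim_has_vector_derivative\<close> it shows that both descriptions of absolutely
  continuous functions agree.\<close>

lemma iprimI:
  assumes ac: "acont a b y" and g: "g absolutely_integrable_on {a..b}" and N: "negligible N"
    and der: "\<And>x. x \<in> {a<..<b} - N \<Longrightarrow> (y has_vector_derivative g x) (at x)"
  shows "iprim a b y g"
  unfolding iprim_def
proof (intro conjI ballI g)
  fix x assume x: "x \<in> {a..b}"
  have "(g has_integral (y x - y a)) {a..x}"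
  \<comment> \<open>The endpoints join the null set because two-sided derivatives are known only
    inside the interval.\<close>
  proof (rule acont_fundamental_theorem[where N = "insert a (insert b N)"])
    show "acont a x y" using acont_subset[OF ac] x by auto
  qed (use x N der in auto)
  then show "y x = y a + integral {a..x} g" by (simp add: integral_unique algebra_simps)
qed

lemma iprim_add:
  assumes "iprim a b y g" "iprim a b v k"
  shows "iprim a b (\<lambda>x. y x + v x) (\<lambda>x. g x + k x)"
  unfolding iprim_def
proof (intro conjI ballI)
  show "(\<lambda>x. g x + k x) absolutely_integrable_on {a..b}"
    using assms by (intro set_integral_add iprim_integrable)
  fix x assume x: "x \<in> {a..b}"
  then have "g integrable_on {a..x}" "k integrable_on {a..x}"
    using assms[THEN iprim_integrable]
    by (auto simp: absolutely_integrable_on_def intro: integrable_on_subinterval)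
  then show "y x + v x = y a + v a + integral {a..x} (\<lambda>x. g x + k x)"
    using iprim_eq[OF assms(1) x] iprim_eq[OF assms(2) x] by (simp add: integral_add)
qed

lemma iprim_cmult:
  assumes "iprim a b y g"
  shows "iprim a b (\<lambda>x. c * y x) (\<lambda>x. c * g x)"
  unfolding iprim_def
proof (intro conjI ballI)
  show "(\<lambda>x. c * g x) absolutely_integrable_on {a..b}"
    using iprim_integrable[OF assms] by (rule set_integrable_mult_right)
  fix x assume x: "x \<in> {a..b}"
  show "c * y x = c * y a + integral {a..x} (\<lambda>x. c * g x)"
    using iprim_eq[OF assms(1) x] by (simp add: algebra_simps)
qed

lemma iprim_cnj:
  assumes "iprim a b y g"
  shows "iprim a b (\<lambda>x. cnj (y x)) (\<lambda>x. cnj (g x))"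
  unfolding iprim_def
proof (intro conjI ballI)
  show "(\<lambda>x. cnj (g x)) absolutely_integrable_on {a..b}"
    using absolutely_integrable_linear[OF iprim_integrable[OF assms] bounded_linear_cnj] by (simp add: o_def)
  fix x assume x: "x \<in> {a..b}"
  show "cnj (y x) = cnj (y a) + integral {a..x} (\<lambda>x. cnj (g x))"
    using iprim_eq[OF assms(1) x] by (simp add: integral_cnj)
qed

lemma absolutely_integrable_continuous_mult:
  fixes y g :: "real \<Rightarrow> complex"
  assumes "continuous_on {a..b} y" "g absolutely_integrable_on {a..b}"
  shows "(\<lambda>x. y x * g x) absolutely_integrable_on {a..b}"
proof (rule absolutely_integrable_bounded_measurable_product[where h = "(*)"])
  show "bilinear ((*) :: complex \<Rightarrow> complex \<Rightarrow> complex)" by (rule bilinear_times)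
  show "y \<in> borel_measurable (lebesgue_on {a..b})"
    using assms by (intro continuous_imp_measurable_on_sets_lebesgue) auto
  show "bounded (y ` {a..b})"
    using assms by (intro compact_imp_bounded compact_continuous_image) auto
qed (use assms in auto)

lemma bounded_on_interval:
  fixes y :: "real \<Rightarrow> 'a::real_normed_vector"
  assumes "continuous_on {a..b} y"
  obtains B where "B > 0" "\<And>x. x \<in> {a..b} \<Longrightarrow> norm (y x) \<le> B"
  using compact_imp_bounded[OF compact_continuous_image[OF assms compact_Icc]]
  unfolding bounded_pos by auto

text \<open>The product is absolutely continuous and obeys the product rule almost everywhere, so
  \<open>iprimI\<close> yields integration by parts without a double integral.\<close>

lemma iprim_mult:
  assumes y: "iprim a b y g" and v: "iprim a b v k"
  shows "iprim a b (\<lambda>x. y x * v x) (\<lambda>x. g x * v x + y x * k x)"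
proof (rule iprimI)
  obtain B where B: "B > 0" "\<And>x. x \<in> {a..b} \<Longrightarrow> norm (y x) \<le> B"
    using bounded_on_interval[OF iprim_continuous[OF y]] by blast
  obtain C where C: "C > 0" "\<And>x. x \<in> {a..b} \<Longrightarrow> norm (v x) \<le> C"
    using bounded_on_interval[OF iprim_continuous[OF v]] by blast
  show "acont a b (\<lambda>x. y x * v x)"
  proof (rule acont_dominated[OF iprim_acont[OF y] iprim_acont[OF v], of "B + C"])
    fix s t assume st: "a \<le> s" "s \<le> t" "t \<le> b"
    have "norm (y t * v t - y s * v s) = norm (y t * (v t - v s) + (y t - y s) * v s)"
      by (simp add: algebra_simps)
    also have "\<dots> \<le> B * norm (v t - v s) + norm (y t - y s) * C"
      unfolding norm_mult[symmetric]
      using mult_right_mono[OF B(2)[of t], of "norm (v t - v s)"]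
        mult_left_mono[OF C(2)[of s], of "norm (y t - y s)"] st
      by (intro order_trans[OF norm_triangle_ineq] add_mono) (simp_all add: norm_mult)
    also have "\<dots> \<le> (B + C) * (norm (y t - y s) + norm (v t - v s))"
      using B C by (simp add: algebra_simps)
    finally show "norm (y t * v t - y s * v s) \<le> (B + C) * (norm (y t - y s) + norm (v t - v s))" .
  qed (use B C in auto)
  show "(\<lambda>x. g x * v x + y x * k x) absolutely_integrable_on {a..b}"
    using absolutely_integrable_continuous_mult[OF iprim_continuous[OF v] iprim_integrable[OF y]]
      absolutely_integrable_continuous_mult[OF iprim_continuous[OF y] iprim_integrable[OF v]]
    by (intro set_integral_add) (auto simp: mult.commute)
  show "negligible ({x \<in> {a<..<b}. \<not> (y has_vector_derivative g x) (at x)} \<union>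
      {x \<in> {a<..<b}. \<not> (v has_vector_derivative k x) (at x)})"
    using iprim_has_vector_derivative[OF y] iprim_has_vector_derivative[OF v] by simp
  fix x assume "x \<in> {a<..<b} - ({x \<in> {a<..<b}. \<not> (y has_vector_derivative g x) (at x)} \<union>
      {x \<in> {a<..<b}. \<not> (v has_vector_derivative k x) (at x)})"
  then have "(y has_vector_derivative g x) (at x)" "(v has_vector_derivative k x) (at x)" by auto
  from has_vector_derivative_mult[OF this]
  show "((\<lambda>x. y x * v x) has_vector_derivative g x * v x + y x * k x) (at x)"
    by (simp add: add.commute)
qed

lemma iprim_inverse:
  assumes v: "iprim a b v k" and nz: "\<And>x. x \<in> {a..b} \<Longrightarrow> v x \<noteq> 0" and "a \<le> b"
  shows "iprim a b (\<lambda>x. inverse (v x)) (\<lambda>x. - k x * inverse (v x) * inverse (v x))"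
proof (rule iprimI)
  have ci: "continuous_on {a..b} (\<lambda>x. inverse (v x))"
    using nz by (intro continuous_intros iprim_continuous[OF v]) auto
  obtain B where B: "B > 0" "\<And>x. x \<in> {a..b} \<Longrightarrow> norm (inverse (v x)) \<le> B"
    using bounded_on_interval[OF ci] by blast
  show "acont a b (\<lambda>x. inverse (v x))"
  proof (rule acont_dominated[OF iprim_acont[OF v] acont_const[of a b 0], of "B * B"])
    fix s t assume st: "a \<le> s" "s \<le> t" "t \<le> b"
    have "inverse (v t) - inverse (v s) = - (inverse (v t) * (v t - v s) * inverse (v s))"
      using nz st by (intro inverse_diff_inverse) auto
    then have "norm (inverse (v t) - inverse (v s)) = norm (inverse (v t)) * norm (inverse (v s)) * norm (v t - v s)"
      by (simp add: norm_mult)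
    also have "\<dots> \<le> B * B * norm (v t - v s)"
      using B(2)[of t] B(2)[of s] B(1) st by (intro mult_right_mono mult_mono) auto
    finally show "norm (inverse (v t) - inverse (v s)) \<le> B * B * (norm (v t - v s) + norm (0 - 0 :: complex))"
      by simp
  qed (use B in auto)
  have "continuous_on {a..b} (\<lambda>x. - (inverse (v x) * inverse (v x)))"
    by (intro continuous_intros ci)
  from absolutely_integrable_continuous_mult[OF this iprim_integrable[OF v]]
  show "(\<lambda>x. - k x * inverse (v x) * inverse (v x)) absolutely_integrable_on {a..b}"
    by (simp add: mult_ac)
  show "negligible {x \<in> {a<..<b}. \<not> (v has_vector_derivative k x) (at x)}"
    by (rule iprim_has_vector_derivative[OF v])
  fix x assume "x \<in> {a<..<b} - {x \<in> {a<..<b}. \<not> (v has_vector_derivative k x) (at x)}"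
  then have x: "x \<in> {a..b}" and d: "(v has_derivative (\<lambda>h. h *\<^sub>R k x)) (at x)"
    by (auto simp: has_vector_derivative_def)
  from Deriv.has_derivative_inverse[OF nz[OF x] d]
  show "((\<lambda>x. inverse (v x)) has_vector_derivative - k x * inverse (v x) * inverse (v x)) (at x)"
    by (simp add: has_vector_derivative_def scaleR_conv_of_real mult_ac)
qed

lemma iprim_zero_const:
  assumes "iprim a b y g" "negligible N" "\<And>x. x \<in> {a..b} - N \<Longrightarrow> g x = 0" "x \<in> {a..b}"
  shows "y x = y a"
proof -
  have "integral {a..x} g = integral {a..x} (\<lambda>x. 0)"
    using assms(3,4) by (intro integral_spike[OF assms(2)]) auto
  then show ?thesis using iprim_eq[OF assms(1,4)] by simp
qed

text \<open>The hypothesis says that the Wronskian of y and v vanishes almost everywhere, that is,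
  the quotient has derivative zero.\<close>

lemma iprim_quotient_const:
  assumes y: "iprim a b y g" and v: "iprim a b v k"
    and nz: "\<And>x. x \<in> {a..b} \<Longrightarrow> v x \<noteq> 0" and N: "negligible N"
    and wr: "\<And>x. x \<in> {a..b} - N \<Longrightarrow> y x * k x = v x * g x" and x: "x \<in> {a..b}"
  shows "y x / v x = y a / v a"
proof -
  have "a \<le> b" using x by simp
  have "y x * inverse (v x) = y a * inverse (v a)"
  proof (rule iprim_zero_const[OF iprim_mult[OF y iprim_inverse[OF v nz \<open>a \<le> b\<close>]] N _ x])
    fix x assume x': "x \<in> {a..b} - N"
    then have "v x \<noteq> 0" using nz by auto
    then show "g x * inverse (v x) + y x * (- k x * inverse (v x) * inverse (v x)) = 0"
      using wr[OF x'] by (simp add: field_simps)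
  qed auto
  then show ?thesis by (simp add: divide_inverse)
qed

section \<open>Gronwall's inequality and derivatives from quadratic remainders\<close>

lemma gronwall:
  fixes u :: "real \<Rightarrow> real"
  assumes cont: "continuous_on {0..b} u" and "K \<ge> 0"
    and le: "\<And>x. x \<in> {0..b} \<Longrightarrow> u x \<le> A + K * integral {0..x} u" and x: "x \<in> {0..b}"
  shows "u x \<le> A * exp (K * x)"
proof -
  define F where "F x = A + K * integral {0..x} u" for x
  define G where "G x = exp (- K * x) * F x" for x
  have dF: "(F has_real_derivative K * u t) (at t within {0..b})" if "t \<in> {0..b}" for t
    unfolding F_def using integral_has_real_derivative[OF cont that]
    by (auto intro!: derivative_eq_intros)
  have dG: "(G has_real_derivative exp (- K * t) * (K * u t - K * F t)) (at t within {0..b})"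
    if "t \<in> {0..b}" for t
    unfolding G_def using dF[OF that]
    by (auto intro!: derivative_eq_intros simp: algebra_simps)
  have "G x \<le> G 0"
  proof (rule DERIV_nonpos_imp_decreasing_open[of 0 x G])
    show "0 \<le> x" using x by simp
    have "continuous_on {0..b} G"
      using dG by (meson DERIV_continuous continuous_on_eq_continuous_within)
    then show "continuous_on {0..x} G" by (rule continuous_on_subset) (use x in auto)
    fix t assume t: "0 < t" "t < x"
    then have tb: "t \<in> {0..b}" "t \<in> interior {0..b}" using x by auto
    have "(G has_real_derivative exp (- K * t) * (K * u t - K * F t)) (at t)"
      using dG[OF tb(1)] at_within_interior[OF tb(2)] by simp
    moreover have "exp (- K * t) * (K * u t - K * F t) \<le> 0"
      using le[OF tb(1)] \<open>K \<ge> 0\<close> unfolding F_def[symmetric]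
      by (simp add: mult_nonneg_nonpos mult_left_mono)
    ultimately show "\<exists>y. (G has_real_derivative y) (at t) \<and> y \<le> 0" by blast
  qed
  also have "G 0 = A" by (simp add: G_def F_def)
  finally have "exp (- (K * x)) * F x \<le> A" by (simp add: G_def)
  then have "exp (K * x) * (exp (- (K * x)) * F x) \<le> exp (K * x) * A" by (intro mult_left_mono) auto
  moreover have "exp (K * x) * (exp (- (K * x)) * F x) = F x"
    by (simp add: exp_minus_inverse flip: mult.assoc)
  ultimately have "F x \<le> A * exp (K * x)" by (simp only: mult.commute)
  then show ?thesis using le[OF x] by (simp add: F_def)
qed

text \<open>All derivatives in the spectral parameter below come from resolvent identities, whose
  remainder is (z - w)^2 times a bounded factor.\<close>

lemma has_field_derivative_quadratic_bound:
  fixes f :: "complex \<Rightarrow> complex"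
  assumes "r > 0" "K \<ge> 0"
    and le: "\<And>z. norm (z - w) < r \<Longrightarrow> norm (f z - f w - (z - w) * D) \<le> K * (norm (z - w))\<^sup>2"
  shows "(f has_field_derivative D) (at w)"
  unfolding has_field_derivative_def has_derivative_at_alt
proof (intro conjI allI impI bounded_linear_mult_right)
  fix e :: real assume "e > 0"
  show "\<exists>d>0. \<forall>y. norm (y - w) < d \<longrightarrow> norm (f y - f w - D * (y - w)) \<le> e * norm (y - w)"
  proof (intro exI[of _ "min r (e / (K + 1))"] conjI allI impI)
    fix y assume y: "norm (y - w) < min r (e / (K + 1))"
    then have "norm (f y - f w - D * (y - w)) \<le> K * norm (y - w) * norm (y - w)"
      using le[of y] by (simp add: power2_eq_square mult_ac)
    also have "\<dots> \<le> e * norm (y - w)"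
    proof (rule mult_right_mono)
      have "K * norm (y - w) \<le> (K + 1) * (e / (K + 1))"
        using y \<open>K \<ge> 0\<close> by (intro mult_mono) auto
      then show "K * norm (y - w) \<le> e" using \<open>K \<ge> 0\<close> by simp
    qed simp
    finally show "norm (f y - f w - D * (y - w)) \<le> e * norm (y - w)" .
  qed (use assms \<open>e > 0\<close> in auto)
qed

section \<open>Isometries defined on total sets\<close>

text \<open>Only a semi-inner product: elements of H and L2 are represented by functions, and
  nonzero functions may have norm 0. Carrier and operations are parameters because both spaces are
  sets of functions rather than types.\<close>

locale sip_space =
  fixes S :: "'a set" and add :: "'a \<Rightarrow> 'a \<Rightarrow> 'a" and scl :: "complex \<Rightarrow> 'a \<Rightarrow> 'a"
    and ip :: "'a \<Rightarrow> 'a \<Rightarrow> complex"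
  assumes add_closed: "x \<in> S \<Longrightarrow> y \<in> S \<Longrightarrow> add x y \<in> S"
    and scl_closed: "x \<in> S \<Longrightarrow> scl c x \<in> S"
    and ip_add: "x \<in> S \<Longrightarrow> y \<in> S \<Longrightarrow> z \<in> S \<Longrightarrow> ip (add x y) z = ip x z + ip y z"
    and ip_scl: "x \<in> S \<Longrightarrow> z \<in> S \<Longrightarrow> ip (scl c x) z = c * ip x z"
    and ip_cnj: "x \<in> S \<Longrightarrow> y \<in> S \<Longrightarrow> ip y x = cnj (ip x y)"
    and ip_nonneg: "x \<in> S \<Longrightarrow> 0 \<le> Re (ip x x)"
begin

definition nrm :: "'a \<Rightarrow> real" where "nrm x = sqrt (Re (ip x x))"
definition sub :: "'a \<Rightarrow> 'a \<Rightarrow> 'a" where "sub x y = add x (scl (-1) y)"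

lemma sub_closed: "x \<in> S \<Longrightarrow> y \<in> S \<Longrightarrow> sub x y \<in> S"
  by (simp add: sub_def add_closed scl_closed)

lemma ip_add_right: "x \<in> S \<Longrightarrow> y \<in> S \<Longrightarrow> z \<in> S \<Longrightarrow> ip z (add x y) = ip z x + ip z y"
  using ip_add[of x y z] ip_cnj[of "add x y" z] ip_cnj[of x z] ip_cnj[of y z] by (simp add: add_closed)

lemma ip_scl_right: "x \<in> S \<Longrightarrow> z \<in> S \<Longrightarrow> ip z (scl c x) = cnj c * ip z x"
  using ip_scl[of x z c] ip_cnj[of "scl c x" z] ip_cnj[of x z] by (simp add: scl_closed)

lemma ip_sub: "x \<in> S \<Longrightarrow> y \<in> S \<Longrightarrow> z \<in> S \<Longrightarrow> ip (sub x y) z = ip x z - ip y z"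
  by (simp add: sub_def ip_add ip_scl scl_closed)

lemma ip_sub_right: "x \<in> S \<Longrightarrow> y \<in> S \<Longrightarrow> z \<in> S \<Longrightarrow> ip z (sub x y) = ip z x - ip z y"
  by (simp add: sub_def ip_add_right ip_scl_right scl_closed)

lemmas ip_expand = ip_add ip_scl ip_add_right ip_scl_right ip_sub ip_sub_right
  add_closed scl_closed sub_closed

lemma nrm_nonneg: "0 \<le> nrm x" if "x \<in> S"
  using ip_nonneg[OF that] by (simp add: nrm_def)

lemma nrm_sq: "x \<in> S \<Longrightarrow> (nrm x)\<^sup>2 = Re (ip x x)"
  by (simp add: nrm_def ip_nonneg)

lemma ip_self: "x \<in> S \<Longrightarrow> ip x x = of_real ((nrm x)\<^sup>2)"
  using ip_cnj[of x x] by (simp add: nrm_sq complex_eq_iff)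

lemma nrm_sub_sq:
  assumes "x \<in> S" "y \<in> S"
  shows "(nrm (sub x y))\<^sup>2 = (nrm x)\<^sup>2 - 2 * Re (ip x y) + (nrm y)\<^sup>2"
  using assms ip_cnj[of x y] by (simp add: nrm_sq ip_expand)

lemma nrm_add_sq:
  assumes "x \<in> S" "y \<in> S"
  shows "(nrm (add x y))\<^sup>2 = (nrm x)\<^sup>2 + 2 * Re (ip x y) + (nrm y)\<^sup>2"
  using assms ip_cnj[of x y] by (simp add: nrm_sq ip_expand)

lemma nrm_scl: "x \<in> S \<Longrightarrow> nrm (scl c x) = cmod c * nrm x"
proof -
  assume x: "x \<in> S"
  have "ip (scl c x) (scl c x) = of_real ((cmod c)\<^sup>2 * (nrm x)\<^sup>2)"
    using x by (simp add: ip_scl ip_scl_right scl_closed)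
      (simp add: ip_self complex_norm_square[of c, unfolded of_real_power] mult_ac)
  then show ?thesis
    using x nrm_nonneg[OF x] unfolding nrm_def[of "scl c x"] by (simp add: real_sqrt_mult)
qed

lemma cauchy_schwarz:
  assumes x: "x \<in> S" and y: "y \<in> S"
  shows "cmod (ip x y) \<le> nrm x * nrm y"
proof -
  define c where "c = ip x y"
  have yx: "ip y x = cnj c" using ip_cnj[OF x y] by (simp add: c_def)
  have cc: "c * cnj c = of_real ((cmod c)\<^sup>2)" by (simp only: complex_norm_square)
  have key: "0 \<le> (nrm x)\<^sup>2 - 2 * s * (cmod c)\<^sup>2 + s\<^sup>2 * (cmod c)\<^sup>2 * (nrm y)\<^sup>2" for s :: real
  proof -
    have "Re (ip x (scl (of_real s * c) y)) = s * (cmod c)\<^sup>2"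
      using x y by (simp add: ip_expand flip: c_def) (simp add: cmod_power2, simp add: power2_eq_square algebra_simps)
    then have "(nrm (sub x (scl (of_real s * c) y)))\<^sup>2 = (nrm x)\<^sup>2 - 2 * (s * (cmod c)\<^sup>2) + (\<bar>s\<bar> * cmod c * nrm y)\<^sup>2"
      using x y by (simp add: nrm_sub_sq scl_closed nrm_scl norm_mult)
    then show ?thesis
      using zero_le_power2[of "nrm (sub x (scl (of_real s * c) y))"]
      by (simp add: power_mult_distrib mult_ac)
  qed
  show ?thesis
  proof (cases "nrm y = 0")
    case True
    have "cmod c = 0"
    proof (rule ccontr)
      assume "cmod c \<noteq> 0"
      \<comment> \<open>This value of s makes the right-hand side of \<open>key\<close> equal to -1
        when y has norm 0.\<close>
      then have "2 * (((nrm x)\<^sup>2 + 1) / (2 * (cmod c)\<^sup>2)) * (cmod c)\<^sup>2 = (nrm x)\<^sup>2 + 1" by simp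
      then show False using key[of "((nrm x)\<^sup>2 + 1) / (2 * (cmod c)\<^sup>2)"] True by simp
    qed
    then show ?thesis using True by (simp add: c_def)
  next
    case False
    then have pos: "(nrm y)\<^sup>2 > 0" by simp
    have "0 \<le> (nrm x)\<^sup>2 - (cmod c)\<^sup>2 / (nrm y)\<^sup>2"
    proof -
      have "(1 / (nrm y)\<^sup>2)\<^sup>2 * (cmod c)\<^sup>2 * (nrm y)\<^sup>2 = (cmod c)\<^sup>2 / (nrm y)\<^sup>2"
        using False by (simp add: power2_eq_square)
      then show ?thesis using key[of "1 / (nrm y)\<^sup>2"] by simp
    qed
    then have "(cmod c)\<^sup>2 \<le> (nrm x * nrm y)\<^sup>2"
      using pos by (simp add: field_simps power_mult_distrib)
    then show ?thesis
      using nrm_nonneg[OF x] nrm_nonneg[OF y] unfolding c_def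
      by (meson mult_nonneg_nonneg power2_le_imp_le)
  qed
qed

lemma nrm_triangle:
  assumes "x \<in> S" "y \<in> S"
  shows "nrm (add x y) \<le> nrm x + nrm y"
proof (rule power2_le_imp_le)
  have "Re (ip x y) \<le> nrm x * nrm y"
    using cauchy_schwarz[OF assms] complex_Re_le_cmod order_trans by blast
  then show "(nrm (add x y))\<^sup>2 \<le> (nrm x + nrm y)\<^sup>2"
    using assms by (simp add: nrm_add_sq power2_sum)
qed (use assms nrm_nonneg in auto)

lemma nrm_sub_commute: "x \<in> S \<Longrightarrow> y \<in> S \<Longrightarrow> nrm (sub x y) = nrm (sub y x)"
  using nrm_sub_sq[of x y] nrm_sub_sq[of y x] ip_cnj[of x y] nrm_nonneg sub_closed
  by (metis (no_types, lifting) add.commute add_diff_eq complex_cnj(1) complex_surj complex.sel(1) diff_add_eq power2_eq_iff_nonneg)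

lemma nrm_triangle_sub:
  assumes "x \<in> S" "y \<in> S" "z \<in> S"
  shows "nrm (sub x z) \<le> nrm (sub x y) + nrm (sub y z)"
proof -
  have "ip (sub x z) (sub x z) = ip (add (sub x y) (sub y z)) (add (sub x y) (sub y z))"
    using assms by (simp add: ip_expand)
  then have "nrm (sub x z) = nrm (add (sub x y) (sub y z))" by (simp add: nrm_def)
  then show ?thesis using nrm_triangle[of "sub x y" "sub y z"] assms sub_closed by simp
qed

lemma ip_tendsto_left:
  assumes X: "\<And>n. X n \<in> S" and x: "x \<in> S" and y: "y \<in> S" and lim: "(\<lambda>n. nrm (sub (X n) x)) \<longlonglongrightarrow> 0"
  shows "(\<lambda>n. ip (X n) y) \<longlonglongrightarrow> ip x y"
proof -
  have "(\<lambda>n. ip (X n) y - ip x y) \<longlonglongrightarrow> 0"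
  proof (rule Lim_null_comparison)
    show "\<forall>\<^sub>F n in sequentially. norm (ip (X n) y - ip x y) \<le> nrm (sub (X n) x) * nrm y"
      using cauchy_schwarz[of "sub (X _) x" y] X x y by (intro always_eventually) (simp add: ip_expand)
    show "(\<lambda>n. nrm (sub (X n) x) * nrm y) \<longlonglongrightarrow> 0" using tendsto_mult_left_zero[OF lim] .
  qed
  then show ?thesis by (simp add: LIM_zero_iff)
qed

lemma null_ip: "x \<in> S \<Longrightarrow> y \<in> S \<Longrightarrow> nrm x = 0 \<Longrightarrow> ip x y = 0"
  using cauchy_schwarz[of x y] by simp

end

locale complete_sip = sip_space +
  assumes complete: "(\<And>n::nat. X n \<in> S) \<Longrightarrow> (\<And>e. e > 0 \<Longrightarrow> \<exists>N. \<forall>m\<ge>N. \<forall>n\<ge>N. nrm (sub (X m) (X n)) < e)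
      \<Longrightarrow> \<exists>x\<in>S. (\<lambda>n. nrm (sub (X n) x)) \<longlonglongrightarrow> 0"
begin

text \<open>Orthogonal projection onto the closure of M. A minimizing sequence for the distance from
  x is Cauchy by the parallelogram law, with midpoints staying in M; its limit p has x - p
  orthogonal to M, so totality makes x - p a null vector.\<close>

lemma total_imp_dense:
  assumes M: "M \<subseteq> S" "M \<noteq> {}" and M_add: "\<And>x y. x \<in> M \<Longrightarrow> y \<in> M \<Longrightarrow> add x y \<in> M"
    and M_scl: "\<And>x c. x \<in> M \<Longrightarrow> scl c x \<in> M"
    and total: "\<And>x. x \<in> S \<Longrightarrow> (\<And>m. m \<in> M \<Longrightarrow> ip x m = 0) \<Longrightarrow> nrm x = 0" and x: "x \<in> S"
  obtains X :: "nat \<Rightarrow> 'a" where "\<And>n. X n \<in> M" "(\<lambda>n. nrm (sub (X n) x)) \<longlonglongrightarrow> 0"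
proof -
  define D where "D m = (nrm (sub x m))\<^sup>2" for m
  define d where "d = Inf (D ` M)"
  have bdd: "bdd_below (D ` M)" by (rule bdd_belowI[of _ 0]) (auto simp: D_def)
  have d_le: "d \<le> D m" if "m \<in> M" for m
    unfolding d_def using bdd that by (intro cInf_lower) auto
  have "\<exists>m\<in>M. D m < d + 1 / (real n + 1)" for n :: nat
  proof -
    have "d < d + 1 / (real n + 1)" by simp
    then show ?thesis using cInf_less_iff[OF _ bdd, of "d + 1 / (real n + 1)"] M(2)
      unfolding d_def[symmetric] by auto
  qed
  then obtain X where XM: "\<And>n::nat. X n \<in> M" and XD: "\<And>n. D (X n) < d + 1 / (real n + 1)" by metis
  have XS: "X n \<in> S" for n using XM M by auto
  have par: "(nrm (sub (X m) (X n)))\<^sup>2 \<le> 2 / (real m + 1) + 2 / (real n + 1)" for m n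
  proof -
    let ?h = "scl (1/2) (add (X m) (X n))"
    have hM: "?h \<in> M" using M_add M_scl XM by simp
    have e: "(nrm (sub (X m) (X n)))\<^sup>2 = 2 * D (X m) + 2 * D (X n) - 4 * D ?h"
    proof -
      have "Re (ip (X n) x) = Re (ip x (X n))" for n using ip_cnj[of x "X n"] x XS by simp
      moreover have "Re (ip (X n) (X m)) = Re (ip (X m) (X n))" using ip_cnj[of "X m" "X n"] XS by simp
      ultimately show ?thesis
        unfolding D_def using x XS by (simp add: nrm_sq ip_expand field_simps)
    qed
    show ?thesis using e XD[of m] XD[of n] d_le[OF hM] by simp
  qed
  have "\<exists>p\<in>S. (\<lambda>n. nrm (sub (X n) p)) \<longlonglongrightarrow> 0"
  proof (rule complete[OF XS])
    fix e :: real assume "e > 0"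
    then obtain N :: nat where N: "1 / (real N + 1) < e\<^sup>2 / 4"
      using nat_approx_posE[of "e\<^sup>2 / 4"] by (auto simp: add.commute)
    have "nrm (sub (X m) (X n)) < e" if "m \<ge> N" "n \<ge> N" for m n
    proof -
      have "1 / (real m + 1) \<le> 1 / (real N + 1)" "1 / (real n + 1) \<le> 1 / (real N + 1)"
        using that by (auto intro!: divide_left_mono)
      then have "(nrm (sub (X m) (X n)))\<^sup>2 < e\<^sup>2" using par[of m n] N by simp
      then show ?thesis using \<open>e > 0\<close> by (simp add: power2_less_imp_less)
    qed
    then show "\<exists>N. \<forall>m\<ge>N. \<forall>n\<ge>N. nrm (sub (X m) (X n)) < e" by blast
  qed
  then obtain p where p: "p \<in> S" and lim: "(\<lambda>n. nrm (sub (X n) p)) \<longlonglongrightarrow> 0" by blast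
  \<comment> \<open>Moving X n by the optimal multiple of m lowers the squared distance by |<x - X
    n, m>|^2 / |m|^2. This cannot exceed the excess of X n over the infimum d.\<close>
  have small: "(cmod (ip (sub x (X n)) m))\<^sup>2 \<le> (nrm m)\<^sup>2 * (1 / (real n + 1))" if m: "m \<in> M" for m n
  proof (cases "nrm m = 0")
    case True
    then have "ip m (sub x (X n)) = 0" using null_ip[of m "sub x (X n)"] m M x XS sub_closed by auto
    then have "ip (sub x (X n)) m = 0"
      using ip_cnj[of m "sub x (X n)"] m M x XS sub_closed by auto
    then show ?thesis by simp
  next
    case False
    then have pos: "(nrm m)\<^sup>2 > 0" by simp
    define g where "g = ip (sub x (X n)) m"
    define c where "c = g / of_real ((nrm m)\<^sup>2)"
    have mS: "m \<in> S" using m M by auto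
    have qM: "add (X n) (scl c m) \<in> M" using M_add M_scl XM m by simp
    have "D (add (X n) (scl c m)) = (nrm (sub (sub x (X n)) (scl c m)))\<^sup>2"
    proof -
      have "ip (sub x (add (X n) (scl c m))) (sub x (add (X n) (scl c m))) =
        ip (sub (sub x (X n)) (scl c m)) (sub (sub x (X n)) (scl c m))"
        using x XS mS by (simp add: ip_expand algebra_simps)
      then show ?thesis by (simp add: D_def nrm_def)
    qed
    also have "\<dots> = D (X n) - 2 * Re (cnj c * g) + (cmod c * nrm m)\<^sup>2"
      using x XS mS by (simp add: nrm_sub_sq sub_closed scl_closed D_def ip_scl_right nrm_scl g_def)
    also have "Re (cnj c * g) = (cmod g)\<^sup>2 / (nrm m)\<^sup>2"
      unfolding c_def by (simp add: cmod_power2 add_divide_distrib) (simp add: power2_eq_square)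
    also have "(cmod c * nrm m)\<^sup>2 = (cmod g)\<^sup>2 / (nrm m)\<^sup>2"
      using pos unfolding c_def
      by (simp add: norm_divide power_divide power_mult_distrib norm_power) (simp add: field_simps power2_eq_square power4_eq_xxxx)
    finally have "(cmod g)\<^sup>2 / (nrm m)\<^sup>2 \<le> D (X n) - d" using d_le[OF qM] by simp
    also have "\<dots> \<le> 1 / (real n + 1)" using XD[of n] by simp
    finally show ?thesis using pos by (simp add: g_def field_simps)
  qed
  have "nrm (sub x p) = 0"
  proof (rule total)
    show "sub x p \<in> S" using x p sub_closed by simp
    fix m assume m: "m \<in> M"
    then have mS: "m \<in> S" using M by auto
    have "(\<lambda>n. ip (X n) m) \<longlonglongrightarrow> ip p m" by (rule ip_tendsto_left[OF XS p mS lim])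
    then have 1: "(\<lambda>n. ip (sub x (X n)) m) \<longlonglongrightarrow> ip (sub x p) m"
      using x XS mS p by (auto simp: ip_expand intro!: tendsto_intros)
    have 2: "(\<lambda>n. ip (sub x (X n)) m) \<longlonglongrightarrow> 0"
    proof (rule Lim_null_comparison)
      have "cmod (ip (sub x (X n)) m) \<le> nrm m * sqrt (1 / (real n + 1))" for n
        using real_sqrt_le_mono[OF small[OF m, of n]] nrm_nonneg[OF mS] by (simp only: real_sqrt_mult real_sqrt_abs abs_norm_cancel abs_of_nonneg)
      then show "\<forall>\<^sub>F n in sequentially. norm (ip (sub x (X n)) m) \<le> nrm m * sqrt (1 / (real n + 1))"
        by simp
      have "(\<lambda>n. 1 / (real n + 1)) \<longlonglongrightarrow> 0"
        using LIMSEQ_inverse_real_of_nat by (simp add: divide_inverse add.commute)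
      then have "(\<lambda>n. nrm m * sqrt (1 / (real n + 1))) \<longlonglongrightarrow> nrm m * sqrt 0"
        by (intro tendsto_intros)
      then show "(\<lambda>n. nrm m * sqrt (1 / (real n + 1))) \<longlonglongrightarrow> 0" by simp
    qed
    show "ip (sub x p) m = 0" using LIMSEQ_unique[OF 1 2] .
  qed
  then have "nrm (sub (X n) x) \<le> nrm (sub (X n) p)" for n
    using nrm_triangle_sub[OF XS[of n] p x] nrm_sub_commute[OF x p] by simp
  then have "(\<lambda>n. nrm (sub (X n) x)) \<longlonglongrightarrow> 0"
    using XS x nrm_nonneg sub_closed by (intro tendsto_sandwich[OF _ _ tendsto_const lim]) auto
  with XM that show thesis by blast
qed

end

text \<open>T is a linear relation, not a function: an isometric assignment between two total
  families, given together with its linear combinations. It is to be extended to a unitary map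
  between the whole spaces.\<close>

locale iso_pair = A: complete_sip S1 add1 scl1 ip1 + B: complete_sip S2 add2 scl2 ip2
  for S1 :: "'a set" and add1 scl1 ip1 and S2 :: "'b set" and add2 scl2 ip2 +
  fixes T :: "('a \<times> 'b) set"
  assumes T_sub: "T \<subseteq> S1 \<times> S2" and T_ne: "T \<noteq> {}"
    and T_add: "(x, X) \<in> T \<Longrightarrow> (y, Y) \<in> T \<Longrightarrow> (add1 x y, add2 X Y) \<in> T"
    and T_scl: "(x, X) \<in> T \<Longrightarrow> (scl1 c x, scl2 c X) \<in> T"
    and T_ip: "(x, X) \<in> T \<Longrightarrow> (y, Y) \<in> T \<Longrightarrow> ip1 x y = ip2 X Y"
    and T_total1: "x \<in> S1 \<Longrightarrow> (\<And>y Y. (y, Y) \<in> T \<Longrightarrow> ip1 x y = 0) \<Longrightarrow> A.nrm x = 0"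
    and T_total2: "X \<in> S2 \<Longrightarrow> (\<And>y Y. (y, Y) \<in> T \<Longrightarrow> ip2 X Y = 0) \<Longrightarrow> B.nrm X = 0"
begin

text \<open>The extension is described by duality with T instead of as a closure. Linearity and
  closedness are then immediate, and totality of the second projection makes the image unique up to
  null vectors.\<close>

definition W :: "('a \<times> 'b) set" where
  "W = {(f, F). f \<in> S1 \<and> F \<in> S2 \<and> (\<forall>(g, G)\<in>T. ip1 f g = ip2 F G)}"

lemma W_D: "(f, F) \<in> W \<Longrightarrow> f \<in> S1" "(f, F) \<in> W \<Longrightarrow> F \<in> S2"
  "(f, F) \<in> W \<Longrightarrow> (g, G) \<in> T \<Longrightarrow> ip1 f g = ip2 F G"
  by (auto simp: W_def)

lemma T_D: "(g, G) \<in> T \<Longrightarrow> g \<in> S1" "(g, G) \<in> T \<Longrightarrow> G \<in> S2"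
  using T_sub by auto

lemma T_sub_W: "T \<subseteq> W"
  using T_sub T_ip by (auto simp: W_def)

lemma W_add: "(f, F) \<in> W \<Longrightarrow> (g, G) \<in> W \<Longrightarrow> (add1 f g, add2 F G) \<in> W"
  using T_D by (auto simp: W_def A.add_closed B.add_closed A.ip_add B.ip_add split: prod.splits)

lemma W_scl: "(f, F) \<in> W \<Longrightarrow> (scl1 c f, scl2 c F) \<in> W"
  using T_D by (auto simp: W_def A.scl_closed B.scl_closed A.ip_scl B.ip_scl split: prod.splits)

lemma W_sub: "(f, F) \<in> W \<Longrightarrow> (g, G) \<in> W \<Longrightarrow> (A.sub f g, B.sub F G) \<in> W"
  unfolding A.sub_def B.sub_def by (intro W_add W_scl)

lemma W_unique: "(f, F) \<in> W \<Longrightarrow> (f, G) \<in> W \<Longrightarrow> B.nrm (B.sub F G) = 0"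
proof (rule T_total2)
  assume h: "(f, F) \<in> W" "(f, G) \<in> W"
  then show "B.sub F G \<in> S2" using W_D B.sub_closed by blast
  fix y Y assume y: "(y, Y) \<in> T"
  then have "ip2 (B.sub F G) Y = ip2 F Y - ip2 G Y" using h W_D T_D by (intro B.ip_sub) blast+
  then show "ip2 (B.sub F G) Y = 0" using W_D(3)[OF h(1) y] W_D(3)[OF h(2) y] by simp
qed

text \<open>The first projection of T is dense because it is total. An approximating sequence for f
  is Cauchy, hence so are its images by isometry, and their limit is paired with f by continuity of
  the inner products.\<close>

lemma W_approx_dom:
  assumes f: "f \<in> S1"
  obtains F x X where "(f, F) \<in> W" "\<And>n::nat. (x n, X n) \<in> T"
    "(\<lambda>n. A.nrm (A.sub (x n) f)) \<longlonglongrightarrow> 0" "(\<lambda>n. B.nrm (B.sub (X n) F)) \<longlonglongrightarrow> 0"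
proof -
  obtain x where x: "\<And>n::nat. x n \<in> fst ` T" and xl: "(\<lambda>n. A.nrm (A.sub (x n) f)) \<longlonglongrightarrow> 0"
  proof (rule A.total_imp_dense[of "fst ` T" f])
    show "fst ` T \<subseteq> S1" using T_sub by auto
    show "fst ` T \<noteq> {}" using T_ne by auto
    show "add1 x y \<in> fst ` T" if "x \<in> fst ` T" "y \<in> fst ` T" for x y
      using that T_add by (force intro: rev_image_eqI)
    show "scl1 c x \<in> fst ` T" if "x \<in> fst ` T" for x c
      using that T_scl by (force intro: rev_image_eqI)
    show "A.nrm x = 0" if "x \<in> S1" "\<And>m. m \<in> fst ` T \<Longrightarrow> ip1 x m = 0" for x
      using that(1) that(2)[OF image_eqI[of _ fst]] by (intro T_total1) auto
  qed (use f in auto)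
  have "\<exists>Y. (x n, Y) \<in> T" for n using x[of n] by auto
  then obtain X where X: "\<And>n. (x n, X n) \<in> T" by metis
  have xS: "x n \<in> S1" and XS: "X n \<in> S2" for n using X T_D by blast+
  have eq: "B.nrm (B.sub (X m) (X n)) = A.nrm (A.sub (x m) (x n))" for m n
  proof -
    have "(A.sub (x m) (x n), B.sub (X m) (X n)) \<in> T"
      unfolding A.sub_def B.sub_def using X T_add T_scl by blast
    then show ?thesis using T_ip by (simp add: A.nrm_def B.nrm_def)
  qed
  have "\<exists>F\<in>S2. (\<lambda>n. B.nrm (B.sub (X n) F)) \<longlonglongrightarrow> 0"
  proof (rule B.complete[OF XS])
    fix e :: real assume "e > 0"
    then obtain N where N: "\<And>n. n \<ge> N \<Longrightarrow> A.nrm (A.sub (x n) f) < e / 2"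
      using LIMSEQ_D[OF xl, of "e / 2"] xS f A.nrm_nonneg A.sub_closed by fastforce
    have "B.nrm (B.sub (X m) (X n)) < e" if "m \<ge> N" "n \<ge> N" for m n
      using A.nrm_triangle_sub[OF xS[of m] f xS[of n]] A.nrm_sub_commute[OF f xS[of n]] N[of m] N[of n] that
      by (simp add: eq)
    then show "\<exists>N. \<forall>m\<ge>N. \<forall>n\<ge>N. B.nrm (B.sub (X m) (X n)) < e" by blast
  qed
  then obtain F where F: "F \<in> S2" and Xl: "(\<lambda>n. B.nrm (B.sub (X n) F)) \<longlonglongrightarrow> 0" by blast
  have "ip1 f g = ip2 F G" if gG: "(g, G) \<in> T" for g G
  proof (rule LIMSEQ_unique)
    show "(\<lambda>n. ip1 (x n) g) \<longlonglongrightarrow> ip1 f g" using A.ip_tendsto_left[OF xS f _ xl] gG T_D by blast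
    show "(\<lambda>n. ip1 (x n) g) \<longlonglongrightarrow> ip2 F G"
      using B.ip_tendsto_left[OF XS F _ Xl, of G] gG T_D T_ip[OF X gG] by simp
  qed
  then have "(f, F) \<in> W" using f F by (auto simp: W_def)
  then show thesis using that X xl Xl by blast
qed

lemma W_exists: "f \<in> S1 \<Longrightarrow> \<exists>F. (f, F) \<in> W"
  using W_approx_dom by metis

lemma W_approx:
  assumes fF: "(f, F) \<in> W"
  obtains x X where "\<And>n::nat. (x n, X n) \<in> T"
    "(\<lambda>n. A.nrm (A.sub (x n) f)) \<longlonglongrightarrow> 0" "(\<lambda>n. B.nrm (B.sub (X n) F)) \<longlonglongrightarrow> 0"
proof -
  obtain F' x X where h: "(f, F') \<in> W" "\<And>n::nat. (x n, X n) \<in> T"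
    "(\<lambda>n. A.nrm (A.sub (x n) f)) \<longlonglongrightarrow> 0" "(\<lambda>n. B.nrm (B.sub (X n) F')) \<longlonglongrightarrow> 0"
    using W_approx_dom W_D(1)[OF fF] by metis
  have S: "F \<in> S2" "F' \<in> S2" "X n \<in> S2" for n using fF h W_D T_D by blast+
  have "B.nrm (B.sub (X n) F) \<le> B.nrm (B.sub (X n) F')" for n
    using B.nrm_triangle_sub[OF S(3,2,1), of n] W_unique[OF h(1) fF] by simp
  then have "(\<lambda>n. B.nrm (B.sub (X n) F)) \<longlonglongrightarrow> 0"
    using S B.nrm_nonneg B.sub_closed by (intro tendsto_sandwich[OF _ _ tendsto_const h(4)]) auto
  with h that show thesis by blast
qed

lemma W_ip:
  assumes fF: "(f, F) \<in> W" and gG: "(g, G) \<in> W"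
  shows "ip1 f g = ip2 F G"
proof -
  obtain x X where h: "\<And>n::nat. (x n, X n) \<in> T"
    "(\<lambda>n. A.nrm (A.sub (x n) f)) \<longlonglongrightarrow> 0" "(\<lambda>n. B.nrm (B.sub (X n) F)) \<longlonglongrightarrow> 0"
    using W_approx[OF fF] by blast
  have S: "F \<in> S2" "f \<in> S1" "g \<in> S1" "G \<in> S2" "X n \<in> S2" "x n \<in> S1" for n
    using fF gG h W_D T_D by blast+
  have e: "ip1 (x n) g = ip2 (X n) G" for n
    using W_D(3)[OF gG h(1)[of n]] A.ip_cnj[OF S(3,6)] B.ip_cnj[OF S(4,5)] by simp
  show ?thesis
    using LIMSEQ_unique[OF A.ip_tendsto_left[OF S(6) S(2,3) h(2)]] B.ip_tendsto_left[OF S(5) S(1,4) h(3)]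
    unfolding e by blast
qed

lemma W_nrm: "(f, F) \<in> W \<Longrightarrow> A.nrm f = B.nrm F"
  using W_ip by (simp add: A.nrm_def B.nrm_def)

lemma W_closed:
  assumes gG: "\<And>n::nat. (g n, G n) \<in> W" and fF: "f \<in> S1" "F \<in> S2"
    and "(\<lambda>n. A.nrm (A.sub (g n) f)) \<longlonglongrightarrow> 0" "(\<lambda>n. B.nrm (B.sub (G n) F)) \<longlonglongrightarrow> 0"
  shows "(f, F) \<in> W"
proof -
  have "ip1 f y = ip2 F Y" if y: "(y, Y) \<in> T" for y Y
  proof (rule LIMSEQ_unique)
    show "(\<lambda>n. ip1 (g n) y) \<longlonglongrightarrow> ip1 f y" using A.ip_tendsto_left[of g f y] assms(2,4) W_D(1)[OF gG] T_D(1)[OF y] by blast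
    show "(\<lambda>n. ip1 (g n) y) \<longlonglongrightarrow> ip2 F Y"
      using B.ip_tendsto_left[of G F Y] assms(3,5) W_D(2)[OF gG] T_D(2)[OF y] W_D(3)[OF gG y] by simp
  qed
  then show ?thesis using fF by (auto simp: W_def)
qed

lemma W_null:
  assumes fF: "(f, F) \<in> W" and "f' \<in> S1" "A.nrm (A.sub f f') = 0" and "F' \<in> S2" "B.nrm (B.sub F F') = 0"
  shows "(f', F') \<in> W"
  by (rule W_closed[of "\<lambda>n. f" "\<lambda>n. F"]) (use assms in auto)

text \<open>The hypotheses are symmetric, so surjectivity of the extension is existence of images
  for the converse relation.\<close>

lemma iso_pair_converse: "iso_pair S2 add2 scl2 ip2 S1 add1 scl1 ip1 (T\<inverse>)"
proof unfold_locales
  show "T\<inverse> \<subseteq> S2 \<times> S1" using T_sub by auto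
  show "T\<inverse> \<noteq> {}" using T_ne by auto
  show "A.nrm X = 0" if "X \<in> S1" "\<And>y Y. (y, Y) \<in> T\<inverse> \<Longrightarrow> ip1 X Y = 0" for X
    using that by (intro T_total1) auto
  show "B.nrm X = 0" if "X \<in> S2" "\<And>y Y. (y, Y) \<in> T\<inverse> \<Longrightarrow> ip2 X y = 0" for X
    using that by (intro T_total2) auto
qed (simp_all add: T_add T_scl T_ip)

lemma W_exists': "F \<in> S2 \<Longrightarrow> \<exists>f. (f, F) \<in> W"
proof -
  assume F: "F \<in> S2"
  interpret C: iso_pair S2 add2 scl2 ip2 S1 add1 scl1 ip1 "T\<inverse>" by (rule iso_pair_converse)
  obtain f where "(F, f) \<in> C.W" using C.W_exists[OF F] by blast
  then have "(f, F) \<in> W" unfolding C.W_def W_def by force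
  then show ?thesis by blast
qed

lemma W_unique_dom: "(f, F) \<in> W \<Longrightarrow> (g, F) \<in> W \<Longrightarrow> A.nrm (A.sub f g) = 0"
proof -
  assume h: "(f, F) \<in> W" "(g, F) \<in> W"
  have "A.nrm (A.sub f g) = B.nrm (B.sub F F)" using W_nrm[OF W_sub[OF h]] .
  also have "\<dots> = 0" using W_unique[OF h(1) h(1)] .
  finally show ?thesis .
qed

end

section \<open>Square-integrable functions\<close>

lemma L2_I: "F \<in> borel_measurable M \<Longrightarrow> integrable M (\<lambda>t. (cmod (F t))\<^sup>2) \<Longrightarrow> F \<in> L2 M"
  by (simp add: L2_def)

lemma L2_measurable: "F \<in> L2 M \<Longrightarrow> F \<in> borel_measurable M"
  and L2_integrable: "F \<in> L2 M \<Longrightarrow> integrable M (\<lambda>t. (cmod (F t))\<^sup>2)"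
  by (auto simp: L2_def)

lemma cmod_add_sq_le: "(cmod (u + v))\<^sup>2 \<le> 2 * (cmod u)\<^sup>2 + 2 * (cmod v)\<^sup>2"
proof -
  have "(cmod (u + v))\<^sup>2 \<le> (cmod u + cmod v)\<^sup>2" by (intro power_mono norm_triangle_ineq) auto
  also have "\<dots> \<le> 2 * (cmod u)\<^sup>2 + 2 * (cmod v)\<^sup>2"
    using sum_squares_bound[of "cmod u" "cmod v"] by (simp add: power2_sum)
  finally show ?thesis .
qed

lemma L2_add: "F \<in> L2 M \<Longrightarrow> G \<in> L2 M \<Longrightarrow> (\<lambda>t. F t + G t) \<in> L2 M"
proof (rule L2_I)
  assume F: "F \<in> L2 M" and G: "G \<in> L2 M"
  note [measurable] = L2_measurable[OF F] L2_measurable[OF G]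
  show "(\<lambda>t. F t + G t) \<in> borel_measurable M" by measurable
  show "integrable M (\<lambda>t. (cmod (F t + G t))\<^sup>2)"
    by (rule Bochner_Integration.integrable_bound[of M "\<lambda>t. 2 * (cmod (F t))\<^sup>2 + 2 * (cmod (G t))\<^sup>2"])
       (use L2_integrable[OF F] L2_integrable[OF G] cmod_add_sq_le in auto)
qed

lemma L2_cmult: "F \<in> L2 M \<Longrightarrow> (\<lambda>t. c * F t) \<in> L2 M"
  by (rule L2_I) (auto simp: L2_def norm_mult power_mult_distrib)

lemma L2_diff: "F \<in> L2 M \<Longrightarrow> G \<in> L2 M \<Longrightarrow> (\<lambda>t. F t - G t) \<in> L2 M"
  using L2_add[of F M "\<lambda>t. (-1) * G t"] L2_cmult[of G M "-1"] by simp

lemma L2_integrable_mult: "F \<in> L2 M \<Longrightarrow> G \<in> L2 M \<Longrightarrow> integrable M (\<lambda>t. F t * cnj (G t))"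
proof -
  assume F: "F \<in> L2 M" and G: "G \<in> L2 M"
  note [measurable] = L2_measurable[OF F] L2_measurable[OF G]
  have "cmod (F t) * cmod (G t) \<le> (cmod (F t))\<^sup>2 + (cmod (G t))\<^sup>2" for t
    using sum_squares_bound[of "cmod (F t)" "cmod (G t)"] mult_nonneg_nonneg[OF norm_ge_zero[of "F t"] norm_ge_zero[of "G t"]]
    by linarith
  then have le: "cmod (F t * cnj (G t)) \<le> norm ((cmod (F t))\<^sup>2 + (cmod (G t))\<^sup>2)" for t
    by (simp add: norm_mult)
  show ?thesis
  proof (rule Bochner_Integration.integrable_bound)
    show "integrable M (\<lambda>t. (cmod (F t))\<^sup>2 + (cmod (G t))\<^sup>2)"
      using L2_integrable[OF F] L2_integrable[OF G] by simp
    show "(\<lambda>t. F t * cnj (G t)) \<in> borel_measurable M"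
      by (intro borel_measurable_times measurable_compose[OF _ borel_measurable_continuous_onI[OF continuous_on_cnj[OF continuous_on_id]], of G]) measurable
  qed (use le in simp)
qed

lemma L2_inner_self: "L2_inner M F F = of_real (LINT t|M. (cmod (F t))\<^sup>2)"
  unfolding L2_inner_def by (simp flip: complex_norm_square integral_complex_of_real)

interpretation L2: sip_space "L2 M" "\<lambda>F G t. F t + G t" "\<lambda>c F t. c * F t" "L2_inner M" for M
proof unfold_locales
  fix x y z :: "real \<Rightarrow> complex" and c
  show "x \<in> L2 M \<Longrightarrow> y \<in> L2 M \<Longrightarrow> z \<in> L2 M \<Longrightarrow> L2_inner M (\<lambda>t. x t + y t) z = L2_inner M x z + L2_inner M y z"
    unfolding L2_inner_def by (simp add: distrib_right L2_integrable_mult)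
  show "L2_inner M (\<lambda>t. c * x t) z = c * L2_inner M x z"
    unfolding L2_inner_def by (simp add: mult.assoc)
  show "L2_inner M y x = cnj (L2_inner M x y)"
    unfolding L2_inner_def Bochner_Integration.integral_cnj[symmetric] by (simp add: mult.commute)
  show "0 \<le> Re (L2_inner M x x)" by (simp add: L2_inner_self)
qed (simp_all add: L2_add L2_cmult)

lemma L2_nrm: "L2.nrm M F = L2_norm M F"
  by (simp add: L2.nrm_def L2_norm_def L2_inner_self)

lemma L2_sub: "L2.sub F G = (\<lambda>t. F t - G t)"
  by (simp add: L2.sub_def)

lemma L2_norm_null: "F \<in> L2 M \<Longrightarrow> L2_norm M F = 0 \<longleftrightarrow> (AE t in M. F t = 0)"
  unfolding L2_norm_def using integral_nonneg_eq_0_iff_AE[OF L2_integrable] by simp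

lemma L2_norm_sq: "(L2_norm M F)\<^sup>2 = (LINT t|M. (cmod (F t))\<^sup>2)"
  by (simp add: L2_norm_def)

lemma L2_cong_AE:
  assumes "F \<in> L2 M" "G \<in> borel_measurable M" "AE t in M. F t = G t"
  shows "G \<in> L2 M"
proof (rule L2_I[OF assms(2)])
  note [measurable] = L2_measurable[OF assms(1)] assms(2)
  show "integrable M (\<lambda>t. (cmod (G t))\<^sup>2)"
    using assms(3) by (intro integrable_cong_AE_imp[OF L2_integrable[OF assms(1)]]) auto
qed

lemma ennreal_le_suminf: "f k \<le> (\<Sum>k. f k)" for f :: "nat \<Rightarrow> ennreal"
  by (rule order_trans[OF _ sum_le_suminf[OF summableI, of "{k}"]]) auto

text \<open>Riesz-Fischer. It is applied both to the spectral measure and, through Cholesky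
  coordinates, to the weighted space on the half-line.\<close>

theorem L2_complete:
  fixes F :: "nat \<Rightarrow> real \<Rightarrow> complex"
  assumes F: "\<And>n. F n \<in> L2 M"
    and C: "\<And>e. e > 0 \<Longrightarrow> \<exists>N. \<forall>m\<ge>N. \<forall>n\<ge>N. L2_norm M (\<lambda>t. F m t - F n t) < e"
  shows "\<exists>G\<in>L2 M. (\<lambda>n. L2_norm M (\<lambda>t. F n t - G t)) \<longlonglongrightarrow> 0"
proof -
  note [measurable] = L2_measurable[OF F]
  have "\<exists>N. \<forall>k. \<forall>m\<ge>N k. \<forall>n\<ge>N k. L2_norm M (\<lambda>t. F m t - F n t) < (1/4) ^ k"
    using C by (intro choice) simp
  then obtain N :: "nat \<Rightarrow> nat" where N: "\<And>k m n. m \<ge> N k \<Longrightarrow> n \<ge> N k \<Longrightarrow> L2_norm M (\<lambda>t. F m t - F n t) < (1/4) ^ k"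
    by blast
  \<comment> \<open>The partial sums make the subsequence monotone and at the same time at least N k
    and at least k.\<close>
  define r where "r k = k + (\<Sum>i\<le>k. N i)" for k
  have rN: "r k \<ge> N k" for k unfolding r_def using member_le_sum[of k "{..k}" N] by simp
  have r_mono: "r k \<le> r (Suc k)" for k unfolding r_def by simp
  have r_ge: "r k \<ge> k" for k unfolding r_def by simp
  define d where "d k t = F (r (Suc k)) t - F (r k) t" for k t
  have dL: "d k \<in> L2 M" for k unfolding d_def by (intro L2_diff F)
  note [measurable] = L2_measurable[OF dL]
  have dn: "(LINT t|M. (cmod (d k t))\<^sup>2) \<le> (1/16) ^ k" for k
  proof -
    have "L2_norm M (d k) \<le> (1/4) ^ k"
      unfolding d_def using N[of k "r (Suc k)" "r k"] rN[of k] r_mono[of k] by simp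
    then have "(L2_norm M (d k))\<^sup>2 \<le> ((1/4) ^ k)\<^sup>2" by (intro power_mono) (auto simp: L2_norm_def)
    also have "((1/4::real) ^ k)\<^sup>2 = (1/16) ^ k" by (simp add: power2_eq_square flip: power_mult_distrib)
    finally show ?thesis by (simp add: L2_norm_sq)
  qed
  \<comment> \<open>The weight 4^k leaves summable integrals 4^(-k), while finiteness of the
    weighted sum at t forces |d k t| <= sqrt c * 2^(-k), which makes the differences summable
    pointwise.\<close>
  have nn: "(\<integral>\<^sup>+ t. ennreal (4 ^ k * (cmod (d k t))\<^sup>2) \<partial>M) \<le> ennreal ((1/4) ^ k)" for k
  proof -
    have "(\<integral>\<^sup>+ t. ennreal (4 ^ k * (cmod (d k t))\<^sup>2) \<partial>M) = ennreal (LINT t|M. 4 ^ k * (cmod (d k t))\<^sup>2)"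
      using L2_integrable[OF dL] by (intro nn_integral_eq_integral) auto
    also have "(LINT t|M. 4 ^ k * (cmod (d k t))\<^sup>2) \<le> 4 ^ k * (1/16) ^ k"
      using dn[of k] by simp
    also have "(4::real) ^ k * (1/16) ^ k = (1/4) ^ k" by (simp flip: power_mult_distrib)
    finally show ?thesis by (simp add: ennreal_leI)
  qed
  have "(\<integral>\<^sup>+ t. (\<Sum>k. ennreal (4 ^ k * (cmod (d k t))\<^sup>2)) \<partial>M) = (\<Sum>k. \<integral>\<^sup>+ t. ennreal (4 ^ k * (cmod (d k t))\<^sup>2) \<partial>M)"
    by (rule nn_integral_suminf) measurable
  also have "\<dots> \<le> (\<Sum>k. ennreal ((1/4) ^ k))" by (intro suminf_le nn) auto
  also have "\<dots> = ennreal (\<Sum>k. (1/4) ^ k)" by (intro suminf_ennreal2) (auto intro: summable_geometric)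
  also have "\<dots> < \<infinity>" by simp
  finally have "AE t in M. (\<Sum>k. ennreal (4 ^ k * (cmod (d k t))\<^sup>2)) \<noteq> \<infinity>"
    by (intro nn_integral_PInf_AE) auto
  then have conv: "AE t in M. convergent (\<lambda>k. F (r k) t)"
  proof eventually_elim
    case (elim t)
    then obtain c where c: "(\<Sum>k. ennreal (4 ^ k * (cmod (d k t))\<^sup>2)) = ennreal c" "c \<ge> 0"
      using ennreal_cases[of "\<Sum>k. ennreal (4 ^ k * (cmod (d k t))\<^sup>2)"] by (metis infinity_ennreal_def)
    have "4 ^ k * (cmod (d k t))\<^sup>2 \<le> c" for k
    proof -
      have "ennreal (4 ^ k * (cmod (d k t))\<^sup>2) \<le> ennreal c"
        unfolding c(1)[symmetric] by (rule ennreal_le_suminf)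
      then show ?thesis using c(2) by (simp add: ennreal_le_iff)
    qed
    then have "cmod (d k t) \<le> sqrt c * (1/2) ^ k" for k
    proof (intro power2_le_imp_le[of "cmod (d k t)"])
      have "((1/2::real) ^ k)\<^sup>2 = 1 / 4 ^ k" by (simp add: power2_eq_square power_divide flip: power_mult_distrib)
      then show "(cmod (d k t))\<^sup>2 \<le> (sqrt c * (1/2) ^ k)\<^sup>2" if "\<And>k. 4 ^ k * (cmod (d k t))\<^sup>2 \<le> c"
        using that[of k] c(2) by (simp add: power_mult_distrib field_simps)
    qed (use c in auto)
    moreover have "summable (\<lambda>k. sqrt c * (1/2) ^ k)"
      by (intro summable_mult summable_geometric) simp
    ultimately have "summable (\<lambda>k. d k t)"
      using summable_comparison_test'[of "\<lambda>k. sqrt c * (1/2) ^ k" 0 "\<lambda>k. d k t"] by simp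
    then have "convergent (\<lambda>n. \<Sum>k<n. d k t)" by (simp add: summable_iff_convergent)
    moreover have "(\<Sum>k<n. d k t) = F (r n) t - F (r 0) t" for n
      unfolding d_def by (rule sum_lessThan_telescope)
    ultimately have "convergent (\<lambda>n. F (r n) t - F (r 0) t)" by simp
    then show ?case using convergent_add[OF _ convergent_const[of "F (r 0) t"]] by fastforce
  qed
  define G where "G t = lim (\<lambda>k. F (r k) t)" for t
  have Gm[measurable]: "G \<in> borel_measurable M"
    unfolding G_def by (rule borel_measurable_lim_metric) measurable
  have lim: "AE t in M. (\<lambda>k. F (r k) t) \<longlonglongrightarrow> G t"
    using conv unfolding G_def by eventually_elim (simp add: convergent_LIMSEQ_iff)
  \<comment> \<open>Fatou's lemma along the subsequence carries the Cauchy estimate over to the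
    pointwise limit G, for integrability and for the bound alike.\<close>
  have key: "integrable M (\<lambda>t. (cmod (F n t - G t))\<^sup>2) \<and> (LINT t|M. (cmod (F n t - G t))\<^sup>2) \<le> e\<^sup>2"
    if e: "e > 0" and n: "\<And>m. m \<ge> n0 \<Longrightarrow> L2_norm M (\<lambda>t. F n t - F m t) < e" for n n0 e
  proof -
    have "(\<integral>\<^sup>+ t. ennreal ((cmod (F n t - G t))\<^sup>2) \<partial>M) =
        (\<integral>\<^sup>+ t. liminf (\<lambda>k. ennreal ((cmod (F n t - F (r k) t))\<^sup>2)) \<partial>M)"
    proof (rule nn_integral_cong_AE, use lim in eventually_elim)
      case (elim t)
      have "(\<lambda>k. ennreal ((cmod (F n t - F (r k) t))\<^sup>2)) \<longlonglongrightarrow> ennreal ((cmod (F n t - G t))\<^sup>2)"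
        by (intro tendsto_intros elim)
      then show ?case by (metis lim_imp_Liminf sequentially_bot)
    qed
    also have "\<dots> \<le> liminf (\<lambda>k. \<integral>\<^sup>+ t. ennreal ((cmod (F n t - F (r k) t))\<^sup>2) \<partial>M)"
      by (rule nn_integral_liminf) measurable
    also have "\<dots> \<le> ennreal (e\<^sup>2)"
    proof (rule Liminf_le[OF sequentially_bot])
      have "(\<integral>\<^sup>+ t. ennreal ((cmod (F n t - F (r k) t))\<^sup>2) \<partial>M) \<le> ennreal (e\<^sup>2)" if "k \<ge> n0" for k
      proof -
        have "(\<integral>\<^sup>+ t. ennreal ((cmod (F n t - F (r k) t))\<^sup>2) \<partial>M) = ennreal ((L2_norm M (\<lambda>t. F n t - F (r k) t))\<^sup>2)"
          unfolding L2_norm_sq using L2_integrable[OF L2_diff[OF F F]] by (intro nn_integral_eq_integral) auto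
        also have "\<dots> \<le> ennreal (e\<^sup>2)"
          using n[of "r k"] r_ge[of k] that
          by (intro ennreal_leI power_mono) (auto simp: L2_norm_def less_imp_le)
        finally show ?thesis .
      qed
      then show "\<forall>\<^sub>F k in sequentially. (\<integral>\<^sup>+ t. ennreal ((cmod (F n t - F (r k) t))\<^sup>2) \<partial>M) \<le> ennreal (e\<^sup>2)"
        unfolding eventually_sequentially by blast
    qed
    finally have b: "(\<integral>\<^sup>+ t. ennreal ((cmod (F n t - G t))\<^sup>2) \<partial>M) \<le> ennreal (e\<^sup>2)" .
    then have int: "integrable M (\<lambda>t. (cmod (F n t - G t))\<^sup>2)"
      by (intro integrableI_bounded) (auto intro: le_less_trans)
    then have "ennreal (LINT t|M. (cmod (F n t - G t))\<^sup>2) \<le> ennreal (e\<^sup>2)"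
      using b by (subst (asm) nn_integral_eq_integral) auto
    then show ?thesis using int by simp
  qed
  obtain n0 where n0: "\<forall>m\<ge>n0. \<forall>n\<ge>n0. L2_norm M (\<lambda>t. F m t - F n t) < 1" using C[of 1] by auto
  have "integrable M (\<lambda>t. (cmod (F n0 t - G t))\<^sup>2)" using key[of 1 n0 n0] n0 by simp
  then have "(\<lambda>t. F n0 t - G t) \<in> L2 M" by (intro L2_I) auto
  from L2_diff[OF F[of n0] this] have GL: "G \<in> L2 M" by simp
  have "(\<lambda>n. L2_norm M (\<lambda>t. F n t - G t)) \<longlonglongrightarrow> 0"
  proof (rule LIMSEQ_I)
    fix e :: real assume "e > 0"
    then obtain n1 where n1: "\<forall>m\<ge>n1. \<forall>n\<ge>n1. L2_norm M (\<lambda>t. F m t - F n t) < e / 2"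
      using C[of "e / 2"] by auto
    have "norm (L2_norm M (\<lambda>t. F n t - G t) - 0) < e" if "n \<ge> n1" for n
    proof -
      have "(LINT t|M. (cmod (F n t - G t))\<^sup>2) \<le> (e / 2)\<^sup>2" using key[of "e / 2" n1 n] n1 that \<open>e > 0\<close> by simp
      then have "L2_norm M (\<lambda>t. F n t - G t) \<le> e / 2"
        unfolding L2_norm_def using \<open>e > 0\<close> by (intro real_le_lsqrt) auto
      then show ?thesis using \<open>e > 0\<close> by (simp add: L2_norm_def)
    qed
    then show "\<exists>n0. \<forall>n\<ge>n0. norm (L2_norm M (\<lambda>t. F n t - G t) - 0) < e" by blast
  qed
  with GL show ?thesis by blast
qed

interpretation L2: complete_sip "L2 M" "\<lambda>F G t. F t + G t" "\<lambda>c F t. c * F t" "L2_inner M" for M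
proof unfold_locales
  fix X :: "nat \<Rightarrow> real \<Rightarrow> complex"
  assume "\<And>n. X n \<in> L2 M" "\<And>e. e > 0 \<Longrightarrow> \<exists>N. \<forall>m\<ge>N. \<forall>n\<ge>N. L2.nrm M (L2.sub (X m) (X n)) < e"
  then show "\<exists>x\<in>L2 M. (\<lambda>n. L2.nrm M (L2.sub (X n) x)) \<longlonglongrightarrow> 0"
    unfolding L2_nrm L2_sub by (rule L2_complete)
qed

section \<open>Integration on the half-line\<close>

abbreviation hline :: "real measure" where "hline \<equiv> lebesgue_on {0<..}"

lemma integrable_lebesgue_on_iff:
  fixes f :: "real \<Rightarrow> 'b::euclidean_space"
  assumes "S \<in> sets lebesgue"
  shows "integrable (lebesgue_on S) f \<longleftrightarrow> f absolutely_integrable_on S"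
  using assms by (simp add: set_integrable_def integrable_restrict_space)

lemma lebesgue_on_integral_eq:
  fixes f :: "real \<Rightarrow> 'b::euclidean_space"
  assumes "S \<in> sets lebesgue" "f absolutely_integrable_on S"
  shows "integral\<^sup>L (lebesgue_on S) f = integral S f"
  using has_integral_integral_lebesgue_on[of S f] assms integrable_lebesgue_on_iff
  by (metis integral_unique)

lemma AE_lebesgue_on_iff:
  assumes "S \<in> sets lebesgue"
  shows "(AE x in lebesgue_on S. P x) \<longleftrightarrow> (AE x in lebesgue. x \<in> S \<longrightarrow> P x)"
  using assms by (intro AE_restrict_space_iff) simp

lemma AE_lebesgue_on_subset:
  assumes "AE x in lebesgue_on S. P x" "T \<subseteq> S" "S \<in> sets lebesgue" "T \<in> sets lebesgue"
  shows "AE x in lebesgue_on T. P x"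
  using assms by (auto simp: AE_lebesgue_on_iff)

lemma AE_lebesgue_negligible: "(AE x in lebesgue. P x) \<longleftrightarrow> negligible {x. \<not> P x}"
  by (simp add: eventually_ae_filter_negligible) (meson Collect_mono negligible_subset mem_Collect_eq subsetI)

lemma AE_on_negligible:
  assumes "AE x in lebesgue_on I. P x" "I \<in> sets lebesgue"
  shows "negligible {x \<in> I. \<not> P x}"
proof -
  have "AE x in lebesgue. x \<in> I \<longrightarrow> P x" using assms by (simp add: AE_lebesgue_on_iff)
  then have "negligible {x. \<not> (x \<in> I \<longrightarrow> P x)}" by (simp only: AE_lebesgue_negligible)
  then show ?thesis by simp
qed

lemma absolutely_integrable_Icc_Ioc:
  fixes f :: "real \<Rightarrow> 'b::euclidean_space"
  shows "f absolutely_integrable_on {a<..b} \<longleftrightarrow> f absolutely_integrable_on {a..b}"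
proof (rule absolutely_integrable_spike_set_eq)
  show "negligible {x \<in> {a<..b} - {a..b}. f x \<noteq> 0}" by (rule negligible_subset[of "{}"]) auto
  show "negligible {x \<in> {a..b} - {a<..b}. f x \<noteq> 0}" by (rule negligible_subset[of "{a}"]) auto
qed

lemma hline_measurable_restrict:
  fixes f :: "real \<Rightarrow> 'b::euclidean_space"
  assumes "f \<in> borel_measurable hline" "S \<subseteq> {0<..}"
  shows "f \<in> borel_measurable (lebesgue_on S)"
  using measurable_restrict_mono[OF assms] .

lemma absolutely_integrable_bounded_by:
  fixes f :: "real \<Rightarrow> 'b::euclidean_space"
  assumes f: "f \<in> borel_measurable hline" and r: "r absolutely_integrable_on {0..b}"
    and le: "\<And>x. 0 < x \<Longrightarrow> x \<le> b \<Longrightarrow> norm (f x) \<le> r x"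
  shows "f absolutely_integrable_on {0..b}"
  unfolding absolutely_integrable_Icc_Ioc[symmetric]
proof (rule measurable_bounded_by_integrable_imp_absolutely_integrable)
  show "f \<in> borel_measurable (lebesgue_on {0<..b})" by (rule hline_measurable_restrict[OF f]) auto
  show "r integrable_on {0<..b}"
    using r unfolding absolutely_integrable_Icc_Ioc[symmetric] by (simp add: absolutely_integrable_on_def)
qed (use le in auto)

lemma continuous_hline_measurable:
  fixes f :: "real \<Rightarrow> 'b::euclidean_space"
  assumes "continuous_on {0..} f"
  shows "f \<in> borel_measurable hline"
  by (rule continuous_imp_measurable_on_sets_lebesgue[OF continuous_on_subset[OF assms]]) auto

lemma hline_integrable_absolutely:
  fixes f :: "real \<Rightarrow> 'b::euclidean_space"
  assumes "integrable hline f"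
  shows "f absolutely_integrable_on {0..b}"
proof -
  have "f absolutely_integrable_on {0<..}" using assms by (simp add: integrable_lebesgue_on_iff)
  then have "f absolutely_integrable_on {0<..b}" by (rule set_integrable_subset) auto
  then show ?thesis by (simp add: absolutely_integrable_Icc_Ioc)
qed

lemma hline_integral_tendsto:
  fixes f :: "real \<Rightarrow> 'b::euclidean_space"
  assumes "integrable hline f"
  shows "((\<lambda>b. integral {0..b} f) \<longlongrightarrow> integral\<^sup>L hline f) at_top"
proof -
  have f0: "f absolutely_integrable_on {0<..}" using assms by (simp add: integrable_lebesgue_on_iff)
  have f1: "f absolutely_integrable_on {0..}"
  proof (subst absolutely_integrable_spike_set_eq[of _ "{0<..}"])
    show "negligible {x \<in> {0..} - {0<..}. f x \<noteq> 0}" by (rule negligible_subset[of "{0}"]) auto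
    show "negligible {x \<in> {0<..} - {0..}. f x \<noteq> 0}" by (rule negligible_subset[of "{}"]) auto
  qed (rule f0)
  have "((\<lambda>b. set_lebesgue_integral lebesgue {0..b} f) \<longlongrightarrow> set_lebesgue_integral lebesgue {0..} f) at_top"
    by (rule tendsto_set_lebesgue_integral_at_top[OF _ f1]) simp
  moreover have "set_lebesgue_integral lebesgue {0..b} f = integral {0..b} f" for b
    by (rule set_lebesgue_integral_eq_integral(2)[OF hline_integrable_absolutely[OF assms]])
  moreover have "set_lebesgue_integral lebesgue {0..} f = integral\<^sup>L hline f"
  proof -
    have "set_lebesgue_integral lebesgue {0..} f = integral {0..} f"
      by (rule set_lebesgue_integral_eq_integral(2)[OF f1])
    also have "\<dots> = integral {0<..} f"
    proof (rule integral_subset_negligible[symmetric])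
      show "negligible ({0..} - {0<..} :: real set)" by (rule negligible_subset[of "{0}"]) auto
    qed auto
    also have "\<dots> = integral\<^sup>L hline f" using lebesgue_on_integral_eq[OF _ f0] by simp
    finally show ?thesis .
  qed
  ultimately show ?thesis by simp
qed

lemma hline_integrableI_bounded:
  fixes f :: "real \<Rightarrow> real"
  assumes m: "f \<in> borel_measurable hline" and nn: "\<And>x. x > 0 \<Longrightarrow> 0 \<le> f x"
    and int: "\<And>b. b \<ge> 0 \<Longrightarrow> f absolutely_integrable_on {0..b}"
    and le: "\<And>b. b \<ge> 0 \<Longrightarrow> integral {0..b} f \<le> C"
  shows "integrable hline f"
proof -
  define g where "g n x = (if x \<le> real n then f x else 0)" for n :: nat and x
  have eq: "(\<lambda>x. indicator {0<..} x *\<^sub>R g n x) = (\<lambda>x. indicator {0<..real n} x *\<^sub>R f x)" for n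
    by (auto simp: g_def indicator_def)
  have gi: "integrable hline (g n)" for n
  proof -
    have "f absolutely_integrable_on {0<..real n}" using int[of "real n"] by (simp add: absolutely_integrable_Icc_Ioc)
    then have "g n absolutely_integrable_on {0<..}" unfolding set_integrable_def eq[of n] .
    then show ?thesis by (simp add: integrable_lebesgue_on_iff)
  qed
  have "integral\<^sup>L hline (g n) = integral {0..real n} f" for n
  proof -
    have "integral\<^sup>L hline (g n) = set_lebesgue_integral lebesgue {0<..real n} f"
      unfolding set_lebesgue_integral_def using eq[of n] by (subst integral_restrict_space) auto
    also have "\<dots> = integral {0<..real n} f"
      using int[of "real n"] by (intro set_lebesgue_integral_eq_integral(2)) (simp add: absolutely_integrable_Icc_Ioc)
    also have "\<dots> = integral {0..real n} f"
    proof (rule integral_subset_negligible)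
      show "negligible ({0..real n} - {0<..real n})" by (rule negligible_subset[of "{0}"]) auto
    qed auto
    finally show ?thesis .
  qed
  then have leC: "integral\<^sup>L hline (g n) \<le> C" for n using le by simp
  have mono: "mono (\<lambda>n. integral\<^sup>L hline (g n))"
    using nn by (intro monoI integral_mono gi) (auto simp: g_def)
  have "incseq (\<lambda>n. integral\<^sup>L hline (g n))" using mono by (simp add: incseq_def mono_def)
  then obtain l where "(\<lambda>n. integral\<^sup>L hline (g n)) \<longlonglongrightarrow> l"
    using incseq_convergent[of "\<lambda>n. integral\<^sup>L hline (g n)" C] leC by blast
  then show ?thesis
  proof (rule integral_monotone_convergence_nonneg[where f = g, rotated 4])
    show "AE x in hline. mono (\<lambda>n. g n x)"
      using nn by (intro AE_I2 monoI) (auto simp: g_def)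
    show "AE x in hline. 0 \<le> g i x" for i using nn by (intro AE_I2) (auto simp: g_def)
    show "AE x in hline. (\<lambda>i. g i x) \<longlonglongrightarrow> f x"
    proof (intro AE_I2)
      fix x
      have "eventually (\<lambda>n. g n x = f x) sequentially"
        using eventually_ge_at_top[of "nat \<lceil>x\<rceil>"] 
      proof eventually_elim
        case (elim n)
        then have "x \<le> real n" by linarith
        then show ?case by (simp add: g_def)
      qed
      then show "(\<lambda>i. g i x) \<longlonglongrightarrow> f x" by (rule tendsto_eventually)
    qed
  qed (use gi m in auto)
qed

section \<open>The Hamiltonian\<close>

definition vec2 :: "complex \<Rightarrow> complex \<Rightarrow> complex^2" where "vec2 s t = vector [s, t]"

lemma vec2_nth [simp]: "vec2 s t $ 1 = s" "vec2 s t $ 2 = t"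
  by (auto simp: vec2_def)

lemma vec2_eq_iff: "u = v \<longleftrightarrow> u $ 1 = v $ 1 \<and> u $ 2 = v $ 2" for u v :: "complex^2"
  by (simp add: vec_eq_iff forall_2)

lemma cdot_eq: "cdot u v = u $ 1 * cnj (v $ 1) + u $ 2 * cnj (v $ 2)"
  by (simp add: cdot_def sum_2)

lemma mact_nth: "mact A v $ i = of_real (A $ i $ 1) * v $ 1 + of_real (A $ i $ 2) * v $ 2"
  by (simp add: mact_def matrix_vector_mult_def map_matrix_def sum_2)

lemma mact_add: "mact A (u + v) = mact A u + mact A v"
  and mact_diff: "mact A (u - v) = mact A u - mact A v"
  and mact_scale: "mact A (c *s u) = c *s mact A u"
  and mact_0: "mact A 0 = 0"
  by (auto simp: vec2_eq_iff mact_nth algebra_simps)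

lemma measurable_vec_nth:
  fixes f :: "'a \<Rightarrow> ('b::euclidean_space) ^ 'n"
  assumes "f \<in> borel_measurable M"
  shows "(\<lambda>x. f x $ i) \<in> borel_measurable M"
  by (rule measurable_compose[OF assms borel_measurable_continuous_onI]) (intro continuous_intros)

lemma measurable_vecI:
  assumes "(\<lambda>x. f x $ 1) \<in> borel_measurable M" "(\<lambda>x. f x $ 2) \<in> borel_measurable M"
  shows "(f :: 'a \<Rightarrow> complex^2) \<in> borel_measurable M"
proof (rule borel_measurable_euclidean_space[THEN iffD2], intro ballI)
  fix i :: "complex^2" assume "i \<in> Basis"
  then obtain j b where i: "i = axis j b" "b \<in> Basis" by (auto simp: Basis_vec_def)
  have "(\<lambda>x. f x \<bullet> i) = (\<lambda>x. f x $ j \<bullet> b)" by (simp add: i inner_axis)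
  moreover have "(\<lambda>x. f x $ j) \<in> borel_measurable M" using assms exhaust_2[of j] by auto
  ultimately show "(\<lambda>x. f x \<bullet> i) \<in> borel_measurable M" by simp
qed

text \<open>The defining properties hold at every point here, not just almost everywhere. A general
  Hamiltonian is replaced by one of this kind in the last section.\<close>

locale ham =
  fixes Ham :: "real \<Rightarrow> real^2^2"
  assumes Ham_meas: "Ham \<in> borel_measurable lebesgue"
    and Ham_sym: "transpose (Ham x) = Ham x"
    and Ham_psd: "v \<bullet> (Ham x *v v) \<ge> 0"
    and Ham_trace: "trace (Ham x) = 1"
begin

definition ha :: "real \<Rightarrow> real" where "ha x = Ham x $ 1 $ 1"
definition hb :: "real \<Rightarrow> real" where "hb x = Ham x $ 1 $ 2"
definition hdd :: "real \<Rightarrow> real" where "hdd x = Ham x $ 2 $ 2"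

lemma Ham_nth: "Ham x $ 1 $ 1 = ha x" "Ham x $ 1 $ 2 = hb x" "Ham x $ 2 $ 1 = hb x" "Ham x $ 2 $ 2 = hdd x"
proof -
  have "Ham x $ 2 $ 1 = transpose (Ham x) $ 1 $ 2" by (simp add: transpose_def)
  then show "Ham x $ 2 $ 1 = hb x" by (simp add: Ham_sym hb_def)
qed (simp_all add: ha_def hb_def hdd_def)

lemma ha_hdd: "ha x + hdd x = 1"
  using Ham_trace[of x] by (simp add: trace_def sum_2 Ham_nth)

lemma psd_quadratic: "0 \<le> s\<^sup>2 * ha x + 2 * s * t * hb x + t\<^sup>2 * hdd x"
proof -
  have "0 \<le> (vector [s, t] :: real^2) \<bullet> (Ham x *v vector [s, t])" by (rule Ham_psd)
  also have "\<dots> = s\<^sup>2 * ha x + 2 * s * t * hb x + t\<^sup>2 * hdd x"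
    by (simp add: inner_vec_def sum_2 matrix_vector_mult_def Ham_nth power2_eq_square algebra_simps)
  finally show ?thesis .
qed

lemma ha_nonneg: "0 \<le> ha x" and hdd_nonneg: "0 \<le> hdd x"
  using psd_quadratic[of 1 x 0] psd_quadratic[of 0 x 1] by simp_all

lemma hdet_nonneg: "(hb x)\<^sup>2 \<le> ha x * hdd x"
proof (cases "ha x = 0")
  case True
  have hd1: "hdd x = 1" using ha_hdd[of x] True by simp
  have "0 \<le> - (hb x)\<^sup>2"
    using psd_quadratic[of "-1" x "hb x"] True hd1 by (simp add: power2_eq_square)
  then show ?thesis using True by simp
next
  case False
  then have "ha x > 0" using ha_nonneg[of x] by simp
  moreover have "0 \<le> ha x * (ha x * hdd x - (hb x)\<^sup>2)"
    using psd_quadratic[of "- hb x" x "ha x"] by (simp add: power2_eq_square algebra_simps)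
  ultimately show ?thesis by (simp add: zero_le_mult_iff)
qed

lemma ha_le: "ha x \<le> 1" and hdd_le: "hdd x \<le> 1"
  using ha_hdd[of x] ha_nonneg[of x] hdd_nonneg[of x] by auto

definition hq :: "real \<Rightarrow> complex^2 \<Rightarrow> complex^2 \<Rightarrow> complex" where
  "hq x u v = cdot u (mact (Ham x) v)"
definition hs :: "real \<Rightarrow> complex^2 \<Rightarrow> real" where "hs x u = Re (hq x u u)"

lemma mact_Ham: "mact (Ham x) v $ 1 = of_real (ha x) * v $ 1 + of_real (hb x) * v $ 2"
  "mact (Ham x) v $ 2 = of_real (hb x) * v $ 1 + of_real (hdd x) * v $ 2"
  by (simp_all add: mact_nth Ham_nth)

lemma hq_eq: "hq x u v = of_real (ha x) * (u $ 1 * cnj (v $ 1)) +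
    of_real (hb x) * (u $ 1 * cnj (v $ 2) + u $ 2 * cnj (v $ 1)) + of_real (hdd x) * (u $ 2 * cnj (v $ 2))"
  by (simp add: hq_def cdot_eq mact_Ham algebra_simps)

lemma hq_left: "hq x u v = mact (Ham x) u $ 1 * cnj (v $ 1) + mact (Ham x) u $ 2 * cnj (v $ 2)"
  by (simp add: hq_eq mact_Ham algebra_simps)

lemma hs_eq: "hs x u = ha x * (cmod (u $ 1))\<^sup>2 + 2 * hb x * Re (u $ 1 * cnj (u $ 2)) + hdd x * (cmod (u $ 2))\<^sup>2"
  by (simp add: hs_def hq_eq cmod_power2) (simp add: power2_eq_square algebra_simps)

text \<open>Entries of a Cholesky factor of the Hamiltonian: \<open>hq\<close> becomes the sum of
  the products of \<open>ch1\<close> and of \<open>ch2\<close>, so the weighted space embeds into a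
  pair of ordinary L2 spaces. If the upper left entry vanishes then the matrix is diag(0, 1);
  \<open>hk\<close> is then 1, and hb / hr is 0 / 0 = 0, as it should be.\<close>

definition hr :: "real \<Rightarrow> real" where "hr x = sqrt (ha x)"
definition hk :: "real \<Rightarrow> real" where
  "hk x = (if ha x = 0 then 1 else sqrt ((ha x * hdd x - (hb x)\<^sup>2) / ha x))"
definition ch1 :: "real \<Rightarrow> complex^2 \<Rightarrow> complex" where
  "ch1 x u = of_real (hr x) * u $ 1 + of_real (hb x / hr x) * u $ 2"
definition ch2 :: "real \<Rightarrow> complex^2 \<Rightarrow> complex" where "ch2 x u = of_real (hk x) * u $ 2"

lemma hq_cholesky: "hq x u v = ch1 x u * cnj (ch1 x v) + ch2 x u * cnj (ch2 x v)"
proof (cases "ha x = 0")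
  case True
  then have "hb x = 0" "hdd x = 1" using hdet_nonneg[of x] ha_hdd[of x] by auto
  then show ?thesis using True by (simp add: hq_eq ch1_def ch2_def hr_def hk_def)
next
  case False
  then have pos: "ha x > 0" using ha_nonneg[of x] by simp
  have r: "hr x * hr x = ha x" "hr x > 0" using pos by (auto simp: hr_def)
  have k: "hk x * hk x = hdd x - hb x * hb x / ha x"
    using pos hdet_nonneg[of x] by (simp add: hk_def field_simps power2_eq_square)
  have b: "hr x * (hb x / hr x) = hb x" "(hb x / hr x) * (hb x / hr x) = hb x * hb x / ha x"
    using r by (auto simp: field_simps)
  have "ch1 x u * cnj (ch1 x v) + ch2 x u * cnj (ch2 x v) =
     of_real (hr x * hr x) * (u $ 1 * cnj (v $ 1)) +
     of_real (hr x * (hb x / hr x)) * (u $ 1 * cnj (v $ 2) + u $ 2 * cnj (v $ 1)) +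
     of_real ((hb x / hr x) * (hb x / hr x) + hk x * hk x) * (u $ 2 * cnj (v $ 2))"
    unfolding ch1_def ch2_def complex_cnj_add complex_cnj_mult complex_cnj_complex_of_real of_real_add of_real_mult
    by (simp add: algebra_simps)
  then show ?thesis unfolding r b k by (simp add: hq_eq)
qed

lemma hs_cholesky: "hs x u = (cmod (ch1 x u))\<^sup>2 + (cmod (ch2 x u))\<^sup>2"
  unfolding hs_def hq_cholesky by (simp add: cmod_power2, simp add: power2_eq_square)

lemma hs_nonneg: "0 \<le> hs x u" by (simp add: hs_cholesky)

lemma hq_self: "hq x u u = of_real (hs x u)"
  unfolding hs_def hq_cholesky by (simp add: complex_eq_iff)

lemma hq_cnj: "cnj (hq x u v) = hq x v u"
  by (simp add: hq_cholesky mult.commute)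

lemma hq_add: "hq x (u + v) w = hq x u w + hq x v w"
  and hq_scale: "hq x (c *s u) w = c * hq x u w"
  and hq_add_right: "hq x w (u + v) = hq x w u + hq x w v"
  and hq_scale_right: "hq x w (c *s u) = cnj c * hq x w u"
  and hq_diff: "hq x (u - v) w = hq x u w - hq x v w"
  and hq_diff_right: "hq x w (u - v) = hq x w u - hq x w v"
  by (simp_all add: hq_eq algebra_simps)

lemma hs_scale: "hs x (c *s u) = (cmod c)\<^sup>2 * hs x u"
proof -
  have "of_real (hs x (c *s u)) = (c * cnj c) * of_real (hs x u)"
    by (simp add: hq_scale hq_scale_right flip: hq_self)
  also have "\<dots> = of_real ((cmod c)\<^sup>2 * hs x u)" by (simp add: complex_norm_square del: of_real_power)
  finally show ?thesis using of_real_eq_iff by blast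
qed

lemma hs_add_le: "hs x (u + v) \<le> 2 * hs x u + 2 * hs x v"
  using cmod_add_sq_le[of "ch1 x u" "ch1 x v"] cmod_add_sq_le[of "ch2 x u" "ch2 x v"]
  by (simp add: hs_cholesky ch1_def ch2_def algebra_simps)

lemma hq_cauchy_schwarz: "(cmod (hq x u v))\<^sup>2 \<le> hs x u * hs x v"
proof -
  have "(cmod (hq x u v))\<^sup>2 \<le> (cmod (ch1 x u) * cmod (ch1 x v) + cmod (ch2 x u) * cmod (ch2 x v))\<^sup>2"
    unfolding hq_cholesky by (intro power_mono order_trans[OF norm_triangle_ineq]) (auto simp: norm_mult)
  also have "\<dots> \<le> hs x u * hs x v"
    using sum_squares_bound[of "cmod (ch1 x u) * cmod (ch2 x v)" "cmod (ch2 x u) * cmod (ch1 x v)"]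
    by (simp add: hs_cholesky power2_eq_square algebra_simps)
  finally show ?thesis .
qed

lemma hq_le: "cmod (hq x u v) \<le> hs x u + hs x v"
proof (rule power2_le_imp_le)
  have "hs x u * hs x v \<le> (hs x u + hs x v)\<^sup>2"
    using hs_nonneg[of x u] hs_nonneg[of x v] by (simp add: power2_sum)
  then show "(cmod (hq x u v))\<^sup>2 \<le> (hs x u + hs x v)\<^sup>2" using hq_cauchy_schwarz order_trans by blast
qed (simp add: hs_nonneg)

text \<open>As the trace is 1, the identity minus H is H conjugated by a rotation through a right
  angle. The estimate is nonnegativity of \<open>hs\<close> at the rotated vector.\<close>

lemma hs_le: "hs x u \<le> (cmod (u $ 1))\<^sup>2 + (cmod (u $ 2))\<^sup>2"
proof -
  have "hs x (vec2 (- cnj (u $ 2)) (cnj (u $ 1))) =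
    hdd x * (cmod (u $ 1))\<^sup>2 - 2 * hb x * Re (u $ 1 * cnj (u $ 2)) + ha x * (cmod (u $ 2))\<^sup>2"
    by (simp add: hs_eq algebra_simps)
  moreover have "hs x (vec2 (- cnj (u $ 2)) (cnj (u $ 1))) \<ge> 0" by (rule hs_nonneg)
  moreover have "hdd x * (cmod (u $ 1))\<^sup>2 = (cmod (u $ 1))\<^sup>2 - ha x * (cmod (u $ 1))\<^sup>2"
    "ha x * (cmod (u $ 2))\<^sup>2 = (cmod (u $ 2))\<^sup>2 - hdd x * (cmod (u $ 2))\<^sup>2"
  proof -
    have h: "hdd x = 1 - ha x" using ha_hdd[of x] by simp
    show "hdd x * (cmod (u $ 1))\<^sup>2 = (cmod (u $ 1))\<^sup>2 - ha x * (cmod (u $ 1))\<^sup>2"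
      "ha x * (cmod (u $ 2))\<^sup>2 = (cmod (u $ 2))\<^sup>2 - hdd x * (cmod (u $ 2))\<^sup>2"
      unfolding h by (simp_all add: algebra_simps)
  qed
  ultimately show ?thesis by (simp add: hs_eq)
qed

text \<open>Cauchy-Schwarz against the two basis vectors, whose weighted norms are at most
  1.\<close>

lemma mact_norm: "(cmod (mact (Ham x) u $ 1))\<^sup>2 \<le> hs x u" "(cmod (mact (Ham x) u $ 2))\<^sup>2 \<le> hs x u"
proof -
  have "hq x u (vec2 1 0) = mact (Ham x) u $ 1" "hq x u (vec2 0 1) = mact (Ham x) u $ 2"
    by (simp_all add: hq_left)
  moreover have "hs x (vec2 1 0) \<le> 1" "hs x (vec2 0 1) \<le> 1"
    using ha_le hdd_le by (simp_all add: hs_eq)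
  ultimately show "(cmod (mact (Ham x) u $ 1))\<^sup>2 \<le> hs x u" "(cmod (mact (Ham x) u $ 2))\<^sup>2 \<le> hs x u"
    using hq_cauchy_schwarz[of x u "vec2 1 0"] hq_cauchy_schwarz[of x u "vec2 0 1"]
      mult_left_mono[OF _ hs_nonneg[of x u]] by (metis mult.right_neutral order_trans)+
qed

lemma hs_zero_iff: "hs x u = 0 \<longleftrightarrow> mact (Ham x) u = 0"
proof
  assume "hs x u = 0"
  then show "mact (Ham x) u = 0" using mact_norm[of x u] by (simp add: vec2_eq_iff)
next
  assume "mact (Ham x) u = 0"
  then show "hs x u = 0" by (simp add: hs_def hq_def cdot_eq)
qed

lemma entries_measurable: "ha \<in> borel_measurable hline" "hb \<in> borel_measurable hline" "hdd \<in> borel_measurable hline"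
proof -
  have "(\<lambda>x. Ham x $ i $ j) \<in> borel_measurable hline" for i j
  proof -
    have "Ham \<in> borel_measurable hline" using Ham_meas by (rule measurable_restrict_space1)
    then have "(\<lambda>x. Ham x $ i) \<in> borel_measurable hline" by (rule measurable_vec_nth)
    then show ?thesis by (rule measurable_vec_nth)
  qed
  then show "ha \<in> borel_measurable hline" "hb \<in> borel_measurable hline" "hdd \<in> borel_measurable hline"
    unfolding ha_def hb_def hdd_def by auto
qed

lemma hq_measurable:
  assumes "f \<in> borel_measurable hline" "g \<in> borel_measurable hline"
  shows "(\<lambda>x. hq x (f x) (g x)) \<in> borel_measurable hline"
proof -
  note [measurable] = entries_measurable assms[THEN measurable_vec_nth]
  have [measurable]: "(\<lambda>x. cnj (g x $ i)) \<in> borel_measurable hline" for i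
    by (rule measurable_compose[OF measurable_vec_nth[OF assms(2)] borel_measurable_continuous_onI]) (intro continuous_intros)
  show ?thesis unfolding hq_eq by measurable
qed

lemma hs_measurable: "f \<in> borel_measurable hline \<Longrightarrow> (\<lambda>x. hs x (f x)) \<in> borel_measurable hline"
  unfolding hs_def using hq_measurable[of f f] by measurable

lemma mact_measurable:
  assumes "f \<in> borel_measurable hline"
  shows "(\<lambda>x. mact (Ham x) (f x) $ i) \<in> borel_measurable hline"
proof -
  note [measurable] = entries_measurable assms[THEN measurable_vec_nth]
  have "(\<lambda>x. mact (Ham x) (f x) $ 1) \<in> borel_measurable hline" "(\<lambda>x. mact (Ham x) (f x) $ 2) \<in> borel_measurable hline"
    unfolding mact_Ham by measurable
  then show ?thesis using exhaust_2[of i] by auto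
qed

text \<open>Local membership in the weighted space. Solutions of the canonical system have it for
  every z, although they need not be globally square integrable.\<close>

definition hloc :: "(real \<Rightarrow> complex^2) \<Rightarrow> bool" where
  "hloc f \<longleftrightarrow> f \<in> borel_measurable hline \<and> (\<forall>b. (\<lambda>x. hs x (f x)) absolutely_integrable_on {0..b})"

lemma hloc_measurable: "hloc f \<Longrightarrow> f \<in> borel_measurable hline"
  and hloc_integrable: "hloc f \<Longrightarrow> (\<lambda>x. hs x (f x)) absolutely_integrable_on {0..b}"
  unfolding hloc_def by blast+

lemma measurable_vec_add:
  fixes f g :: "'a \<Rightarrow> complex^2"
  assumes "f \<in> borel_measurable M" "g \<in> borel_measurable M"
  shows "(\<lambda>x. f x + g x) \<in> borel_measurable M"
  using assms by (rule borel_measurable_add)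

lemma measurable_vec_scale:
  fixes f :: "'a \<Rightarrow> complex^2"
  assumes "f \<in> borel_measurable M"
  shows "(\<lambda>x. c *s f x) \<in> borel_measurable M"
  by (rule measurable_vecI) (use assms[THEN measurable_vec_nth] in simp_all)

lemma hloc_add: assumes "hloc f" "hloc g" shows "hloc (\<lambda>x. f x + g x)"
  unfolding hloc_def
proof (intro conjI allI)
  show m: "(\<lambda>x. f x + g x) \<in> borel_measurable hline"
    using assms by (intro measurable_vec_add hloc_measurable)
  show "(\<lambda>x. hs x (f x + g x)) absolutely_integrable_on {0..b}" for b
  proof (rule absolutely_integrable_bounded_by[OF hs_measurable[OF m]])
    show "(\<lambda>x. 2 * hs x (f x) + 2 * hs x (g x)) absolutely_integrable_on {0..b}"
      using assms by (intro set_integral_add set_integrable_mult_right) (auto simp: hloc_def)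
    show "norm (hs x (f x + g x)) \<le> 2 * hs x (f x) + 2 * hs x (g x)" for x
      using hs_add_le[of x "f x" "g x"] hs_nonneg[of x "f x + g x"] by simp
  qed
qed

lemma hloc_scale: assumes "hloc f" shows "hloc (\<lambda>x. c *s f x)"
  using assms unfolding hloc_def hs_scale by (auto intro: measurable_vec_scale)

lemma hloc_diff: assumes "hloc f" "hloc g" shows "hloc (\<lambda>x. f x - g x)"
  using hloc_add[OF assms(1) hloc_scale[OF assms(2), of "-1"]] by simp

lemma hloc_continuous:
  assumes "continuous_on {0..} f"
  shows "hloc f"
  unfolding hloc_def
proof (intro conjI allI)
  show m: "f \<in> borel_measurable hline" by (rule continuous_hline_measurable[OF assms])
  fix b :: real
  have "continuous_on {0..b} f" by (rule continuous_on_subset[OF assms]) auto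
  then have c: "continuous_on {0..b} (\<lambda>x. (cmod (f x $ 1))\<^sup>2 + (cmod (f x $ 2))\<^sup>2)"
    by (intro continuous_intros)
  show "(\<lambda>x. hs x (f x)) absolutely_integrable_on {0..b}"
    by (rule absolutely_integrable_bounded_by[OF hs_measurable[OF m] absolutely_integrable_continuous_real[OF c]])
       (simp add: hs_nonneg hs_le)
qed

lemma hq_loc_integrable:
  assumes "hloc f" "hloc g" "0 \<le> a"
  shows "(\<lambda>x. hq x (f x) (g x)) absolutely_integrable_on {a..b}"
proof -
  have "(\<lambda>x. hq x (f x) (g x)) absolutely_integrable_on {0..b}"
  proof (rule absolutely_integrable_bounded_by)
    show "(\<lambda>x. hs x (f x) + hs x (g x)) absolutely_integrable_on {0..b}"
      using assms by (intro set_integral_add hloc_integrable)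
    show "(\<lambda>x. hq x (f x) (g x)) \<in> borel_measurable hline"
      using assms by (intro hq_measurable hloc_measurable)
  qed (rule hq_le)
  then show ?thesis by (rule absolutely_integrable_on_subinterval) (use assms in auto)
qed

lemma hs_loc_integrable:
  assumes "hloc f" "0 \<le> a"
  shows "(\<lambda>x. hs x (f x)) absolutely_integrable_on {a..b}"
  by (rule absolutely_integrable_on_subinterval[OF hloc_integrable[OF assms(1), of b]]) (use assms in auto)

lemma mact_loc_integrable:
  assumes "hloc f" "0 \<le> a"
  shows "(\<lambda>x. mact (Ham x) (f x) $ i) absolutely_integrable_on {a..b}"
proof -
  have le: "cmod (mact (Ham x) v $ i) \<le> 1 + hs x v" for x v
  proof -
    have "i = 1 \<or> i = 2" by (rule exhaust_2)
    then have 1: "(cmod (mact (Ham x) v $ i))\<^sup>2 \<le> hs x v"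
      using mact_norm[of x v] by (elim disjE) simp_all
    have 2: "hs x v \<le> (1 + hs x v)\<^sup>2"
      using hs_nonneg[of x v] zero_le_power2[of "hs x v"] unfolding power2_sum by simp
    show ?thesis
      by (rule power2_le_imp_le[OF order_trans[OF 1 2]]) (simp add: hs_nonneg)
  qed
  have "(\<lambda>x. mact (Ham x) (f x) $ i) absolutely_integrable_on {0..b}"
  proof (rule absolutely_integrable_bounded_by)
    show "(\<lambda>x. 1 + hs x (f x)) absolutely_integrable_on {0..b}"
      by (rule set_integral_add(1)[OF absolutely_integrable_on_const hloc_integrable[OF assms(1)]]) simp
    show "(\<lambda>x. mact (Ham x) (f x) $ i) \<in> borel_measurable hline"
      using assms by (intro mact_measurable hloc_measurable)
  qed (rule le)
  then show ?thesis by (rule absolutely_integrable_on_subinterval) (use assms in auto)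
qed

section \<open>Inner products over bounded intervals\<close>

definition hin :: "real \<Rightarrow> real \<Rightarrow> (real \<Rightarrow> complex^2) \<Rightarrow> (real \<Rightarrow> complex^2) \<Rightarrow> complex" where
  "hin a b f g = integral {a..b} (\<lambda>x. hq x (f x) (g x))"
definition hsn :: "real \<Rightarrow> real \<Rightarrow> (real \<Rightarrow> complex^2) \<Rightarrow> real" where
  "hsn a b f = integral {a..b} (\<lambda>x. hs x (f x))"

lemma absolutely_integrable_imp: "f absolutely_integrable_on S \<Longrightarrow> f integrable_on S"
  for f :: "'a::euclidean_space \<Rightarrow> 'b::euclidean_space"
  by (simp add: absolutely_integrable_on_def)

lemma hin_self: "0 \<le> a \<Longrightarrow> hloc f \<Longrightarrow> hin a b f f = of_real (hsn a b f)"
proof -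
  assume h: "0 \<le> a" "hloc f"
  have "((\<lambda>x. complex_of_real (hs x (f x))) has_integral of_real (hsn a b f)) {a..b}"
    unfolding hsn_def using absolutely_integrable_imp[OF hs_loc_integrable[OF h(2,1)]]
    by (intro has_integral_of_real integrable_integral)
  then show ?thesis unfolding hin_def hq_self by (rule integral_unique)
qed

lemma hsn_nonneg: "0 \<le> hsn a b f"
  unfolding hsn_def by (cases "(\<lambda>x. hs x (f x)) integrable_on {a..b}")
    (auto intro: integral_nonneg simp: hs_nonneg not_integrable_integral)

lemma hin_sip: "0 \<le> a \<Longrightarrow> sip_space {f. hloc f} (\<lambda>f g x. f x + g x) (\<lambda>c f x. c *s f x) (hin a b)"
proof unfold_locales
  assume a: "0 \<le> a"
  note ii = absolutely_integrable_imp[OF hq_loc_integrable[OF _ _ a]]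
  fix x y z :: "real \<Rightarrow> complex^2" and c
  show "hin a b (\<lambda>t. x t + y t) z = hin a b x z + hin a b y z"
    if "x \<in> {f. hloc f}" "y \<in> {f. hloc f}" "z \<in> {f. hloc f}"
    using that unfolding hin_def hq_add by (intro integral_add ii) auto
  show "hin a b (\<lambda>t. c *s x t) z = c * hin a b x z"
    unfolding hin_def hq_scale by simp
  show "hin a b y x = cnj (hin a b x y)"
    unfolding hin_def Henstock_Kurzweil_Integration.integral_cnj hq_cnj ..
  show "0 \<le> Re (hin a b x x)" if "x \<in> {f. hloc f}"
    using that hin_self[OF a] hsn_nonneg by auto
qed (simp_all add: hloc_add hloc_scale)

lemma hin_cauchy_schwarz:
  assumes "0 \<le> a" "hloc f" "hloc g"
  shows "cmod (hin a b f g) \<le> sqrt (hsn a b f) * sqrt (hsn a b g)"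
proof -
  interpret sip_space "{f. hloc f}" "\<lambda>f g x. f x + g x" "\<lambda>c f x. c *s f x" "hin a b"
    by (rule hin_sip[OF assms(1)])
  show ?thesis using cauchy_schwarz[of f g] assms by (simp add: nrm_def hin_self)
qed

lemma hsn_triangle:
  assumes "0 \<le> a" "hloc f" "hloc g"
  shows "sqrt (hsn a b (\<lambda>x. f x + g x)) \<le> sqrt (hsn a b f) + sqrt (hsn a b g)"
proof -
  interpret sip_space "{f. hloc f}" "\<lambda>f g x. f x + g x" "\<lambda>c f x. c *s f x" "hin a b"
    by (rule hin_sip[OF assms(1)])
  show ?thesis using nrm_triangle[of f g] assms by (simp add: nrm_def hin_self hloc_add)
qed

lemma hsn_scale: "hsn a b (\<lambda>x. c *s f x) = (cmod c)\<^sup>2 * hsn a b f"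
  unfolding hsn_def hs_scale by simp

lemma hin_split:
  assumes "0 \<le> a" "a \<le> c" "c \<le> b" "hloc f" "hloc g"
  shows "hin a b f g = hin a c f g + hin c b f g"
  unfolding hin_def
  using Henstock_Kurzweil_Integration.integral_combine[OF assms(2,3), of "\<lambda>x. hq x (f x) (g x)"]
    absolutely_integrable_imp[OF hq_loc_integrable[OF assms(4,5,1)]] by simp

lemma hsn_split:
  assumes "0 \<le> a" "a \<le> c" "c \<le> b" "hloc f"
  shows "hsn a b f = hsn a c f + hsn c b f"
  unfolding hsn_def
  using Henstock_Kurzweil_Integration.integral_combine[OF assms(2,3), of "\<lambda>x. hs x (f x)"]
    absolutely_integrable_imp[OF hs_loc_integrable[OF assms(4,1)]] by simp

section \<open>The weighted space and its subspace H\<close>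

lemma weighted_L2_iff:
  "f \<in> weighted_L2 Ham \<longleftrightarrow> f \<in> borel_measurable hline \<and> integrable hline (\<lambda>x. hs x (f x))"
  unfolding weighted_L2_def hq_def[symmetric] hq_self
  using complex_of_real_integrable_eq[of hline "\<lambda>x. hs x (f x)"] by simp

lemma wL2_measurable: "f \<in> weighted_L2 Ham \<Longrightarrow> f \<in> borel_measurable hline"
  and wL2_integrable: "f \<in> weighted_L2 Ham \<Longrightarrow> integrable hline (\<lambda>x. hs x (f x))"
  by (auto simp: weighted_L2_iff)

lemma wL2_hloc: "f \<in> weighted_L2 Ham \<Longrightarrow> hloc f"
  unfolding hloc_def by (auto simp: weighted_L2_iff intro: hline_integrable_absolutely)

lemma wL2_add:
  assumes "f \<in> weighted_L2 Ham" "g \<in> weighted_L2 Ham"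
  shows "(\<lambda>x. f x + g x) \<in> weighted_L2 Ham"
  unfolding weighted_L2_iff
proof
  show m: "(\<lambda>x. f x + g x) \<in> borel_measurable hline"
    using assms by (intro measurable_vec_add wL2_measurable)
  show "integrable hline (\<lambda>x. hs x (f x + g x))"
  proof (rule Bochner_Integration.integrable_bound)
    show "integrable hline (\<lambda>x. 2 * hs x (f x) + 2 * hs x (g x))"
      using assms by (simp add: wL2_integrable)
    show "(\<lambda>x. hs x (f x + g x)) \<in> borel_measurable hline" by (rule hs_measurable[OF m])
    have "norm (hs x (f x + g x)) \<le> norm (2 * hs x (f x) + 2 * hs x (g x))" for x
      using hs_add_le[of x "f x" "g x"] hs_nonneg[of x "f x + g x"] by simp
    then show "AE x in hline. norm (hs x (f x + g x)) \<le> norm (2 * hs x (f x) + 2 * hs x (g x))" by simp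
  qed
qed

lemma wL2_scale: "f \<in> weighted_L2 Ham \<Longrightarrow> (\<lambda>x. c *s f x) \<in> weighted_L2 Ham"
  unfolding weighted_L2_iff hs_scale by (auto intro: measurable_vec_scale)

lemma wL2_diff: "f \<in> weighted_L2 Ham \<Longrightarrow> g \<in> weighted_L2 Ham \<Longrightarrow> (\<lambda>x. f x - g x) \<in> weighted_L2 Ham"
  using wL2_add[of f "\<lambda>x. (-1) *s g x"] wL2_scale[of g "-1"] by simp

lemma wL2_hq_integrable:
  assumes "f \<in> weighted_L2 Ham" "g \<in> weighted_L2 Ham"
  shows "integrable hline (\<lambda>x. hq x (f x) (g x))"
proof (rule Bochner_Integration.integrable_bound)
  show "integrable hline (\<lambda>x. hs x (f x) + hs x (g x))"
    using assms by (simp add: wL2_integrable)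
  show "AE x in hline. norm (hq x (f x) (g x)) \<le> norm (hs x (f x) + hs x (g x))"
    using hq_le hs_nonneg by (intro AE_I2) (simp add: abs_of_nonneg)
qed (use assms in \<open>intro hq_measurable wL2_measurable\<close>)

lemma hinner_hq: "hinner Ham f g = (LINT x|hline. hq x (f x) (g x))"
  by (simp add: hinner_def hq_def)

lemma hinner_self: "hinner Ham f f = of_real (LINT x|hline. hs x (f x))"
  unfolding hinner_hq hq_self by (rule integral_complex_of_real)

lemma hinner_sip: "sip_space (weighted_L2 Ham) (\<lambda>f g x. f x + g x) (\<lambda>c f x. c *s f x) (hinner Ham)"
proof
  fix x y z :: "real \<Rightarrow> complex^2" and c
  assume x: "x \<in> weighted_L2 Ham"
  then show "(\<lambda>t. c *s x t) \<in> weighted_L2 Ham" by (rule wL2_scale)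
  show "0 \<le> Re (hinner Ham x x)"
    unfolding hinner_self by (simp add: hs_nonneg)
  assume y: "y \<in> weighted_L2 Ham"
  with x show "(\<lambda>t. x t + y t) \<in> weighted_L2 Ham" by (rule wL2_add)
  show "hinner Ham y x = cnj (hinner Ham x y)"
    unfolding hinner_hq Bochner_Integration.integral_cnj[symmetric] hq_cnj ..
  assume z: "z \<in> weighted_L2 Ham"
  show "hinner Ham (\<lambda>t. x t + y t) z = hinner Ham x z + hinner Ham y z"
    unfolding hinner_hq hq_add using x y z by (intro Bochner_Integration.integral_add wL2_hq_integrable)
next
  fix x z :: "real \<Rightarrow> complex^2" and c
  show "hinner Ham (\<lambda>t. c *s x t) z = c * hinner Ham x z"
    unfolding hinner_hq hq_scale by simp
qed

sublocale HW: sip_space "weighted_L2 Ham" "\<lambda>f g x. f x + g x" "\<lambda>c f x. c *s f x" "hinner Ham"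
  by (rule hinner_sip)

lemma HW_nrm: "HW.nrm = hnorm Ham"
  by (simp add: HW.nrm_def hnorm_def fun_eq_iff)

lemma HW_sub: "HW.sub f g = (\<lambda>x. f x - g x)"
  by (simp add: HW.sub_def)

lemma hnorm_sq: "(hnorm Ham f)\<^sup>2 = (LINT x|hline. hs x (f x))"
  by (simp add: hnorm_def hinner_self hs_nonneg)

lemma hin_tendsto_hinner:
  assumes "f \<in> weighted_L2 Ham" "g \<in> weighted_L2 Ham"
  shows "((\<lambda>b. hin 0 b f g) \<longlongrightarrow> hinner Ham f g) at_top"
  unfolding hin_def hinner_hq by (rule hline_integral_tendsto[OF wL2_hq_integrable[OF assms]])

lemma hsn_tendsto_hnorm:
  assumes "f \<in> weighted_L2 Ham"
  shows "((\<lambda>b. hsn 0 b f) \<longlongrightarrow> (hnorm Ham f)\<^sup>2) at_top"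
  unfolding hsn_def hnorm_sq by (rule hline_integral_tendsto[OF wL2_integrable[OF assms]])

lemma hsn_mono:
  assumes "hloc f" "0 \<le> a" "a \<le> b" "b \<le> c"
  shows "hsn a b f \<le> hsn a c f"
  using hsn_split[OF assms(2-4,1)] hsn_nonneg[of b c f] by simp

lemma hsn_le_hnorm:
  assumes "f \<in> weighted_L2 Ham"
  shows "hsn 0 b f \<le> (hnorm Ham f)\<^sup>2"
proof (cases "0 \<le> b")
  case True
  show ?thesis
  proof (rule tendsto_lowerbound[OF hsn_tendsto_hnorm[OF assms]])
    show "\<forall>\<^sub>F x in at_top. hsn 0 b f \<le> hsn 0 x f"
      using eventually_ge_at_top[of b] by eventually_elim (use hsn_mono[OF wL2_hloc[OF assms]] True in auto)
  qed simp
qed (simp add: hsn_def)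

lemma wL2_bounded:
  assumes "hloc f" "\<And>b. b \<ge> 0 \<Longrightarrow> hsn 0 b f \<le> C"
  shows "f \<in> weighted_L2 Ham"
  unfolding weighted_L2_iff
proof
  show "f \<in> borel_measurable hline" using assms(1) by (rule hloc_measurable)
  then show "integrable hline (\<lambda>x. hs x (f x))"
    using assms by (intro hline_integrableI_bounded[of _ C])
      (auto simp: hs_nonneg hs_measurable hloc_integrable hsn_def)
qed

lemma hnorm_le:
  assumes "f \<in> weighted_L2 Ham" "\<And>b. b \<ge> 0 \<Longrightarrow> hsn 0 b f \<le> C\<^sup>2" "C \<ge> 0"
  shows "hnorm Ham f \<le> C"
proof (rule power2_le_imp_le[OF _ assms(3)])
  show "(hnorm Ham f)\<^sup>2 \<le> C\<^sup>2"
  proof (rule tendsto_upperbound[OF hsn_tendsto_hnorm[OF assms(1)]])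
    show "\<forall>\<^sub>F b in at_top. hsn 0 b f \<le> C\<^sup>2"
      using eventually_ge_at_top[of 0] by eventually_elim (rule assms(2))
  qed simp
qed

lemma weighted_eq_sym: "weighted_eq Ham S f g \<Longrightarrow> weighted_eq Ham S g f"
  unfolding weighted_eq_def by (auto simp: mact_diff)

lemma weighted_eq_trans:
  assumes "weighted_eq Ham S f g" "weighted_eq Ham S g h"
  shows "weighted_eq Ham S f h"
  using assms unfolding weighted_eq_def by eventually_elim (simp add: mact_diff)

lemma weighted_eq_subset:
  assumes "weighted_eq Ham S f g" "T \<subseteq> S" "S \<in> sets lebesgue" "T \<in> sets lebesgue"
  shows "weighted_eq Ham T f g"
  using assms unfolding weighted_eq_def by (rule AE_lebesgue_on_subset)

lemma hnorm_zero_iff: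
  assumes "f \<in> weighted_L2 Ham"
  shows "hnorm Ham f = 0 \<longleftrightarrow> (AE x in hline. mact (Ham x) (f x) = 0)"
proof -
  have "hnorm Ham f = 0 \<longleftrightarrow> (LINT x|hline. hs x (f x)) = 0"
    using hnorm_sq[of f] by (metis power_zero_numeral zero_eq_power2)
  also have "\<dots> \<longleftrightarrow> (AE x in hline. hs x (f x) = 0)"
    by (rule integral_nonneg_eq_0_iff_AE[OF wL2_integrable[OF assms]]) (simp add: hs_nonneg)
  finally show ?thesis by (simp add: hs_zero_iff)
qed

lemma weighted_eq_iff_hnorm:
  assumes "f \<in> weighted_L2 Ham" "g \<in> weighted_L2 Ham"
  shows "weighted_eq Ham {0<..} f g \<longleftrightarrow> hnorm Ham (\<lambda>x. f x - g x) = 0"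
  unfolding weighted_eq_def hnorm_zero_iff[OF wL2_diff[OF assms]] ..

lemma H_space_D: "f \<in> H_space Ham \<Longrightarrow> f \<in> weighted_L2 Ham"
  "f \<in> H_space Ham \<Longrightarrow> singular_interval Ham I \<Longrightarrow> \<exists>c. weighted_eq Ham I f (\<lambda>x. c)"
  by (auto simp: H_space_def)

lemma weighted_eq_add:
  assumes "weighted_eq Ham S f f'" "weighted_eq Ham S g g'"
  shows "weighted_eq Ham S (\<lambda>x. f x + g x) (\<lambda>x. f' x + g' x)"
  using assms unfolding weighted_eq_def by eventually_elim (simp add: mact_diff mact_add)

lemma weighted_eq_scale:
  assumes "weighted_eq Ham S f f'"
  shows "weighted_eq Ham S (\<lambda>x. c *s f x) (\<lambda>x. c *s f' x)"
  using assms unfolding weighted_eq_def by eventually_elim (simp add: mact_diff mact_scale)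

lemma H_space_add: "f \<in> H_space Ham \<Longrightarrow> g \<in> H_space Ham \<Longrightarrow> (\<lambda>x. f x + g x) \<in> H_space Ham"
  unfolding H_space_def using wL2_add weighted_eq_add by fast

lemma H_space_scale: "f \<in> H_space Ham \<Longrightarrow> (\<lambda>x. c *s f x) \<in> H_space Ham"
  unfolding H_space_def using wL2_scale weighted_eq_scale by fast

lemma H_space_diff: "f \<in> H_space Ham \<Longrightarrow> g \<in> H_space Ham \<Longrightarrow> (\<lambda>x. f x - g x) \<in> H_space Ham"
  using H_space_add[of f "\<lambda>x. (-1) *s g x"] H_space_scale[of g "-1"] by simp

lemma H_space_cong:
  assumes "f \<in> H_space Ham" "g \<in> borel_measurable hline" "weighted_eq Ham {0<..} f g"
  shows "g \<in> H_space Ham"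
  unfolding H_space_def
proof (intro CollectI conjI allI impI)
  have ae: "AE x in hline. hs x (g x) = hs x (f x)"
    using assms(3) unfolding weighted_eq_def
  proof eventually_elim
    case (elim x)
    then have "mact (Ham x) (f x) = mact (Ham x) (g x)" by (simp add: mact_diff)
    then have "hq x (f x) (f x) = hq x (g x) (g x)" by (metis hq_cnj hq_def)
    then show ?case by (simp add: hs_def)
  qed
  show "g \<in> weighted_L2 Ham"
    unfolding weighted_L2_iff
    using assms(2) ae hs_measurable[OF assms(2)] wL2_integrable[OF H_space_D(1)[OF assms(1)]]
    by (auto intro: integrable_cong_AE_imp)
  fix I assume I: "singular_interval Ham I"
  then obtain c where "weighted_eq Ham I f (\<lambda>x. c)" using H_space_D(2)[OF assms(1)] by blast
  moreover have "weighted_eq Ham I f g"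
    using I by (intro weighted_eq_subset[OF assms(3)])
      (auto simp: singular_interval_def indivisible_on_def intro: borel_open)
  ultimately show "\<exists>c. weighted_eq Ham I g (\<lambda>x. c)"
    using weighted_eq_trans weighted_eq_sym by blast
qed

end

section \<open>Indivisible intervals and completeness\<close>

lemma squeeze_zero:
  fixes f g :: "nat \<Rightarrow> real"
  assumes "\<And>n. 0 \<le> f n" "\<And>n. f n \<le> g n" "g \<longlonglongrightarrow> 0"
  shows "f \<longlonglongrightarrow> 0"
  by (rule tendsto_sandwich[OF _ _ tendsto_const assms(3)]) (auto simp: assms)

context ham
begin

text \<open>The entries of the matrix e e^T. Trace 1 then forces e to be a unit vector.\<close>

definition rank_one :: "real^2 \<Rightarrow> real \<Rightarrow> bool" where
  "rank_one e x \<longleftrightarrow> ha x = (e $ 1)\<^sup>2 \<and> hb x = e $ 1 * e $ 2 \<and> hdd x = (e $ 2)\<^sup>2"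

lemma rank_one_iff: "(\<forall>v. Ham x *v v = (v \<bullet> e) *\<^sub>R e) \<longleftrightarrow> rank_one e x"
proof
  assume h: "\<forall>v. Ham x *v v = (v \<bullet> e) *\<^sub>R e"
  have "Ham x *v vector [1, 0] = ((vector [1, 0] :: real^2) \<bullet> e) *\<^sub>R e"
    "Ham x *v vector [0, 1] = ((vector [0, 1] :: real^2) \<bullet> e) *\<^sub>R e" using h by blast+
  then show "rank_one e x"
    by (simp add: vec_eq_iff forall_2 matrix_vector_mult_def sum_2 inner_vec_def Ham_nth rank_one_def power2_eq_square)
next
  assume "rank_one e x"
  then show "\<forall>v. Ham x *v v = (v \<bullet> e) *\<^sub>R e"
    by (simp add: vec_eq_iff forall_2 matrix_vector_mult_def sum_2 inner_vec_def Ham_nth rank_one_def power2_eq_square algebra_simps)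
qed

definition edot :: "real^2 \<Rightarrow> complex^2 \<Rightarrow> complex" where
  "edot e u = of_real (e $ 1) * u $ 1 + of_real (e $ 2) * u $ 2"

lemma mact_rank_one:
  assumes "rank_one e x"
  shows "mact (Ham x) u $ 1 = of_real (e $ 1) * edot e u" "mact (Ham x) u $ 2 = of_real (e $ 2) * edot e u"
  using assms by (simp_all add: mact_Ham rank_one_def edot_def power2_eq_square algebra_simps)

lemma rank_one_unit: "rank_one e x \<Longrightarrow> (e $ 1)\<^sup>2 + (e $ 2)\<^sup>2 = 1"
  using ha_hdd[of x] by (simp add: rank_one_def)

lemma mact_rank_one_zero_iff:
  assumes "rank_one e x"
  shows "mact (Ham x) u = 0 \<longleftrightarrow> edot e u = 0"
  using rank_one_unit[OF assms] by (auto simp: vec2_eq_iff mact_rank_one[OF assms])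

lemma hs_rank_one:
  assumes "rank_one e x"
  shows "hs x u = (cmod (edot e u))\<^sup>2"
proof -
  have "hq x u u = edot e u * cnj (edot e u)"
    using assms by (simp add: hq_eq rank_one_def edot_def power2_eq_square algebra_simps)
  then show ?thesis by (simp add: hs_def flip: complex_norm_square)
qed

lemma indivisible_on_iff: "indivisible_on Ham I \<longleftrightarrow>
    open I \<and> is_interval I \<and> I \<noteq> {} \<and> I \<subseteq> {0<..} \<and> (\<exists>e. AE x in lebesgue_on I. rank_one e x)"
  by (simp add: indivisible_on_def rank_one_iff)

lemma AE_open_witness:
  fixes I :: "real set"
  assumes "open I" "I \<noteq> {}" "AE x in lebesgue_on I. P x"
  shows "\<exists>x\<in>I. P x"
proof (rule ccontr)
  assume n: "\<not> ?thesis"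
  have "AE x in lebesgue. x \<in> I \<longrightarrow> P x" using assms AE_lebesgue_on_iff[of I P] by (simp add: lebesgue_openin)
  then have "negligible {x. \<not> (x \<in> I \<longrightarrow> P x)}" by (simp add: AE_lebesgue_negligible)
  moreover have "I \<subseteq> {x. \<not> (x \<in> I \<longrightarrow> P x)}" using n by auto
  ultimately have "negligible I" by (rule negligible_subset)
  then show False using assms open_not_negligible by blast
qed

lemma indivisible_D:
  assumes "indivisible_on Ham I"
  shows "open I" "is_interval I" "I \<noteq> {}" "I \<subseteq> {0<..}" "I \<in> sets lebesgue"
  using assms by (auto simp: indivisible_on_def intro: borel_open)

lemma indivisible_obtain:
  assumes "indivisible_on Ham I"
  obtains e where "AE x in lebesgue_on I. rank_one e x" "(e $ 1)\<^sup>2 + (e $ 2)\<^sup>2 = 1"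
proof -
  obtain e where e: "AE x in lebesgue_on I. rank_one e x" using assms by (auto simp: indivisible_on_iff)
  then obtain x where "rank_one e x" using AE_open_witness[of I] indivisible_D[OF assms] by blast
  with e that rank_one_unit show thesis by blast
qed

text \<open>Two of the intervals overlap in a nonempty open set around x0. At a point where both
  rank-one representations hold they are the same matrix, so one vector e serves all intervals.
  Lindelof's theorem reduces the exceptional sets to countably many null sets.\<close>

lemma indivisible_Union:
  assumes K: "\<And>K. K \<in> \<K> \<Longrightarrow> indivisible_on Ham K" and ne: "\<K> \<noteq> {}" and x0: "\<And>K. K \<in> \<K> \<Longrightarrow> x0 \<in> K"
  shows "indivisible_on Ham (\<Union>\<K>)"
  unfolding indivisible_on_iff
proof (intro conjI)
  show op: "open (\<Union>\<K>)" by (intro open_Union ballI indivisible_D(1)[OF K])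
  have "x0 \<in> \<Inter>\<K>" using x0 by blast
  moreover have "connected L" if "L \<in> \<K>" for L
    using indivisible_D(2)[OF K[OF that]] by (simp add: is_interval_connected_1)
  ultimately have "connected (\<Union>\<K>)" by (intro connected_Union) blast+
  then show "is_interval (\<Union>\<K>)" by (simp add: is_interval_connected_1)
  show "\<Union>\<K> \<noteq> {}" using ne x0 by blast
  show "\<Union>\<K> \<subseteq> {0<..}" by (rule Union_least) (rule indivisible_D(4)[OF K])
  obtain K0 where K0: "K0 \<in> \<K>" using ne by blast
  obtain e where e: "AE x in lebesgue_on K0. rank_one e x" using indivisible_obtain[OF K[OF K0]] by blast
  have each: "AE x in lebesgue. x \<in> L \<longrightarrow> rank_one e x" if L: "L \<in> \<K>" for L
  proof -
    obtain e' where e': "AE x in lebesgue_on L. rank_one e' x" using indivisible_obtain[OF K[OF L]] by blast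
    have "AE x in lebesgue_on (K0 \<inter> L). rank_one e x \<and> rank_one e' x"
      using AE_lebesgue_on_subset[OF e, of "K0 \<inter> L"] AE_lebesgue_on_subset[OF e', of "K0 \<inter> L"]
        indivisible_D(5)[OF K[OF K0]] indivisible_D(5)[OF K[OF L]] by auto
    moreover have "open (K0 \<inter> L)" "K0 \<inter> L \<noteq> {}"
      using indivisible_D(1)[OF K[OF K0]] indivisible_D(1)[OF K[OF L]] x0[OF K0] x0[OF L] by auto
    ultimately have "\<exists>x\<in>K0 \<inter> L. rank_one e x \<and> rank_one e' x" by (intro AE_open_witness)
    then obtain x where "rank_one e x" "rank_one e' x" by blast
    then have "rank_one e' y \<longleftrightarrow> rank_one e y" for y by (simp add: rank_one_def)
    then show ?thesis using e' indivisible_D(5)[OF K[OF L]] by (simp add: AE_lebesgue_on_iff)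
  qed
  obtain \<K>' where K': "\<K>' \<subseteq> \<K>" "countable \<K>'" "\<Union>\<K>' = \<Union>\<K>"
    by (rule Lindelof[of \<K>, OF indivisible_D(1)[OF K]])
  have "AE x in lebesgue. \<forall>L\<in>\<K>'. x \<in> L \<longrightarrow> rank_one e x"
    using K' each by (subst AE_ball_countable) auto
  then have "AE x in lebesgue. x \<in> \<Union>\<K> \<longrightarrow> rank_one e x"
    unfolding K'(3)[symmetric] by eventually_elim blast
  then show "\<exists>e. AE x in lebesgue_on (\<Union>\<K>). rank_one e x"
    using op by (auto simp: AE_lebesgue_on_iff borel_open)
qed

text \<open>The union of all indivisible intervals containing I is indivisible, hence the maximal
  one.\<close>

lemma singular_exists:
  assumes I: "indivisible_on Ham I"
  obtains K where "singular_interval Ham K" "I \<subseteq> K"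
proof -
  obtain x0 where x0: "x0 \<in> I" using indivisible_D(3)[OF I] by blast
  define \<K> where "\<K> = {K. indivisible_on Ham K \<and> I \<subseteq> K}"
  have ind: "indivisible_on Ham (\<Union>\<K>)"
    by (rule indivisible_Union[of _ x0]) (use I x0 in \<open>auto simp: \<K>_def\<close>)
  have "I \<subseteq> \<Union>\<K>" using I by (auto simp: \<K>_def)
  moreover have "singular_interval Ham (\<Union>\<K>)"
    unfolding singular_interval_def
  proof (intro conjI allI impI ind)
    fix K assume K: "indivisible_on Ham K \<and> \<Union>\<K> \<subseteq> K"
    then have "K \<in> \<K>" using \<open>I \<subseteq> \<Union>\<K>\<close> by (auto simp: \<K>_def)
    then show "K = \<Union>\<K>" using K by blast
  qed
  ultimately show thesis using that by blast
qed

lemma singular_disjoint: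
  assumes "singular_interval Ham I" "singular_interval Ham K" "x \<in> I" "x \<in> K"
  shows "I = K"
proof -
  have "indivisible_on Ham (\<Union>{I, K})"
    by (rule indivisible_Union[of _ x]) (use assms in \<open>auto simp: singular_interval_def\<close>)
  then show ?thesis using assms unfolding singular_interval_def by (metis Union_insert Union_upper insertI1 insert_commute)
qed

text \<open>On an indivisible interval the weighted space sees only the component of f along
  e.\<close>

lemma singular_constant_iff:
  assumes e: "AE x in lebesgue_on I. rank_one e x"
  shows "weighted_eq Ham I f (\<lambda>x. c) \<longleftrightarrow> (AE x in lebesgue_on I. edot e (f x) = edot e c)"
proof -
  have "mact (Ham x) (f x - c) = 0 \<longleftrightarrow> edot e (f x) = edot e c" if "rank_one e x" for x
    using mact_rank_one_zero_iff[OF that] by (simp add: edot_def algebra_simps)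
  then show ?thesis unfolding weighted_eq_def
    using e by (auto intro: AE_mp)
qed

definition eval :: "real^2 \<Rightarrow> complex \<Rightarrow> complex^2" where
  "eval e k = vec2 (of_real (e $ 1) * k) (of_real (e $ 2) * k)"

lemma edot_eval: "(e $ 1)\<^sup>2 + (e $ 2)\<^sup>2 = 1 \<Longrightarrow> edot e (eval e k) = k"
  by (simp add: edot_def eval_def power2_eq_square flip: mult.assoc distrib_right of_real_mult of_real_add)

lemma wL2_cholesky:
  assumes "f \<in> borel_measurable hline"
  shows "f \<in> weighted_L2 Ham \<longleftrightarrow> (\<lambda>x. ch1 x (f x)) \<in> L2 hline \<and> (\<lambda>x. ch2 x (f x)) \<in> L2 hline"
    and "(\<lambda>x. ch1 x (f x)) \<in> borel_measurable hline" "(\<lambda>x. ch2 x (f x)) \<in> borel_measurable hline"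
proof -
  note [measurable] = entries_measurable assms[THEN measurable_vec_nth]
  show m[measurable]: "(\<lambda>x. ch1 x (f x)) \<in> borel_measurable hline" "(\<lambda>x. ch2 x (f x)) \<in> borel_measurable hline"
    unfolding ch1_def ch2_def hr_def hk_def by measurable
  show "f \<in> weighted_L2 Ham \<longleftrightarrow> (\<lambda>x. ch1 x (f x)) \<in> L2 hline \<and> (\<lambda>x. ch2 x (f x)) \<in> L2 hline"
  proof
    assume f: "f \<in> weighted_L2 Ham"
    have "integrable hline (\<lambda>x. (cmod (ch1 x (f x)))\<^sup>2)" "integrable hline (\<lambda>x. (cmod (ch2 x (f x)))\<^sup>2)"
      by (rule Bochner_Integration.integrable_bound[OF wL2_integrable[OF f]]; simp add: hs_cholesky)+
    then show "(\<lambda>x. ch1 x (f x)) \<in> L2 hline \<and> (\<lambda>x. ch2 x (f x)) \<in> L2 hline" by (auto intro: L2_I)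
  next
    assume "(\<lambda>x. ch1 x (f x)) \<in> L2 hline \<and> (\<lambda>x. ch2 x (f x)) \<in> L2 hline"
    then show "f \<in> weighted_L2 Ham"
      using assms by (auto simp: weighted_L2_iff hs_cholesky dest: L2_integrable)
  qed
qed

lemma hnorm_cholesky:
  assumes "f \<in> weighted_L2 Ham"
  shows "(hnorm Ham f)\<^sup>2 = (L2_norm hline (\<lambda>x. ch1 x (f x)))\<^sup>2 + (L2_norm hline (\<lambda>x. ch2 x (f x)))\<^sup>2"
proof -
  have "(\<lambda>x. ch1 x (f x)) \<in> L2 hline" "(\<lambda>x. ch2 x (f x)) \<in> L2 hline"
    using wL2_cholesky(1)[OF wL2_measurable[OF assms]] assms by blast+
  then show ?thesis
    unfolding hnorm_sq L2_norm_sq hs_cholesky by (intro Bochner_Integration.integral_add L2_integrable)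
qed

lemma L2_norm_mono:
  assumes "G \<in> L2 M" "F \<in> borel_measurable M" "\<And>x. cmod (F x) \<le> cmod (G x)"
  shows "F \<in> L2 M" "L2_norm M F \<le> L2_norm M G"
proof -
  note [measurable] = assms(2)
  have le: "(cmod (F x))\<^sup>2 \<le> (cmod (G x))\<^sup>2" for x by (intro power_mono assms) simp
  show F: "F \<in> L2 M"
    by (rule L2_I[OF assms(2)], rule Bochner_Integration.integrable_bound[OF L2_integrable[OF assms(1)]])
       (use le in auto)
  show "L2_norm M F \<le> L2_norm M G"
    unfolding L2_norm_def by (intro real_sqrt_le_mono integral_mono L2_integrable F assms le)
qed

text \<open>In Cholesky coordinates a Cauchy sequence becomes a pair of Cauchy sequences in ordinary
  L2; their limits are pulled back by solving the triangular system pointwise.\<close>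

lemma wL2_complete:
  fixes f :: "nat \<Rightarrow> real \<Rightarrow> complex^2"
  assumes f: "\<And>n. f n \<in> weighted_L2 Ham"
    and C: "\<And>e. e > 0 \<Longrightarrow> \<exists>N. \<forall>m\<ge>N. \<forall>n\<ge>N. hnorm Ham (\<lambda>x. f m x - f n x) < e"
  shows "\<exists>g\<in>weighted_L2 Ham. (\<lambda>n. hnorm Ham (\<lambda>x. f n x - g x)) \<longlonglongrightarrow> 0"
proof -
  define F1 where "F1 n x = ch1 x (f n x)" for n x
  define F2 where "F2 n x = ch2 x (f n x)" for n x
  have FL: "F1 n \<in> L2 hline" "F2 n \<in> L2 hline" for n
    using wL2_cholesky(1)[OF wL2_measurable[OF f[of n]]] f[of n] unfolding F1_def F2_def by blast+
  have ch_diff: "ch1 x (u - v) = ch1 x u - ch1 x v" "ch2 x (u - v) = ch2 x u - ch2 x v" for x u v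
    by (simp_all add: ch1_def ch2_def algebra_simps)
  have dn: "(hnorm Ham (\<lambda>x. f m x - f n x))\<^sup>2 =
     (L2_norm hline (\<lambda>x. F1 m x - F1 n x))\<^sup>2 + (L2_norm hline (\<lambda>x. F2 m x - F2 n x))\<^sup>2" for m n
    using hnorm_cholesky[OF wL2_diff[OF f[of m] f[of n]]] by (simp add: ch_diff F1_def F2_def)
  have hn: "0 \<le> hnorm Ham (\<lambda>x. f m x - f n x)" for m n
    using HW.nrm_nonneg[OF wL2_diff[OF f[of m] f[of n]]] by (simp add: HW_nrm)
  have L1: "L2_norm hline (\<lambda>x. F1 m x - F1 n x) \<le> hnorm Ham (\<lambda>x. f m x - f n x)"
   and L2: "L2_norm hline (\<lambda>x. F2 m x - F2 n x) \<le> hnorm Ham (\<lambda>x. f m x - f n x)" for m n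
    by (rule power2_le_imp_le[OF _ hn]; simp add: dn)+
  have CL: "\<exists>N. \<forall>m\<ge>N. \<forall>n\<ge>N. L2_norm hline (\<lambda>x. G m x - G n x) < e"
    if le: "\<And>m n. L2_norm hline (\<lambda>x. G m x - G n x) \<le> hnorm Ham (\<lambda>x. f m x - f n x)" and "e > 0"
    for G :: "nat \<Rightarrow> real \<Rightarrow> complex" and e
    using C[OF \<open>e > 0\<close>] le le_less_trans by blast
  obtain p1 where p1: "p1 \<in> L2 hline" "(\<lambda>n. L2_norm hline (\<lambda>x. F1 n x - p1 x)) \<longlonglongrightarrow> 0"
    using L2_complete[OF FL(1) CL[OF L1]] by blast
  obtain p2 where p2: "p2 \<in> L2 hline" "(\<lambda>n. L2_norm hline (\<lambda>x. F2 n x - p2 x)) \<longlonglongrightarrow> 0"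
    using L2_complete[OF FL(2) CL[OF L2]] by blast
  note [measurable] = entries_measurable L2_measurable[OF p1(1)] L2_measurable[OF p2(1)]
  \<comment> \<open>Where a diagonal entry of the factor is 0, the coordinates of all f n vanish,
    and division by zero makes those of g vanish too. So the distance from f n to g is at most that
    of the coordinates to p1 and p2.\<close>
  define g2 where "g2 x = p2 x / of_real (hk x)" for x
  define g1 where "g1 x = (p1 x - of_real (hb x / hr x) * g2 x) / of_real (hr x)" for x
  define g where "g x = vec2 (g1 x) (g2 x)" for x
  have [measurable]: "g2 \<in> borel_measurable hline" unfolding g2_def hk_def by measurable
  have [measurable]: "g1 \<in> borel_measurable hline" unfolding g1_def hr_def by measurable
  have gm: "g \<in> borel_measurable hline" by (rule measurable_vecI) (simp_all add: g_def)
  have cg1: "ch1 x (g x) = (if hr x = 0 then 0 else p1 x)" for x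
    by (simp add: ch1_def g_def g1_def)
  have cg2: "ch2 x (g x) = (if hk x = 0 then 0 else p2 x)" for x
    by (simp add: ch2_def g_def g2_def)
  have gL: "g \<in> weighted_L2 Ham"
    unfolding wL2_cholesky(1)[OF gm]
    using L2_norm_mono(1)[OF p1(1) wL2_cholesky(2)[OF gm]] L2_norm_mono(1)[OF p2(1) wL2_cholesky(3)[OF gm]]
    by (simp add: cg1 cg2)
  have fg: "(hnorm Ham (\<lambda>x. f n x - g x))\<^sup>2 \<le>
     (L2_norm hline (\<lambda>x. F1 n x - p1 x))\<^sup>2 + (L2_norm hline (\<lambda>x. F2 n x - p2 x))\<^sup>2" for n
  proof -
    have m: "(\<lambda>x. f n x - g x) \<in> borel_measurable hline" using wL2_measurable[OF wL2_diff[OF f gL]] .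
    have "L2_norm hline (\<lambda>x. ch1 x (f n x - g x)) \<le> L2_norm hline (\<lambda>x. F1 n x - p1 x)"
    proof (rule L2_norm_mono(2)[OF L2_diff[OF FL(1) p1(1)] wL2_cholesky(2)[OF m]])
      show "cmod (ch1 x (f n x - g x)) \<le> cmod (F1 n x - p1 x)" for x
        unfolding ch_diff cg1 F1_def by (simp add: ch1_def)
    qed
    moreover have "L2_norm hline (\<lambda>x. ch2 x (f n x - g x)) \<le> L2_norm hline (\<lambda>x. F2 n x - p2 x)"
    proof (rule L2_norm_mono(2)[OF L2_diff[OF FL(2) p2(1)] wL2_cholesky(3)[OF m]])
      show "cmod (ch2 x (f n x - g x)) \<le> cmod (F2 n x - p2 x)" for x
        unfolding ch_diff cg2 F2_def by (simp add: ch2_def)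
    qed
    ultimately show ?thesis
      unfolding hnorm_cholesky[OF wL2_diff[OF f gL]]
      by (intro add_mono power_mono) (auto simp: L2_norm_def)
  qed
  have "(\<lambda>n. (L2_norm hline (\<lambda>x. F1 n x - p1 x))\<^sup>2 + (L2_norm hline (\<lambda>x. F2 n x - p2 x))\<^sup>2) \<longlonglongrightarrow> 0\<^sup>2 + 0\<^sup>2"
    by (intro tendsto_intros p1 p2)
  then have "(\<lambda>n. (hnorm Ham (\<lambda>x. f n x - g x))\<^sup>2) \<longlonglongrightarrow> 0"
    by (intro squeeze_zero[OF _ fg]) auto
  then have "(\<lambda>n. sqrt ((hnorm Ham (\<lambda>x. f n x - g x))\<^sup>2)) \<longlonglongrightarrow> sqrt 0" by (intro tendsto_intros)
  then have "(\<lambda>n. hnorm Ham (\<lambda>x. f n x - g x)) \<longlonglongrightarrow> 0"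
    using HW.nrm_nonneg[OF wL2_diff[OF f gL]] by (simp add: HW_nrm)
  with gL show ?thesis by blast
qed

text \<open>Convergence in norm gives almost everywhere convergence of the components along e for a
  subsequence. On a singular interval these are constants, hence so is their limit.\<close>

lemma H_space_closed:
  fixes f :: "nat \<Rightarrow> real \<Rightarrow> complex^2"
  assumes f: "\<And>n. f n \<in> H_space Ham" and g: "g \<in> weighted_L2 Ham"
    and lim: "(\<lambda>n. hnorm Ham (\<lambda>x. f n x - g x)) \<longlonglongrightarrow> 0"
  shows "g \<in> H_space Ham"
  unfolding H_space_def
proof (intro CollectI conjI allI impI g)
  fix I assume I: "singular_interval Ham I"
  then have ind: "indivisible_on Ham I" by (simp add: singular_interval_def)
  note ID = indivisible_D[OF ind]
  obtain e where e: "AE x in lebesgue_on I. rank_one e x" "(e $ 1)\<^sup>2 + (e $ 2)\<^sup>2 = 1"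
    using indivisible_obtain[OF ind] by blast
  have "\<forall>n. \<exists>c. AE x in lebesgue_on I. edot e (f n x) = edot e c"
    using H_space_D(2)[OF f I] singular_constant_iff[OF e(1)] by blast
  from choice[OF this] obtain c where c: "\<And>n. AE x in lebesgue_on I. edot e (f n x) = edot e (c n)" by blast
  define u where "u n x = hs x (f n x - g x)" for n x
  have dL: "(\<lambda>x. f n x - g x) \<in> weighted_L2 Ham" for n by (intro wL2_diff g H_space_D(1) f)
  have uh: "integrable hline (u n)" for n unfolding u_def by (rule wL2_integrable[OF dL])
  have ui: "integrable (lebesgue_on I) (u n)" for n
  proof -
    have "u n absolutely_integrable_on {0<..}" using uh[of n] by (simp add: integrable_lebesgue_on_iff)
    then have "u n absolutely_integrable_on I" by (rule set_integrable_subset) (use ID in auto)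
    then show ?thesis by (simp add: integrable_lebesgue_on_iff ID)
  qed
  have ule: "(LINT x|lebesgue_on I. norm (u n x)) \<le> (hnorm Ham (\<lambda>x. f n x - g x))\<^sup>2" for n
  proof -
    have a1: "u n absolutely_integrable_on I" "u n absolutely_integrable_on {0<..}"
      using ui[of n] uh[of n] by (simp_all add: integrable_lebesgue_on_iff ID)
    have nn: "\<bar>u n x\<bar> = u n x" for x by (simp add: u_def hs_nonneg)
    have "(LINT x|lebesgue_on I. norm (u n x)) = integral I (u n)"
      using lebesgue_on_integral_eq[OF ID(5) a1(1)] nn by simp
    also have "\<dots> \<le> integral {0<..} (u n)"
      using a1 ID by (intro integral_subset_le absolutely_integrable_imp) (auto simp: u_def hs_nonneg)
    also have "\<dots> = (hnorm Ham (\<lambda>x. f n x - g x))\<^sup>2"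
      using lebesgue_on_integral_eq[OF _ a1(2)] unfolding hnorm_sq by (simp add: u_def[abs_def])
    finally show ?thesis .
  qed
  have "(\<lambda>n. (hnorm Ham (\<lambda>x. f n x - g x))\<^sup>2) \<longlonglongrightarrow> 0\<^sup>2" by (intro tendsto_intros lim)
  then have L1: "(\<lambda>n. LINT x|lebesgue_on I. norm (u n x)) \<longlonglongrightarrow> 0"
    by (intro squeeze_zero[OF _ ule]) auto
  obtain r where r: "AE x in lebesgue_on I. (\<lambda>n. u (r n) x) \<longlonglongrightarrow> 0"
    using tendsto_L1_AE_subseq[OF ui L1] by blast
  have "AE x in lebesgue_on I. \<forall>n. edot e (f n x) = edot e (c n)" using c by (simp add: AE_all_countable)
  then have "AE x in lebesgue_on I. edot e (g x) = lim (\<lambda>n. edot e (c (r n)))"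
    using r e(1)
  proof eventually_elim
    case (elim x)
    have "u n x = (cmod (edot e (c n) - edot e (g x)))\<^sup>2" for n
      using elim(1) unfolding u_def hs_rank_one[OF elim(3)]
      by (simp add: edot_def algebra_simps)
    then have "(\<lambda>n. sqrt ((cmod (edot e (c (r n)) - edot e (g x)))\<^sup>2)) \<longlonglongrightarrow> sqrt 0"
      using elim(2) by (intro tendsto_real_sqrt) simp
    then have "(\<lambda>n. edot e (c (r n)) - edot e (g x)) \<longlonglongrightarrow> 0" by (simp add: tendsto_norm_zero_iff)
    then have "(\<lambda>n. edot e (c (r n))) \<longlonglongrightarrow> edot e (g x)" by (simp add: LIM_zero_iff)
    then show ?case by (simp add: limI)
  qed
  then have "weighted_eq Ham I g (\<lambda>x. eval e (lim (\<lambda>n. edot e (c (r n)))))"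
    unfolding singular_constant_iff[OF e(1)] edot_eval[OF e(2)] .
  then show "\<exists>c. weighted_eq Ham I g (\<lambda>x. c)" by (rule exI)
qed

lemma H_space_sip: "complete_sip (H_space Ham) (\<lambda>f g x. f x + g x) (\<lambda>c f x. c *s f x) (hinner Ham)"
proof -
  interpret S: sip_space "H_space Ham" "\<lambda>f g x. f x + g x" "\<lambda>c f x. c *s f x" "hinner Ham"
    by unfold_locales
      (auto intro: H_space_add H_space_scale HW.ip_add HW.ip_scl HW.ip_cnj HW.ip_nonneg dest: H_space_D(1))
  have nrm: "S.nrm = hnorm Ham" by (simp add: S.nrm_def hnorm_def fun_eq_iff)
  have sub: "S.sub f g = (\<lambda>x. f x - g x)" for f g by (simp add: S.sub_def)
  show ?thesis
  proof unfold_locales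
    fix X :: "nat \<Rightarrow> real \<Rightarrow> complex^2"
    assume X: "\<And>n. X n \<in> H_space Ham"
      and C: "\<And>e. e > 0 \<Longrightarrow> \<exists>N. \<forall>m\<ge>N. \<forall>n\<ge>N. S.nrm (S.sub (X m) (X n)) < e"
    obtain g where g: "g \<in> weighted_L2 Ham" "(\<lambda>n. hnorm Ham (\<lambda>x. X n x - g x)) \<longlonglongrightarrow> 0"
      using wL2_complete[of X] H_space_D(1)[OF X] C by (auto simp: nrm sub)
    show "\<exists>x\<in>H_space Ham. (\<lambda>n. S.nrm (S.sub (X n) x)) \<longlonglongrightarrow> 0"
      using H_space_closed[OF X g] g(2) by (auto simp: nrm sub)
  qed
qed

sublocale HH: complete_sip "H_space Ham" "\<lambda>f g x. f x + g x" "\<lambda>c f x. c *s f x" "hinner Ham"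
  by (rule H_space_sip)

lemma HH_nrm: "HH.nrm = hnorm Ham" and HH_sub: "HH.sub f g = (\<lambda>x. f x - g x)"
  by (simp_all add: HH.nrm_def hnorm_def HH.sub_def fun_eq_iff)

end

section \<open>The equation in integrated form and Green's identity\<close>

definition vcnj :: "complex^2 \<Rightarrow> complex^2" where "vcnj v = vec2 (cnj (v $ 1)) (cnj (v $ 2))"

lemma vcnj_nth [simp]: "vcnj v $ 1 = cnj (v $ 1)" "vcnj v $ 2 = cnj (v $ 2)"
  by (simp_all add: vcnj_def)

text \<open>This is \<open>cdot (symplectic_J *v u) v\<close>, the boundary form of Green's
  identity.\<close>

definition Bf :: "complex^2 \<Rightarrow> complex^2 \<Rightarrow> complex" where
  "Bf u v = u $ 1 * cnj (v $ 2) - u $ 2 * cnj (v $ 1)"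

lemma symplectic_J_nth: "(symplectic_J *v v) $ 1 = - v $ 2" "(symplectic_J *v v) $ 2 = v $ 1"
  by (simp_all add: symplectic_J_def matrix_vector_mult_def sum_2)

lemma abs_continuous_on_interval_acont: "abs_continuous_on_interval a b f = acont a b f"
  by (simp add: abs_continuous_on_interval_def acont_def)

lemma norm_vec2_le: "norm v \<le> cmod (v $ 1) + cmod (v $ 2)" for v :: "complex^2"
  by (simp add: norm_vec_def L2_set_def sum_2 sqrt_sum_squares_le_sum)

lemma bounded_linear_vec2: "bounded_linear (\<lambda>c. vec2 c 0)" "bounded_linear (\<lambda>c. vec2 0 c)"
  by (rule bounded_linear_intro[where K = 1];
      simp add: vec2_eq_iff norm_vec_def L2_set_def sum_2)+

lemma continuous_on_vec2:
  assumes "continuous_on S (\<lambda>x. u x $ 1)" "continuous_on S (\<lambda>x. u x $ 2)"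
  shows "continuous_on S (u :: 'a::topological_space \<Rightarrow> complex^2)"
proof -
  have "continuous_on S (\<lambda>x. vec2 (u x $ 1) 0 + vec2 0 (u x $ 2))"
    by (intro continuous_on_add bounded_linear.continuous_on[OF bounded_linear_vec2(1)]
        bounded_linear.continuous_on[OF bounded_linear_vec2(2)] assms)
  moreover have "(\<lambda>x. vec2 (u x $ 1) 0 + vec2 0 (u x $ 2)) = u" by (simp add: fun_eq_iff vec2_eq_iff)
  ultimately show ?thesis by (simp only:)
qed

lemma has_vector_derivative_vec2:
  fixes u :: "real \<Rightarrow> complex^2"
  assumes "((\<lambda>x. u x $ 1) has_vector_derivative d1) (at x)" "((\<lambda>x. u x $ 2) has_vector_derivative d2) (at x)"
  shows "(u has_vector_derivative vec2 d1 d2) (at x)"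
proof -
  have "((\<lambda>x. vec2 (u x $ 1) 0 + vec2 0 (u x $ 2)) has_vector_derivative vec2 d1 0 + vec2 0 d2) (at x)"
    by (intro has_vector_derivative_add bounded_linear.has_vector_derivative[OF bounded_linear_vec2(1)]
        bounded_linear.has_vector_derivative[OF bounded_linear_vec2(2)] assms)
  moreover have "(\<lambda>x. vec2 (u x $ 1) 0 + vec2 0 (u x $ 2)) = u" by (simp add: fun_eq_iff vec2_eq_iff)
  moreover have "vec2 d1 0 + vec2 0 d2 = vec2 d1 d2" by (simp add: vec2_eq_iff)
  ultimately show ?thesis by simp
qed

context ham
begin

text \<open>The equation J u' = H h, solved for u' and integrated from 0 in each component.\<close>

definition ode :: "(real \<Rightarrow> complex^2) \<Rightarrow> (real \<Rightarrow> complex^2) \<Rightarrow> bool" where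
  "ode u h \<longleftrightarrow> (\<forall>b. iprim 0 b (\<lambda>x. u x $ 1) (\<lambda>x. mact (Ham x) (h x) $ 2) \<and>
                  iprim 0 b (\<lambda>x. u x $ 2) (\<lambda>x. - mact (Ham x) (h x) $ 1))"

lemma ode_iprim:
  assumes "ode u h" "0 \<le> a"
  shows "iprim a b (\<lambda>x. u x $ 1) (\<lambda>x. mact (Ham x) (h x) $ 2)"
    and "iprim a b (\<lambda>x. u x $ 2) (\<lambda>x. - mact (Ham x) (h x) $ 1)"
  using assms unfolding ode_def by (auto intro: iprim_subinterval[of 0 b])

lemma ode_continuous: assumes "ode u h" shows "continuous_on {0..} u"
proof -
  have c: "continuous_on {0..b} u" for b
    by (intro continuous_on_vec2 iprim_continuous[OF ode_iprim(1)[OF assms order_refl]]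
        iprim_continuous[OF ode_iprim(2)[OF assms order_refl]])
  show ?thesis
    unfolding continuous_on_eq_continuous_within
  proof
    fix x :: real assume x: "x \<in> {0..}"
    have "continuous (at x within {0..x+1}) u"
      using c[of "x + 1"] x by (auto simp: continuous_on_eq_continuous_within)
    moreover have "at x within {0..x+1} = at x within {0..}"
      by (rule at_within_nhd[of _ "{..<x+1}"]) auto
    ultimately show "continuous (at x within {0..}) u" by simp
  qed
qed

lemma ode_hloc: "ode u h \<Longrightarrow> hloc u"
  by (rule hloc_continuous[OF ode_continuous])

lemma ode_add: "ode u h \<Longrightarrow> ode v k \<Longrightarrow> ode (\<lambda>x. u x + v x) (\<lambda>x. h x + k x)"
  unfolding ode_def mact_add vector_add_component minus_add_distrib
  by (intro allI conjI iprim_add) simp_all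

lemma ode_scale: "ode u h \<Longrightarrow> ode (\<lambda>x. c *s u x) (\<lambda>x. c *s h x)"
  unfolding ode_def mact_scale vector_smult_component mult_minus_right[symmetric]
  by (intro allI conjI iprim_cmult) simp_all

lemma ode_diff: "ode u h \<Longrightarrow> ode v k \<Longrightarrow> ode (\<lambda>x. u x - v x) (\<lambda>x. h x - k x)"
  using ode_add[of u h "\<lambda>x. (-1) *s v x" "\<lambda>x. (-1) *s k x"] ode_scale[of v k "-1"] by simp

lemma mact_vcnj: "mact (Ham x) (vcnj v) = vcnj (mact (Ham x) v)"
  by (simp add: vec2_eq_iff mact_Ham)

lemma ode_vcnj: assumes "ode u h" shows "ode (\<lambda>x. vcnj (u x)) (\<lambda>x. vcnj (h x))"
  unfolding ode_def
proof (intro allI conjI)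
  fix b
  show "iprim 0 b (\<lambda>x. vcnj (u x) $ 1) (\<lambda>x. mact (Ham x) (vcnj (h x)) $ 2)"
    using iprim_cnj[OF ode_iprim(1)[OF assms, of 0 b]] by (simp add: mact_vcnj)
  show "iprim 0 b (\<lambda>x. vcnj (u x) $ 2) (\<lambda>x. - mact (Ham x) (vcnj (h x)) $ 1)"
    using iprim_cnj[OF ode_iprim(2)[OF assms, of 0 b]] by (simp add: mact_vcnj)
qed

lemma hs_vcnj: "hs x (vcnj v) = hs x v"
  by (simp add: hs_eq)

lemma hloc_vcnj:
  assumes "hloc f"
  shows "hloc (\<lambda>x. vcnj (f x))"
proof -
  have "(\<lambda>x. vcnj (f x) $ i) \<in> borel_measurable hline" for i
  proof -
    have "(\<lambda>x. cnj (f x $ i)) \<in> borel_measurable hline" for i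
      by (rule measurable_compose[OF measurable_vec_nth[OF hloc_measurable[OF assms]] borel_measurable_continuous_onI])
         (intro continuous_intros)
    from this[of 1] this[of 2] show ?thesis using exhaust_2[of i] by auto
  qed
  then have "(\<lambda>x. vcnj (f x)) \<in> borel_measurable hline" by (intro measurable_vecI)
  then show ?thesis using assms unfolding hloc_def hs_vcnj by blast
qed

lemma wL2_vcnj: "f \<in> weighted_L2 Ham \<Longrightarrow> (\<lambda>x. vcnj (f x)) \<in> weighted_L2 Ham"
  using hloc_measurable[OF hloc_vcnj[OF wL2_hloc]] by (auto simp: weighted_L2_iff hs_vcnj)

lemma ode_cong:
  assumes "ode u h" "weighted_eq Ham {0<..} h h'" "\<And>x. 0 \<le> x \<Longrightarrow> u x = u' x"
  shows "ode u' h'"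
proof -
  have "AE x in lebesgue. x \<in> {0<..} \<longrightarrow> mact (Ham x) (h x) = mact (Ham x) (h' x)"
    using assms(2) by (simp add: weighted_eq_def mact_diff AE_lebesgue_on_iff)
  then have N: "negligible {x. \<not> (x \<in> {0<..} \<longrightarrow> mact (Ham x) (h x) = mact (Ham x) (h' x))}" (is "negligible ?N")
    by (simp only: AE_lebesgue_negligible)
  then have N0: "negligible (insert 0 ?N)" by simp
  show ?thesis unfolding ode_def
  proof (intro allI conjI)
    fix b
    show "iprim 0 b (\<lambda>x. u' x $ 1) (\<lambda>x. mact (Ham x) (h' x) $ 2)"
      by (rule iprim_cong[OF ode_iprim(1)[OF assms(1) order_refl] _ N0]) (use assms(3) in auto)
    show "iprim 0 b (\<lambda>x. u' x $ 2) (\<lambda>x. - mact (Ham x) (h' x) $ 1)"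
      by (rule iprim_cong[OF ode_iprim(2)[OF assms(1) order_refl] _ N0]) (use assms(3) in auto)
  qed
qed

theorem green:
  assumes u: "ode u h" and v: "ode v k" and "0 \<le> a" "a \<le> b" and h: "hloc h" and k: "hloc k"
  shows "hin a b h v - hin a b u k = Bf (u b) (v b) - Bf (u a) (v a)"
proof -
  note U = ode_iprim[OF u \<open>0 \<le> a\<close>, of b]
  note V = ode_iprim[OF v \<open>0 \<le> a\<close>, THEN iprim_cnj, of b]
  have "iprim a b (\<lambda>x. u x $ 1 * cnj (v x $ 2) + (-1) * (u x $ 2 * cnj (v x $ 1)))
     (\<lambda>x. (mact (Ham x) (h x) $ 2 * cnj (v x $ 2) + u x $ 1 * cnj (- mact (Ham x) (k x) $ 1)) +
       (-1) * (- mact (Ham x) (h x) $ 1 * cnj (v x $ 1) + u x $ 2 * cnj (mact (Ham x) (k x) $ 2)))"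
    by (intro iprim_add iprim_cmult iprim_mult U V)
  moreover have "(mact (Ham x) (h x) $ 2 * cnj (v x $ 2) + u x $ 1 * cnj (- mact (Ham x) (k x) $ 1)) +
       (-1) * (- mact (Ham x) (h x) $ 1 * cnj (v x $ 1) + u x $ 2 * cnj (mact (Ham x) (k x) $ 2))
     = hq x (h x) (v x) - hq x (u x) (k x)" for x
    unfolding hq_left[of x "h x"] hq_def[of x "u x"] cdot_eq by (simp add: algebra_simps)
  ultimately have "iprim a b (\<lambda>x. Bf (u x) (v x)) (\<lambda>x. hq x (h x) (v x) - hq x (u x) (k x))"
    by (simp add: Bf_def)
  then have "Bf (u b) (v b) - Bf (u a) (v a) = integral {a..b} (\<lambda>x. hq x (h x) (v x) - hq x (u x) (k x))"
    using \<open>a \<le> b\<close> by (intro iprim_diff_eq) auto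
  also have "\<dots> = hin a b h v - hin a b u k"
    unfolding hin_def
    by (intro integral_diff absolutely_integrable_imp hq_loc_integrable h k ode_hloc[OF u] ode_hloc[OF v] \<open>0 \<le> a\<close>)
  finally show ?thesis by simp
qed

text \<open>One direction is the fundamental theorem for absolutely continuous functions, the other
  Lebesgue differentiation. Afterwards solutions are handled in integrated form.\<close>

theorem solves_J_iff_ode:
  assumes "hloc h"
  shows "solves_J u (\<lambda>x. mact (Ham x) (h x)) \<longleftrightarrow> ode u h"
proof
  assume s: "solves_J u (\<lambda>x. mact (Ham x) (h x))"
  have ac: "acont 0 b u" for b
  proof (cases "b \<ge> 0")
    case True then show ?thesis
      using s by (simp add: solves_J_def loc_abs_continuous_def abs_continuous_on_interval_acont)
  next
    case False
    have "acont 0 0 u" using s by (simp add: solves_J_def loc_abs_continuous_def abs_continuous_on_interval_acont)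
    then show ?thesis by (rule acont_subset) (use False in auto)
  qed
  have aci: "acont 0 b (\<lambda>x. u x $ i)" for b i
  proof (rule acont_dominated[OF ac[of b] acont_const[of 0 b "0::complex"], of 1])
    show "norm (u t $ i - u s $ i) \<le> 1 * (norm (u t - u s) + norm (0 - 0 :: complex))" for s t
      using Finite_Cartesian_Product.norm_nth_le[of "u t - u s" i] by simp
  qed simp
  let ?P = "\<lambda>x. \<exists>Y'. (u has_vector_derivative Y') (at x) \<and> symplectic_J *v Y' = mact (Ham x) (h x)"
  have "AE x in lebesgue. x \<in> {0<..} \<longrightarrow> ?P x"
    using s AE_lebesgue_on_iff[of "{0<..}" ?P] by (simp add: solves_J_def)
  then have N: "negligible {x. \<not> (x \<in> {0<..} \<longrightarrow> ?P x)}" by (simp only: AE_lebesgue_negligible)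
  show "ode u h"
    unfolding ode_def
  proof (intro allI conjI)
    fix b :: real
    have der: "((\<lambda>x. u x $ 1) has_vector_derivative mact (Ham x) (h x) $ 2) (at x) \<and>
         ((\<lambda>x. u x $ 2) has_vector_derivative - mact (Ham x) (h x) $ 1) (at x)"
      if x: "x \<in> {0<..<b} - {x. \<not> (x \<in> {0<..} \<longrightarrow> ?P x)}" for x
    proof -
      obtain Y' where Y: "(u has_vector_derivative Y') (at x)" "symplectic_J *v Y' = mact (Ham x) (h x)"
        using x by auto
      have "((\<lambda>x. u x $ i) has_vector_derivative Y' $ i) (at x)" for i
        by (rule bounded_linear.has_vector_derivative[OF bounded_linear_vec_nth Y(1)])
      from this[of 1] this[of 2] show ?thesis
        using symplectic_J_nth[of Y'] unfolding Y(2) by simp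
    qed
    note i = mact_loc_integrable[OF assms order_refl]
    show "iprim 0 b (\<lambda>x. u x $ 1) (\<lambda>x. mact (Ham x) (h x) $ 2)"
      by (rule iprimI[OF aci i N]) (use der in blast)
    have "(\<lambda>x. - mact (Ham x) (h x) $ 1) absolutely_integrable_on {0..b}"
      using set_integrable_mult_right[where a = "-1", OF i] by simp
    then show "iprim 0 b (\<lambda>x. u x $ 2) (\<lambda>x. - mact (Ham x) (h x) $ 1)"
      by (rule iprimI[OF aci _ N]) (use der in blast)
  qed
next
  assume o: "ode u h"
  note I = ode_iprim[OF o order_refl]
  show "solves_J u (\<lambda>x. mact (Ham x) (h x))"
    unfolding solves_J_def
  proof
    show "loc_abs_continuous u"
      unfolding loc_abs_continuous_def abs_continuous_on_interval_acont
    proof (intro allI impI)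
      fix b :: real
      show "acont 0 b u"
      proof (rule acont_dominated[OF iprim_acont[OF I(1)] iprim_acont[OF I(2)], of 1])
        show "norm (u t - u s) \<le> 1 * (norm (u t $ 1 - u s $ 1) + norm (u t $ 2 - u s $ 2))" for s t
          using norm_vec2_le[of "u t - u s"] by simp
      qed simp
    qed
    let ?B1 = "\<lambda>n::nat. {x \<in> {0<..<real n}. \<not> ((\<lambda>x. u x $ 1) has_vector_derivative mact (Ham x) (h x) $ 2) (at x)}"
    let ?B2 = "\<lambda>n::nat. {x \<in> {0<..<real n}. \<not> ((\<lambda>x. u x $ 2) has_vector_derivative - mact (Ham x) (h x) $ 1) (at x)}"
    have neg: "negligible ((\<Union>n. ?B1 n) \<union> (\<Union>n. ?B2 n))"
      by (intro negligible_Un negligible_Union_nat iprim_has_vector_derivative I)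
    let ?P = "\<lambda>x. \<exists>Y'. (u has_vector_derivative Y') (at x) \<and> symplectic_J *v Y' = mact (Ham x) (h x)"
    have "{x. \<not> (x \<in> {0<..} \<longrightarrow> ?P x)} \<subseteq> (\<Union>n. ?B1 n) \<union> (\<Union>n. ?B2 n)"
    proof
      fix x assume x: "x \<in> {x. \<not> (x \<in> {0<..} \<longrightarrow> ?P x)}"
      then have x0: "0 < x" "\<not> ?P x" by auto
      obtain n :: nat where n: "x < real n" using reals_Archimedean2 by blast
      show "x \<in> (\<Union>n. ?B1 n) \<union> (\<Union>n. ?B2 n)"
      proof (rule ccontr)
        assume "\<not> ?thesis"
        then have "x \<notin> ?B1 n" "x \<notin> ?B2 n" by blast+
        then have "((\<lambda>x. u x $ 1) has_vector_derivative mact (Ham x) (h x) $ 2) (at x)"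
          "((\<lambda>x. u x $ 2) has_vector_derivative - mact (Ham x) (h x) $ 1) (at x)"
          using x0 n by auto
        from has_vector_derivative_vec2[OF this]
        have "(u has_vector_derivative vec2 (mact (Ham x) (h x) $ 2) (- mact (Ham x) (h x) $ 1)) (at x)" .
        moreover have "symplectic_J *v vec2 (mact (Ham x) (h x) $ 2) (- mact (Ham x) (h x) $ 1) = mact (Ham x) (h x)"
          by (simp add: vec2_eq_iff symplectic_J_nth)
        ultimately show False using x0(2) by blast
      qed
    qed
    from negligible_subset[OF neg this]
    have "AE x in lebesgue. x \<in> {0<..} \<longrightarrow> ?P x" by (simp only: AE_lebesgue_negligible)
    then show "AE x in hline. ?P x" by (simp add: AE_lebesgue_on_iff)
  qed
qed

text \<open>On a singular interval H h is a multiple of e, so u' is orthogonal to e and the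
  component of u along e is constant. Hence a square integrable solution automatically belongs to
  H.\<close>

lemma ode_singular:
  assumes o: "ode u h" and I: "singular_interval Ham I"
  shows "\<exists>c. weighted_eq Ham I u (\<lambda>x. c)"
proof -
  have ind: "indivisible_on Ham I" using I by (simp add: singular_interval_def)
  note ID = indivisible_D[OF ind]
  obtain e where e: "AE x in lebesgue_on I. rank_one e x" "(e $ 1)\<^sup>2 + (e $ 2)\<^sup>2 = 1"
    using indivisible_obtain[OF ind] by blast
  have const: "edot e (u q) = edot e (u p)" if "p \<in> I" "q \<in> I" "p \<le> q" for p q
  proof -
    have sub: "{p..q} \<subseteq> I" using ID(2) that by (meson atLeastAtMost_iff is_interval_1 subsetI)
    have p0: "0 \<le> p" using ID(4) that by force
    have "iprim p q (\<lambda>x. of_real (e $ 1) * u x $ 1 + of_real (e $ 2) * u x $ 2)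
       (\<lambda>x. of_real (e $ 1) * mact (Ham x) (h x) $ 2 + of_real (e $ 2) * (- mact (Ham x) (h x) $ 1))"
      by (intro iprim_add iprim_cmult ode_iprim[OF o p0])
    then have "of_real (e $ 1) * u q $ 1 + of_real (e $ 2) * u q $ 2 = of_real (e $ 1) * u p $ 1 + of_real (e $ 2) * u p $ 2"
    proof (rule iprim_zero_const[OF _ AE_on_negligible[OF e(1) ID(5)]])
      fix x assume "x \<in> {p..q} - {x \<in> I. \<not> rank_one e x}"
      then have "rank_one e x" using sub by auto
      then show "of_real (e $ 1) * mact (Ham x) (h x) $ 2 + of_real (e $ 2) * (- mact (Ham x) (h x) $ 1) = 0"
        by (simp add: mact_rank_one)
    qed (use that in auto)
    then show ?thesis by (simp add: edot_def)
  qed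
  obtain p where p: "p \<in> I" using ID(3) by blast
  have "edot e (u x) = edot e (u p)" if "x \<in> I" for x
    using const[of x p] const[of p x] p that by (cases "x \<le> p") auto
  then have "AE x in lebesgue_on I. edot e (u x) = edot e (u p)" by (intro AE_I2) simp
  then have "weighted_eq Ham I u (\<lambda>x. u p)" unfolding singular_constant_iff[OF e(1)] .
  then show ?thesis by (rule exI)
qed

lemma ode_H_space: "ode u h \<Longrightarrow> u \<in> weighted_L2 Ham \<Longrightarrow> u \<in> H_space Ham"
  using ode_singular by (auto simp: H_space_def)

section \<open>Truncation\<close>

definition trunc :: "real \<Rightarrow> (real \<Rightarrow> complex^2) \<Rightarrow> real \<Rightarrow> complex^2" where
  "trunc b f x = (if x \<le> b then f x else 0)"

lemma hs_0: "hs x 0 = 0" by (simp add: hs_def hq_eq)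

lemma hq_0: "hq x 0 v = 0" "hq x v 0 = 0" by (simp_all add: hq_eq)

lemma trunc_hloc: assumes "hloc f" shows "hloc (trunc b f)"
proof -
  have m: "trunc b f \<in> borel_measurable hline"
  proof -
    note [measurable] = hloc_measurable[OF assms]
    have [measurable]: "(\<lambda>x. x) \<in> borel_measurable hline"
      using id_borel_measurable_lebesgue_on by (simp add: id_def)
    have "(\<lambda>x. if x \<in> {..b} then f x else 0) \<in> borel_measurable hline" by measurable
    then show ?thesis by (simp add: trunc_def[abs_def])
  qed
  have "(\<lambda>x. hs x (trunc b f x)) absolutely_integrable_on {0..B}" for B
    by (rule absolutely_integrable_bounded_by[OF hs_measurable[OF m] hloc_integrable[OF assms]])
       (simp add: trunc_def hs_nonneg hs_0)
  with m show ?thesis by (simp add: hloc_def)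
qed

lemma integral_eq_except_endpoint:
  fixes f g :: "real \<Rightarrow> 'b::banach"
  assumes "\<And>x. a < x \<Longrightarrow> x \<le> b \<Longrightarrow> f x = g x"
  shows "integral {a..b} f = integral {a..b} g"
  using assms by (intro integral_spike[of "{a}"]) auto

lemma hsn_trunc_le: "hloc f \<Longrightarrow> 0 \<le> b \<Longrightarrow> hsn 0 B (trunc b f) \<le> hsn 0 b f"
proof (cases "B \<le> b")
  case True
  assume h: "hloc f" "0 \<le> b"
  have "hsn 0 B (trunc b f) = hsn 0 B f"
    unfolding hsn_def using True by (intro integral_cong) (auto simp: trunc_def)
  also have "\<dots> \<le> hsn 0 b f"
  proof (cases "0 \<le> B")
    case True then show ?thesis using hsn_mono[OF h(1) order_refl True] \<open>B \<le> b\<close> by simp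
  next
    case False
    then have "hsn 0 B f = 0" by (simp add: hsn_def)
    then show ?thesis using hsn_nonneg[of 0 b f] by simp
  qed
  finally show ?thesis .
next
  case False
  assume h: "hloc f" "0 \<le> b"
  have "hsn 0 B (trunc b f) = hsn 0 b (trunc b f) + hsn b B (trunc b f)"
    using False h by (intro hsn_split trunc_hloc) auto
  also have "hsn 0 b (trunc b f) = hsn 0 b f"
    unfolding hsn_def by (intro integral_cong) (auto simp: trunc_def)
  also have "hsn b B (trunc b f) = integral {b..B} (\<lambda>x. 0)"
    unfolding hsn_def by (rule integral_eq_except_endpoint) (simp add: trunc_def hs_0)
  finally show ?thesis by simp
qed

lemma trunc_wL2: "hloc f \<Longrightarrow> 0 \<le> b \<Longrightarrow> trunc b f \<in> weighted_L2 Ham"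
  by (rule wL2_bounded[OF trunc_hloc]) (auto intro: hsn_trunc_le)

lemma hnorm_trunc_le:
  assumes "f \<in> weighted_L2 Ham" "0 \<le> b"
  shows "hnorm Ham (trunc b f) \<le> hnorm Ham f"
proof (rule hnorm_le[OF trunc_wL2[OF wL2_hloc[OF assms(1)] assms(2)]])
  show "hsn 0 B (trunc b f) \<le> (hnorm Ham f)\<^sup>2" for B
    using hsn_trunc_le[OF wL2_hloc[OF assms(1)] assms(2), of B] hsn_le_hnorm[OF assms(1), of b] by simp
qed (use HW.nrm_nonneg[OF assms(1)] in \<open>simp add: HW_nrm\<close>)

lemma hnorm_trunc_diff:
  assumes f: "f \<in> weighted_L2 Ham" and "0 \<le> b"
  shows "(hnorm Ham (\<lambda>x. trunc b f x - f x))\<^sup>2 \<le> (hnorm Ham f)\<^sup>2 - hsn 0 b f"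
proof -
  have d: "(\<lambda>x. trunc b f x - f x) \<in> weighted_L2 Ham" by (intro wL2_diff trunc_wL2 wL2_hloc assms)
  show ?thesis
  proof (rule tendsto_upperbound[OF hsn_tendsto_hnorm[OF d]])
    have "hsn 0 B (\<lambda>x. trunc b f x - f x) \<le> (hnorm Ham f)\<^sup>2 - hsn 0 b f" if "B \<ge> b" for B
    proof -
      have "hsn 0 B (\<lambda>x. trunc b f x - f x) = hsn 0 b (\<lambda>x. trunc b f x - f x) + hsn b B (\<lambda>x. trunc b f x - f x)"
        using that assms by (intro hsn_split wL2_hloc[OF d]) auto
      also have "hsn 0 b (\<lambda>x. trunc b f x - f x) = integral {0..b} (\<lambda>x. 0)"
        unfolding hsn_def by (intro integral_cong) (auto simp: trunc_def hs_0)
      also have "hsn b B (\<lambda>x. trunc b f x - f x) = hsn b B f"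
        unfolding hsn_def using hs_scale[of _ "-1"]
        by (intro integral_eq_except_endpoint) (auto simp: trunc_def)
      also have "\<dots> = hsn 0 B f - hsn 0 b f"
        using hsn_split[of 0 b B f] that assms wL2_hloc[OF f] by simp
      finally show ?thesis using hsn_le_hnorm[OF f, of B] by simp
    qed
    then show "\<forall>\<^sub>F B in at_top. hsn 0 B (\<lambda>x. trunc b f x - f x) \<le> (hnorm Ham f)\<^sup>2 - hsn 0 b f"
      unfolding eventually_at_top_linorder by blast
  qed simp
qed

lemma trunc_tendsto:
  assumes f: "f \<in> weighted_L2 Ham" and b: "filterlim b at_top sequentially" "\<And>n. 0 \<le> b n"
  shows "(\<lambda>n. hnorm Ham (\<lambda>x. trunc (b n) f x - f x)) \<longlonglongrightarrow> 0"
proof -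
  have "(\<lambda>n. hsn 0 (b n) f) \<longlonglongrightarrow> (hnorm Ham f)\<^sup>2"
    by (rule filterlim_compose[OF hsn_tendsto_hnorm[OF f] b(1)])
  then have "(\<lambda>n. (hnorm Ham f)\<^sup>2 - hsn 0 (b n) f) \<longlonglongrightarrow> (hnorm Ham f)\<^sup>2 - (hnorm Ham f)\<^sup>2"
    by (intro tendsto_intros)
  then have "(\<lambda>n. (hnorm Ham (\<lambda>x. trunc (b n) f x - f x))\<^sup>2) \<longlonglongrightarrow> 0"
    by (intro squeeze_zero[OF _ hnorm_trunc_diff[OF f b(2)]]) auto
  then have "(\<lambda>n. sqrt ((hnorm Ham (\<lambda>x. trunc (b n) f x - f x))\<^sup>2)) \<longlonglongrightarrow> sqrt 0" by (intro tendsto_intros)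
  moreover have "(\<lambda>x. trunc (b n) f x - f x) \<in> weighted_L2 Ham" for n
    by (intro wL2_diff trunc_wL2 wL2_hloc f b)
  ultimately show ?thesis using HW.nrm_nonneg by (simp add: HW_nrm)
qed

text \<open>A cut in the interior of a singular interval would destroy constancy on it; cutting at
  such a point keeps elements of H in H.\<close>

definition regular_point :: "real \<Rightarrow> bool" where
  "regular_point b \<longleftrightarrow> 0 < b \<and> (\<forall>I. singular_interval Ham I \<longrightarrow> I \<subseteq> {..b} \<or> I \<subseteq> {b..})"

lemma trunc_H_space:
  assumes h: "hloc f" and c: "\<And>I. singular_interval Ham I \<Longrightarrow> \<exists>c. weighted_eq Ham I f (\<lambda>x. c)"
    and b: "regular_point b"
  shows "trunc b f \<in> H_space Ham"
  unfolding H_space_def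
proof (intro CollectI conjI allI impI)
  show "trunc b f \<in> weighted_L2 Ham" using b by (intro trunc_wL2 h) (simp add: regular_point_def)
  fix I assume I: "singular_interval Ham I"
  have op: "open I" using I indivisible_D by (simp add: singular_interval_def)
  from b I consider "I \<subseteq> {..b}" | "I \<subseteq> {b..}" unfolding regular_point_def by blast
  then show "\<exists>c. weighted_eq Ham I (trunc b f) (\<lambda>x. c)"
  proof cases
    case 1
    then have "weighted_eq Ham I (trunc b f) f"
      unfolding weighted_eq_def by (intro AE_I2) (auto simp: trunc_def mact_0)
    then show ?thesis using c[OF I] weighted_eq_trans by blast
  next
    case 2
    then have "interior I \<subseteq> interior {b..}" by (rule interior_mono)
    then have "I \<subseteq> {b<..}" using op by (simp add: interior_open)
    then have "weighted_eq Ham I (trunc b f) (\<lambda>x. 0)"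
      unfolding weighted_eq_def by (intro AE_I2) (auto simp: trunc_def mact_0)
    then show ?thesis by (rule exI)
  qed
qed

lemma hin_vanishing:
  assumes f: "hloc f" "weighted_eq Ham {b<..} f (\<lambda>x. 0)" and g: "hloc g" and "0 \<le> b" "b \<le> B"
  shows "hin 0 B f g = hin 0 b f g" "hin 0 B g f = hin 0 b g f"
proof -
  have "negligible {x \<in> {b<..}. \<not> mact (Ham x) (f x) = 0}"
    using f(2) by (intro AE_on_negligible) (auto simp: weighted_eq_def)
  then have N: "negligible (insert b {x \<in> {b<..}. \<not> mact (Ham x) (f x) = 0})" by simp
  have "hin b B f g = integral {b..B} (\<lambda>x. 0)"
    unfolding hin_def by (rule integral_spike[OF N]) (auto simp: hq_left)
  moreover have "hin b B g f = integral {b..B} (\<lambda>x. 0)"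
    unfolding hin_def by (rule integral_spike[OF N]) (auto simp: hq_def cdot_eq)
  ultimately show "hin 0 B f g = hin 0 b f g" "hin 0 B g f = hin 0 b g f"
    using hin_split[OF order_refl assms(4,5) f(1) g] hin_split[OF order_refl assms(4,5) g f(1)] by simp_all
qed

lemma hinner_vanishing_tendsto:
  assumes f: "f \<in> weighted_L2 Ham" "weighted_eq Ham {b<..} f (\<lambda>x. 0)" and g: "g \<in> weighted_L2 Ham" and "0 \<le> b"
  shows "hinner Ham f g = hin 0 b f g"
proof (rule tendsto_unique[OF _ hin_tendsto_hinner[OF f(1) g]])
  show "((\<lambda>B. hin 0 B f g) \<longlongrightarrow> hin 0 b f g) at_top"
  proof (rule tendsto_eventually)
    show "\<forall>\<^sub>F B in at_top. hin 0 B f g = hin 0 b f g"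
      using eventually_ge_at_top[of b]
      by eventually_elim (use hin_vanishing(1)[OF wL2_hloc[OF f(1)] f(2) wL2_hloc[OF g] \<open>0 \<le> b\<close>] in blast)
  qed
qed simp

end

section \<open>Triviality of the kernel\<close>

locale reg_ham = ham +
  assumes cond_L: "condition_L Ham"
    and no_semiaxis: "\<And>b. b > 0 \<Longrightarrow> \<not> (\<exists>I. singular_interval Ham I \<and> {b<..} \<subseteq> I)"
begin

lemma interval_side:
  fixes K :: "real set"
  assumes "is_interval K" "c \<notin> K"
  shows "K \<subseteq> {..c} \<or> K \<subseteq> {c..}"
proof (rule ccontr)
  assume "\<not> ?thesis"
  then obtain x y where "x \<in> K" "x > c" "y \<in> K" "y < c" by force
  then have "c \<in> K" using mem_is_interval_1_I[OF assms(1), of y x c] by simp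
  then show False using assms by simp
qed

lemma singular_D:
  assumes "singular_interval Ham I"
  shows "indivisible_on Ham I" "open I" "is_interval I" "I \<subseteq> {0<..}" "I \<noteq> {}"
  using assms indivisible_D by (auto simp: singular_interval_def)

text \<open>If N lies in a singular interval, take the right endpoint of that interval. It is finite
  because no singular interval contains a semiaxis, and no other singular interval contains it,
  since it would meet the first one and so coincide with it.\<close>

lemma regular_exists: "\<exists>b\<ge>N. regular_point b"
proof -
  define N' where "N' = max N 1"
  have N': "N' > 0" "N' \<ge> N" by (auto simp: N'_def)
  show ?thesis
  proof (cases "\<exists>I. singular_interval Ham I \<and> N' \<in> I")
    case False
    then have "regular_point N'"
      unfolding regular_point_def using N' interval_side singular_D(3) by blast
    then show ?thesis using N' by blast
  next
    case True
    then obtain I where I: "singular_interval Ham I" "N' \<in> I" by blast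
    have "\<not> {N'<..} \<subseteq> I" using no_semiaxis[OF N'(1)] I by blast
    then obtain y where y: "y > N'" "y \<notin> I" by auto
    then have Iy: "I \<subseteq> {..y}" using interval_side[OF singular_D(3)[OF I(1)] y(2)] I(2) y(1) by force
    then have bdd: "bdd_above I" by (rule bdd_above_mono[rotated]) simp
    define c where "c = Sup I"
    have le: "x \<le> c" if "x \<in> I" for x unfolding c_def using bdd that by (rule cSup_upper[rotated])
    have cN: "N' \<le> c" using le[OF I(2)] .
    have cI: "c \<notin> I"
    proof
      assume "c \<in> I"
      then obtain d where "d > 0" "ball c d \<subseteq> I" using singular_D(2)[OF I(1)] by (meson openE)
      then have "c + d / 2 \<in> I" by (auto simp: dist_real_def subset_iff)
      then show False using le[of "c + d / 2"] \<open>d > 0\<close> by simp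
    qed
    have "c \<notin> K" if K: "singular_interval Ham K" for K
    proof
      assume "c \<in> K"
      then obtain d where d: "d > 0" "ball c d \<subseteq> K" using singular_D(2)[OF K] by (meson openE)
      then obtain x where x: "x \<in> I" "x > c - d"
        using less_cSup_iff[OF singular_D(5)[OF I(1)] bdd, of "c - d"] unfolding c_def[symmetric] by auto
      then have "x \<in> K" using d le[OF x(1)] by (auto simp: dist_real_def subset_iff)
      then have "I = K" using singular_disjoint[OF I(1) K x(1)] by blast
      then show False using \<open>c \<in> K\<close> cI by simp
    qed
    then have "regular_point c"
      unfolding regular_point_def using N' cN interval_side singular_D(3) by (metis less_le_trans)
    then show ?thesis using N' cN by (meson order_trans)
  qed
qed

lemma regular_sequence:
  obtains b where "\<And>n::nat. regular_point (b n)" "filterlim b at_top sequentially" "\<And>n. 0 \<le> b n"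
proof -
  have "\<forall>n. \<exists>b\<ge>real n. regular_point b" using regular_exists by blast
  from choice[OF this] obtain b where b: "\<And>n. b n \<ge> real n" "\<And>n. regular_point (b n)" by blast
  have "filterlim b at_top sequentially"
    by (rule filterlim_at_top_mono[OF filterlim_real_sequentially]) (simp add: b)
  moreover have "0 \<le> b n" for n using b(1)[of n] of_nat_0_le_iff[of n] by linarith
  ultimately show thesis using that b(2) by blast
qed

lemma right_zero:
  fixes l :: "real \<Rightarrow> complex"
  assumes c: "continuous_on {0..} l" and x0: "0 < x0" "l x0 \<noteq> 0"
  shows "(\<forall>x\<ge>x0. l x \<noteq> 0) \<or> (\<exists>b>x0. l b = 0 \<and> (\<forall>x. x0 \<le> x \<longrightarrow> x < b \<longrightarrow> l x \<noteq> 0))"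
proof (cases "\<forall>x\<ge>x0. l x \<noteq> 0")
  case False
  then obtain y where y: "y \<ge> x0" "l y = 0" by blast
  define Z where "Z = {x \<in> {x0..y}. l x = 0}"
  have "continuous_on {x0..y} l" by (rule continuous_on_subset[OF c]) (use x0 in auto)
  then have "closed Z"
    unfolding Z_def using continuous_closed_preimage_constant[of "{x0..y}" l 0] by simp
  moreover have ne: "Z \<noteq> {}" using y by (auto simp: Z_def)
  moreover have bdd: "bdd_below Z" by (rule bdd_belowI[of _ x0]) (simp add: Z_def)
  ultimately have b: "Inf Z \<in> Z" by (intro closed_contains_Inf)
  then have "Inf Z \<noteq> x0" using x0 by (auto simp: Z_def)
  then have "Inf Z > x0" using b by (auto simp: Z_def)
  moreover have "l x \<noteq> 0" if "x0 \<le> x" "x < Inf Z" for x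
  proof
    assume "l x = 0"
    then have "x \<in> Z" using that b by (auto simp: Z_def)
    then show False using cInf_lower[OF _ bdd] that by fastforce
  qed
  ultimately show ?thesis using b by (auto simp: Z_def)
qed simp

lemma left_zero:
  fixes l :: "real \<Rightarrow> complex"
  assumes c: "continuous_on {0..} l" and x0: "0 < x0" "l x0 \<noteq> 0"
  shows "\<exists>a\<ge>0. a < x0 \<and> (l a = 0 \<or> a = 0) \<and> (\<forall>x. a < x \<longrightarrow> x \<le> x0 \<longrightarrow> l x \<noteq> 0)"
proof (cases "\<forall>x. 0 < x \<longrightarrow> x \<le> x0 \<longrightarrow> l x \<noteq> 0")
  case True then show ?thesis using x0 by blast
next
  case False
  then obtain y where y: "0 < y" "y \<le> x0" "l y = 0" by blast
  define Z where "Z = {x \<in> {0..x0}. l x = 0}"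
  have "continuous_on {0..x0} l" by (rule continuous_on_subset[OF c]) auto
  then have "closed Z"
    unfolding Z_def using continuous_closed_preimage_constant[of "{0..x0}" l 0] by simp
  moreover have ne: "Z \<noteq> {}" using y by (auto simp: Z_def)
  moreover have bdd: "bdd_above Z" by (rule bdd_aboveI[of _ x0]) (simp add: Z_def)
  ultimately have b: "Sup Z \<in> Z" by (intro closed_contains_Sup)
  then have "Sup Z \<noteq> x0" using x0 by (auto simp: Z_def)
  then have "Sup Z < x0" using b by (auto simp: Z_def)
  moreover have "l x \<noteq> 0" if "Sup Z < x" "x \<le> x0" for x
  proof
    assume "l x = 0"
    then have "x \<in> Z" using that b by (auto simp: Z_def)
    then show False using cSup_upper[OF _ bdd] that by fastforce
  qed
  ultimately show ?thesis using b by (auto simp: Z_def)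
qed

text \<open>Used for each component l of a vector function u, with q the other one. On the largest
  interval around x0 where l has no zero, q / l is constant by \<open>quot\<close>, so the kernel of
  H has a fixed direction and the interval is indivisible. It cannot be unbounded; otherwise u
  vanishes at both ends, where \<open>start\<close> takes care of a left end at 0, and
  \<open>affine\<close> makes l vanish inside.\<close>

lemma kernel_component:
  fixes l q :: "real \<Rightarrow> complex"
  assumes cl: "continuous_on {0..} l" and cq: "continuous_on {0..} q"
    and quot: "\<And>r s. 0 \<le> r \<Longrightarrow> r \<le> s \<Longrightarrow> (\<And>x. x \<in> {r..s} \<Longrightarrow> l x \<noteq> 0) \<Longrightarrow> q s / l s = q r / l r"
    and rank: "\<And>k I. open I \<Longrightarrow> I \<subseteq> {0<..} \<Longrightarrow> I \<noteq> {} \<Longrightarrow> (\<And>x. x \<in> I \<Longrightarrow> l x \<noteq> 0 \<and> q x = k * l x) \<Longrightarrow>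
        \<exists>e. AE x in lebesgue_on I. rank_one e x"
    and affine: "\<And>a b. 0 \<le> a \<Longrightarrow> a < b \<Longrightarrow> indivisible_on Ham {a<..<b} \<Longrightarrow> l a = 0 \<Longrightarrow> q a = 0 \<Longrightarrow>
        l b = 0 \<Longrightarrow> q b = 0 \<Longrightarrow> (\<And>x. x \<in> {a<..<b} \<Longrightarrow> l x = 0)"
    and start: "\<And>k b. 0 < b \<Longrightarrow> (\<And>x. x \<in> {0<..<b} \<Longrightarrow> l x \<noteq> 0 \<and> q x = k * l x) \<Longrightarrow> l 0 = 0"
    and x0: "0 < x0"
  shows "l x0 = 0"
proof (rule ccontr)
  assume l0: "l x0 \<noteq> 0"
  obtain a where a: "0 \<le> a" "a < x0" "l a = 0 \<or> a = 0" "\<And>x. a < x \<Longrightarrow> x \<le> x0 \<Longrightarrow> l x \<noteq> 0"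
    using left_zero[OF cl x0 l0] by blast
  define k where "k = q x0 / l x0"
  have lin: "l x \<noteq> 0 \<and> q x = k * l x" if x: "a < x" "\<And>y. x0 \<le> y \<Longrightarrow> y \<le> x \<Longrightarrow> l y \<noteq> 0" for x
  proof -
    have nz: "l y \<noteq> 0" if "a < y" "y \<le> x" for y using a(4)[of y] x(2)[of y] that by linarith
    have nz': "l x \<noteq> 0" using nz x(1) by blast
    have "q x / l x = k"
    proof (cases "x \<le> x0")
      case True
      have "q x0 / l x0 = q x / l x" by (rule quot) (use True x(1) a in auto)
      then show ?thesis by (simp add: k_def)
    next
      case False
      have "q x / l x = q x0 / l x0" by (rule quot) (use False x0 x(2) in auto)
      then show ?thesis by (simp add: k_def)
    qed
    then show ?thesis using nz' by (simp add: field_simps)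
  qed
  consider "\<forall>x\<ge>x0. l x \<noteq> 0" | b where "b > x0" "l b = 0" "\<And>x. x0 \<le> x \<Longrightarrow> x < b \<Longrightarrow> l x \<noteq> 0"
    using right_zero[OF cl x0 l0] by blast
  then show False
  proof cases
    case 1
    then have L: "l x \<noteq> 0 \<and> q x = k * l x" if "x \<in> {a<..}" for x using lin[of x] that by auto
    have "\<exists>e. AE x in lebesgue_on {a<..}. rank_one e x"
      by (rule rank[of "{a<..}" k]) (use a L in auto)
    then have "indivisible_on Ham {a<..}"
      unfolding indivisible_on_iff using a by (auto simp: is_interval_1)
    then obtain K where K: "singular_interval Ham K" "{a<..} \<subseteq> K" using singular_exists by blast
    then have "{a + 1<..} \<subseteq> K" by auto
    then show False using no_semiaxis[of "a + 1"] K a by auto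
  next
    case 2
    then have L: "l x \<noteq> 0 \<and> q x = k * l x" if "x \<in> {a<..<b}" for x using lin[of x] that by auto
    have ab: "a < b" using a 2 by simp
    have "\<exists>e. AE x in lebesgue_on {a<..<b}. rank_one e x"
      by (rule rank[of "{a<..<b}" k]) (use a L ab in auto)
    then have ind: "indivisible_on Ham {a<..<b}"
      unfolding indivisible_on_iff using a ab by (auto simp: is_interval_1)
    have ext: "q x - k * l x = 0" if "x \<in> {a..b}" for x
    proof (rule continuous_constant_on_closure[of "{a<..<b}"])
      have "continuous_on {a..b} (\<lambda>x. q x - k * l x)"
        using a by (intro continuous_intros continuous_on_subset[OF cq] continuous_on_subset[OF cl]) auto
      then show "continuous_on (closure {a<..<b}) (\<lambda>x. q x - k * l x)" using ab by simp
    qed (use L that ab in auto)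
    have "l a = 0"
    proof (rule ccontr)
      assume n: "l a \<noteq> 0"
      then have "a = 0" using a(3) by simp
      then show False using start[of b k] L n ab by blast
    qed
    then have "q a = 0" "q b = 0" using ext[of a] ext[of b] ab 2(2) by auto
    then have "l x0 = 0" using affine[OF a(1) ab ind \<open>l a = 0\<close>] 2 a by simp
    then show False using l0 by simp
  qed
qed

text \<open>An element of the domain that is zero in the weighted space is zero as a function. This
  is what makes D single valued and its resolvent injective.\<close>

theorem kernel_zero:
  assumes o: "ode u g" and g: "g \<in> H_space Ham" and u0: "u 0 $ 2 = 0"
    and ker: "AE x in hline. mact (Ham x) (u x) = 0"
  shows "0 \<le> x \<Longrightarrow> u x = 0"
proof -
  define N where "N = {x \<in> {0<..}. \<not> mact (Ham x) (u x) = 0}"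
  have N: "negligible (insert 0 N)"
    using AE_on_negligible[OF ker] by (simp add: N_def)
  note O = ode_iprim[OF o]
  have cu: "continuous_on {0..} (\<lambda>x. u x $ i)" for i
    by (rule continuous_on_component[OF ode_continuous[OF o]])
  \<comment> \<open>Since H is symmetric and H u = 0, the bilinear product of u with H g is 0. In
    terms of u' this says that u and u' are parallel, so quotients of the components are locally
    constant.\<close>
  have wr: "u x $ 1 * (- mact (Ham x) (g x) $ 1) = u x $ 2 * mact (Ham x) (g x) $ 2"
    if "x > 0" "x \<notin> N" for x
  proof -
    have "mact (Ham x) (u x) $ 1 = 0" "mact (Ham x) (u x) $ 2 = 0" using that by (auto simp: N_def)
    moreover have "u x $ 1 * mact (Ham x) (g x) $ 1 + u x $ 2 * mact (Ham x) (g x) $ 2 =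
      mact (Ham x) (u x) $ 1 * g x $ 1 + mact (Ham x) (u x) $ 2 * g x $ 2"
      by (simp add: mact_Ham algebra_simps)
    ultimately have "u x $ 1 * mact (Ham x) (g x) $ 1 + u x $ 2 * mact (Ham x) (g x) $ 2 = 0" by simp
    then show ?thesis by (simp add: add_eq_0_iff)
  qed
  have AEN: "AE x in lebesgue_on I. x \<notin> N" if "I \<subseteq> {0<..}" "open I" for I
  proof -
    have "AE x in lebesgue_on I. mact (Ham x) (u x) = 0"
      using that by (intro AE_lebesgue_on_subset[OF ker]) (auto intro: borel_open)
    then show ?thesis by eventually_elim (simp add: N_def)
  qed
  \<comment> \<open>As g is in H, H g is a constant vector on an indivisible interval, so u is
    affine there and vanishes with its end values.\<close>
  have aff: "u x = 0" if ab: "0 \<le> a" "a < b" "indivisible_on Ham {a<..<b}" "u a = 0" "u b = 0" "x \<in> {a<..<b}" for a b x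
  proof -
    obtain K where K: "singular_interval Ham K" "{a<..<b} \<subseteq> K" using singular_exists[OF ab(3)] by blast
    obtain c where c: "weighted_eq Ham K g (\<lambda>x. c)" using H_space_D(2)[OF g K(1)] by blast
    obtain e where e: "AE x in lebesgue_on {a<..<b}. rank_one e x" "(e $ 1)\<^sup>2 + (e $ 2)\<^sup>2 = 1"
      using indivisible_obtain[OF ab(3)] by blast
    have "weighted_eq Ham {a<..<b} g (\<lambda>x. c)"
      using singular_D[OF K(1)] by (intro weighted_eq_subset[OF c K(2)]) auto
    then have "AE x in lebesgue_on {a<..<b}. edot e (g x) = edot e c"
      by (simp add: singular_constant_iff[OF e(1)])
    then have "AE x in lebesgue_on {a<..<b}. mact (Ham x) (g x) $ 1 = of_real (e $ 1) * edot e c \<and>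
        mact (Ham x) (g x) $ 2 = of_real (e $ 2) * edot e c"
      using e(1) by eventually_elim (simp add: mact_rank_one)
    from AE_on_negligible[OF this]
    have "negligible (insert a (insert b {x \<in> {a<..<b}. \<not> (mact (Ham x) (g x) $ 1 = of_real (e $ 1) * edot e c \<and>
        mact (Ham x) (g x) $ 2 = of_real (e $ 2) * edot e c)}))" (is "negligible ?N")
      by simp
    have val: "u y $ 1 = of_real (y - a) * (of_real (e $ 2) * edot e c) \<and>
          u y $ 2 = - of_real (y - a) * (of_real (e $ 1) * edot e c)" if y: "y \<in> {a..b}" for y
    proof -
      have "u y $ 1 - u a $ 1 = integral {a..y} (\<lambda>x. mact (Ham x) (g x) $ 2)"
        by (rule iprim_diff_eq[OF O(1)[OF ab(1), of b]]) (use y in auto)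
      also have "\<dots> = integral {a..y} (\<lambda>x. of_real (e $ 2) * edot e c)"
        by (rule integral_spike[OF \<open>negligible ?N\<close>]) (use y in auto)
      finally have 1: "u y $ 1 = of_real (y - a) * (of_real (e $ 2) * edot e c)"
        using y ab(4) by (simp add: scaleR_conv_of_real)
      have "u y $ 2 - u a $ 2 = integral {a..y} (\<lambda>x. - mact (Ham x) (g x) $ 1)"
        by (rule iprim_diff_eq[OF O(2)[OF ab(1), of b]]) (use y in auto)
      also have "\<dots> = integral {a..y} (\<lambda>x. - (of_real (e $ 1) * edot e c))"
        by (rule integral_spike[OF \<open>negligible ?N\<close>]) (use y in auto)
      finally have 2: "u y $ 2 = - of_real (y - a) * (of_real (e $ 1) * edot e c)"
        using y ab(4) by (simp add: scaleR_conv_of_real) (simp add: algebra_simps)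
      show ?thesis using 1 2 by blast
    qed
    have "b \<in> {a..b}" using ab by simp
    from val[OF this] have "of_real (e $ 2) * edot e c = 0" "of_real (e $ 1) * edot e c = 0"
      using ab(2,5) by (auto simp flip: of_real_diff)
    then show "u x = 0" using val[of x] ab(6) by (simp add: vec2_eq_iff)
  qed
  have z2: "u y $ 2 = 0" if "0 < y" for y
  proof (rule kernel_component[where q = "\<lambda>x. u x $ 1" and l = "\<lambda>x. u x $ 2", OF cu cu _ _ _ _ that])
    fix r s :: real assume rs: "0 \<le> r" "r \<le> s" "\<And>x. x \<in> {r..s} \<Longrightarrow> u x $ 2 \<noteq> 0"
    show "u s $ 1 / u s $ 2 = u r $ 1 / u r $ 2"
      by (rule iprim_quotient_const[OF O(1)[OF rs(1)] O(2)[OF rs(1)] rs(3) N]) (use rs wr in auto)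
  next
    fix k and I :: "real set"
    assume I: "open I" "I \<subseteq> {0<..}" "I \<noteq> {}" "\<And>x. x \<in> I \<Longrightarrow> u x $ 2 \<noteq> 0 \<and> u x $ 1 = k * u x $ 2"
    \<comment> \<open>The kernel of H is spanned by (k, 1), so e is (1, -k) normalised; real parts
      suffice because H is real.\<close>
    define s where "s = 1 / sqrt (1 + (Re k)\<^sup>2)"
    have s2: "s\<^sup>2 = 1 / (1 + (Re k)\<^sup>2)" unfolding s_def by (simp add: power_divide)
    have "rank_one (vector [s, - Re k * s]) x" if x: "x \<in> I" "x \<notin> N" for x
    proof -
      have "mact (Ham x) (u x) = 0" using x I(2) by (auto simp: N_def)
      then have "(of_real (ha x) * k + of_real (hb x)) * u x $ 2 = 0" "(of_real (hb x) * k + of_real (hdd x)) * u x $ 2 = 0"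
        using I(4)[OF x(1)] by (auto simp: vec2_eq_iff mact_Ham algebra_simps)
      then have h: "of_real (ha x) * k + of_real (hb x) = 0" "of_real (hb x) * k + of_real (hdd x) = 0"
        using I(4)[OF x(1)] by auto
      have "hb x = - ha x * Re k" "hdd x = - hb x * Re k"
        using arg_cong[OF h(1), of Re] arg_cong[OF h(2), of Re] by simp_all
      then have "hb x = - ha x * Re k" "hdd x = ha x * (Re k)\<^sup>2" by (simp_all add: power2_eq_square)
      moreover have "ha x = s\<^sup>2"
        using ha_hdd[of x] \<open>hdd x = ha x * (Re k)\<^sup>2\<close> unfolding s2
        by (simp add: field_simps add_nonneg_eq_0_iff)
      ultimately show ?thesis by (simp add: rank_one_def power2_eq_square)
    qed
    moreover have "AE x in lebesgue_on I. x \<in> I" by (rule AE_I2) simp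
    ultimately have "AE x in lebesgue_on I. rank_one (vector [s, - Re k * s]) x"
      using AEN[OF I(2,1)] by (auto elim: eventually_elim2)
    then show "\<exists>e. AE x in lebesgue_on I. rank_one e x" by blast
  next
    fix a b x :: real
    assume "0 \<le> a" "a < b" "indivisible_on Ham {a<..<b}" "u a $ 2 = 0" "u a $ 1 = 0" "u b $ 2 = 0" "u b $ 1 = 0" "x \<in> {a<..<b}"
    then show "u x $ 2 = 0" using aff[of a b x] by (simp add: vec2_eq_iff)
  next
    show "u 0 $ 2 = 0" by (rule u0)
  qed
  \<comment> \<open>With the lower component gone, the kernel contains (1, 0) and H is diag(0, 1)
    wherever the upper one is nonzero. Condition (L) forbids this next to 0.\<close>
  have z1: "u y $ 1 = 0" if "0 < y" for y
  proof (rule kernel_component[where q = "\<lambda>x. u x $ 2" and l = "\<lambda>x. u x $ 1", OF cu cu _ _ _ _ that])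
    have z2': "u y $ 2 = 0" if "0 \<le> y" for y using z2[of y] u0 that by (cases "y = 0") auto
    show "u s $ 2 / u s $ 1 = u r $ 2 / u r $ 1" if "0 \<le> r" "r \<le> s" for r s
      using z2'[of r] z2'[of s] that by simp
    have ro: "rank_one (vector [0, 1]) x" if x: "x > 0" "u x $ 1 \<noteq> 0" "x \<notin> N" for x
    proof -
      have "mact (Ham x) (u x) = 0" using x by (auto simp: N_def)
      then have h: "ha x = 0" "hb x = 0" using x z2[of x] by (auto simp: vec2_eq_iff mact_Ham)
      then show ?thesis using ha_hdd[of x] by (simp add: rank_one_def)
    qed
    have roI: "AE x in lebesgue_on I. rank_one (vector [0, 1]) x"
      if I: "open I" "I \<subseteq> {0<..}" "\<And>x. x \<in> I \<Longrightarrow> u x $ 1 \<noteq> 0" for I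
    proof -
      have "AE x in lebesgue_on I. x \<in> I" by (rule AE_I2) simp
      then show ?thesis using AEN[OF I(2,1)] by eventually_elim (use ro I in auto)
    qed
    show "\<exists>e. AE x in lebesgue_on I. rank_one e x"
      if I: "open I" "I \<subseteq> {0<..}" "I \<noteq> {}" "\<And>x. x \<in> I \<Longrightarrow> u x $ 1 \<noteq> 0 \<and> u x $ 2 = k * u x $ 1" for I k
      using roI[OF I(1,2)] I(4) by blast
    show "u x $ 1 = 0" if "0 \<le> a" "a < b" "indivisible_on Ham {a<..<b}" "u a $ 1 = 0" "u a $ 2 = 0" "u b $ 1 = 0"
        "u b $ 2 = 0" "x \<in> {a<..<b}" for a b x
      using aff[of a b x] that by (simp add: vec2_eq_iff)
    show "u 0 $ 1 = 0" if b: "0 < b" "\<And>x. x \<in> {0<..<b} \<Longrightarrow> u x $ 1 \<noteq> 0 \<and> u x $ 2 = k * u x $ 1" for k b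
    proof -
      have "AE x in lebesgue_on {0<..<b}. rank_one (vector [0, 1]) x"
        by (rule roI) (use b in auto)
      then have "AE x in lebesgue_on {0<..<b}. Ham x = vector [vector [0, 0], vector [0, 1]]"
        by eventually_elim (simp add: rank_one_def vec_eq_iff forall_2 Ham_nth)
      then show ?thesis using cond_L b(1) unfolding condition_L_def by blast
    qed
  qed
  assume x: "0 \<le> x"
  have "u x = 0" if "0 < x" using z1[OF that] z2[OF that] by (simp add: vec2_eq_iff)
  moreover have "u 0 $ 1 = 0"
    using continuous_constant_on_closure[of "{0<..}" "\<lambda>x. u x $ 1" 0 0] cu[of 1] z1 by auto
  ultimately show "u x = 0" using x u0 by (cases "x = 0") (auto simp: vec2_eq_iff)
qed

end

lemma acont_continuous:
  fixes f :: "real \<Rightarrow> 'a::real_normed_vector"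
  assumes "acont a b f"
  shows "continuous_on {a..b} f"
  unfolding continuous_on_iff
proof (intro ballI allI impI)
  fix x e :: real assume x: "x \<in> {a..b}" and "e > 0"
  obtain \<delta> where \<delta>: "\<delta> > 0" "\<And>d. d division_of \<Union>d \<Longrightarrow> \<Union>d \<subseteq> {a..b} \<Longrightarrow> (\<Sum>k\<in>d. Sup k - Inf k) < \<delta> \<Longrightarrow>
     (\<Sum>k\<in>d. norm (f (Sup k) - f (Inf k))) < e" using acontD[OF assms \<open>e > 0\<close>] by blast
  have key: "norm (f t - f s) < e" if "s \<in> {a..b}" "t \<in> {a..b}" "s \<le> t" "t - s < \<delta>" for s t
  proof -
    have "{{s..t}} division_of \<Union>{{s..t}}"
      using that division_of_self[of s t] by (simp add: box_real)
    from \<delta>(2)[OF this] show ?thesis using that by auto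
  qed
  have "dist (f y) (f x) < e" if "y \<in> {a..b}" "dist y x < \<delta>" for y
    using key[of x y] key[of y x] that x
    by (cases "x \<le> y") (auto simp: dist_norm dist_real_def norm_minus_commute)
  then show "\<exists>d>0. \<forall>x'\<in>{a..b}. dist x' x < d \<longrightarrow> dist (f x') (f x) < e" using \<delta>(1) by blast
qed

lemma loc_abs_continuous_continuous:
  assumes "loc_abs_continuous u"
  shows "continuous_on {0..} u"
  unfolding continuous_on_eq_continuous_within
proof
  fix x :: real assume x: "x \<in> {0..}"
  have "continuous_on {0..x+1} u"
    using assms x acont_continuous[of 0 "x + 1" u]
    by (simp add: loc_abs_continuous_def abs_continuous_on_interval_acont)
  then have "continuous (at x within {0..x+1}) u"
    using x by (auto simp: continuous_on_eq_continuous_within)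
  moreover have "at x within {0..x+1} = at x within {0..}"
    by (rule at_within_nhd[of _ "{..<x+1}"]) (use x in auto)
  ultimately show "continuous (at x within {0..}) u" by simp
qed

section \<open>Algebra of the boundary form and a lemma of Liouville type\<close>

definition Wr :: "complex^2 \<Rightarrow> complex^2 \<Rightarrow> complex" where
  "Wr u v = u $ 1 * v $ 2 - u $ 2 * v $ 1"

lemma Bf_vcnj: "Bf u (vcnj v) = Wr u v"
  by (simp add: Bf_def Wr_def)

lemma vcnj_vcnj [simp]: "vcnj (vcnj v) = v"
  by (simp add: vec2_eq_iff)

lemma Wr_expand: "Wr a b = 1 \<Longrightarrow> y = Wr y b *s a - Wr y a *s b"
proof -
  assume h: "Wr a b = 1"
  have "y = (Wr a b) *s y" by (simp add: h)
  also have "\<dots> = Wr y b *s a - Wr y a *s b"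
    by (simp add: vec2_eq_iff Wr_def algebra_simps)
  finally show ?thesis .
qed

text \<open>The Gram determinant of a and u for the skew-hermitian form \<open>Bf\<close> is the
  squared modulus of their ordinary determinant \<open>Wr a u\<close>.\<close>

lemma Bf_gram: "Bf a a * Bf u u = of_real ((cmod (Wr a u))\<^sup>2) - of_real ((cmod (Bf u a))\<^sup>2)"
  unfolding complex_norm_square by (simp add: Bf_def Wr_def algebra_simps)

lemma Bf_polar: "4 * Bf u v = Bf (u + v) (u + v) - Bf (u + (-1) *s v) (u + (-1) *s v)
   + \<i> * Bf (u + \<i> *s v) (u + \<i> *s v) - \<i> * Bf (u + (-\<i>) *s v) (u + (-\<i>) *s v)"
  by (simp add: Bf_def algebra_simps)

text \<open>On the circle |z| = R the factor z^2 - R^2 has modulus 2 R |Im z|, which cancels the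
  singular bound. The maximum principle then bounds the product by 2 R C, while the factor itself
  grows like R^2.\<close>

lemma entire_inverse_Im_bound_zero:
  assumes hol: "h holomorphic_on UNIV" and "C \<ge> 0"
    and le: "\<And>z. Im z \<noteq> 0 \<Longrightarrow> cmod (h z) \<le> C / \<bar>Im z\<bar>"
  shows "h z0 = 0"
proof (rule ccontr)
  assume n: "h z0 \<noteq> 0"
  define c where "c = cmod (h z0)"
  have c: "c > 0" using n by (simp add: c_def)
  \<comment> \<open>Large enough that |z0| <= R / 2 and c * R > 4 * C. The first gives |z0^2 - R^2|
    >= R^2 / 2, and the resulting c * R <= 4 * C contradicts the second.\<close>
  define R where "R = 2 * cmod z0 + 4 * C / c + 1"
  have R: "R > 0" "R \<ge> 2 * cmod z0" "c * R > 4 * C"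
    using c \<open>C \<ge> 0\<close> unfolding R_def by (auto simp: field_simps add_pos_nonneg intro!: add_nonneg_pos)
  have "cmod ((z0\<^sup>2 - of_real (R\<^sup>2)) * h z0) \<le> 2 * R * C"
  proof (rule maximum_modulus_frontier[of "\<lambda>z. (z\<^sup>2 - of_real (R\<^sup>2)) * h z" "cball 0 R"])
    show "(\<lambda>z. (z\<^sup>2 - of_real (R\<^sup>2)) * h z) holomorphic_on interior (cball 0 R)"
      by (intro holomorphic_intros holomorphic_on_subset[OF hol]) auto
    show "continuous_on (closure (cball 0 R)) (\<lambda>z. (z\<^sup>2 - of_real (R\<^sup>2)) * h z)"
      by (intro continuous_intros continuous_on_subset[OF holomorphic_on_imp_continuous_on[OF hol]]) auto
    show "z0 \<in> cball 0 R" using R norm_ge_zero[of z0] by (simp only: mem_cball dist_0_norm)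
    fix z :: complex assume "z \<in> frontier (cball 0 R)"
    then have z: "cmod z = R" using R by (simp add: frontier_cball dist_norm)
    have "z\<^sup>2 - of_real (R\<^sup>2) = z * (z - cnj z)"
      unfolding z[symmetric] complex_norm_square by (simp add: power2_eq_square algebra_simps)
    also have "z - cnj z = 2 * \<i> * of_real (Im z)" by (simp add: complex_eq_iff)
    finally have e: "cmod (z\<^sup>2 - of_real (R\<^sup>2)) = R * (2 * \<bar>Im z\<bar>)" by (simp add: norm_mult z)
    show "cmod ((z\<^sup>2 - of_real (R\<^sup>2)) * h z) \<le> 2 * R * C"
    proof (cases "Im z = 0")
      case False
      then have "R * (2 * \<bar>Im z\<bar>) * cmod (h z) \<le> R * (2 * \<bar>Im z\<bar>) * (C / \<bar>Im z\<bar>)"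
        using R by (intro mult_left_mono le) auto
      moreover have "R * (2 * \<bar>Im z\<bar>) * (C / \<bar>Im z\<bar>) = 2 * R * C" using False by simp
      ultimately show ?thesis unfolding norm_mult e by simp
    qed (use e R \<open>C \<ge> 0\<close> in \<open>simp add: norm_mult\<close>)
  qed auto
  then have 1: "cmod (z0\<^sup>2 - of_real (R\<^sup>2)) * c \<le> 2 * R * C" by (simp add: norm_mult c_def)
  have "R\<^sup>2 - (cmod z0)\<^sup>2 \<le> cmod (z0\<^sup>2 - of_real (R\<^sup>2))"
    using norm_triangle_ineq3[of "z0\<^sup>2" "of_real (R\<^sup>2)"] R by (simp add: norm_power)
  moreover have "(cmod z0)\<^sup>2 \<le> (R / 2)\<^sup>2" using R by (intro power_mono) auto
  moreover have "(R / 2)\<^sup>2 = R\<^sup>2 / 4" by (simp add: power_divide)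
  ultimately have "R\<^sup>2 / 2 \<le> cmod (z0\<^sup>2 - of_real (R\<^sup>2))"
    using zero_le_power2[of R] by linarith
  then have "R\<^sup>2 / 2 * c \<le> 2 * R * C" using 1 c by (meson less_imp_le mult_right_mono order_trans)
  then have "R * (c * R) \<le> R * (4 * C)" by (simp add: power2_eq_square algebra_simps)
  then show False using R by simp
qed

section \<open>Fundamental solutions\<close>

locale weyl = reg_ham +
  fixes \<Theta> \<Phi> :: "real \<Rightarrow> complex \<Rightarrow> complex^2" and m :: "complex \<Rightarrow> complex"
  assumes Theta: "canonical_solution Ham z (vector [1, 0]) (\<lambda>x. \<Theta> x z)"
    and Phi: "canonical_solution Ham z (vector [0, 1]) (\<lambda>x. \<Phi> x z)"
    and WT: "weyl_titchmarsh Ham \<Theta> \<Phi> m"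
begin

lemma canonical_ode:
  assumes "canonical_solution Ham z v Y"
  shows "ode Y (\<lambda>x. z *s Y x)" "Y 0 = v"
proof -
  have s: "Y 0 = v" "solves_J Y (\<lambda>x. mact (Ham x) (z *s Y x))"
    using assms by (auto simp: canonical_solution_def mact_scale)
  have "hloc Y" using s(2) by (intro hloc_continuous loc_abs_continuous_continuous) (simp add: solves_J_def)
  then show "ode Y (\<lambda>x. z *s Y x)" using s(2) solves_J_iff_ode[OF hloc_scale] by blast
  show "Y 0 = v" by (rule s)
qed

lemma Theta_ode: "ode (\<lambda>x. \<Theta> x z) (\<lambda>x. z *s \<Theta> x z)"
  and Phi_ode: "ode (\<lambda>x. \<Phi> x z) (\<lambda>x. z *s \<Phi> x z)"
  by (rule canonical_ode(1)[OF Theta] canonical_ode(1)[OF Phi])+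

lemma init [simp]: "\<Theta> 0 z $ 1 = 1" "\<Theta> 0 z $ 2 = 0" "\<Phi> 0 z $ 1 = 0" "\<Phi> 0 z $ 2 = 1"
  using canonical_ode(2)[OF Theta] canonical_ode(2)[OF Phi] by simp_all

lemma Theta_hloc: "hloc (\<lambda>x. \<Theta> x z)" and Phi_hloc: "hloc (\<lambda>x. \<Phi> x z)"
  by (rule ode_hloc[OF Theta_ode] ode_hloc[OF Phi_ode])+

lemma hin_add_left:
  assumes "hloc f" "hloc g" "hloc k" "0 \<le> a"
  shows "hin a b (\<lambda>x. f x + g x) k = hin a b f k + hin a b g k"
  unfolding hin_def hq_add using assms by (intro integral_add absolutely_integrable_imp hq_loc_integrable)

lemma hin_scale_left: "hin a b (\<lambda>x. c *s f x) k = c * hin a b f k"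
  unfolding hin_def hq_scale by simp

lemma hin_scale_right: "hin a b k (\<lambda>x. c *s f x) = cnj c * hin a b k f"
  unfolding hin_def hq_scale_right by simp

lemma hin_diff_left:
  assumes "hloc f" "hloc g" "hloc k" "0 \<le> a"
  shows "hin a b (\<lambda>x. f x - g x) k = hin a b f k - hin a b g k"
  using hin_add_left[OF assms(1) hloc_scale[OF assms(2), of "-1"] assms(3,4)] hin_scale_left[of a b "-1" g k] by simp

lemma vcnj_scale: "vcnj (c *s v) = cnj c *s vcnj v"
  by (simp add: vec2_eq_iff)

text \<open>H is real, so the conjugate of v solves the equation with cnj z, and the terms with z
  cancel in Green's identity.\<close>

lemma green_spectral:
  assumes u: "ode u (\<lambda>x. z *s u x + f x)" and f: "hloc f" and v: "ode v (\<lambda>x. z *s v x)" and x: "0 \<le> x"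
  shows "Wr (u x) (v x) = Wr (u 0) (v 0) + hin 0 x f (\<lambda>t. vcnj (v t))"
proof -
  note hu = ode_hloc[OF u] and hv = ode_hloc[OF v]
  have ov: "ode (\<lambda>x. vcnj (v x)) (\<lambda>x. cnj z *s vcnj (v x))"
    using ode_vcnj[OF v] by (simp add: vcnj_scale)
  have "hin 0 x (\<lambda>x. z *s u x + f x) (\<lambda>t. vcnj (v t)) - hin 0 x u (\<lambda>x. cnj z *s vcnj (v x))
     = Bf (u x) (vcnj (v x)) - Bf (u 0) (vcnj (v 0))"
    by (rule green[OF u ov order_refl x]) (intro hloc_add hloc_scale hloc_vcnj hu hv f)+
  moreover have "hin 0 x (\<lambda>x. z *s u x + f x) (\<lambda>t. vcnj (v t)) = z * hin 0 x u (\<lambda>t. vcnj (v t)) + hin 0 x f (\<lambda>t. vcnj (v t))"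
    using hin_add_left[OF hloc_scale[OF hu, of z] f hloc_vcnj[OF hv] order_refl, of x] by (simp add: hin_scale_left)
  ultimately show ?thesis by (simp add: hin_scale_right Bf_vcnj algebra_simps)
qed

lemma hloc_zero: "hloc (\<lambda>x. 0)"
  by (rule hloc_continuous) simp

lemma wronskian: "0 \<le> x \<Longrightarrow> Wr (\<Theta> x z) (\<Phi> x z) = 1"
proof -
  assume x: "0 \<le> x"
  have "ode (\<lambda>x. \<Theta> x z) (\<lambda>x. z *s \<Theta> x z + 0)" using Theta_ode by simp
  from green_spectral[OF this hloc_zero Phi_ode x]
  show ?thesis by (simp add: Wr_def hin_def hq_0)
qed

text \<open>Variation of constants: conjugating Phi and Theta makes the integrals linear in them,
  and \<open>cz z f\<close> is the solution of J u' = H (z u + f) that vanishes at 0.\<close>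

definition cP :: "complex \<Rightarrow> (real \<Rightarrow> complex^2) \<Rightarrow> real \<Rightarrow> complex" where
  "cP z f x = hin 0 x f (\<lambda>t. vcnj (\<Phi> t z))"
definition cQ :: "complex \<Rightarrow> (real \<Rightarrow> complex^2) \<Rightarrow> real \<Rightarrow> complex" where
  "cQ z f x = hin 0 x f (\<lambda>t. vcnj (\<Theta> t z))"
definition cz :: "complex \<Rightarrow> (real \<Rightarrow> complex^2) \<Rightarrow> real \<Rightarrow> complex^2" where
  "cz z f x = cP z f x *s \<Theta> x z - cQ z f x *s \<Phi> x z"

text \<open>Uniqueness for the initial value problem by Wronskians: \<open>Wr\<close> of u with Phi
  and Theta, known from \<open>green_spectral\<close>, are its coordinates in the basis Theta,
  Phi.\<close>

lemma solution_eq: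
  assumes u: "ode u (\<lambda>x. z *s u x + f x)" and f: "hloc f" and x: "0 \<le> x"
  shows "u x = u 0 $ 1 *s \<Theta> x z + u 0 $ 2 *s \<Phi> x z + cz z f x"
proof -
  have "u x = Wr (u x) (\<Phi> x z) *s \<Theta> x z - Wr (u x) (\<Theta> x z) *s \<Phi> x z"
    by (rule Wr_expand[OF wronskian[OF x]])
  also have "Wr (u x) (\<Phi> x z) = u 0 $ 1 + cP z f x"
    using green_spectral[OF u f Phi_ode x] by (simp add: Wr_def cP_def)
  also have "Wr (u x) (\<Theta> x z) = - u 0 $ 2 + cQ z f x"
    using green_spectral[OF u f Theta_ode x] by (simp add: Wr_def cQ_def)
  finally show ?thesis by (simp add: cz_def vec2_eq_iff algebra_simps)
qed

lemma homogeneous_eq: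
  assumes u: "ode u (\<lambda>x. z *s u x)" and x: "0 \<le> x"
  shows "u x = u 0 $ 1 *s \<Theta> x z + u 0 $ 2 *s \<Phi> x z"
proof -
  have "ode u (\<lambda>x. z *s u x + 0)" using u by simp
  from solution_eq[OF this hloc_zero x] show ?thesis
    by (simp add: cz_def cP_def cQ_def hin_def hq_0 vec2_eq_iff)
qed

lemma iprim_integral: "g absolutely_integrable_on {0..b} \<Longrightarrow> iprim 0 b (\<lambda>x. integral {0..x} g) g"
  unfolding iprim_def by simp

lemma cz_ode:
  assumes f: "hloc f"
  shows "ode (cz z f) (\<lambda>x. z *s cz z f x + f x)"
  unfolding ode_def
proof (intro allI conjI)
  fix b
  have P: "iprim 0 b (cP z f) (\<lambda>x. hq x (f x) (vcnj (\<Phi> x z)))"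
    unfolding cP_def hin_def
    by (intro iprim_integral hq_loc_integrable f hloc_vcnj Phi_hloc order_refl)
  have Q: "iprim 0 b (cQ z f) (\<lambda>x. hq x (f x) (vcnj (\<Theta> x z)))"
    unfolding cQ_def hin_def
    by (intro iprim_integral hq_loc_integrable f hloc_vcnj Theta_hloc order_refl)
  note T = ode_iprim[OF Theta_ode order_refl] and F = ode_iprim[OF Phi_ode order_refl]
  have W: "\<Theta> x z $ 1 * \<Phi> x z $ 2 - \<Theta> x z $ 2 * \<Phi> x z $ 1 = 1" if "x \<in> {0..b}" for x
    using wronskian[of x z] that by (simp add: Wr_def)
  have "iprim 0 b (\<lambda>x. cP z f x * \<Theta> x z $ 1 + (-1) * (cQ z f x * \<Phi> x z $ 1))
    (\<lambda>x. (hq x (f x) (vcnj (\<Phi> x z)) * \<Theta> x z $ 1 + cP z f x * mact (Ham x) (z *s \<Theta> x z) $ 2) +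
       (-1) * (hq x (f x) (vcnj (\<Theta> x z)) * \<Phi> x z $ 1 + cQ z f x * mact (Ham x) (z *s \<Phi> x z) $ 2))"
    by (intro iprim_add iprim_cmult iprim_mult P Q T F)
  then show "iprim 0 b (\<lambda>x. cz z f x $ 1) (\<lambda>x. mact (Ham x) (z *s cz z f x + f x) $ 2)"
  proof (rule iprim_cong[OF _ _ negligible_empty])
    fix x assume "x \<in> {0..b} - {}"
    then have w: "\<Theta> x z $ 1 * \<Phi> x z $ 2 = 1 + \<Theta> x z $ 2 * \<Phi> x z $ 1" using W[of x] by (simp add: algebra_simps)
    have "hq x (f x) (vcnj (\<Phi> x z)) * \<Theta> x z $ 1 - hq x (f x) (vcnj (\<Theta> x z)) * \<Phi> x z $ 1 =
      mact (Ham x) (f x) $ 2 * (\<Theta> x z $ 1 * \<Phi> x z $ 2 - \<Theta> x z $ 2 * \<Phi> x z $ 1)"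
      by (simp add: hq_left algebra_simps)
    also have "\<dots> = mact (Ham x) (f x) $ 2" by (simp add: w)
    finally show "(hq x (f x) (vcnj (\<Phi> x z)) * \<Theta> x z $ 1 + cP z f x * mact (Ham x) (z *s \<Theta> x z) $ 2) +
       (-1) * (hq x (f x) (vcnj (\<Theta> x z)) * \<Phi> x z $ 1 + cQ z f x * mact (Ham x) (z *s \<Phi> x z) $ 2) =
       mact (Ham x) (z *s cz z f x + f x) $ 2"
      by (simp add: cz_def mact_add mact_scale mact_diff algebra_simps)
  qed (simp add: cz_def)
  have "iprim 0 b (\<lambda>x. cP z f x * \<Theta> x z $ 2 + (-1) * (cQ z f x * \<Phi> x z $ 2))
    (\<lambda>x. (hq x (f x) (vcnj (\<Phi> x z)) * \<Theta> x z $ 2 + cP z f x * (- mact (Ham x) (z *s \<Theta> x z) $ 1)) +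
       (-1) * (hq x (f x) (vcnj (\<Theta> x z)) * \<Phi> x z $ 2 + cQ z f x * (- mact (Ham x) (z *s \<Phi> x z) $ 1)))"
    by (intro iprim_add iprim_cmult iprim_mult P Q T F)
  then show "iprim 0 b (\<lambda>x. cz z f x $ 2) (\<lambda>x. - mact (Ham x) (z *s cz z f x + f x) $ 1)"
  proof (rule iprim_cong[OF _ _ negligible_empty])
    fix x assume "x \<in> {0..b} - {}"
    then have w: "\<Theta> x z $ 1 * \<Phi> x z $ 2 = 1 + \<Theta> x z $ 2 * \<Phi> x z $ 1" using W[of x] by (simp add: algebra_simps)
    have "hq x (f x) (vcnj (\<Phi> x z)) * \<Theta> x z $ 2 - hq x (f x) (vcnj (\<Theta> x z)) * \<Phi> x z $ 2 =
      - mact (Ham x) (f x) $ 1 * (\<Theta> x z $ 1 * \<Phi> x z $ 2 - \<Theta> x z $ 2 * \<Phi> x z $ 1)"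
      by (simp add: hq_left algebra_simps)
    also have "\<dots> = - mact (Ham x) (f x) $ 1" by (simp add: w)
    finally show "(hq x (f x) (vcnj (\<Phi> x z)) * \<Theta> x z $ 2 + cP z f x * (- mact (Ham x) (z *s \<Theta> x z) $ 1)) +
       (-1) * (hq x (f x) (vcnj (\<Theta> x z)) * \<Phi> x z $ 2 + cQ z f x * (- mact (Ham x) (z *s \<Phi> x z) $ 1)) =
       - mact (Ham x) (z *s cz z f x + f x) $ 1"
      by (simp add: cz_def mact_add mact_scale mact_diff algebra_simps)
  qed (simp add: cz_def)
qed

lemma cz_hloc: "hloc f \<Longrightarrow> hloc (cz z f)"
  by (rule ode_hloc[OF cz_ode])

lemma cz_0 [simp]: "cz z f 0 = 0"
  by (simp add: cz_def cP_def cQ_def hin_def vec2_eq_iff)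

lemma Theta_cnj: "0 \<le> x \<Longrightarrow> vcnj (\<Theta> x z) = \<Theta> x (cnj z)"
  using homogeneous_eq[of "\<lambda>x. vcnj (\<Theta> x z)" "cnj z" x] ode_vcnj[OF Theta_ode[of z]]
  by (simp add: vcnj_scale vec2_eq_iff)

lemma Phi_cnj: "0 \<le> x \<Longrightarrow> vcnj (\<Phi> x z) = \<Phi> x (cnj z)"
  using homogeneous_eq[of "\<lambda>x. vcnj (\<Phi> x z)" "cnj z" x] ode_vcnj[OF Phi_ode[of z]]
  by (simp add: vcnj_scale vec2_eq_iff)

section \<open>Growth bounds and analyticity of the solution operator\<close>

definition n1 :: "complex^2 \<Rightarrow> real" where "n1 u = cmod (u $ 1) + cmod (u $ 2)"

lemma n1_nonneg: "0 \<le> n1 u" by (simp add: n1_def)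

lemma hb_le: "\<bar>hb x\<bar> \<le> 1"
proof -
  have "(hb x)\<^sup>2 \<le> 1 * 1"
    using hdet_nonneg[of x] mult_mono[OF ha_le[of x] hdd_le[of x]] hdd_nonneg[of x] by linarith
  then show ?thesis by (simp add: abs_square_le_1)
qed

lemma mact_n1: "cmod (mact (Ham x) u $ 1) \<le> n1 u" "cmod (mact (Ham x) u $ 2) \<le> n1 u"
proof -
  have m: "\<bar>r\<bar> * c \<le> c" if "\<bar>r\<bar> \<le> 1" "c \<ge> 0" for r c :: real
    using mult_right_mono[OF that] by simp
  have "cmod (of_real r * u $ 1 + of_real s * u $ 2) \<le> n1 u" if "\<bar>r\<bar> \<le> 1" "\<bar>s\<bar> \<le> 1" for r s
    unfolding n1_def using m[OF that(1), of "cmod (u $ 1)"] m[OF that(2), of "cmod (u $ 2)"]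
    by (intro order_trans[OF norm_triangle_ineq] add_mono) (simp_all add: norm_mult)
  then show "cmod (mact (Ham x) u $ 1) \<le> n1 u" "cmod (mact (Ham x) u $ 2) \<le> n1 u"
    unfolding mact_Ham using ha_nonneg[of x] ha_le[of x] hdd_nonneg[of x] hdd_le[of x] hb_le[of x] by simp_all
qed

text \<open>Entries of H are at most 1 in modulus, so each component of u grows at rate at most |z|
  n1(u); the factor 2 in the exponent comes from adding two components.\<close>

lemma solution_bound:
  assumes u: "ode u (\<lambda>x. z *s u x)" and u0: "n1 (u 0) \<le> 1" and x: "0 \<le> x"
  shows "n1 (u x) \<le> exp (2 * cmod z * x)"
proof -
  have c: "continuous_on {0..x} (\<lambda>t. n1 (u t))"
    unfolding n1_def
    by (intro continuous_intros continuous_on_component continuous_on_subset[OF ode_continuous[OF u]]) auto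
  have ni: "(\<lambda>t. n1 (u t)) integrable_on {0..y}" if "y \<in> {0..x}" for y
    by (rule integrable_continuous_real, rule continuous_on_subset[OF c]) (use that in auto)
  have "n1 (u x) \<le> 1 * exp (2 * cmod z * x)"
  proof (rule gronwall[OF c])
    fix y assume y: "y \<in> {0..x}"
    have ii: "(\<lambda>t. mact (Ham t) (z *s u t) $ i) integrable_on {0..y}" for i
      by (intro absolutely_integrable_imp mact_loc_integrable hloc_scale ode_hloc[OF u] order_refl)
    have b: "cmod (integral {0..y} (\<lambda>t. mact (Ham t) (z *s u t) $ i)) \<le> cmod z * integral {0..y} (\<lambda>t. n1 (u t))" for i
    proof -
      have "cmod (integral {0..y} (\<lambda>t. mact (Ham t) (z *s u t) $ i)) \<le> integral {0..y} (\<lambda>t. cmod z * n1 (u t))"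
      proof (rule integral_norm_bound_integral[OF ii])
        show "(\<lambda>t. cmod z * n1 (u t)) integrable_on {0..y}"
          using integrable_on_cmult_left[OF ni[OF y], of "cmod z"] by simp
        show "cmod (mact (Ham t) (z *s u t) $ i) \<le> cmod z * n1 (u t)" for t
          using mact_n1[of t "u t"] exhaust_2[of i] by (auto simp: mact_scale norm_mult intro!: mult_left_mono)
      qed
      then show ?thesis by simp
    qed
    have "u y $ 1 = u 0 $ 1 + integral {0..y} (\<lambda>t. mact (Ham t) (z *s u t) $ 2)"
      by (rule iprim_eq[OF ode_iprim(1)[OF u order_refl, of y]]) (use y in simp)
    then have 1: "cmod (u y $ 1) \<le> cmod (u 0 $ 1) + cmod z * integral {0..y} (\<lambda>t. n1 (u t))"
      using b[of 2] norm_triangle_ineq[of "u 0 $ 1" "integral {0..y} (\<lambda>t. mact (Ham t) (z *s u t) $ 2)"] by simp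
    have "u y $ 2 = u 0 $ 2 + integral {0..y} (\<lambda>t. - mact (Ham t) (z *s u t) $ 1)"
      by (rule iprim_eq[OF ode_iprim(2)[OF u order_refl, of y]]) (use y in simp)
    then have 2: "cmod (u y $ 2) \<le> cmod (u 0 $ 2) + cmod z * integral {0..y} (\<lambda>t. n1 (u t))"
      using b[of 1] norm_triangle_ineq4[of "u 0 $ 2" "integral {0..y} (\<lambda>t. mact (Ham t) (z *s u t) $ 1)"] by simp
    show "n1 (u y) \<le> 1 + 2 * cmod z * integral {0..y} (\<lambda>t. n1 (u t))"
      using 1 2 u0 unfolding n1_def by linarith
  qed (use x in auto)
  then show ?thesis by simp
qed

lemma Theta_bound: "0 \<le> x \<Longrightarrow> n1 (\<Theta> x z) \<le> exp (2 * cmod z * x)"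
  by (rule solution_bound[OF Theta_ode]) (simp_all add: n1_def)

lemma Phi_bound: "0 \<le> x \<Longrightarrow> n1 (\<Phi> x z) \<le> exp (2 * cmod z * x)"
  by (rule solution_bound[OF Phi_ode]) (simp_all add: n1_def)

lemma hs_n1: "hs x u \<le> (n1 u)\<^sup>2"
proof -
  have "0 \<le> 2 * cmod (u $ 1) * cmod (u $ 2)" by simp
  then show ?thesis using hs_le[of x u] unfolding n1_def power2_sum by linarith
qed

lemma hsn_bound:
  assumes "hloc f" "0 \<le> b" "\<And>x. 0 \<le> x \<Longrightarrow> x \<le> b \<Longrightarrow> n1 (f x) \<le> K"
  shows "hsn 0 b f \<le> b * K\<^sup>2"
proof -
  have "hsn 0 b f \<le> integral {0..b} (\<lambda>x. K\<^sup>2)"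
    unfolding hsn_def
  proof (rule integral_le)
    show "(\<lambda>x. hs x (f x)) integrable_on {0..b}"
      by (intro absolutely_integrable_imp hs_loc_integrable assms order_refl)
    show "hs x (f x) \<le> K\<^sup>2" if "x \<in> {0..b}" for x
      using that by (intro order_trans[OF hs_n1] power_mono assms n1_nonneg) auto
  qed (rule integrable_const_ivl)
  then show ?thesis using assms(2) by simp
qed

lemma n1_scale: "n1 (c *s u) = cmod c * n1 u"
  by (simp add: n1_def norm_mult distrib_left)

lemma n1_diff: "n1 (u - v) \<le> n1 u + n1 v"
  unfolding n1_def using norm_triangle_ineq4[of "u $ 1" "v $ 1"] norm_triangle_ineq4[of "u $ 2" "v $ 2"] by simp

lemma n1_vcnj: "n1 (vcnj u) = n1 u" by (simp add: n1_def)

text \<open>A norm bound for f to \<open>cz z f\<close> on [0, b]. Cauchy-Schwarz for the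
  coefficients gives sqrt b * exp (2 |z| b), the solutions give another exp (2 |z| b), the two terms
  a factor 2, and the final integration a second sqrt b.\<close>

definition cbound :: "complex \<Rightarrow> real \<Rightarrow> real" where
  "cbound z b = 2 * b * exp (4 * cmod z * b)"

lemma cPQ_bound:
  assumes f: "hloc f" and x: "0 \<le> x" "x \<le> b"
  shows "cmod (cP z f x) \<le> sqrt (hsn 0 b f) * (sqrt b * exp (2 * cmod z * b))"
    and "cmod (cQ z f x) \<le> sqrt (hsn 0 b f) * (sqrt b * exp (2 * cmod z * b))"
proof -
  have key: "cmod (hin 0 x f (\<lambda>t. vcnj (v t))) \<le> sqrt (hsn 0 b f) * (sqrt b * exp (2 * cmod z * b))"
    if v: "hloc v" "\<And>t. 0 \<le> t \<Longrightarrow> n1 (v t) \<le> exp (2 * cmod z * t)" for v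
  proof -
    have "cmod (hin 0 x f (\<lambda>t. vcnj (v t))) \<le> sqrt (hsn 0 x f) * sqrt (hsn 0 x (\<lambda>t. vcnj (v t)))"
      by (intro hin_cauchy_schwarz order_refl f hloc_vcnj v)
    also have "\<dots> \<le> sqrt (hsn 0 b f) * sqrt (b * (exp (2 * cmod z * b))\<^sup>2)"
    proof (intro mult_mono real_sqrt_le_mono)
      show "hsn 0 x f \<le> hsn 0 b f" using x by (intro hsn_mono f) auto
      have "hsn 0 x (\<lambda>t. vcnj (v t)) \<le> hsn 0 b (\<lambda>t. vcnj (v t))"
        using x by (intro hsn_mono hloc_vcnj v) auto
      also have "\<dots> \<le> b * (exp (2 * cmod z * b))\<^sup>2"
      proof (rule hsn_bound)
        fix t assume t: "0 \<le> t" "t \<le> b"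
        have "n1 (v t) \<le> exp (2 * cmod z * t)" by (rule v(2)[OF t(1)])
        also have "\<dots> \<le> exp (2 * cmod z * b)" using t by (simp add: mult_left_mono)
        finally show "n1 (vcnj (v t)) \<le> exp (2 * cmod z * b)" by (simp add: n1_vcnj)
      qed (use x v hloc_vcnj in auto)
      finally show "hsn 0 x (\<lambda>t. vcnj (v t)) \<le> b * (exp (2 * cmod z * b))\<^sup>2" .
    qed (simp_all add: hsn_nonneg)
    finally show ?thesis by (simp add: real_sqrt_mult)
  qed
  show "cmod (cP z f x) \<le> sqrt (hsn 0 b f) * (sqrt b * exp (2 * cmod z * b))"
    unfolding cP_def by (rule key[OF Phi_hloc Phi_bound])
  show "cmod (cQ z f x) \<le> sqrt (hsn 0 b f) * (sqrt b * exp (2 * cmod z * b))"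
    unfolding cQ_def by (rule key[OF Theta_hloc Theta_bound])
qed

lemma comb_bound:
  assumes x: "0 \<le> x" "x \<le> b" and p: "cmod p \<le> S * (sqrt b * exp (2 * cmod z * b))"
    and q: "cmod q \<le> S * (sqrt b * exp (2 * cmod z * b))" and "0 \<le> S"
  shows "n1 (p *s \<Theta> x z - q *s \<Phi> x z) \<le> 2 * S * sqrt b * exp (4 * cmod z * b)"
proof -
  have e: "exp (2 * cmod z * x) \<le> exp (2 * cmod z * b)" using x by (simp add: mult_left_mono)
  have "n1 (p *s \<Theta> x z - q *s \<Phi> x z) \<le> cmod p * n1 (\<Theta> x z) + cmod q * n1 (\<Phi> x z)"
    using n1_diff[of "p *s \<Theta> x z" "q *s \<Phi> x z"] by (simp add: n1_scale)
  also have "\<dots> \<le> S * (sqrt b * exp (2 * cmod z * b)) * exp (2 * cmod z * b)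
      + S * (sqrt b * exp (2 * cmod z * b)) * exp (2 * cmod z * b)"
    using x \<open>0 \<le> S\<close>
    by (intro add_mono mult_mono p q n1_nonneg order_trans[OF Theta_bound[OF x(1)] e]
        order_trans[OF Phi_bound[OF x(1)] e]) simp_all
  also have "\<dots> = 2 * S * sqrt b * (exp (2 * cmod z * b) * exp (2 * cmod z * b))" by (simp add: algebra_simps)
  also have "exp (2 * cmod z * b) * exp (2 * cmod z * b) = exp (4 * cmod z * b)" by (simp flip: exp_add)
  finally show ?thesis .
qed

lemma hsn_comb_bound:
  assumes "hloc u" "0 \<le> b" "0 \<le> S"
    and "\<And>x. 0 \<le> x \<Longrightarrow> x \<le> b \<Longrightarrow> n1 (u x) \<le> 2 * S * sqrt b * exp (4 * cmod z * b)"
  shows "sqrt (hsn 0 b u) \<le> cbound z b * S"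
proof -
  have "hsn 0 b u \<le> b * (2 * S * sqrt b * exp (4 * cmod z * b))\<^sup>2"
    by (rule hsn_bound) (use assms in auto)
  also have "\<dots> = (cbound z b * S)\<^sup>2"
    using assms(2) by (simp add: cbound_def power_mult_distrib) (simp add: power2_eq_square)
  finally have "sqrt (hsn 0 b u) \<le> sqrt ((cbound z b * S)\<^sup>2)" by (rule real_sqrt_le_mono)
  then show ?thesis using assms(2,3) by (simp add: cbound_def)
qed

lemma cz_bound:
  assumes f: "hloc f" and b: "0 \<le> b"
  shows "sqrt (hsn 0 b (cz z f)) \<le> cbound z b * sqrt (hsn 0 b f)"
proof (rule hsn_comb_bound[OF cz_hloc[OF f] b])
  show "n1 (cz z f x) \<le> 2 * sqrt (hsn 0 b f) * sqrt b * exp (4 * cmod z * b)" if "0 \<le> x" "x \<le> b" for x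
    unfolding cz_def by (rule comb_bound[OF that cPQ_bound(1)[OF f that] cPQ_bound(2)[OF f that]]) (simp add: hsn_nonneg)
qed (simp add: hsn_nonneg)

lemma cz_scale: "cz z (\<lambda>x. c *s f x) x = c *s cz z f x"
  by (simp add: cz_def cP_def cQ_def hin_scale_left vec2_eq_iff algebra_simps)

text \<open>The difference solves the equation for z with right-hand side (z - w)
  \<open>cz w f\<close> and vanishes at 0.\<close>

lemma cz_resolvent:
  assumes f: "hloc f" and x: "0 \<le> x"
  shows "cz z f x - cz w f x = (z - w) *s cz z (cz w f) x"
proof -
  have "ode (\<lambda>x. cz z f x - cz w f x) (\<lambda>x. (z *s cz z f x + f x) - (w *s cz w f x + f x))"
    by (intro ode_diff cz_ode f)
  moreover have "(z *s cz z f x + f x) - (w *s cz w f x + f x) =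
     z *s (cz z f x - cz w f x) + (z - w) *s cz w f x" for x
    by (simp add: vec2_eq_iff algebra_simps)
  ultimately have "ode (\<lambda>x. cz z f x - cz w f x) (\<lambda>x. z *s (cz z f x - cz w f x) + (z - w) *s cz w f x)" by simp
  from solution_eq[OF this hloc_scale[OF cz_hloc[OF f]] x]
  show ?thesis by (simp only: cz_0 diff_self zero_index vector_smult_lzero add_0 cz_scale)
qed

lemma hin_cong:
  assumes "\<And>x. 0 \<le> x \<Longrightarrow> x \<le> b \<Longrightarrow> f x = f' x" "\<And>x. 0 \<le> x \<Longrightarrow> x \<le> b \<Longrightarrow> g x = g' x"
  shows "hin 0 b f g = hin 0 b f' g'"
  unfolding hin_def using assms by (intro integral_cong) auto

lemma hsn_cong:
  assumes "\<And>x. 0 \<le> x \<Longrightarrow> x \<le> b \<Longrightarrow> f x = f' x"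
  shows "hsn 0 b f = hsn 0 b f'"
  unfolding hsn_def using assms by (intro integral_cong) auto

text \<open>The resolvent identity applied twice leaves the remainder (z - w)^2 times a product with
  \<open>cz z k\<close>, which is bounded for z near w.\<close>

lemma cz_holomorphic:
  assumes f: "hloc f" and g: "hloc g" and b: "0 \<le> b"
  shows "(\<lambda>z. hin 0 b (cz z f) g) holomorphic_on UNIV"
proof -
  have "((\<lambda>z. hin 0 b (cz z f) g) has_field_derivative hin 0 b (cz w (cz w f)) g) (at w)" for w
  proof (rule has_field_derivative_quadratic_bound[of 1])
    define k where "k = cz w (cz w f)"
    have k: "hloc k" unfolding k_def by (intro cz_hloc f)
    define M where "M = cbound (of_real (cmod w + 1)) b * sqrt (hsn 0 b k) * sqrt (hsn 0 b g)"
    show "M \<ge> 0" unfolding M_def cbound_def using b by (simp add: hsn_nonneg)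
    fix z assume z: "norm (z - w) < 1"
    have zw: "cmod z \<le> cmod w + 1" using z norm_triangle_ineq2[of z w] by simp
    have "hin 0 b (cz z f) g - hin 0 b (cz w f) g = hin 0 b (\<lambda>x. cz z f x - cz w f x) g"
      by (rule hin_diff_left[symmetric]) (intro cz_hloc f g order_refl)+
    also have "\<dots> = hin 0 b (\<lambda>x. (z - w) *s cz z (cz w f) x) g"
      by (rule hin_cong) (simp_all add: cz_resolvent[OF f])
    also have "\<dots> = (z - w) * hin 0 b (cz z (cz w f)) g" by (rule hin_scale_left)
    finally have 1: "hin 0 b (cz z f) g - hin 0 b (cz w f) g = (z - w) * hin 0 b (cz z (cz w f)) g" .
    have "hin 0 b (cz z (cz w f)) g - hin 0 b k g = hin 0 b (\<lambda>x. cz z (cz w f) x - cz w (cz w f) x) g"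
      unfolding k_def by (rule hin_diff_left[symmetric]) (intro cz_hloc f g order_refl)+
    also have "\<dots> = hin 0 b (\<lambda>x. (z - w) *s cz z k x) g"
      unfolding k_def by (rule hin_cong) (simp_all add: cz_resolvent[OF cz_hloc[OF f]])
    also have "\<dots> = (z - w) * hin 0 b (cz z k) g" by (rule hin_scale_left)
    finally have 2: "hin 0 b (cz z (cz w f)) g - hin 0 b k g = (z - w) * hin 0 b (cz z k) g" .
    have "hin 0 b (cz z f) g - hin 0 b (cz w f) g - (z - w) * hin 0 b k g =
       (z - w) * (hin 0 b (cz z (cz w f)) g - hin 0 b k g)"
      unfolding 1 by (simp add: algebra_simps)
    also have "\<dots> = (z - w)\<^sup>2 * hin 0 b (cz z k) g" unfolding 2 by (simp add: power2_eq_square)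
    finally have e: "norm (hin 0 b (cz z f) g - hin 0 b (cz w f) g - (z - w) * hin 0 b k g) =
       (norm (z - w))\<^sup>2 * cmod (hin 0 b (cz z k) g)" by (simp add: norm_mult norm_power)
    have "cmod (hin 0 b (cz z k) g) \<le> sqrt (hsn 0 b (cz z k)) * sqrt (hsn 0 b g)"
      by (intro hin_cauchy_schwarz cz_hloc k g order_refl)
    also have "\<dots> \<le> cbound z b * sqrt (hsn 0 b k) * sqrt (hsn 0 b g)"
      by (intro mult_right_mono cz_bound k b) (simp add: hsn_nonneg)
    also have "\<dots> \<le> M"
    proof -
      have "cbound z b \<le> cbound (of_real (cmod w + 1)) b"
        unfolding cbound_def using zw b by (intro mult_left_mono) (auto intro!: mult_right_mono)
      then show ?thesis unfolding M_def by (intro mult_right_mono) (auto simp: hsn_nonneg)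
    qed
    finally have "(norm (z - w))\<^sup>2 * cmod (hin 0 b (cz z k) g) \<le> (norm (z - w))\<^sup>2 * M" by (intro mult_left_mono) auto
    then show "norm (hin 0 b (cz z f) g - hin 0 b (cz w f) g - (z - w) * hin 0 b (cz w (cz w f)) g)
        \<le> M * (norm (z - w))\<^sup>2"
      using e by (simp add: k_def mult.commute)
  qed simp
  then show ?thesis
    unfolding holomorphic_on_def field_differentiable_def by (blast intro: has_field_derivative_at_within)
qed

end

section \<open>Weyl solutions and the resolvent\<close>

context weyl
begin

lemma WT_iff: "z \<notin> \<real> \<Longrightarrow> (\<lambda>x. \<Phi> x z - w *s \<Theta> x z) \<in> H_space Ham \<longleftrightarrow> w = m z"
  using WT by (simp add: weyl_titchmarsh_def)

definition psi :: "complex \<Rightarrow> real \<Rightarrow> complex^2" where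
  "psi z x = \<Phi> x z - m z *s \<Theta> x z"

lemma psi_ode: "ode (psi z) (\<lambda>x. z *s psi z x)"
proof -
  have "ode (\<lambda>x. \<Phi> x z - m z *s \<Theta> x z) (\<lambda>x. z *s \<Phi> x z - m z *s (z *s \<Theta> x z))"
    by (intro ode_diff ode_scale Phi_ode Theta_ode)
  moreover have "(\<lambda>x. z *s \<Phi> x z - m z *s (z *s \<Theta> x z)) = (\<lambda>x. z *s (\<Phi> x z - m z *s \<Theta> x z))"
    by (simp add: fun_eq_iff vec2_eq_iff algebra_simps)
  ultimately show ?thesis by (simp only: psi_def[abs_def])
qed

lemma psi_init [simp]: "psi z 0 $ 1 = - m z" "psi z 0 $ 2 = 1"
  by (simp_all add: psi_def)

lemma psi_H: "z \<notin> \<real> \<Longrightarrow> psi z \<in> H_space Ham"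
  using WT_iff[of z "m z"] by (simp add: psi_def[abs_def])

lemma psi_wL2: "z \<notin> \<real> \<Longrightarrow> psi z \<in> weighted_L2 Ham"
  by (rule H_space_D(1)[OF psi_H])

text \<open>Were Theta square integrable, m z + 1 would satisfy the defining condition of m z as
  well.\<close>

lemma Theta_not_wL2: assumes "z \<notin> \<real>" shows "(\<lambda>x. \<Theta> x z) \<notin> weighted_L2 Ham"
proof
  assume "(\<lambda>x. \<Theta> x z) \<in> weighted_L2 Ham"
  then have T: "(\<lambda>x. \<Theta> x z) \<in> H_space Ham" by (rule ode_H_space[OF Theta_ode])
  have "(\<lambda>x. psi z x + (-1) *s \<Theta> x z) \<in> H_space Ham"
    by (intro H_space_add psi_H[OF assms] H_space_scale T)
  moreover have "(\<lambda>x. psi z x + (-1) *s \<Theta> x z) = (\<lambda>x. \<Phi> x z - (m z + 1) *s \<Theta> x z)"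
    by (simp add: fun_eq_iff psi_def vec2_eq_iff algebra_simps)
  ultimately have "m z + 1 = m z" by (simp only: WT_iff[OF assms])
  then show False by simp
qed

definition tA :: "real \<Rightarrow> real" where "tA x = hsn 0 x (\<lambda>t. \<Theta> t \<i>)"

lemma tA_mono: "0 \<le> x \<Longrightarrow> x \<le> y \<Longrightarrow> tA x \<le> tA y"
  unfolding tA_def by (rule hsn_mono[OF Theta_hloc order_refl])

lemma tA_unbounded: "\<exists>b\<ge>0. tA b > C"
proof (rule ccontr)
  assume "\<not> ?thesis"
  then have "hsn 0 b (\<lambda>t. \<Theta> t \<i>) \<le> C" if "b \<ge> 0" for b using that by (force simp: tA_def not_less)
  then have "(\<lambda>t. \<Theta> t \<i>) \<in> weighted_L2 Ham" by (rule wL2_bounded[OF Theta_hloc])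
  then show False using Theta_not_wL2[of \<i>] by (simp add: complex_is_Real_iff)
qed

lemma tA_eventually: "\<forall>\<^sub>F x in at_top. tA x > C"
proof -
  obtain b where b: "b \<ge> 0" "tA b > C" using tA_unbounded by blast
  show ?thesis
    using eventually_ge_at_top[of b] by eventually_elim (use b tA_mono in \<open>force intro: less_le_trans\<close>)
qed

text \<open>The maximal relation: no boundary condition at 0, so that it contains the Weyl
  solutions.\<close>

definition dmax :: "(real \<Rightarrow> complex^2) \<Rightarrow> (real \<Rightarrow> complex^2) \<Rightarrow> bool" where
  "dmax u h \<longleftrightarrow> u \<in> weighted_L2 Ham \<and> h \<in> weighted_L2 Ham \<and> ode u h"

lemma dmax_D: "dmax u h \<Longrightarrow> u \<in> weighted_L2 Ham" "dmax u h \<Longrightarrow> h \<in> weighted_L2 Ham" "dmax u h \<Longrightarrow> ode u h"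
  by (auto simp: dmax_def)

lemma dmax_add: "dmax u h \<Longrightarrow> dmax v k \<Longrightarrow> dmax (\<lambda>x. u x + v x) (\<lambda>x. h x + k x)"
  by (simp add: dmax_def wL2_add ode_add)

lemma dmax_scale: "dmax u h \<Longrightarrow> dmax (\<lambda>x. c *s u x) (\<lambda>x. c *s h x)"
  by (simp add: dmax_def wL2_scale ode_scale)

lemma hsn_tail_le:
  assumes f: "f \<in> weighted_L2 Ham" and "0 \<le> a" "a \<le> b"
  shows "hsn a b f \<le> (hnorm Ham f)\<^sup>2 - hsn 0 a f"
  using hsn_split[of 0 a b f] hsn_le_hnorm[OF f, of b] wL2_hloc[OF f] assms by simp

lemma tail_small:
  assumes f: "f \<in> weighted_L2 Ham" and "\<epsilon> > 0"
  shows "\<forall>\<^sub>F a in at_top. \<forall>b\<ge>a. sqrt (hsn a b f) \<le> \<epsilon>"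
proof -
  have "((\<lambda>a. (hnorm Ham f)\<^sup>2 - hsn 0 a f) \<longlongrightarrow> (hnorm Ham f)\<^sup>2 - (hnorm Ham f)\<^sup>2) at_top"
    by (intro tendsto_intros hsn_tendsto_hnorm f)
  then have "\<forall>\<^sub>F a in at_top. (hnorm Ham f)\<^sup>2 - hsn 0 a f < \<epsilon>\<^sup>2"
    using \<open>\<epsilon> > 0\<close> by (intro order_tendstoD(2)) auto
  then show ?thesis using eventually_ge_at_top[of 0]
  proof eventually_elim
    case (elim a)
    show ?case
    proof (intro allI impI)
      fix b assume "a \<le> b"
      then have "hsn a b f \<le> \<epsilon>\<^sup>2" using hsn_tail_le[OF f, of a b] elim by simp
      then show "sqrt (hsn a b f) \<le> \<epsilon>" using \<open>\<epsilon> > 0\<close> by (intro real_le_lsqrt) (auto simp: hsn_nonneg)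
    qed
  qed
qed

text \<open>The boundary form of $u$ with a solution $a$ outside the space is of smaller order than the square root of
  tA. As the boundary form of $\Theta_{\mathrm{i}}$ with itself is $2 \mathrm{i}$ tA, a determinant identity then makes that of
  $u$ with itself vanish at infinity.\<close>

lemma boundary_small:
  assumes u: "dmax u h" and a: "ode a (\<lambda>x. w *s a x)" and A: "\<And>x. hsn 0 x a = tA x" and "\<epsilon> > 0"
  shows "\<forall>\<^sub>F x in at_top. cmod (Bf (u x) (a x)) \<le> \<epsilon> * sqrt (tA x)"
proof -
  define \<delta> where "\<delta> = \<epsilon> / 3"
  define \<delta>' where "\<delta>' = \<delta> / (cmod w + 1)"
  have pos: "\<delta> > 0" "\<delta>' > 0" using \<open>\<epsilon> > 0\<close> by (auto simp: \<delta>_def \<delta>'_def add_nonneg_pos)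
  note ha = ode_hloc[OF a] and hu = wL2_hloc[OF dmax_D(1)[OF u]] and hh = wL2_hloc[OF dmax_D(2)[OF u]]
  \<comment> \<open>The point x0 is fixed first, so that the tails of u and h beyond it are small.
    The boundary value K at x0 is then a constant, which the growth of tA absorbs.\<close>
  obtain x0 where x0: "x0 \<ge> 0" "\<And>b. b \<ge> x0 \<Longrightarrow> sqrt (hsn x0 b h) \<le> \<delta>" "\<And>b. b \<ge> x0 \<Longrightarrow> sqrt (hsn x0 b u) \<le> \<delta>'"
    using eventually_happens[OF eventually_conj[OF eventually_conj[OF tail_small[OF dmax_D(2)[OF u] pos(1)]
        tail_small[OF dmax_D(1)[OF u] pos(2)]] eventually_ge_at_top[of 0]]] by auto
  define K where "K = cmod (Bf (u x0) (a x0))"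
  show ?thesis
    using eventually_ge_at_top[of x0] tA_eventually[of "(K / \<delta>)\<^sup>2"]
  proof eventually_elim
    case (elim x)
    have sA: "sqrt (hsn x0 x a) \<le> sqrt (tA x)"
      using hsn_split[of 0 x0 x a] x0(1) elim(1) ha hsn_nonneg[of 0 x0 a] A by simp
    have "hin x0 x h a - hin x0 x u (\<lambda>x. w *s a x) = Bf (u x) (a x) - Bf (u x0) (a x0)"
      by (rule green[OF dmax_D(3)[OF u] a x0(1) elim(1) hh hloc_scale[OF ha]])
    then have "Bf (u x) (a x) = Bf (u x0) (a x0) + hin x0 x h a - cnj w * hin x0 x u a"
      by (simp add: hin_scale_right algebra_simps)
    then have "cmod (Bf (u x) (a x)) \<le> K + cmod (hin x0 x h a) + cmod w * cmod (hin x0 x u a)"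
      unfolding K_def
      using norm_triangle_ineq4[of "Bf (u x0) (a x0) + hin x0 x h a" "cnj w * hin x0 x u a"]
        norm_triangle_ineq[of "Bf (u x0) (a x0)" "hin x0 x h a"] by (simp add: norm_mult)
    also have "cmod (hin x0 x h a) \<le> \<delta> * sqrt (tA x)"
      by (rule order_trans[OF hin_cauchy_schwarz[OF x0(1) hh ha] mult_mono[OF x0(2)[OF elim(1)] sA]])
        (use pos in \<open>simp_all add: hsn_nonneg\<close>)
    also have "cmod w * cmod (hin x0 x u a) \<le> \<delta> * sqrt (tA x)"
    proof -
      have "cmod (hin x0 x u a) \<le> \<delta>' * sqrt (tA x)"
        by (rule order_trans[OF hin_cauchy_schwarz[OF x0(1) hu ha] mult_mono[OF x0(3)[OF elim(1)] sA]])
          (use pos in \<open>simp_all add: hsn_nonneg\<close>)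
      then have "cmod w * cmod (hin x0 x u a) \<le> (cmod w + 1) * (\<delta>' * sqrt (tA x))"
        by (intro mult_mono) auto
      moreover have "(cmod w + 1) * \<delta>' = \<delta>" unfolding \<delta>'_def by (simp add: add_nonneg_eq_0_iff)
      ultimately show ?thesis by (simp add: mult.assoc[symmetric])
    qed
    also have "K \<le> \<delta> * sqrt (tA x)"
    proof -
      have "sqrt ((K / \<delta>)\<^sup>2) \<le> sqrt (tA x)" using elim(2) by (intro real_sqrt_le_mono) simp
      then have "K / \<delta> \<le> sqrt (tA x)" using pos by (simp add: K_def)
      then show ?thesis using pos by (simp add: field_simps)
    qed
    finally show ?case by (simp add: \<delta>_def)
  qed
qed

lemma hsn_vcnj: "hsn a b (\<lambda>x. vcnj (f x)) = hsn a b f"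
  by (simp add: hsn_def hs_vcnj)

lemma Bf_Theta_i: "0 \<le> x \<Longrightarrow> Bf (\<Theta> x \<i>) (\<Theta> x \<i>) = 2 * \<i> * of_real (tA x)"
proof -
  assume x: "0 \<le> x"
  have "hin 0 x (\<lambda>t. \<i> *s \<Theta> t \<i>) (\<lambda>t. \<Theta> t \<i>) - hin 0 x (\<lambda>t. \<Theta> t \<i>) (\<lambda>t. \<i> *s \<Theta> t \<i>)
     = Bf (\<Theta> x \<i>) (\<Theta> x \<i>) - Bf (\<Theta> 0 \<i>) (\<Theta> 0 \<i>)"
    by (rule green[OF Theta_ode Theta_ode order_refl x]) (intro hloc_scale Theta_hloc)+
  moreover have "Bf (\<Theta> 0 \<i>) (\<Theta> 0 \<i>) = 0" by (simp add: Bf_def)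
  ultimately show ?thesis
    by (simp add: hin_scale_left hin_scale_right hin_self[OF order_refl Theta_hloc] tA_def mult.assoc)
qed

lemma boundary_vanishes_diag:
  assumes u: "dmax u h"
  shows "((\<lambda>x. Bf (u x) (u x)) \<longlongrightarrow> 0) at_top"
  unfolding tendsto_iff dist_norm
proof (intro allI impI)
  fix e :: real assume "e > 0"
  define \<epsilon> where "\<epsilon> = sqrt (e / 2)"
  have \<epsilon>: "\<epsilon> > 0" "\<epsilon>\<^sup>2 = e / 2" using \<open>e > 0\<close> by (auto simp: \<epsilon>_def)
  \<comment> \<open>The conjugate of Theta has the same tA. It controls \<open>Wr\<close>, the other
    term of the determinant identity.\<close>
  have oc: "ode (\<lambda>x. vcnj (\<Theta> x \<i>)) (\<lambda>x. cnj \<i> *s vcnj (\<Theta> x \<i>))"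
    using ode_vcnj[OF Theta_ode] by (simp only: vcnj_scale)
  have Ac: "hsn 0 x (\<lambda>x. vcnj (\<Theta> x \<i>)) = tA x" for x by (simp only: hsn_vcnj tA_def)
  show "\<forall>\<^sub>F x in at_top. norm (Bf (u x) (u x) - 0) < e"
    using boundary_small[OF u Theta_ode[of \<i>] tA_def[symmetric] \<epsilon>(1)]
      boundary_small[OF u oc Ac \<epsilon>(1)]
      eventually_ge_at_top[of 0] tA_eventually[of 0]
  proof eventually_elim
    case (elim x)
    let ?a = "\<Theta> x \<i>"
    have w: "cmod (Wr ?a (u x)) \<le> \<epsilon> * sqrt (tA x)"
    proof -
      have "Wr ?a (u x) = - Bf (u x) (vcnj ?a)" unfolding Bf_vcnj by (simp add: Wr_def)
      then show ?thesis using elim(2) by simp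
    qed
    have sq: "(\<epsilon> * sqrt (tA x))\<^sup>2 = e / 2 * tA x" using elim(4) by (simp add: power_mult_distrib \<epsilon>(2))
    have 1: "(cmod (Wr ?a (u x)))\<^sup>2 \<le> e / 2 * tA x" unfolding sq[symmetric] using w by (intro power_mono) auto
    have 2: "(cmod (Bf (u x) ?a))\<^sup>2 \<le> e / 2 * tA x" unfolding sq[symmetric] using elim(1) by (intro power_mono) auto
    have "cmod (Bf ?a ?a * Bf (u x) (u x)) = \<bar>(cmod (Wr ?a (u x)))\<^sup>2 - (cmod (Bf (u x) ?a))\<^sup>2\<bar>"
      unfolding Bf_gram by (simp only: norm_of_real flip: of_real_diff)
    then have "2 * tA x * cmod (Bf (u x) (u x)) = \<bar>(cmod (Wr ?a (u x)))\<^sup>2 - (cmod (Bf (u x) ?a))\<^sup>2\<bar>"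
      using elim(4) unfolding Bf_Theta_i[OF elim(3)] by (simp add: norm_mult)
    also have "\<dots> \<le> e / 2 * tA x"
      using 1 2 zero_le_power2[of "cmod (Wr ?a (u x))"] zero_le_power2[of "cmod (Bf (u x) ?a)"] by linarith
    finally have "cmod (Bf (u x) (u x)) \<le> e / 4" using elim(4) by (simp add: field_simps)
    then show ?case using \<open>e > 0\<close> by simp
  qed
qed

theorem boundary_vanishes:
  assumes u: "dmax u h" and v: "dmax v k"
  shows "((\<lambda>x. Bf (u x) (v x)) \<longlongrightarrow> 0) at_top"
proof -
  have b: "((\<lambda>x. Bf (u x + c *s v x) (u x + c *s v x)) \<longlongrightarrow> 0) at_top" for c
    by (rule boundary_vanishes_diag[OF dmax_add[OF u dmax_scale[OF v]]])
  have "((\<lambda>x. (Bf (u x + 1 *s v x) (u x + 1 *s v x) - Bf (u x + (-1) *s v x) (u x + (-1) *s v x)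
     + \<i> * Bf (u x + \<i> *s v x) (u x + \<i> *s v x) - \<i> * Bf (u x + (-\<i>) *s v x) (u x + (-\<i>) *s v x)) / 4)
     \<longlongrightarrow> (0 - 0 + \<i> * 0 - \<i> * 0) / 4) at_top"
    by (intro tendsto_intros b) auto
  moreover have "(Bf (u x + 1 *s v x) (u x + 1 *s v x) - Bf (u x + (-1) *s v x) (u x + (-1) *s v x)
     + \<i> * Bf (u x + \<i> *s v x) (u x + \<i> *s v x) - \<i> * Bf (u x + (-\<i>) *s v x) (u x + (-\<i>) *s v x)) / 4
     = Bf (u x) (v x)" for x
    by (simp only: vector_smult_lid Bf_polar[symmetric]) simp
  ultimately show ?thesis by simp
qed

theorem green_infinity:
  assumes u: "dmax u h" and v: "dmax v k"
  shows "hinner Ham h v - hinner Ham u k = - Bf (u 0) (v 0)"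
proof (rule tendsto_unique)
  show "((\<lambda>b. hin 0 b h v - hin 0 b u k) \<longlongrightarrow> hinner Ham h v - hinner Ham u k) at_top"
    using u v by (intro tendsto_intros hin_tendsto_hinner) (auto simp: dmax_def)
  have "((\<lambda>b. Bf (u b) (v b) - Bf (u 0) (v 0)) \<longlongrightarrow> 0 - Bf (u 0) (v 0)) at_top"
    by (intro tendsto_intros boundary_vanishes[OF u v])
  moreover have "\<forall>\<^sub>F b in at_top. Bf (u b) (v b) - Bf (u 0) (v 0) = hin 0 b h v - hin 0 b u k"
    using eventually_ge_at_top[of 0]
    by eventually_elim (rule green[symmetric, OF dmax_D(3)[OF u] dmax_D(3)[OF v] order_refl _
        wL2_hloc[OF dmax_D(2)[OF u]] wL2_hloc[OF dmax_D(2)[OF v]]])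
  ultimately show "((\<lambda>b. hin 0 b h v - hin 0 b u k) \<longlongrightarrow> - Bf (u 0) (v 0)) at_top"
    by (simp add: tendsto_cong)
qed simp

lemma psi_dmax: "z \<notin> \<real> \<Longrightarrow> dmax (psi z) (\<lambda>x. z *s psi z x)"
  by (simp add: dmax_def psi_wL2 wL2_scale psi_ode)

lemma psi_inner:
  assumes "z \<notin> \<real>" "w \<notin> \<real>"
  shows "(z - cnj w) * hinner Ham (psi z) (psi w) = m z - cnj (m w)"
proof -
  have "hinner Ham (\<lambda>x. z *s psi z x) (psi w) - hinner Ham (psi z) (\<lambda>x. w *s psi w x) = - Bf (psi z 0) (psi w 0)"
    by (rule green_infinity[OF psi_dmax psi_dmax]) (rule assms)+
  then show ?thesis
    using assms by (simp add: HW.ip_scl HW.ip_scl_right psi_wL2 Bf_def algebra_simps)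
qed

section \<open>The resolvent\<close>

lemma hnorm_nonneg: "f \<in> weighted_L2 Ham \<Longrightarrow> 0 \<le> hnorm Ham f"
  using HW.nrm_nonneg by (simp add: HW_nrm)

lemma Im_neq_0: "z \<notin> \<real> \<Longrightarrow> Im z \<noteq> 0"
  by (simp add: complex_is_Real_iff)

text \<open>The boundary form vanishes at 0 and at infinity, so 2 |Im z| |u|^2 is the modulus of <u,
  f> - <f, u>, which is at most 2 |u| |f|.\<close>

theorem resolvent_bound:
  assumes u: "u \<in> weighted_L2 Ham" and f: "f \<in> weighted_L2 Ham"
    and o: "ode u (\<lambda>x. z *s u x + f x)" and u0: "u 0 $ 2 = 0" and z: "z \<notin> \<real>"
  shows "hnorm Ham u \<le> hnorm Ham f / \<bar>Im z\<bar>"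
proof -
  have d: "dmax u (\<lambda>x. z *s u x + f x)" using u f o by (simp add: dmax_def wL2_add wL2_scale)
  have s: "(\<lambda>x. z *s u x) \<in> weighted_L2 Ham" by (rule wL2_scale[OF u])
  have "hinner Ham (\<lambda>x. z *s u x + f x) u - hinner Ham u (\<lambda>x. z *s u x + f x) = - Bf (u 0) (u 0)"
    by (rule green_infinity[OF d d])
  also have "Bf (u 0) (u 0) = 0" using u0 by (simp add: Bf_def)
  also have "hinner Ham (\<lambda>x. z *s u x + f x) u = z * hinner Ham u u + hinner Ham f u"
    using HW.ip_add[OF s f u] HW.ip_scl[OF u u, of z] by simp
  also have "hinner Ham u (\<lambda>x. z *s u x + f x) = cnj z * hinner Ham u u + hinner Ham u f"
    using HW.ip_add_right[OF s f u] HW.ip_scl_right[OF u u, of z] by simp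
  finally have "(z - cnj z) * hinner Ham u u = hinner Ham u f - hinner Ham f u" by (simp add: algebra_simps)
  moreover have "z - cnj z = 2 * \<i> * of_real (Im z)" by (simp add: complex_eq_iff)
  ultimately have "2 * \<i> * of_real (Im z) * hinner Ham u u = hinner Ham u f - hinner Ham f u" by simp
  then have "cmod (2 * \<i> * of_real (Im z) * hinner Ham u u) \<le> cmod (hinner Ham u f) + cmod (hinner Ham f u)"
    using norm_triangle_ineq4[of "hinner Ham u f" "hinner Ham f u"] by simp
  also have "\<dots> \<le> 2 * (hnorm Ham u * hnorm Ham f)"
    using HW.cauchy_schwarz[OF u f] HW.cauchy_schwarz[OF f u] by (simp add: HW_nrm mult.commute)
  also have "hinner Ham u u = of_real ((hnorm Ham u)\<^sup>2)" using HW.ip_self[OF u] by (simp add: HW_nrm)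
  finally have le: "\<bar>Im z\<bar> * (hnorm Ham u)\<^sup>2 \<le> hnorm Ham u * hnorm Ham f" by (simp add: norm_mult norm_power)
  show ?thesis
  proof (cases "hnorm Ham u = 0")
    case True then show ?thesis using hnorm_nonneg[OF f] by simp
  next
    case False
    then have "hnorm Ham u > 0" using hnorm_nonneg[OF u] by simp
    moreover have "hnorm Ham u * (\<bar>Im z\<bar> * hnorm Ham u) \<le> hnorm Ham u * hnorm Ham f"
      using le by (simp add: power2_eq_square mult_ac)
    ultimately have "\<bar>Im z\<bar> * hnorm Ham u \<le> hnorm Ham f" by simp
    then show ?thesis using Im_neq_0[OF z] by (simp add: field_simps)
  qed
qed

lemma cnj_not_Reals: "z \<notin> \<real> \<Longrightarrow> cnj z \<notin> \<real>"
  by (simp add: complex_is_Real_iff)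

text \<open>Because H is real, conjugation carries solutions at z to solutions at cnj z; uniqueness
  of m identifies the coefficient.\<close>

lemma m_cnj:
  assumes z: "z \<notin> \<real>"
  shows "m (cnj z) = cnj (m z)"
proof -
  have e: "vcnj (psi z x) = \<Phi> x (cnj z) - cnj (m z) *s \<Theta> x (cnj z)" if "0 \<le> x" for x
    using Theta_cnj[OF that, of z] Phi_cnj[OF that, of z] by (simp add: psi_def vec2_eq_iff)
  have c: "(\<lambda>x. vcnj (psi z x)) \<in> H_space Ham"
    by (rule ode_H_space[OF ode_vcnj[OF psi_ode] wL2_vcnj[OF psi_wL2[OF z]]])
  have "(\<lambda>x. \<Phi> x (cnj z) - cnj (m z) *s \<Theta> x (cnj z)) \<in> H_space Ham"
  proof (rule H_space_cong[OF c])
    show "(\<lambda>x. \<Phi> x (cnj z) - cnj (m z) *s \<Theta> x (cnj z)) \<in> borel_measurable hline"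
      by (intro hloc_measurable hloc_diff hloc_scale Theta_hloc Phi_hloc)
    show "weighted_eq Ham {0<..} (\<lambda>x. vcnj (psi z x)) (\<lambda>x. \<Phi> x (cnj z) - cnj (m z) *s \<Theta> x (cnj z))"
      unfolding weighted_eq_def by (intro AE_I2) (simp add: e mact_0)
  qed
  then show ?thesis using WT_iff[OF cnj_not_Reals[OF z]] by simp
qed

lemma psi_cnj:
  assumes "z \<notin> \<real>" "0 \<le> x"
  shows "vcnj (psi z x) = psi (cnj z) x"
  using Theta_cnj[OF assms(2), of z] Phi_cnj[OF assms(2), of z] m_cnj[OF assms(1)]
  by (simp add: psi_def vec2_eq_iff)

text \<open>The coefficient is chosen so that for f supported in [0, b] the function
  \<open>rz z f\<close> is a multiple of the Weyl solution beyond b, hence square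
  integrable.\<close>

definition kap :: "complex \<Rightarrow> (real \<Rightarrow> complex^2) \<Rightarrow> complex" where
  "kap z f = hinner Ham f (psi (cnj z))"
definition rz :: "complex \<Rightarrow> (real \<Rightarrow> complex^2) \<Rightarrow> real \<Rightarrow> complex^2" where
  "rz z f x = cz z f x - kap z f *s \<Theta> x z"

lemma rz_init [simp]: "rz z f 0 $ 1 = - kap z f" "rz z f 0 $ 2 = 0"
  by (simp_all add: rz_def)

lemma rz_ode:
  assumes "hloc f"
  shows "ode (rz z f) (\<lambda>x. z *s rz z f x + f x)"
proof -
  have "ode (\<lambda>x. cz z f x - kap z f *s \<Theta> x z) (\<lambda>x. (z *s cz z f x + f x) - kap z f *s (z *s \<Theta> x z))"
    by (intro ode_diff ode_scale cz_ode Theta_ode assms)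
  moreover have "(\<lambda>x. (z *s cz z f x + f x) - kap z f *s (z *s \<Theta> x z)) =
      (\<lambda>x. z *s (cz z f x - kap z f *s \<Theta> x z) + f x)"
    by (simp add: fun_eq_iff vec2_eq_iff algebra_simps)
  ultimately show ?thesis by (simp only: rz_def[abs_def])
qed

lemma rz_hloc: "hloc f \<Longrightarrow> hloc (rz z f)"
  by (rule ode_hloc[OF rz_ode])

lemma hin_psi:
  assumes f: "hloc f" and z: "z \<notin> \<real>"
  shows "hin 0 b f (psi (cnj z)) = cP z f b - m z * cQ z f b"
proof -
  have "hin 0 b f (psi (cnj z)) = integral {0..b} (\<lambda>x. hq x (f x) (vcnj (\<Phi> x z)) - m z * hq x (f x) (vcnj (\<Theta> x z)))"
    unfolding hin_def
  proof (rule integral_cong)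
    fix x assume "x \<in> {0..b}"
    then have "psi (cnj z) x = vcnj (\<Phi> x z) - cnj (m z) *s vcnj (\<Theta> x z)"
      using psi_cnj[OF z, of x] by (simp add: psi_def vec2_eq_iff)
    then show "hq x (f x) (psi (cnj z) x) = hq x (f x) (vcnj (\<Phi> x z)) - m z * hq x (f x) (vcnj (\<Theta> x z))"
      by (simp add: hq_diff_right hq_scale_right)
  qed
  also have "\<dots> = cP z f b - m z * cQ z f b"
    unfolding cP_def cQ_def hin_def
    by (subst integral_diff) (auto intro!: absolutely_integrable_imp hq_loc_integrable f hloc_vcnj Phi_hloc Theta_hloc
        set_integrable_mult_right)
  finally show ?thesis .
qed

lemma rz_compact:
  assumes f: "f \<in> weighted_L2 Ham" and b: "0 \<le> b" and van: "weighted_eq Ham {b<..} f (\<lambda>x. 0)" and z: "z \<notin> \<real>" and x: "b \<le> x"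
  shows "rz z f x = (- cQ z f b) *s psi z x"
proof -
  note hf = wL2_hloc[OF f]
  have P: "cP z f x = cP z f b" "cQ z f x = cQ z f b"
    unfolding cP_def cQ_def by (rule hin_vanishing(1)[OF hf van _ b x], intro hloc_vcnj Phi_hloc Theta_hloc)+
  have k: "kap z f = cP z f b - m z * cQ z f b"
    unfolding kap_def
    using hinner_vanishing_tendsto[OF f van psi_wL2[OF cnj_not_Reals[OF z]] b] hin_psi[OF hf z] by simp
  show ?thesis unfolding rz_def cz_def P psi_def k by (simp add: vec2_eq_iff algebra_simps)
qed

lemma rz_compact_wL2:
  assumes f: "f \<in> weighted_L2 Ham" and b: "0 \<le> b" and van: "weighted_eq Ham {b<..} f (\<lambda>x. 0)" and z: "z \<notin> \<real>"
  shows "rz z f \<in> weighted_L2 Ham"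
proof -
  note hr = rz_hloc[OF wL2_hloc[OF f], of z]
  define g where "g x = trunc b (rz z f) x + ((- cQ z f b) *s psi z x - trunc b (\<lambda>x. (- cQ z f b) *s psi z x) x)" for x
  have g: "g \<in> weighted_L2 Ham"
    unfolding g_def by (intro wL2_add wL2_diff trunc_wL2 hr b wL2_scale psi_wL2 z hloc_scale wL2_hloc)
  have "g = rz z f"
    using rz_compact[OF assms] by (auto simp: g_def trunc_def fun_eq_iff)
  then show ?thesis using g by simp
qed

text \<open>For truncations of f the resolvent bound applies and is uniform. On a fixed [0, b] the
  functions \<open>rz\<close> of f and of a long truncation differ only by the change of
  \<open>kap\<close> times Theta, which tends to 0, so the bound passes to f.\<close>

theorem rz_wL2:
  assumes f: "f \<in> weighted_L2 Ham" and z: "z \<notin> \<real>"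
  shows "rz z f \<in> weighted_L2 Ham" "hnorm Ham (rz z f) \<le> hnorm Ham f / \<bar>Im z\<bar>"
proof -
  note hf = wL2_hloc[OF f]
  define C where "C = hnorm Ham f / \<bar>Im z\<bar>"
  have C0: "C \<ge> 0" using hnorm_nonneg[OF f] by (simp add: C_def)
  define fn where "fn n = trunc (real n) f" for n :: nat
  have fnL: "fn n \<in> weighted_L2 Ham" for n unfolding fn_def by (intro trunc_wL2 hf) simp
  have fnv: "weighted_eq Ham {real n<..} (fn n) (\<lambda>x. 0)" for n
    unfolding weighted_eq_def fn_def by (intro AE_I2) (simp add: trunc_def mact_0)
  have rL: "rz z (fn n) \<in> weighted_L2 Ham" for n
    by (rule rz_compact_wL2[OF fnL _ fnv z]) simp
  have rC: "hnorm Ham (rz z (fn n)) \<le> C" for n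
  proof -
    have "hnorm Ham (rz z (fn n)) \<le> hnorm Ham (fn n) / \<bar>Im z\<bar>"
      by (rule resolvent_bound[OF rL fnL rz_ode[OF wL2_hloc[OF fnL]] rz_init(2) z])
    also have "\<dots> \<le> C"
      unfolding C_def fn_def by (intro divide_right_mono hnorm_trunc_le f) auto
    finally show ?thesis .
  qed
  have klim: "(\<lambda>n. kap z (fn n)) \<longlonglongrightarrow> kap z f"
    unfolding kap_def
  proof (rule HW.ip_tendsto_left[OF fnL f psi_wL2[OF cnj_not_Reals[OF z]]])
    show "(\<lambda>n. HW.nrm (HW.sub (fn n) f)) \<longlonglongrightarrow> 0"
      unfolding HW_nrm HW_sub fn_def by (rule trunc_tendsto[OF f filterlim_real_sequentially]) simp
  qed
  have bound: "sqrt (hsn 0 b (rz z f)) \<le> C" if b: "b \<ge> 0" for b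
  proof -
    define T where "T = sqrt (hsn 0 b (\<lambda>x. \<Theta> x z))"
    have "(\<lambda>n. C + cmod (kap z (fn n) - kap z f) * T) \<longlonglongrightarrow> C + cmod (kap z f - kap z f) * T"
      by (intro tendsto_intros klim)
    moreover have "\<forall>\<^sub>F n in sequentially. sqrt (hsn 0 b (rz z f)) \<le> C + cmod (kap z (fn n) - kap z f) * T"
      using eventually_ge_at_top[of "nat \<lceil>b\<rceil>"]
    proof eventually_elim
      case (elim n)
      then have nb: "b \<le> real n" by linarith
      have eq: "rz z f x = rz z (fn n) x + (kap z (fn n) - kap z f) *s \<Theta> x z" if x: "0 \<le> x" "x \<le> b" for x
      proof -
        have "hin 0 x (fn n) g = hin 0 x f g" for g
          unfolding fn_def using x nb by (intro hin_cong) (auto simp: trunc_def)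
        then have "cz z (fn n) x = cz z f x" by (simp add: cz_def cP_def cQ_def)
        then show ?thesis by (simp add: rz_def vec2_eq_iff algebra_simps)
      qed
      have 1: "hsn 0 b (rz z f) = hsn 0 b (\<lambda>x. rz z (fn n) x + (kap z (fn n) - kap z f) *s \<Theta> x z)"
        by (rule hsn_cong) (rule eq)
      have 2: "sqrt (hsn 0 b (\<lambda>x. rz z (fn n) x + (kap z (fn n) - kap z f) *s \<Theta> x z))
          \<le> sqrt (hsn 0 b (rz z (fn n))) + sqrt (hsn 0 b (\<lambda>x. (kap z (fn n) - kap z f) *s \<Theta> x z))"
        by (intro hsn_triangle order_refl rz_hloc wL2_hloc fnL hloc_scale Theta_hloc)
      have 3: "sqrt (hsn 0 b (\<lambda>x. (kap z (fn n) - kap z f) *s \<Theta> x z)) = cmod (kap z (fn n) - kap z f) * T"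
        unfolding hsn_scale T_def real_sqrt_mult by simp
      have "sqrt (hsn 0 b (rz z (fn n))) \<le> hnorm Ham (rz z (fn n))"
        using hsn_le_hnorm[OF rL, of b n] hnorm_nonneg[OF rL, of n] by (intro real_le_lsqrt)
      then show ?case using 2 rC[of n] unfolding 1 3 by linarith
    qed
    ultimately have "sqrt (hsn 0 b (rz z f)) \<le> C + cmod (kap z f - kap z f) * T"
      by (rule tendsto_lowerbound[OF _ _ sequentially_bot])
    then show ?thesis by simp
  qed
  have "hsn 0 b (rz z f) \<le> C\<^sup>2" if "b \<ge> 0" for b
    by (rule sqrt_le_D[OF bound[OF that]])
  then show L: "rz z f \<in> weighted_L2 Ham" by (rule wL2_bounded[OF rz_hloc[OF hf]])
  show "hnorm Ham (rz z f) \<le> hnorm Ham f / \<bar>Im z\<bar>"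
    by (rule resolvent_bound[OF L f rz_ode[OF hf] rz_init(2) z])
qed

lemma rz_H: "f \<in> weighted_L2 Ham \<Longrightarrow> z \<notin> \<real> \<Longrightarrow> rz z f \<in> H_space Ham"
  by (rule ode_H_space[OF rz_ode[OF wL2_hloc] rz_wL2(1)])

text \<open>After subtracting the multiple of psi with the right lower component at 0, the
  difference is a multiple of Theta; being square integrable, it is zero.\<close>

lemma rz_unique:
  assumes u: "u \<in> weighted_L2 Ham" and f: "f \<in> weighted_L2 Ham" and o: "ode u (\<lambda>x. z *s u x + f x)"
    and z: "z \<notin> \<real>" and x: "0 \<le> x"
  shows "u x = rz z f x + u 0 $ 2 *s psi z x"
proof -
  define d where "d x = (u x - rz z f x) - u 0 $ 2 *s psi z x" for x
  have "ode d (\<lambda>x. ((z *s u x + f x) - (z *s rz z f x + f x)) - u 0 $ 2 *s (z *s psi z x))"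
    unfolding d_def by (intro ode_diff o rz_ode wL2_hloc f ode_scale psi_ode)
  moreover have "((z *s u x + f x) - (z *s rz z f x + f x)) - u 0 $ 2 *s (z *s psi z x) = z *s d x" for x
    by (simp add: d_def vec2_eq_iff algebra_simps)
  ultimately have od: "ode d (\<lambda>x. z *s d x)" by simp
  have d2: "d 0 $ 2 = 0" by (simp add: d_def)
  obtain c where c: "c = d 0 $ 1" by blast
  have dT: "d x = c *s \<Theta> x z" if "0 \<le> x" for x
    using homogeneous_eq[OF od that] d2 unfolding c by (simp add: vec2_eq_iff)
  have dL: "d \<in> weighted_L2 Ham"
    unfolding d_def by (intro wL2_diff u rz_wL2 f z wL2_scale psi_wL2)
  have "c = 0"
  proof (rule ccontr)
    assume n: "c \<noteq> 0"
    have "hsn 0 b (\<lambda>x. \<Theta> x z) \<le> (hnorm Ham (\<lambda>x. (1 / c) *s d x))\<^sup>2" for b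
    proof -
      have "hsn 0 b (\<lambda>x. \<Theta> x z) = hsn 0 b (\<lambda>x. (1 / c) *s d x)"
        using n by (intro hsn_cong) (simp add: dT vec2_eq_iff)
      then show ?thesis using hsn_le_hnorm[OF wL2_scale[OF dL]] by simp
    qed
    then have "(\<lambda>x. \<Theta> x z) \<in> weighted_L2 Ham" by (rule wL2_bounded[OF Theta_hloc])
    then show False using Theta_not_wL2[OF z] by simp
  qed
  then have "d x = 0" using dT[OF x] by (simp add: vec2_eq_iff)
  then show ?thesis by (simp add: d_def vec2_eq_iff algebra_simps)
qed

text \<open>Green's identity with a Weyl solution. This is the counterpart in H of the partial
  fraction formula for \<open>ck\<close>, and identifies the resolvent with multiplication by
  \<open>ck z\<close> later.\<close>

lemma rz_inner:
  assumes f: "f \<in> weighted_L2 Ham" and z: "z \<notin> \<real>" and w: "w \<notin> \<real>"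
  shows "(z - cnj w) * hinner Ham (rz z f) (psi w) = hinner Ham f (psi (cnj z)) - hinner Ham f (psi w)"
proof -
  note r = rz_wL2(1)[OF f z]
  have d: "dmax (rz z f) (\<lambda>x. z *s rz z f x + f x)"
    using f r rz_ode[OF wL2_hloc[OF f]] by (simp add: dmax_def wL2_add wL2_scale)
  have s: "(\<lambda>x. z *s rz z f x) \<in> weighted_L2 Ham" by (rule wL2_scale[OF r])
  have "hinner Ham (\<lambda>x. z *s rz z f x + f x) (psi w) - hinner Ham (rz z f) (\<lambda>x. w *s psi w x) = - Bf (rz z f 0) (psi w 0)"
    by (rule green_infinity[OF d psi_dmax[OF w]])
  also have "hinner Ham (\<lambda>x. z *s rz z f x + f x) (psi w) = z * hinner Ham (rz z f) (psi w) + hinner Ham f (psi w)"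
    using HW.ip_add[OF s f psi_wL2[OF w]] HW.ip_scl[OF r psi_wL2[OF w], of z] by simp
  also have "hinner Ham (rz z f) (\<lambda>x. w *s psi w x) = cnj w * hinner Ham (rz z f) (psi w)"
    using HW.ip_scl_right[OF psi_wL2[OF w] r, of w] by simp
  also have "Bf (rz z f 0) (psi w 0) = - kap z f" by (simp add: Bf_def)
  finally show ?thesis by (simp add: kap_def algebra_simps)
qed

lemma ode_zero:
  assumes o: "ode u h" and u: "\<And>x. 0 \<le> x \<Longrightarrow> u x = 0"
  shows "AE x in hline. mact (Ham x) (h x) = 0"
proof -
  note I = ode_iprim[OF o order_refl]
  let ?B1 = "\<lambda>n::nat. {x \<in> {0<..<real n}. \<not> ((\<lambda>x. u x $ 1) has_vector_derivative mact (Ham x) (h x) $ 2) (at x)}"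
  let ?B2 = "\<lambda>n::nat. {x \<in> {0<..<real n}. \<not> ((\<lambda>x. u x $ 2) has_vector_derivative - mact (Ham x) (h x) $ 1) (at x)}"
  have neg: "negligible ((\<Union>n. ?B1 n) \<union> (\<Union>n. ?B2 n))"
    by (intro negligible_Un negligible_Union_nat iprim_has_vector_derivative I)
  have "{x. \<not> (x \<in> {0<..} \<longrightarrow> mact (Ham x) (h x) = 0)} \<subseteq> (\<Union>n. ?B1 n) \<union> (\<Union>n. ?B2 n)"
  proof
    fix x assume x: "x \<in> {x. \<not> (x \<in> {0<..} \<longrightarrow> mact (Ham x) (h x) = 0)}"
    then have x0: "0 < x" "mact (Ham x) (h x) \<noteq> 0" by auto
    obtain n :: nat where n: "x < real n" using reals_Archimedean2 by blast
    have z: "((\<lambda>x. u x $ i) has_vector_derivative 0) (at x)" for i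
      by (rule has_vector_derivative_transform_within_open[OF has_vector_derivative_const[of 0], of "{0<..}"])
         (use x0 u in auto)
    show "x \<in> (\<Union>n. ?B1 n) \<union> (\<Union>n. ?B2 n)"
    proof (rule ccontr)
      assume "\<not> ?thesis"
      then have "x \<notin> ?B1 n" "x \<notin> ?B2 n" by blast+
      then have "((\<lambda>x. u x $ 1) has_vector_derivative mact (Ham x) (h x) $ 2) (at x)"
        "((\<lambda>x. u x $ 2) has_vector_derivative - mact (Ham x) (h x) $ 1) (at x)"
        using x0 n by auto
      then have "mact (Ham x) (h x) $ 2 = 0" "- mact (Ham x) (h x) $ 1 = 0"
        using z vector_derivative_unique_at by blast+
      then show False using x0(2) by (simp add: vec2_eq_iff)
    qed
  qed
  from negligible_subset[OF neg this]
  have "AE x in lebesgue. x \<in> {0<..} \<longrightarrow> mact (Ham x) (h x) = 0" by (simp only: AE_lebesgue_negligible)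
  then show ?thesis by (simp add: AE_lebesgue_on_iff)
qed

text \<open>If $f$ is orthogonal to all Weyl solutions, the resolvent coincides with the solution operator of the
  initial value problem, which is entire in $z$; the resolvent bound then forces it to vanish.\<close>

theorem psi_total:
  assumes f: "f \<in> H_space Ham" and orth: "\<And>z. z \<notin> \<real> \<Longrightarrow> hinner Ham f (psi z) = 0"
  shows "hnorm Ham f = 0"
proof -
  note fL = H_space_D(1)[OF f] and hf = wL2_hloc[OF H_space_D(1)[OF f]]
  have rc: "rz z f = cz z f" if "z \<notin> \<real>" for z
    using orth[OF cnj_not_Reals[OF that]] by (simp add: rz_def kap_def fun_eq_iff vec2_eq_iff)
  have iR: "\<i> \<notin> \<real>" by (simp add: complex_is_Real_iff)
  define u where "u = cz \<i> f"
  have uL: "u \<in> weighted_L2 Ham" using rz_wL2(1)[OF fL iR] rc[OF iR] by (simp add: u_def)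
  have zero: "hsn 0 b u = 0" if b: "0 \<le> b" for b
  proof -
    note hu = wL2_hloc[OF uL]
    define C where "C = hnorm Ham f * sqrt (hsn 0 b u)"
    \<comment> \<open>Testing against u itself turns the value of the entire function at z = i into
      the squared norm of u on [0, b].\<close>
    have "hin 0 b (cz \<i> f) u = 0"
    proof (rule entire_inverse_Im_bound_zero[OF cz_holomorphic[OF hf hu b]])
      show "C \<ge> 0" unfolding C_def using hnorm_nonneg[OF fL] by (simp add: hsn_nonneg)
      fix z assume "Im z \<noteq> 0"
      then have z: "z \<notin> \<real>" by (simp add: complex_is_Real_iff)
      have cL: "cz z f \<in> weighted_L2 Ham" "hnorm Ham (cz z f) \<le> hnorm Ham f / \<bar>Im z\<bar>"
        using rz_wL2[OF fL z] rc[OF z] by simp_all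
      have "cmod (hin 0 b (cz z f) u) \<le> sqrt (hsn 0 b (cz z f)) * sqrt (hsn 0 b u)"
        by (intro hin_cauchy_schwarz cz_hloc hf hu order_refl)
      also have "\<dots> \<le> (hnorm Ham f / \<bar>Im z\<bar>) * sqrt (hsn 0 b u)"
      proof (rule mult_right_mono)
        have "sqrt (hsn 0 b (cz z f)) \<le> hnorm Ham (cz z f)"
          using hsn_le_hnorm[OF cL(1), of b] hnorm_nonneg[OF cL(1)] by (intro real_le_lsqrt) (auto simp: hsn_nonneg)
        then show "sqrt (hsn 0 b (cz z f)) \<le> hnorm Ham f / \<bar>Im z\<bar>" using cL(2) by simp
      qed (simp add: hsn_nonneg)
      finally show "cmod (hin 0 b (cz z f) u) \<le> C / \<bar>Im z\<bar>" by (simp add: C_def)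
    qed
    then show ?thesis using hin_self[OF order_refl hu, of b] by (simp add: u_def)
  qed
  have "hnorm Ham u \<le> 0" by (rule hnorm_le[OF uL]) (simp_all add: zero)
  then have "hnorm Ham u = 0" using hnorm_nonneg[OF uL] by simp
  then have ker: "AE x in hline. mact (Ham x) (u x) = 0" by (simp add: hnorm_zero_iff[OF uL])
  have o: "ode u (\<lambda>x. \<i> *s u x + f x)" unfolding u_def by (rule cz_ode[OF hf])
  have uH: "u \<in> H_space Ham" by (rule ode_H_space[OF o uL])
  have "u x = 0" if "0 \<le> x" for x
    by (rule kernel_zero[OF o _ _ ker that]) (intro H_space_add H_space_scale uH f, simp add: u_def)
  then have "AE x in hline. mact (Ham x) (\<i> *s u x + f x) = 0" by (rule ode_zero[OF o])
  then have "AE x in hline. mact (Ham x) (f x) = 0"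
    using ker by eventually_elim (simp add: mact_add mact_scale vec2_eq_iff)
  then show ?thesis by (simp add: hnorm_zero_iff[OF fL])
qed

end

section \<open>Cauchy kernels\<close>

definition ck :: "complex \<Rightarrow> real \<Rightarrow> complex" where "ck z t = 1 / (of_real t - z)"

lemma ck_nz: "z \<notin> \<real> \<Longrightarrow> of_real t - z \<noteq> 0"
  by auto

lemma ck_cnj: "cnj (ck z t) = ck (cnj z) t"
  by (simp add: ck_def)

lemma cmod_ck_sq: "(cmod (ck z t))\<^sup>2 = 1 / ((t - Re z)\<^sup>2 + (Im z)\<^sup>2)"
  by (simp add: ck_def norm_divide power_divide cmod_power2)

lemma cmod_ck_le: "z \<notin> \<real> \<Longrightarrow> cmod (ck z t) \<le> 1 / \<bar>Im z\<bar>"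
proof -
  assume z: "z \<notin> \<real>"
  have "\<bar>Im z\<bar> \<le> cmod (of_real t - z)" using abs_Im_le_cmod[of "of_real t - z"] by simp
  then show ?thesis using z by (auto simp: ck_def norm_divide complex_is_Real_iff intro!: divide_left_mono mult_pos_pos)
qed

lemma ck_diff: "z \<notin> \<real> \<Longrightarrow> w \<notin> \<real> \<Longrightarrow> ck z t - ck w t = (z - w) * (ck z t * ck w t)"
  using ck_nz[of z t] ck_nz[of w t] by (simp add: ck_def field_simps)

lemma ck_measurable: "ck z \<in> borel_measurable borel"
  unfolding ck_def by measurable

locale cauchy_measure =
  fixes \<mu> :: "real measure"
  assumes sets_mu: "sets \<mu> = sets borel"
    and int_mu: "Im z > 0 \<Longrightarrow> integrable \<mu> (\<lambda>t. 1 / ((t - Re z)\<^sup>2 + (Im z)\<^sup>2))"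
begin

lemma space_mu: "space \<mu> = UNIV"
  using sets_eq_imp_space_eq[OF sets_mu] by simp

lemma measurable_mu: "f \<in> borel_measurable borel \<Longrightarrow> f \<in> borel_measurable \<mu>"
  using measurable_cong_sets[OF sets_mu refl] by blast

lemma ck_L2: assumes "z \<notin> \<real>" shows "ck z \<in> L2 \<mu>"
proof (rule L2_I)
  show "ck z \<in> borel_measurable \<mu>" by (rule measurable_mu[OF ck_measurable])
  have "Im (Complex (Re z) \<bar>Im z\<bar>) > 0" using assms by (simp add: complex_is_Real_iff)
  from int_mu[OF this] show "integrable \<mu> (\<lambda>t. (cmod (ck z t))\<^sup>2)" by (simp add: cmod_ck_sq)
qed

lemma int_poly: "integrable \<mu> (\<lambda>t. 1 / (1 + t\<^sup>2))"
  using int_mu[of \<i>] by (simp add: add.commute)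

lemma finite_interval: "emeasure \<mu> {-r..r} < \<infinity>"
proof -
  have "integrable \<mu> (\<lambda>t. indicator {-r..r} t :: real)"
  proof (rule Bochner_Integration.integrable_bound)
    show "integrable \<mu> (\<lambda>t. (1 + r\<^sup>2) * (1 / (1 + t\<^sup>2)))" using int_poly by (intro integrable_mult_right)
    show "(\<lambda>t. indicator {-r..r} t :: real) \<in> borel_measurable \<mu>" by (intro measurable_mu) measurable
    have "indicator {-r..r} t \<le> (1 + r\<^sup>2) * (1 / (1 + t\<^sup>2))" for t :: real
    proof (cases "t \<in> {-r..r}")
      case True
      then have "\<bar>t\<bar> \<le> \<bar>r\<bar>" by auto
      then have "t\<^sup>2 \<le> r\<^sup>2" by (simp add: abs_le_square_iff)
      then show ?thesis using True by (simp add: field_simps add_pos_nonneg)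
    qed simp
    then show "AE t in \<mu>. norm (indicator {-r..r} t :: real) \<le> norm ((1 + r\<^sup>2) * (1 / (1 + t\<^sup>2)))"
      by (intro AE_I2) (simp add: abs_of_nonneg)
  qed
  then have "emeasure \<mu> ({-r..r} \<inter> space \<mu>) < \<infinity>"
    using integrable_indicator_iff[of \<mu> "{-r..r}"] by simp
  then show ?thesis by (simp add: space_mu)
qed

lemma sigma_finite_mu: "sigma_finite_measure \<mu>"
proof
  show "\<exists>A. countable A \<and> A \<subseteq> sets \<mu> \<and> \<Union>A = space \<mu> \<and> (\<forall>a\<in>A. emeasure \<mu> a \<noteq> \<infinity>)"
  proof (intro exI[of _ "range (\<lambda>n::nat. {- real n..real n})"] conjI)
    show "\<Union>(range (\<lambda>n::nat. {- real n..real n})) = space \<mu>"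
    proof -
      have "\<exists>n::nat. t \<in> {- real n..real n}" for t :: real
      proof -
        obtain n :: nat where "\<bar>t\<bar> < real n" using reals_Archimedean2 by blast
        then show ?thesis by (intro exI[of _ n]) auto
      qed
      then show ?thesis by (auto simp: space_mu)
    qed
    show "\<forall>a\<in>range (\<lambda>n::nat. {- real n..real n}). emeasure \<mu> a \<noteq> \<infinity>"
      using finite_interval by (auto simp: less_top[symmetric])
  qed (auto simp: sets_mu)
qed

text \<open>pi times the Poisson kernel of the upper half-plane.\<close>

definition pk :: "real \<Rightarrow> real \<Rightarrow> real \<Rightarrow> real" where "pk e t x = e / ((t - x)\<^sup>2 + e\<^sup>2)"

lemma pk_ck: "e > 0 \<Longrightarrow> of_real (pk e t x) = (ck (Complex x e) t - ck (Complex x (-e)) t) / (2 * \<i>)"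
proof -
  assume e: "e > 0"
  have nr: "Complex x e \<notin> \<real>" "Complex x (-e) \<notin> \<real>" using e by (auto simp: complex_is_Real_iff)
  have c: "ck (Complex x (-e)) t = cnj (ck (Complex x e) t)" by (simp add: ck_cnj complex_cnj)
  have d: "Complex x e - Complex x (-e) = 2 * \<i> * of_real e" by (simp add: complex_eq_iff)
  have "ck (Complex x e) t - ck (Complex x (-e)) t = 2 * \<i> * of_real e * (ck (Complex x e) t * cnj (ck (Complex x e) t))"
    using ck_diff[OF nr, of t] unfolding d c .
  also have "ck (Complex x e) t * cnj (ck (Complex x e) t) = of_real (1 / ((t - x)\<^sup>2 + e\<^sup>2))"
    using cmod_ck_sq[of "Complex x e" t] by (simp only: complex_norm_square[symmetric] complex.sel)
  finally have "ck (Complex x e) t - ck (Complex x (-e)) t = of_real (pk e t x) * (2 * \<i>)"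
    by (simp add: pk_def)
  moreover have "2 * \<i> \<noteq> 0" by simp
  ultimately show ?thesis by (metis nonzero_mult_div_cancel_right)
qed

lemma pk_integral:
  assumes "e > 0" "a \<le> b"
  shows "((\<lambda>x. pk e t x) has_integral (arctan ((b - t) / e) - arctan ((a - t) / e))) {a..b}"
proof (rule fundamental_theorem_of_calculus[OF assms(2)])
  fix x assume "x \<in> {a..b}"
  have "((\<lambda>x. arctan ((x - t) / e)) has_real_derivative pk e t x) (at x within {a..b})"
    using assms(1) unfolding pk_def
    by (auto intro!: derivative_eq_intros simp: field_simps power2_eq_square add_pos_nonneg)
  then show "((\<lambda>x. arctan ((x - t) / e)) has_vector_derivative pk e t x) (at x within {a..b})"
    by (simp add: has_real_derivative_iff_has_vector_derivative)
qed

text \<open>A bound by a multiple of 1 / (1 + t^2), uniform for x in a bounded set, as Fubini's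
  theorem requires. It comes from t^2 <= 2 (t - x)^2 + 2 x^2.\<close>

lemma pk_le:
  assumes e: "0 < e" and x: "\<bar>x\<bar> \<le> X"
  shows "pk e t x \<le> e * (2 + (2 * X\<^sup>2 + 1) / e\<^sup>2) * (1 / (1 + t\<^sup>2))"
proof -
  have "0 \<le> (t - 2 * x)\<^sup>2" by simp
  then have "t\<^sup>2 \<le> 2 * (t - x)\<^sup>2 + 2 * x\<^sup>2" by (simp add: power2_eq_square algebra_simps)
  also have "x\<^sup>2 \<le> X\<^sup>2" using x by (simp add: abs_le_square_iff[symmetric])
  finally have "1 + t\<^sup>2 \<le> 2 * (t - x)\<^sup>2 + (2 * X\<^sup>2 + 1)" by simp
  also have "\<dots> \<le> (2 + (2 * X\<^sup>2 + 1) / e\<^sup>2) * ((t - x)\<^sup>2 + e\<^sup>2)"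
  proof -
    have "(2 * X\<^sup>2 + 1) / e\<^sup>2 * ((t - x)\<^sup>2 + e\<^sup>2) = (2 * X\<^sup>2 + 1) / e\<^sup>2 * (t - x)\<^sup>2 + (2 * X\<^sup>2 + 1)"
      using e by (simp add: distrib_left)
    moreover have "0 \<le> (2 * X\<^sup>2 + 1) / e\<^sup>2 * (t - x)\<^sup>2" by (intro mult_nonneg_nonneg divide_nonneg_nonneg) auto
    ultimately show ?thesis by (simp add: distrib_right)
  qed
  finally have h: "1 + t\<^sup>2 \<le> (2 + (2 * X\<^sup>2 + 1) / e\<^sup>2) * ((t - x)\<^sup>2 + e\<^sup>2)" .
  have p: "(t - x)\<^sup>2 + e\<^sup>2 > 0" "1 + t\<^sup>2 > 0" using e by (auto simp: add_nonneg_pos add_pos_nonneg)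
  have "1 / ((t - x)\<^sup>2 + e\<^sup>2) \<le> (2 + (2 * X\<^sup>2 + 1) / e\<^sup>2) * (1 / (1 + t\<^sup>2))"
    using h p by (simp add: field_simps)
  then have "e * (1 / ((t - x)\<^sup>2 + e\<^sup>2)) \<le> e * ((2 + (2 * X\<^sup>2 + 1) / e\<^sup>2) * (1 / (1 + t\<^sup>2)))"
    using e by (intro mult_left_mono) auto
  then show ?thesis by (simp add: pk_def mult.assoc)
qed

lemma L2_weight: assumes "G \<in> L2 \<mu>" shows "integrable \<mu> (\<lambda>t. cmod (G t) * (1 / (1 + t\<^sup>2)))"
proof (rule Bochner_Integration.integrable_bound)
  show "integrable \<mu> (\<lambda>t. (cmod (G t))\<^sup>2 + 1 / (1 + t\<^sup>2))"
    using L2_integrable[OF assms] int_poly by (rule Bochner_Integration.integrable_add)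
  note [measurable] = L2_measurable[OF assms]
  have [measurable]: "(\<lambda>t. 1 / (1 + t\<^sup>2)) \<in> borel_measurable \<mu>" by (rule borel_measurable_integrable[OF int_poly])
  show "(\<lambda>t. cmod (G t) * (1 / (1 + t\<^sup>2))) \<in> borel_measurable \<mu>" by measurable
  have "cmod (G t) * (1 / (1 + t\<^sup>2)) \<le> (cmod (G t))\<^sup>2 + 1 / (1 + t\<^sup>2)" for t
  proof -
    define q where "q = 1 / (1 + t\<^sup>2)"
    have q: "0 \<le> q" "q \<le> 1" by (auto simp: q_def add_pos_nonneg field_simps)
    then have "q\<^sup>2 \<le> q" by (simp add: power2_eq_square mult_left_le)
    moreover have "2 * cmod (G t) * q \<le> (cmod (G t))\<^sup>2 + q\<^sup>2" by (rule sum_squares_bound)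
    moreover have "0 \<le> cmod (G t) * q" using q by simp
    ultimately show ?thesis unfolding q_def[symmetric] by linarith
  qed
  then show "AE t in \<mu>. norm (cmod (G t) * (1 / (1 + t\<^sup>2))) \<le> norm ((cmod (G t))\<^sup>2 + 1 / (1 + t\<^sup>2))"
    by (intro AE_I2) (simp add: abs_of_nonneg add_nonneg_nonneg)
qed

lemma ortho_pk:
  assumes G: "G \<in> L2 \<mu>" and orth: "\<And>z. z \<notin> \<real> \<Longrightarrow> L2_inner \<mu> G (ck z) = 0" and e: "e > 0"
  shows "(LINT t|\<mu>. G t * of_real (pk e t x)) = 0"
proof -
  have nr: "Complex x e \<notin> \<real>" "Complex x (-e) \<notin> \<real>" using e by (auto simp: complex_is_Real_iff)
  have z: "(LINT t|\<mu>. G t * ck z t) = 0" "integrable \<mu> (\<lambda>t. G t * ck z t)" if "z \<notin> \<real>" for z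
    using L2_integrable_mult[OF G ck_L2, of "cnj z"] that orth[of "cnj z"]
    by (simp_all add: L2_inner_def ck_cnj complex_is_Real_iff)
  have "(LINT t|\<mu>. G t * of_real (pk e t x)) =
     (LINT t|\<mu>. (G t * ck (Complex x e) t - G t * ck (Complex x (-e)) t) / (2 * \<i>))"
    by (simp add: pk_ck[OF e] algebra_simps diff_divide_distrib)
  also have "\<dots> = ((LINT t|\<mu>. G t * ck (Complex x e) t) - (LINT t|\<mu>. G t * ck (Complex x (-e)) t)) / (2 * \<i>)"
    using z nr by (subst integral_divide_zero, subst Bochner_Integration.integral_diff) auto
  also have "\<dots> = 0" using z nr by simp
  finally show ?thesis .
qed

text \<open>Integrate \<open>ortho_pk\<close> in x over [a, b] and exchange the integrals; the
  arctangent is the primitive of the Poisson kernel.\<close>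

lemma ortho_arctan:
  assumes G: "G \<in> L2 \<mu>" and orth: "\<And>z. z \<notin> \<real> \<Longrightarrow> L2_inner \<mu> G (ck z) = 0" and e: "e > 0" and ab: "a \<le> b"
  shows "(LINT t|\<mu>. G t * of_real (arctan ((b - t) / e) - arctan ((a - t) / e))) = 0"
proof -
  define N where "N = restrict_space lborel {a..b}"
  have fN: "finite_measure N"
    unfolding N_def by (rule finite_measureI) (simp add: emeasure_restrict_space space_restrict_space emeasure_lborel_Icc_eq)
  interpret N: finite_measure N by (rule fN)
  interpret mu: sigma_finite_measure \<mu> by (rule sigma_finite_mu)
  interpret P: pair_sigma_finite \<mu> N ..
  define X where "X = max \<bar>a\<bar> \<bar>b\<bar>"
  define C where "C = e * (2 + (2 * X\<^sup>2 + 1) / e\<^sup>2)"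
  have spN: "space N = {a..b}" by (simp add: N_def space_restrict_space)
  have mN: "f \<in> borel_measurable borel \<Longrightarrow> f \<in> borel_measurable N" for f :: "real \<Rightarrow> complex"
    unfolding N_def by (rule measurable_restrict_space1) simp
  have pk_nonneg: "0 \<le> pk e t x" for t x using e by (simp add: pk_def)
  have bnd: "pk e t x \<le> C * (1 / (1 + t\<^sup>2))" if "x \<in> {a..b}" for t x
    unfolding C_def by (rule pk_le[OF e]) (use that in \<open>auto simp: X_def\<close>)
  have sets_pair: "sets (\<mu> \<Otimes>\<^sub>M N) = sets (borel \<Otimes>\<^sub>M N)"
    by (intro sets_pair_measure_cong sets_mu refl)
  have idN: "(\<lambda>x. x) \<in> borel_measurable N" unfolding N_def by (rule measurable_restrict_space1) simp
  have m1: "(\<lambda>p. pk e (fst p) (snd p)) \<in> borel_measurable (\<mu> \<Otimes>\<^sub>M N)"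
  proof -
    have [measurable]: "(\<lambda>p. fst p) \<in> borel_measurable (\<mu> \<Otimes>\<^sub>M N)"
      using measurable_fst[of \<mu> N] measurable_cong_sets[OF refl sets_mu] by blast
    have [measurable]: "(\<lambda>p. snd p) \<in> borel_measurable (\<mu> \<Otimes>\<^sub>M N)"
      by (rule measurable_compose[OF measurable_snd idN])
    show ?thesis unfolding pk_def by measurable
  qed
  have mG: "(\<lambda>p. G (fst p)) \<in> borel_measurable (\<mu> \<Otimes>\<^sub>M N)"
    using measurable_compose[OF measurable_fst L2_measurable[OF G]] .
  define f where "f = (\<lambda>t x. G t * complex_of_real (pk e t x))"
  have mf: "case_prod f \<in> borel_measurable (\<mu> \<Otimes>\<^sub>M N)"
    using borel_measurable_times[OF mG measurable_compose[OF m1 borel_measurable_continuous_onI[OF continuous_on_of_real_id]]]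
    by (simp add: f_def case_prod_beta)
  have nf: "norm (f t x) = cmod (G t) * pk e t x" for t x
    using pk_nonneg[of t x] by (simp add: f_def norm_mult)
  have mfx: "f t \<in> borel_measurable N" for t
    using measurable_Pair2[OF mf] space_mu by simp
  have intx: "integrable N (f t)" for t
  proof (rule N.integrable_const_bound[of _ "cmod (G t) * (C * (1 / (1 + t\<^sup>2)))"])
    show "AE x in N. norm (f t x) \<le> cmod (G t) * (C * (1 / (1 + t\<^sup>2)))"
      unfolding nf by (intro AE_I2 mult_left_mono bnd) (auto simp: spN)
  qed (rule mfx)
  have int: "integrable (\<mu> \<Otimes>\<^sub>M N) (case_prod f)"
  proof (rule P.Fubini_integrable[OF mf])
    show "AE t in \<mu>. integrable N (\<lambda>x. case_prod f (t, x))" using intx by simp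
    show "integrable \<mu> (\<lambda>t. LINT x|N. norm (case_prod f (t, x)))"
    proof (rule Bochner_Integration.integrable_bound)
      show "integrable \<mu> (\<lambda>t. measure N (space N) * C * (cmod (G t) * (1 / (1 + t\<^sup>2))))"
        by (intro integrable_mult_right L2_weight G)
      show "(\<lambda>t. LINT x|N. norm (case_prod f (t, x))) \<in> borel_measurable \<mu>"
        using mf by (intro N.borel_measurable_lebesgue_integral) (simp add: case_prod_beta)
      have "(LINT x|N. norm (f t x)) \<le> measure N (space N) * C * (cmod (G t) * (1 / (1 + t\<^sup>2)))" for t
      proof -
        have "(LINT x|N. norm (f t x)) \<le> (LINT x|N. cmod (G t) * (C * (1 / (1 + t\<^sup>2))))"
        proof (rule integral_mono)
          show "norm (f t x) \<le> cmod (G t) * (C * (1 / (1 + t\<^sup>2)))" if "x \<in> space N" for x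
            unfolding nf using that by (intro mult_left_mono bnd) (auto simp: spN)
        qed (use intx in auto)
        then show ?thesis by (simp add: mult_ac)
      qed
      moreover have "0 \<le> (LINT x|N. norm (f t x))" for t by simp
      ultimately have "norm (LINT x|N. norm (f t x)) \<le> norm (measure N (space N) * C * (cmod (G t) * (1 / (1 + t\<^sup>2))))" for t
        using abs_ge_self order_trans unfolding real_norm_def by (metis abs_of_nonneg)
      then show "AE t in \<mu>. norm (LINT x|N. norm (case_prod f (t, x)))
         \<le> norm (measure N (space N) * C * (cmod (G t) * (1 / (1 + t\<^sup>2))))"
        by simp
    qed
  qed
  have ix: "(LINT x|N. f t x) = G t * of_real (arctan ((b - t) / e) - arctan ((a - t) / e))" for t
  proof -
    have c: "continuous_on {a..b} (pk e t)" unfolding pk_def using e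
      by (intro continuous_intros) (auto simp: add_nonneg_eq_0_iff)
    have "(LINT x|N. pk e t x) = set_lebesgue_integral lborel {a..b} (pk e t)"
      unfolding N_def set_lebesgue_integral_def by (subst integral_restrict_space) auto
    also have "\<dots> = integral {a..b} (pk e t)"
      by (rule set_borel_integral_eq_integral(2)[OF borel_integrable_atLeastAtMost'[OF c]])
    also have "\<dots> = arctan ((b - t) / e) - arctan ((a - t) / e)"
      by (rule integral_unique[OF pk_integral[OF e ab]])
    finally show ?thesis unfolding f_def by (simp only: integral_mult_right_zero integral_complex_of_real)
  qed
  have "(LINT t|\<mu>. LINT x|N. f t x) = (LINT x|N. LINT t|\<mu>. f t x)"
    by (rule P.Fubini_integral[OF int, symmetric])
  also have "\<dots> = 0" unfolding f_def by (simp add: ortho_pk[OF G orth e])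
  finally show ?thesis unfolding ix .
qed

text \<open>A majorant independent of e <= 1, for dominated convergence. For |t| <= 2 X the
  difference is at most pi; for larger |t| the interval is far from t and the kernel is at most 8 /
  (1 + t^2).\<close>

lemma arctan_diff_bound:
  assumes e: "0 < e" "e \<le> 1" and ab: "a \<le> b" and X: "\<bar>a\<bar> \<le> X" "\<bar>b\<bar> \<le> X" "1 \<le> X"
  shows "\<bar>arctan ((b - t) / e) - arctan ((a - t) / e)\<bar> \<le> (pi * (1 + 4 * X\<^sup>2) + 8 * (b - a)) * (1 / (1 + t\<^sup>2))"
proof -
  have p: "1 + t\<^sup>2 > 0" by (simp add: add_pos_nonneg)
  have "(a - t) / e \<le> (b - t) / e" using ab e by (simp add: divide_right_mono)
  then have nn: "0 \<le> arctan ((b - t) / e) - arctan ((a - t) / e)" by (simp add: arctan_le_iff)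
  show ?thesis
  proof (cases "\<bar>t\<bar> \<le> 2 * X")
    case True
    then have "t\<^sup>2 \<le> (2 * X)\<^sup>2" using X by (subst abs_le_square_iff[symmetric]) simp
    then have t: "1 + t\<^sup>2 \<le> 1 + 4 * X\<^sup>2" by (simp add: power_mult_distrib)
    have "arctan ((b - t) / e) - arctan ((a - t) / e) \<le> pi"
      using arctan_bounded[of "(b - t) / e"] arctan_bounded[of "(a - t) / e"] by simp
    then have "(arctan ((b - t) / e) - arctan ((a - t) / e)) * (1 + t\<^sup>2) \<le> pi * (1 + t\<^sup>2)"
      using p by (intro mult_right_mono) auto
    also have "\<dots> \<le> pi * (1 + 4 * X\<^sup>2)" by (intro mult_left_mono t) simp
    also have "\<dots> \<le> pi * (1 + 4 * X\<^sup>2) + 8 * (b - a)" using ab by simp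
    finally show ?thesis using nn p by (simp add: field_simps)
  next
    case False
    then have t1: "1 \<le> \<bar>t\<bar>" using X by linarith
    then have t2: "1 \<le> t\<^sup>2" using power_mono[of 1 "\<bar>t\<bar>" 2] by simp
    have "pk e t x \<le> 8 / (1 + t\<^sup>2)" if x: "x \<in> {a..b}" for x
    proof -
      have "\<bar>x\<bar> \<le> X" using x X by auto
      then have "\<bar>t\<bar> / 2 \<le> \<bar>t - x\<bar>" using False by linarith
      then have "(\<bar>t\<bar> / 2)\<^sup>2 \<le> \<bar>t - x\<bar>\<^sup>2" by (intro power_mono) auto
      then have "t\<^sup>2 / 4 \<le> (t - x)\<^sup>2" by (simp add: power_divide)
      then have "1 + t\<^sup>2 \<le> 8 * ((t - x)\<^sup>2 + e\<^sup>2)" using t2 zero_le_power2[of e] by argo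
      moreover have "e * (1 + t\<^sup>2) \<le> 1 * (1 + t\<^sup>2)" using e p by (intro mult_right_mono) auto
      ultimately have "e * (1 + t\<^sup>2) \<le> 8 * ((t - x)\<^sup>2 + e\<^sup>2)" by (metis mult_1 order_trans)
      moreover have "(t - x)\<^sup>2 + e\<^sup>2 > 0" using e by (simp add: add_nonneg_pos)
      ultimately show ?thesis unfolding pk_def using p by (simp add: field_simps)
    qed
    then have "arctan ((b - t) / e) - arctan ((a - t) / e) \<le> measure lborel {a..b} *\<^sub>R (8 / (1 + t\<^sup>2))"
      by (intro has_integral_le[OF pk_integral[OF e(1) ab] has_integral_const_real])
    also have "\<dots> = 8 * (b - a) * (1 / (1 + t\<^sup>2))" using ab by simp
    also have "\<dots> \<le> (pi * (1 + 4 * X\<^sup>2) + 8 * (b - a)) * (1 / (1 + t\<^sup>2))"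
      using p by (intro mult_right_mono) auto
    finally show ?thesis using nn by simp
  qed
qed

lemma L2_set_integrable: assumes "G \<in> L2 \<mu>" and A: "A \<in> sets borel" "A \<subseteq> {-r..r}" shows "set_integrable \<mu> A G"
  unfolding set_integrable_def
proof (rule Bochner_Integration.integrable_bound)
  show "integrable \<mu> (\<lambda>t. (1 + r\<^sup>2) * (cmod (G t) * (1 / (1 + t\<^sup>2))))" by (intro integrable_mult_right L2_weight assms)
  show "(\<lambda>t. indicat_real A t *\<^sub>R G t) \<in> borel_measurable \<mu>"
    using A(1) by (intro borel_measurable_scaleR borel_measurable_indicator L2_measurable[OF assms(1)]) (simp add: sets_mu)
  have "cmod (indicat_real A t *\<^sub>R G t) \<le> (1 + r\<^sup>2) * (cmod (G t) * (1 / (1 + t\<^sup>2)))" for t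
  proof (cases "t \<in> A")
    case True
    then have "t \<in> {-r..r}" using A(2) by blast
    then have "\<bar>t\<bar> \<le> \<bar>r\<bar>" by auto
    then have "t\<^sup>2 \<le> r\<^sup>2" by (simp add: abs_le_square_iff)
    then have "1 \<le> (1 + r\<^sup>2) * (1 / (1 + t\<^sup>2))" by (simp add: field_simps add_pos_nonneg)
    then have "cmod (G t) * 1 \<le> cmod (G t) * ((1 + r\<^sup>2) * (1 / (1 + t\<^sup>2)))" by (intro mult_left_mono) auto
    then show ?thesis using True by (simp add: mult_ac)
  qed (simp add: add_nonneg_nonneg)
  then show "AE t in \<mu>. norm (indicat_real A t *\<^sub>R G t) \<le> norm ((1 + r\<^sup>2) * (cmod (G t) * (1 / (1 + t\<^sup>2))))"
    by (intro AE_I2) (metis abs_ge_self order_trans real_norm_def)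
qed

lemma arctan_at_top: assumes "c > 0"
  shows "(\<lambda>n. arctan (c * (real (Suc n))\<^sup>2 + d * real (Suc n))) \<longlonglongrightarrow> pi / 2"
proof -
  have "filterlim (\<lambda>n. c * (real (Suc n))\<^sup>2 + d * real (Suc n)) at_top sequentially" using assms by real_asymp
  then show ?thesis by (rule filterlim_compose[OF tendsto_arctan_at_top])
qed

text \<open>Stieltjes inversion, with the interval slightly enlarged so that no endpoint terms appear.\<close>

lemma ortho_interval:
  assumes G: "G \<in> L2 \<mu>" and orth: "\<And>z. z \<notin> \<real> \<Longrightarrow> L2_inner \<mu> G (ck z) = 0" and ab: "a \<le> b"
  shows "(LINT t:{a..b}|\<mu>. G t) = 0"
proof -
  \<comment> \<open>The interval is enlarged by 1 / (n + 1) on both sides while the height is e = 1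
    / (n + 1)^2. The quotient of the two tends to infinity, so the limit is pi also at t = a and t =
    b. The enlargement by at most 2 in total explains the 1 in X and the 2 in K.\<close>
  define s where "s n t = G t * complex_of_real (arctan ((b + 1 / real (Suc n) - t) / (1 / (real (Suc n))\<^sup>2))
     - arctan ((a - 1 / real (Suc n) - t) / (1 / (real (Suc n))\<^sup>2)))" for n t
  define X where "X = max \<bar>a\<bar> \<bar>b\<bar> + 1"
  define K where "K = pi * (1 + 4 * X\<^sup>2) + 8 * (b - a + 2)"
  have eq: "(b + 1 / real (Suc n) - t) / (1 / (real (Suc n))\<^sup>2) = (b - t) * (real (Suc n))\<^sup>2 + 1 * real (Suc n)"
    "(a - 1 / real (Suc n) - t) / (1 / (real (Suc n))\<^sup>2) = - ((t - a) * (real (Suc n))\<^sup>2 + 1 * real (Suc n))" for n t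
    by (simp_all add: field_simps power2_eq_square del: of_nat_Suc)
  have lim1: "(\<lambda>n. arctan ((b - t) * (real (Suc n))\<^sup>2 + 1 * real (Suc n))) \<longlonglongrightarrow> (if t \<le> b then pi / 2 else - (pi / 2))" for t b
  proof (cases t b rule: linorder_cases)
    case less then show ?thesis using arctan_at_top[of "b - t" 1] by simp
  next
    case equal
    have "filterlim (\<lambda>n. real (Suc n)) at_top sequentially" by real_asymp
    then have "(\<lambda>n. arctan (real (Suc n))) \<longlonglongrightarrow> pi / 2" by (rule filterlim_compose[OF tendsto_arctan_at_top])
    then show ?thesis using equal by simp
  next
    case greater
    have "(\<lambda>n. - arctan ((t - b) * (real (Suc n))\<^sup>2 + (-1) * real (Suc n))) \<longlonglongrightarrow> - (pi / 2)"
      using arctan_at_top[of "t - b" "-1"] greater by (intro tendsto_minus) auto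
    also have "(\<lambda>n. - arctan ((t - b) * (real (Suc n))\<^sup>2 + (-1) * real (Suc n))) = (\<lambda>n. arctan ((b - t) * (real (Suc n))\<^sup>2 + 1 * real (Suc n)))"
      by (simp add: fun_eq_iff arctan_minus[symmetric] algebra_simps del: of_nat_Suc)
    finally show ?thesis using greater by simp
  qed
  have "(\<lambda>n. LINT t|\<mu>. s n t) \<longlonglongrightarrow> (LINT t|\<mu>. of_real pi * (indicat_real {a..b} t *\<^sub>R G t))"
  proof (rule integral_dominated_convergence[where w = "\<lambda>t. K * (cmod (G t) * (1 / (1 + t\<^sup>2)))"])
    have "(\<lambda>t. complex_of_real (arctan ((b + 1 / real (Suc n) - t) / (1 / (real (Suc n))\<^sup>2))
     - arctan ((a - 1 / real (Suc n) - t) / (1 / (real (Suc n))\<^sup>2)))) \<in> borel_measurable borel" for n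
      by (intro borel_measurable_continuous_onI continuous_intros) auto
    then show "s n \<in> borel_measurable \<mu>" for n
      unfolding s_def[abs_def] by (intro borel_measurable_times L2_measurable[OF G] measurable_mu)
    have "{a..b} \<subseteq> {-X..X}" using X_def by auto
    then have "set_integrable \<mu> {a..b} G" by (intro L2_set_integrable[OF G]) auto
    then show "(\<lambda>t. of_real pi * (indicat_real {a..b} t *\<^sub>R G t)) \<in> borel_measurable \<mu>"
      unfolding set_integrable_def by (intro borel_measurable_times borel_measurable_const borel_measurable_integrable)
    show "integrable \<mu> (\<lambda>t. K * (cmod (G t) * (1 / (1 + t\<^sup>2))))" by (intro integrable_mult_right L2_weight G)
    have "(\<lambda>n. s n t) \<longlonglongrightarrow> of_real pi * (indicat_real {a..b} t *\<^sub>R G t)" for t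
    proof -
      have "(\<lambda>n. s n t) \<longlonglongrightarrow> G t * complex_of_real ((if t \<le> b then pi / 2 else - (pi / 2)) - (- (if a \<le> t then pi / 2 else - (pi / 2))))"
        unfolding s_def eq arctan_minus using lim1[of b t] lim1[of t a] by (intro tendsto_intros) auto
      also have "G t * complex_of_real ((if t \<le> b then pi / 2 else - (pi / 2)) - (- (if a \<le> t then pi / 2 else - (pi / 2))))
         = of_real pi * (indicat_real {a..b} t *\<^sub>R G t)" using ab by auto
      finally show ?thesis .
    qed
    then show "AE t in \<mu>. (\<lambda>n. s n t) \<longlonglongrightarrow> of_real pi * (indicat_real {a..b} t *\<^sub>R G t)" by simp
    have "norm (s n t) \<le> K * (cmod (G t) * (1 / (1 + t\<^sup>2)))" for n t
    proof -
      have n1: "0 < 1 / real (Suc n)" "1 / real (Suc n) \<le> 1" "0 < 1 / (real (Suc n))\<^sup>2" "1 / (real (Suc n))\<^sup>2 \<le> 1"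
        using one_le_power[of "real (Suc n)" 2] by (simp_all add: divide_le_eq_1)
      have "\<bar>arctan ((b + 1 / real (Suc n) - t) / (1 / (real (Suc n))\<^sup>2)) - arctan ((a - 1 / real (Suc n) - t) / (1 / (real (Suc n))\<^sup>2))\<bar>
         \<le> (pi * (1 + 4 * X\<^sup>2) + 8 * ((b + 1 / real (Suc n)) - (a - 1 / real (Suc n)))) * (1 / (1 + t\<^sup>2))"
        using ab n1 unfolding X_def by (intro arctan_diff_bound n1) linarith+
      also have "\<dots> \<le> K * (1 / (1 + t\<^sup>2))" 
      proof (rule mult_right_mono)
        show "pi * (1 + 4 * X\<^sup>2) + 8 * ((b + 1 / real (Suc n)) - (a - 1 / real (Suc n))) \<le> K"
          unfolding K_def using n1(2) by argo
      qed (simp add: add_nonneg_nonneg)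
      finally show ?thesis unfolding s_def norm_mult norm_of_real by (subst mult.left_commute) (intro mult_left_mono, auto)
    qed
    then show "AE t in \<mu>. norm (s n t) \<le> K * (cmod (G t) * (1 / (1 + t\<^sup>2)))" for n by simp
  qed
  moreover have "(LINT t|\<mu>. s n t) = 0" for n
    unfolding s_def
  proof (rule ortho_arctan[OF G orth])
    have "0 \<le> 1 / real (Suc n)" by simp
    then show "a - 1 / real (Suc n) \<le> b + 1 / real (Suc n)" using ab by linarith
  qed auto
  ultimately have "(LINT t|\<mu>. of_real pi * (indicat_real {a..b} t *\<^sub>R G t)) = 0"
    by (simp only: LIMSEQ_const_iff)
  then show ?thesis by (simp add: set_lebesgue_integral_def integral_mult_right_zero del: mult_scaleR_right)
qed

text \<open>G need not be integrable over the line, so the induction over Borel sets takes place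
  inside [-r, r].\<close>

lemma ortho_borel:
  assumes G: "G \<in> L2 \<mu>" and orth: "\<And>z. z \<notin> \<real> \<Longrightarrow> L2_inner \<mu> G (ck z) = 0" and r: "0 \<le> r" and A: "A \<in> sets borel"
  shows "(LINT t:A \<inter> {-r..r}|\<mu>. G t) = 0"
  using A
proof (induction rule: borel_set_induct)
  case empty show ?case by (simp add: set_lebesgue_integral_def)
next
  case (interval a b)
  show ?case
  proof (cases "max a (-r) \<le> min b r")
    case True
    then show ?thesis using ortho_interval[OF G orth True] by (simp add: Int_atLeastAtMost)
  next
    case False
    then have "{a..b} \<inter> {-r..r} = {}" by auto
    then have "(LINT t:{a..b} \<inter> {-r..r}|\<mu>. G t) = (LINT t:{}|\<mu>. G t)" by (rule arg_cong)
    then show ?thesis by (simp add: set_lebesgue_integral_def)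
  qed
next
  case (compl A)
  have "A \<inter> {-r..r} \<union> -A \<inter> {-r..r} = {-r..r}" by auto
  moreover have "(LINT t:(A \<inter> {-r..r} \<union> -A \<inter> {-r..r})|\<mu>. G t) = (LINT t:A \<inter> {-r..r}|\<mu>. G t) + (LINT t:-A \<inter> {-r..r}|\<mu>. G t)"
    using compl(1) by (intro set_integral_Un L2_set_integrable[OF G, of _ r]) auto
  moreover have "(LINT t:{-r..r}|\<mu>. G t) = 0" using r by (intro ortho_interval[OF G orth]) auto
  ultimately show ?case using compl by simp
next
  case (union f)
  have "(LINT t:(\<Union>i. f i \<inter> {-r..r})|\<mu>. G t) = (\<Sum>i. (LINT t:f i \<inter> {-r..r}|\<mu>. G t))"
    using union(1,2) by (intro lebesgue_integral_countable_add L2_set_integrable[OF G, of _ r])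
      (auto simp: sets_mu disjoint_family_on_def)
  then show ?case using union(3) by (simp add: Int_UN_distrib2)
qed

lemma real_zero_AE:
  assumes h: "set_integrable \<mu> B h" and B: "B \<in> sets borel" and mh: "h \<in> borel_measurable \<mu>"
    and z: "\<And>A. A \<in> sets borel \<Longrightarrow> (LINT t:A \<inter> B|\<mu>. h t) = (0::real)"
  shows "AE t in \<mu>. t \<in> B \<longrightarrow> h t \<le> 0"
proof -
  define A where "A = {t. 0 < h t}"
  have "{t \<in> space \<mu>. 0 < h t} \<in> sets \<mu>" using mh by measurable
  then have A: "A \<in> sets borel" by (simp add: A_def space_mu sets_mu)
  have i: "integrable \<mu> (\<lambda>t. indicat_real (A \<inter> B) t * h t)"
    using set_integrable_subset[OF h, of "A \<inter> B"] A B by (simp add: set_integrable_def sets_mu)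
  have "AE t in \<mu>. indicat_real (A \<inter> B) t * h t = 0"
    using integral_nonneg_eq_0_iff_AE[OF i] z[OF A] by (simp add: set_lebesgue_integral_def A_def indicator_def)
  then show ?thesis by eventually_elim (auto simp: A_def indicator_def not_less split: if_splits)
qed

theorem ck_total:
  assumes G: "G \<in> L2 \<mu>" and orth: "\<And>z. z \<notin> \<real> \<Longrightarrow> L2_inner \<mu> G (ck z) = 0"
  shows "AE t in \<mu>. G t = 0"
proof -
  have "AE t in \<mu>. t \<in> {-real n..real n} \<longrightarrow> G t = 0" for n
  proof -
    let ?B = "{-real n..real n}"
    have i: "set_integrable \<mu> ?B G" by (rule L2_set_integrable[OF G _ order_refl]) simp
    have k: "AE t in \<mu>. t \<in> ?B \<longrightarrow> Re (c * G t) \<le> 0" for c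
    proof (rule real_zero_AE)
      have ic: "set_integrable \<mu> A (\<lambda>t. Re (c * G t))" if "A \<in> sets borel" "A \<subseteq> ?B" for A
      proof -
        have "integrable \<mu> (\<lambda>t. c * (indicat_real A t *\<^sub>R G t))"
          using L2_set_integrable[OF G that] unfolding set_integrable_def by (rule integrable_mult_right)
        from integrable_Re[OF this] show ?thesis unfolding set_integrable_def by (simp add: algebra_simps)
      qed
      show "set_integrable \<mu> ?B (\<lambda>t. Re (c * G t))" by (rule ic) auto
      show "(\<lambda>t. Re (c * G t)) \<in> borel_measurable \<mu>" using L2_measurable[OF G] by measurable
      fix A :: "real set" assume A: "A \<in> sets borel"
      have j: "integrable \<mu> (\<lambda>t. c * (indicat_real (A \<inter> ?B) t *\<^sub>R G t))"
        using L2_set_integrable[OF G, of "A \<inter> ?B" "real n"] A unfolding set_integrable_def by (intro integrable_mult_right) auto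
      have "(LINT t|\<mu>. c * (indicat_real (A \<inter> ?B) t *\<^sub>R G t)) = 0"
        using ortho_borel[OF G orth, of "real n" A] A
        by (simp add: set_lebesgue_integral_def integral_mult_right_zero del: mult_scaleR_right)
      then have "(LINT t|\<mu>. Re (c * (indicat_real (A \<inter> ?B) t *\<^sub>R G t))) = 0" using integral_Re[OF j] by simp
      then show "(LINT t:A \<inter> ?B|\<mu>. Re (c * G t)) = 0" unfolding set_lebesgue_integral_def by (simp add: algebra_simps)
    qed simp
    \<comment> \<open>The four constants 1, -1, i, -i force the real and the imaginary part of G to
      vanish.\<close>
    have "AE t in \<mu>. (t \<in> ?B \<longrightarrow> Re (1 * G t) \<le> 0) \<and> (t \<in> ?B \<longrightarrow> Re ((-1) * G t) \<le> 0) \<and>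
       (t \<in> ?B \<longrightarrow> Re (\<i> * G t) \<le> 0) \<and> (t \<in> ?B \<longrightarrow> Re ((-\<i>) * G t) \<le> 0)"
      by (intro AE_conjI k)
    then show ?thesis by eventually_elim (auto simp: complex_eq_iff)
  qed
  then have "AE t in \<mu>. \<forall>n::nat. t \<in> {-real n..real n} \<longrightarrow> G t = 0" by (subst AE_all_countable) blast
  then show ?thesis
  proof eventually_elim
    fix t assume h: "\<forall>n::nat. t \<in> {-real n..real n} \<longrightarrow> G t = 0"
    obtain n :: nat where "\<bar>t\<bar> < real n" using reals_Archimedean2 by blast
    then have "t \<in> {-real n..real n}" by auto
    then show "G t = 0" using h by blast
  qed
qed

end

section \<open>The integral representation of the Weyl function\<close>

locale herg = weyl +
  fixes \<mu> :: "real measure"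
  assumes herg: "herglotz_measure m \<mu>"

sublocale herg \<subseteq> cauchy_measure \<mu>
  using herg unfolding herglotz_measure_def by unfold_locales auto

context herg
begin

definition hc :: real where
  "hc = (SOME c. \<forall>z. Im z > 0 \<longrightarrow>
     Im (m z) = Im z / pi * (LINT t|\<mu>. 1 / ((t - Re z)\<^sup>2 + (Im z)\<^sup>2)) + c * Im z)"

lemma Im_m:
  assumes "Im z > 0"
  shows "Im (m z) = Im z / pi * (LINT t|\<mu>. 1 / ((t - Re z)\<^sup>2 + (Im z)\<^sup>2)) + hc * Im z"
proof -
  have "\<exists>c. \<forall>z. Im z > 0 \<longrightarrow> Im (m z) = Im z / pi * (LINT t|\<mu>. 1 / ((t - Re z)\<^sup>2 + (Im z)\<^sup>2)) + c * Im z"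
    using herg unfolding herglotz_measure_def by blast
  from someI_ex[OF this] show ?thesis using assms unfolding hc_def by blast
qed

definition cI :: "complex \<Rightarrow> complex \<Rightarrow> complex" where
  "cI z v = of_real (1 / pi) * (LINT t|\<mu>. ck z t * ck v t)"

text \<open>The value predicted for m z - m v. The two-point form needs no regularising term in the
  Herglotz formula, as \<open>ck z - ck v\<close> is (z - v) \<open>ck z * ck v\<close>, which is
  integrable.\<close>

definition mL :: "complex \<Rightarrow> complex \<Rightarrow> complex" where
  "mL z v = (z - v) * (of_real hc + cI z v)"

lemma ck_mult_integrable: "z \<notin> \<real> \<Longrightarrow> v \<notin> \<real> \<Longrightarrow> integrable \<mu> (\<lambda>t. ck z t * ck v t)"
  using L2_integrable_mult[OF ck_L2 ck_L2, of z "cnj v"] by (simp add: ck_cnj complex_is_Real_iff)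

lemma cI_inner: "cI z v = of_real (1 / pi) * L2_inner \<mu> (ck z) (ck (cnj v))"
  by (simp add: cI_def L2_inner_def ck_cnj)

lemma cI_commute: "cI z v = cI v z"
  by (simp add: cI_def mult.commute)

lemma cI_cnj: "cI (cnj z) (cnj v) = cnj (cI z v)"
  unfolding cI_def ck_cnj[symmetric] complex_cnj_mult[symmetric] Bochner_Integration.integral_cnj by simp

lemma mL_commute: "mL z v = - mL v z"
  by (simp add: mL_def cI_commute[of z v] algebra_simps)

lemma mL_cnj: "mL (cnj z) (cnj v) = cnj (mL z v)"
  by (simp add: mL_def cI_cnj)

lemma mL_cocycle:
  assumes "z \<notin> \<real>" "w \<notin> \<real>" "v \<notin> \<real>"
  shows "mL z w + mL w v = mL z v"
proof -
  have "(z - w) * (LINT t|\<mu>. ck z t * ck w t) + (w - v) * (LINT t|\<mu>. ck w t * ck v t)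
     = (LINT t|\<mu>. (z - w) * (ck z t * ck w t) + (w - v) * (ck w t * ck v t))"
    using ck_mult_integrable assms by (subst Bochner_Integration.integral_add) auto
  also have "\<dots> = (LINT t|\<mu>. (z - v) * (ck z t * ck v t))"
    using ck_diff[OF assms(1,2), symmetric] ck_diff[OF assms(2,3), symmetric] ck_diff[OF assms(1,3), symmetric] by simp
  finally have "(z - w) * (LINT t|\<mu>. ck z t * ck w t) + (w - v) * (LINT t|\<mu>. ck w t * ck v t) = (z - v) * (LINT t|\<mu>. ck z t * ck v t)"
    by simp
  then have "of_real (1 / pi) * ((z - w) * (LINT t|\<mu>. ck z t * ck w t) + (w - v) * (LINT t|\<mu>. ck w t * ck v t))
      = of_real (1 / pi) * ((z - v) * (LINT t|\<mu>. ck z t * ck v t))" by simp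
  then show ?thesis unfolding mL_def cI_def by (simp only: algebra_simps)
qed

lemma near_Im: assumes "norm (z - w) < \<bar>Im w\<bar> / 2" shows "\<bar>Im w\<bar> / 2 \<le> \<bar>Im z\<bar>" "z \<notin> \<real>"
proof -
  have "\<bar>Im (z - w)\<bar> < \<bar>Im w\<bar> / 2" using abs_Im_le_cmod[of "z - w"] assms by linarith
  then show le: "\<bar>Im w\<bar> / 2 \<le> \<bar>Im z\<bar>" unfolding minus_complex.sel by linarith
  moreover have "0 < \<bar>Im w\<bar>" using assms norm_ge_zero[of "z - w"] by linarith
  ultimately show "z \<notin> \<real>" using le by (auto simp: complex_is_Real_iff)
qed

lemma ck_near: assumes "norm (z - w) < \<bar>Im w\<bar> / 2" shows "cmod (ck z t) \<le> 2 / \<bar>Im w\<bar>"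
proof -
  have "cmod (ck z t) \<le> 1 / \<bar>Im z\<bar>" by (rule cmod_ck_le[OF near_Im(2)[OF assms]])
  also have "\<dots> \<le> 1 / (\<bar>Im w\<bar> / 2)"
    using near_Im(1)[OF assms] assms norm_ge_zero[of "z - w"] by (intro divide_left_mono mult_pos_pos) linarith+
  finally show ?thesis by simp
qed

text \<open>By the cocycle identity the increment from w to z is \<open>mL z w\<close>, independent
  of v, and partial fractions for \<open>ck\<close> make its remainder quadratic.\<close>

lemma mL_deriv:
  assumes w: "w \<notin> \<real>" and v: "v \<notin> \<real>"
  shows "((\<lambda>z. mL z v) has_field_derivative (of_real hc + cI w w)) (at w)"
proof (rule has_field_derivative_quadratic_bound)
  define K where "K = (1 / pi) * (2 / \<bar>Im w\<bar> * (LINT t|\<mu>. (cmod (ck w t))\<^sup>2))"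
  show "0 < \<bar>Im w\<bar> / 2" using Im_neq_0[OF w] by simp
  show "0 \<le> K" unfolding K_def by simp
  fix z assume z: "norm (z - w) < \<bar>Im w\<bar> / 2"
  note nz = near_Im(2)[OF z]
  have pt: "norm (ck z t * (ck w t * ck w t)) \<le> 2 / \<bar>Im w\<bar> * (cmod (ck w t))\<^sup>2" for t
    unfolding norm_mult power2_eq_square by (intro mult_right_mono ck_near[OF z]) simp
  have i: "integrable \<mu> (\<lambda>t. ck z t * (ck w t * ck w t))"
  proof (rule Bochner_Integration.integrable_bound)
    show "integrable \<mu> (\<lambda>t. 2 / \<bar>Im w\<bar> * (cmod (ck w t))\<^sup>2)" by (intro integrable_mult_right L2_integrable ck_L2 w)
    show "(\<lambda>t. ck z t * (ck w t * ck w t)) \<in> borel_measurable \<mu>"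
      by (intro borel_measurable_times measurable_mu ck_measurable)
    show "AE t in \<mu>. norm (ck z t * (ck w t * ck w t)) \<le> norm (2 / \<bar>Im w\<bar> * (cmod (ck w t))\<^sup>2)"
      by (intro AE_I2) (rule order_trans[OF pt], simp)
  qed
  have "cI z w - cI w w = of_real (1 / pi) * (LINT t|\<mu>. ck z t * ck w t - ck w t * ck w t)"
    using ck_mult_integrable[OF nz w] ck_mult_integrable[OF w w]
    by (simp add: cI_def right_diff_distrib Bochner_Integration.integral_diff)
  also have "(\<lambda>t. ck z t * ck w t - ck w t * ck w t) = (\<lambda>t. (z - w) * (ck z t * (ck w t * ck w t)))"
    using ck_diff[OF nz w] by (simp add: fun_eq_iff left_diff_distrib[symmetric])
  finally have eq: "cI z w - cI w w = (z - w) * (of_real (1 / pi) * (LINT t|\<mu>. ck z t * (ck w t * ck w t)))"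
    by simp
  have "norm (LINT t|\<mu>. ck z t * (ck w t * ck w t)) \<le> (LINT t|\<mu>. norm (ck z t * (ck w t * ck w t)))"
    by (rule integral_norm_bound)
  also have "\<dots> \<le> (LINT t|\<mu>. 2 / \<bar>Im w\<bar> * (cmod (ck w t))\<^sup>2)"
    by (intro integral_mono integrable_norm i integrable_mult_right L2_integrable ck_L2 w pt)
  finally have "norm (LINT t|\<mu>. ck z t * (ck w t * ck w t)) \<le> 2 / \<bar>Im w\<bar> * (LINT t|\<mu>. (cmod (ck w t))\<^sup>2)" by simp
  then have le: "norm (of_real (1 / pi) * (LINT t|\<mu>. ck z t * (ck w t * ck w t))) \<le> K"
    unfolding K_def norm_mult norm_of_real by (intro mult_mono) auto
  have "mL z v - mL w v = (z - w) * (of_real hc + cI z w)"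
    using mL_cocycle[OF nz w v] by (simp add: mL_def algebra_simps)
  then have "mL z v - mL w v - (z - w) * (of_real hc + cI w w) = (z - w) * (cI z w - cI w w)"
    by (simp add: algebra_simps)
  then have "norm (mL z v - mL w v - (z - w) * (of_real hc + cI w w)) = (norm (z - w))\<^sup>2 * norm (of_real (1 / pi) * (LINT t|\<mu>. ck z t * (ck w t * ck w t)))"
    unfolding eq by (simp only: norm_mult power2_eq_square mult.assoc)
  also have "\<dots> \<le> (norm (z - w))\<^sup>2 * K" by (intro mult_left_mono le) simp
  finally show "norm (mL z v - mL w v - (z - w) * (of_real hc + cI w w)) \<le> K * (norm (z - w))\<^sup>2"
    by (simp only: mult.commute)
qed

text \<open>Both Weyl solutions have lower component 1 at 0, so their difference satisfies the
  boundary condition and is the resolvent at z applied to (z - w) psi w.\<close>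

lemma psi_diff_bound:
  assumes z: "z \<notin> \<real>" and w: "w \<notin> \<real>"
  shows "hnorm Ham (\<lambda>x. psi z x - psi w x) \<le> cmod (z - w) * hnorm Ham (psi w) / \<bar>Im z\<bar>"
proof -
  have "ode (\<lambda>x. psi z x - psi w x) (\<lambda>x. z *s psi z x - w *s psi w x)" by (intro ode_diff psi_ode)
  moreover have "(\<lambda>x. z *s psi z x - w *s psi w x) = (\<lambda>x. z *s (psi z x - psi w x) + (z - w) *s psi w x)"
    by (simp add: fun_eq_iff vec2_eq_iff algebra_simps)
  ultimately have o: "ode (\<lambda>x. psi z x - psi w x) (\<lambda>x. z *s (psi z x - psi w x) + (z - w) *s psi w x)" by (simp only:)
  have "hnorm Ham (\<lambda>x. psi z x - psi w x) \<le> hnorm Ham (\<lambda>x. (z - w) *s psi w x) / \<bar>Im z\<bar>"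
    by (rule resolvent_bound[OF _ _ o]) (use z w in \<open>simp_all add: wL2_diff wL2_scale psi_wL2\<close>)
  also have "hnorm Ham (\<lambda>x. (z - w) *s psi w x) = cmod (z - w) * hnorm Ham (psi w)"
    using HW.nrm_scl[OF psi_wL2[OF w], of "z - w"] by (simp add: HW_nrm)
  finally show ?thesis .
qed

lemma m_diff: "z \<notin> \<real> \<Longrightarrow> w \<notin> \<real> \<Longrightarrow> m z - m w = (z - w) * hinner Ham (psi z) (psi (cnj w))"
  using psi_inner[of z "cnj w"] m_cnj[of w] cnj_not_Reals[of w] by simp

text \<open>Analyticity of m is derived, not presupposed: its increments are inner products of Weyl
  solutions, and these depend on z in a Lipschitz way.\<close>

lemma m_deriv:
  assumes w: "w \<notin> \<real>"
  shows "(m has_field_derivative hinner Ham (psi w) (psi (cnj w))) (at w)"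
proof (rule has_field_derivative_quadratic_bound)
  define K where "K = 2 * hnorm Ham (psi w) / \<bar>Im w\<bar> * hnorm Ham (psi (cnj w))"
  have w': "cnj w \<notin> \<real>" using w by (rule cnj_not_Reals)
  note pw = psi_H[OF w] psi_H[OF w'] psi_wL2[OF w] psi_wL2[OF w']
  show "0 < \<bar>Im w\<bar> / 2" using Im_neq_0[OF w] by simp
  show "0 \<le> K" unfolding K_def using hnorm_nonneg pw by simp
  fix z assume z: "norm (z - w) < \<bar>Im w\<bar> / 2"
  note nz = near_Im(2)[OF z]
  have "m z - m w - (z - w) * hinner Ham (psi w) (psi (cnj w)) = (z - w) * hinner Ham (\<lambda>x. psi z x - psi w x) (psi (cnj w))"
    using m_diff[OF nz w] HH.ip_sub[OF psi_H[OF nz] pw(1,2)] by (simp only: HH_sub right_diff_distrib)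
  then have "norm (m z - m w - (z - w) * hinner Ham (psi w) (psi (cnj w))) = cmod (z - w) * cmod (hinner Ham (\<lambda>x. psi z x - psi w x) (psi (cnj w)))"
    by (simp only: norm_mult)
  also have "\<dots> \<le> cmod (z - w) * (cmod (z - w) * K)"
  proof (rule mult_left_mono)
    have "cmod (hinner Ham (\<lambda>x. psi z x - psi w x) (psi (cnj w))) \<le> hnorm Ham (\<lambda>x. psi z x - psi w x) * hnorm Ham (psi (cnj w))"
      using HH.cauchy_schwarz[OF H_space_diff[OF psi_H[OF nz] pw(1)] pw(2)] by (simp only: HH_nrm)
    also have "\<dots> \<le> (cmod (z - w) * hnorm Ham (psi w) / \<bar>Im z\<bar>) * hnorm Ham (psi (cnj w))"
      by (intro mult_right_mono psi_diff_bound nz w hnorm_nonneg pw)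
    also have "\<dots> \<le> (cmod (z - w) * hnorm Ham (psi w) / (\<bar>Im w\<bar> / 2)) * hnorm Ham (psi (cnj w))"
      using near_Im(1)[OF z] Im_neq_0[OF w] Im_neq_0[OF nz]
      by (intro mult_right_mono divide_left_mono mult_nonneg_nonneg hnorm_nonneg pw mult_pos_pos) auto
    finally show "cmod (hinner Ham (\<lambda>x. psi z x - psi w x) (psi (cnj w))) \<le> cmod (z - w) * K"
      by (simp add: K_def mult_ac)
  qed simp
  finally show "norm (m z - m w - (z - w) * hinner Ham (psi w) (psi (cnj w))) \<le> K * (norm (z - w))\<^sup>2"
    by (simp add: power2_eq_square mult_ac)
qed

lemma i_not_Reals: "\<i> \<notin> \<real>"
  by (simp add: complex_is_Real_iff)

definition mG :: "complex \<Rightarrow> complex" where "mG z = m z - mL z \<i>"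

lemma mG_deriv:
  "w \<notin> \<real> \<Longrightarrow> (mG has_field_derivative (hinner Ham (psi w) (psi (cnj w)) - (of_real hc + cI w w))) (at w)"
  unfolding mG_def[abs_def] by (intro DERIV_diff m_deriv mL_deriv i_not_Reals)

lemma mL_diag: assumes "Im z > 0" shows "mL z (cnj z) = m z - m (cnj z)"
proof -
  have nz: "z \<notin> \<real>" using assms by (auto simp: complex_is_Real_iff)
  have "(LINT t|\<mu>. ck z t * ck (cnj z) t) = of_real (LINT t|\<mu>. (cmod (ck z t))\<^sup>2)"
    by (simp add: ck_cnj[symmetric] complex_norm_square[symmetric] integral_complex_of_real[symmetric] del: integral_complex_of_real)
  then have "mL z (cnj z) = 2 * \<i> * of_real (Im z * (hc + 1 / pi * (LINT t|\<mu>. 1 / ((t - Re z)\<^sup>2 + (Im z)\<^sup>2))))"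
    unfolding mL_def cI_def by (simp add: cmod_ck_sq complex_eq_iff)
  also have "\<dots> = 2 * \<i> * of_real (Im (m z))" using Im_m[OF assms] by (simp add: algebra_simps)
  also have "\<dots> = m z - m (cnj z)" using m_cnj[OF nz] by (simp add: complex_eq_iff)
  finally show ?thesis .
qed

text \<open>The imaginary parts of $m$ and of its integral representation agree up to a constant, so the
  difference is not open and hence constant.\<close>

lemma mG_upper: assumes z: "Im z > 0" shows "mG z = mG \<i>"
proof -
  let ?S = "{z. Im z > 0}"
  have nr: "z \<notin> \<real>" if "Im z > 0" for z using that by (auto simp: complex_is_Real_iff)
  have oS: "open ?S" by (rule open_halfspace_Im_gt)
  have hol: "mG holomorphic_on ?S"
    unfolding holomorphic_on_open[OF oS] using mG_deriv nr by blast
  have Im: "Im (mG z) = Im (m \<i>)" if z: "Im z > 0" for z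
  proof -
    have nz: "z \<notin> \<real>" "cnj z \<notin> \<real>" "- \<i> \<notin> \<real>" using nr[OF z] cnj_not_Reals by (auto simp: complex_is_Real_iff)
    \<comment> \<open>The integral representation speaks about the diagonal value
      \<open>mL z (cnj z)\<close> only. The cocycle identity moves from the base point i to this
      diagonal.\<close>
    have "mL z \<i> - cnj (mL z \<i>) = mL z \<i> - mL (cnj z) (- \<i>)" using mL_cnj[of z \<i>] by simp
    also have "\<dots> = mL z \<i> - (mL (cnj z) \<i> + mL \<i> (- \<i>))" using mL_cocycle[OF nz(2) i_not_Reals nz(3)] by simp
    also have "\<dots> = (mL z \<i> + mL \<i> (cnj z)) - mL \<i> (cnj \<i>)" using mL_commute[of "cnj z" \<i>] by simp
    also have "\<dots> = (m z - m (cnj z)) - (m \<i> - m (cnj \<i>))"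
      using mL_cocycle[OF nz(1) i_not_Reals nz(2)] mL_diag[OF z] mL_diag[of \<i>] by simp
    also have "\<dots> = (m z - cnj (m z)) - (m \<i> - cnj (m \<i>))" using m_cnj[OF nz(1)] m_cnj[OF i_not_Reals] by simp
    finally have "Im (mL z \<i> - cnj (mL z \<i>)) = Im ((m z - cnj (m z)) - (m \<i> - cnj (m \<i>)))" by (rule arg_cong)
    then show ?thesis by (simp add: mG_def)
  qed
  have "mG constant_on ?S"
  proof (rule ccontr)
    assume nc: "\<not> mG constant_on ?S"
    have "open (mG ` ?S)"
      by (rule open_mapping_thm[OF hol oS _ oS order_refl nc]) (simp add: convex_connected convex_halfspace_Im_gt)
    moreover have "mG \<i> \<in> mG ` ?S" by simp
    ultimately obtain e where e: "e > 0" "ball (mG \<i>) e \<subseteq> mG ` ?S" by (meson openE)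
    have "mG \<i> + of_real (e / 2) * \<i> \<in> ball (mG \<i>) e" using e(1) by (simp add: dist_norm norm_mult)
    then obtain y where "Im y > 0" "mG \<i> + of_real (e / 2) * \<i> = mG y" using e(2) by blast
    then have "Im (mG \<i> + of_real (e / 2) * \<i>) = Im (m \<i>)" using Im by simp
    then show False using Im[of \<i>] e(1) by simp
  qed
  then obtain k where "\<And>y. Im y > 0 \<Longrightarrow> mG y = k" unfolding constant_on_def by blast
  then show ?thesis using z by simp
qed

text \<open>The diagonal identity connects z with cnj z across the real axis, so both half-planes
  have the same constant.\<close>

lemma mG_const: assumes z: "z \<notin> \<real>" shows "mG z = mG \<i>"
proof (cases "Im z > 0")
  case False
  then have c: "Im (cnj z) > 0" using Im_neq_0[OF z] by simp
  have "mL (cnj z) z = m (cnj z) - m z" using mL_diag[OF c] by simp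
  then have "mG z = mG (cnj z)"
    using mL_cocycle[OF cnj_not_Reals[OF z] z i_not_Reals] unfolding mG_def by algebra
  then show ?thesis using mG_upper[OF c] by simp
qed (rule mG_upper)

lemma m_mL: assumes "z \<notin> \<real>" "v \<notin> \<real>" shows "m z - m v = mL z v"
  using mG_const[OF assms(1)] mG_const[OF assms(2)] mL_cocycle[OF assms(1) i_not_Reals assms(2)] mL_commute[of v \<i>]
  unfolding mG_def by algebra

text \<open>For z different from cnj w the factor z - cnj w can be cancelled. In the exceptional
  case both sides are derivatives, of m and of its representation, whose difference is
  constant.\<close>

lemma psi_ip_hc:
  assumes z: "z \<notin> \<real>" and w: "w \<notin> \<real>"
  shows "hinner Ham (psi z) (psi w) = of_real hc + cI z (cnj w)"
proof (cases "z = cnj w")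
  case True
  have "(mG has_field_derivative 0) (at z)"
  proof (rule has_field_derivative_transform_within_open[of "\<lambda>_. mG \<i>"])
    show "open (- \<real> :: complex set)" using closed_complex_Reals by (simp add: open_Compl)
    show "mG \<i> = mG x" if "x \<in> - \<real>" for x using mG_const[of x] that by simp
  qed (use z in auto)
  from DERIV_unique[OF this mG_deriv[OF z]] show ?thesis using True by simp
next
  case False
  have "(z - cnj w) * hinner Ham (psi z) (psi w) = (z - cnj w) * (of_real hc + cI z (cnj w))"
    using psi_inner[OF z w] m_mL[OF z cnj_not_Reals[OF w]] m_cnj[OF w] by (simp add: mL_def)
  then show ?thesis using False by simp
qed

text \<open>Points tending to v but different from it, on the same horizontal line; they remove the
  exceptional case of a vanishing factor z - cnj w by continuity.\<close>

definition nb :: "complex \<Rightarrow> nat \<Rightarrow> complex" where "nb v n = v + of_real (1 / real (Suc n))"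

lemma nb_simps: "Im (nb v n) = Im v" "cmod (nb v n - v) = 1 / real (Suc n)" "nb v n \<noteq> v" "nb v n \<in> \<real> \<longleftrightarrow> v \<in> \<real>"
  by (simp_all add: nb_def complex_is_Real_iff norm_divide del: of_nat_Suc)

lemma psi_seq:
  assumes v: "v \<notin> \<real>"
  shows "(\<lambda>n. hnorm Ham (\<lambda>x. psi (nb v n) x - psi v x)) \<longlonglongrightarrow> 0"
proof (rule squeeze_zero)
  have nr: "nb v n \<notin> \<real>" for n using v by (simp add: nb_simps)
  show "0 \<le> hnorm Ham (\<lambda>x. psi (nb v n) x - psi v x)" for n
    by (intro hnorm_nonneg wL2_diff psi_wL2 nr v)
  show "hnorm Ham (\<lambda>x. psi (nb v n) x - psi v x) \<le> 1 / real (Suc n) * (hnorm Ham (psi v) / \<bar>Im v\<bar>)" for n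
    using psi_diff_bound[OF nr v, of n] unfolding nb_simps by simp
  have "(\<lambda>n. 1 / real (Suc n) * (hnorm Ham (psi v) / \<bar>Im v\<bar>)) \<longlonglongrightarrow> 0 * (hnorm Ham (psi v) / \<bar>Im v\<bar>)"
    by (intro tendsto_mult tendsto_const LIMSEQ_Suc[OF lim_1_over_n])
  then show "(\<lambda>n. 1 / real (Suc n) * (hnorm Ham (psi v) / \<bar>Im v\<bar>)) \<longlonglongrightarrow> 0" by simp
qed

lemma psi_tendsto_right:
  assumes v: "v \<notin> \<real>" and f: "f \<in> H_space Ham"
  shows "(\<lambda>n. hinner Ham f (psi (nb v n))) \<longlonglongrightarrow> hinner Ham f (psi v)"
proof -
  have nr: "nb v n \<notin> \<real>" for n using v by (simp add: nb_simps)
  have "(\<lambda>n. HH.nrm (HH.sub (psi (nb v n)) (psi v))) \<longlonglongrightarrow> 0"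
    unfolding HH_nrm HH_sub by (rule psi_seq[OF v])
  then have "(\<lambda>n. hinner Ham (psi (nb v n)) f) \<longlonglongrightarrow> hinner Ham (psi v) f"
    by (rule HH.ip_tendsto_left[OF psi_H[OF nr] psi_H[OF v] f])
  then have "(\<lambda>n. cnj (hinner Ham (psi (nb v n)) f)) \<longlonglongrightarrow> cnj (hinner Ham (psi v) f)"
    by (rule tendsto_cnj)
  then show ?thesis unfolding HH.ip_cnj[OF psi_H[OF nr] f, symmetric] HH.ip_cnj[OF psi_H[OF v] f, symmetric] .
qed

lemma resolvent_null:
  assumes f: "f \<in> H_space Ham" and z: "z \<notin> \<real>" and r: "hnorm Ham (rz z f) = 0"
  shows "hnorm Ham f = 0"
proof -
  note fL = H_space_D(1)[OF f]
  have rH: "rz z f \<in> H_space Ham" by (rule rz_H[OF fL z])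
  have ker: "AE x in hline. mact (Ham x) (rz z f x) = 0"
    using hnorm_zero_iff[OF H_space_D(1)[OF rH]] r by simp
  have "rz z f x = 0" if "0 \<le> x" for x
    by (rule kernel_zero[OF rz_ode[OF wL2_hloc[OF fL]] _ _ ker that]) (simp_all add: H_space_add H_space_scale rH f)
  then have "AE x in hline. mact (Ham x) (z *s rz z f x + f x) = 0"
    by (rule ode_zero[OF rz_ode[OF wL2_hloc[OF fL]]])
  then have "AE x in hline. mact (Ham x) (f x) = 0" using ker
    by eventually_elim (simp add: mact_add mact_scale)
  then show ?thesis using hnorm_zero_iff[OF fL] by simp
qed

definition zs :: "nat \<Rightarrow> complex" where "zs n = of_real (real (Suc n)) * \<i>"

lemma zs_nr: "zs n \<notin> \<real>"
  by (simp add: zs_def complex_is_Real_iff del: of_nat_Suc)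

lemma ck_zs_norm: "(\<lambda>n. L2_norm \<mu> (ck (zs n))) \<longlonglongrightarrow> 0"
proof -
  have "(\<lambda>n. LINT t|\<mu>. (cmod (ck (zs n) t))\<^sup>2) \<longlonglongrightarrow> (LINT t|\<mu>. 0)"
  proof (rule integral_dominated_convergence[where w = "\<lambda>t. 1 / (1 + t\<^sup>2)"])
    show "(\<lambda>t. (cmod (ck (zs n) t))\<^sup>2) \<in> borel_measurable \<mu>" for n
      by (rule borel_measurable_integrable[OF L2_integrable[OF ck_L2[OF zs_nr]]])
    have e: "(cmod (ck (zs n) t))\<^sup>2 = 1 / (t\<^sup>2 + (real (Suc n))\<^sup>2)" for n t
      by (simp add: cmod_ck_sq zs_def del: of_nat_Suc)
    have "(\<lambda>n. 1 / (t\<^sup>2 + (real (Suc n))\<^sup>2)) \<longlonglongrightarrow> 0" for t by real_asymp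
    then show "AE t in \<mu>. (\<lambda>n. (cmod (ck (zs n) t))\<^sup>2) \<longlonglongrightarrow> 0" by (simp only: e AE_I2)
    have "1 / (t\<^sup>2 + (real (Suc n))\<^sup>2) \<le> 1 / (1 + t\<^sup>2)" for n t
      using one_le_power[of "real (Suc n)" 2] by (intro divide_left_mono mult_pos_pos) (auto simp: add_pos_nonneg add_nonneg_pos)
    then show "AE t in \<mu>. norm ((cmod (ck (zs n) t))\<^sup>2) \<le> 1 / (1 + t\<^sup>2)" for n by (simp add: e del: of_nat_Suc)
  qed (simp_all add: int_poly)
  then have "(\<lambda>n. sqrt (LINT t|\<mu>. (cmod (ck (zs n) t))\<^sup>2)) \<longlonglongrightarrow> sqrt 0"
    by (intro tendsto_real_sqrt) simp
  then show ?thesis by (simp add: L2_norm_def)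
qed

text \<open>Along $z = \mathrm{i} n$ the kernels tend to zero and the Weyl solutions to some $\xi$ with
  $\langle \xi, \psi_w \rangle = c$ for all $w$. By the resolvent identity the resolvent annihilates $\xi$, which is therefore
  zero.\<close>

lemma hc_zero: "hc = 0"
proof -
  have kL: "ck (zs n) \<in> L2 \<mu>" for n by (rule ck_L2[OF zs_nr])
  have pH: "psi (zs n) \<in> H_space Ham" for n by (rule psi_H[OF zs_nr])
  \<comment> \<open>The constant c cancels in the squared norm of a difference, so up to 1 / pi the
    distances of the Weyl solutions are those of the kernels, which tend to 0.\<close>
  have "(hnorm Ham (\<lambda>x. psi (zs n) x - psi (zs k) x))\<^sup>2 = 1 / pi * (L2_norm \<mu> (\<lambda>t. ck (zs n) t - ck (zs k) t))\<^sup>2" for n k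
  proof -
    have Re_ip: "Re (hinner Ham (psi (zs i)) (psi (zs j))) = hc + 1 / pi * Re (L2_inner \<mu> (ck (zs i)) (ck (zs j)))" for i j
      by (simp add: psi_ip_hc[OF zs_nr zs_nr] cI_inner)
    have "(hnorm Ham (\<lambda>x. psi (zs n) x - psi (zs k) x))\<^sup>2
        = Re (hinner Ham (psi (zs n)) (psi (zs n))) - 2 * Re (hinner Ham (psi (zs n)) (psi (zs k))) + Re (hinner Ham (psi (zs k)) (psi (zs k)))"
      using HH.nrm_sub_sq[OF pH pH, of n k] HH.nrm_sq[OF pH] by (simp only: HH_nrm HH_sub)
    moreover have "(L2_norm \<mu> (\<lambda>t. ck (zs n) t - ck (zs k) t))\<^sup>2
        = Re (L2_inner \<mu> (ck (zs n)) (ck (zs n))) - 2 * Re (L2_inner \<mu> (ck (zs n)) (ck (zs k))) + Re (L2_inner \<mu> (ck (zs k)) (ck (zs k)))"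
      using L2.nrm_sub_sq[OF kL kL, of n k] L2.nrm_sq[OF kL] by (simp only: L2_nrm L2_sub)
    ultimately show ?thesis unfolding Re_ip by algebra
  qed
  note dn = this
  have le: "hnorm Ham (\<lambda>x. psi (zs n) x - psi (zs k) x) \<le> L2_norm \<mu> (\<lambda>t. ck (zs n) t - ck (zs k) t)" for n k
  proof (rule power2_le_imp_le)
    have "1 / pi * (L2_norm \<mu> (\<lambda>t. ck (zs n) t - ck (zs k) t))\<^sup>2 \<le> 1 * (L2_norm \<mu> (\<lambda>t. ck (zs n) t - ck (zs k) t))\<^sup>2"
      using pi_ge_two by (intro mult_right_mono) auto
    then show "(hnorm Ham (\<lambda>x. psi (zs n) x - psi (zs k) x))\<^sup>2 \<le> (L2_norm \<mu> (\<lambda>t. ck (zs n) t - ck (zs k) t))\<^sup>2"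
      unfolding dn by simp
  qed (simp add: L2_norm_def)
  have "\<exists>\<xi>\<in>H_space Ham. (\<lambda>n. HH.nrm (HH.sub (psi (zs n)) \<xi>)) \<longlonglongrightarrow> 0"
  proof (rule HH.complete[OF pH])
    fix e :: real assume e: "e > 0"
    then have "\<forall>\<^sub>F n in sequentially. L2_norm \<mu> (ck (zs n)) < e / 2" using ck_zs_norm by (intro order_tendstoD) auto
    then obtain N where N: "\<And>n. n \<ge> N \<Longrightarrow> L2_norm \<mu> (ck (zs n)) < e / 2" unfolding eventually_sequentially by blast
    have "HH.nrm (HH.sub (psi (zs n)) (psi (zs k))) < e" if nk: "n \<ge> N" "k \<ge> N" for n k
    proof -
      have "L2.nrm \<mu> (\<lambda>t. ck (zs n) t + (-1) * ck (zs k) t) \<le> L2.nrm \<mu> (ck (zs n)) + L2.nrm \<mu> (\<lambda>t. (-1) * ck (zs k) t)"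
        by (intro L2.nrm_triangle kL L2_cmult)
      also have "L2.nrm \<mu> (\<lambda>t. (-1) * ck (zs k) t) = L2.nrm \<mu> (ck (zs k))" using L2.nrm_scl[OF kL, of "-1" k] by simp
      finally have "L2_norm \<mu> (\<lambda>t. ck (zs n) t - ck (zs k) t) \<le> L2_norm \<mu> (ck (zs n)) + L2_norm \<mu> (ck (zs k))"
        by (simp add: L2_nrm)
      then show ?thesis using N[OF nk(1)] N[OF nk(2)] le[of n k] unfolding HH_nrm HH_sub by linarith
    qed
    then show "\<exists>N. \<forall>n\<ge>N. \<forall>k\<ge>N. HH.nrm (HH.sub (psi (zs n)) (psi (zs k))) < e" by blast
  qed
  then obtain \<xi> where \<xi>: "\<xi> \<in> H_space Ham" and lim: "(\<lambda>n. HH.nrm (HH.sub (psi (zs n)) \<xi>)) \<longlonglongrightarrow> 0" by blast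
  have ip: "hinner Ham \<xi> (psi w) = of_real hc" if w: "w \<notin> \<real>" for w
  proof (rule LIMSEQ_unique)
    show "(\<lambda>n. hinner Ham (psi (zs n)) (psi w)) \<longlonglongrightarrow> hinner Ham \<xi> (psi w)"
      by (rule HH.ip_tendsto_left[OF pH \<xi> psi_H[OF w] lim])
    have "(\<lambda>n. L2_inner \<mu> (ck (zs n)) (ck w)) \<longlonglongrightarrow> 0"
    proof (rule Lim_null_comparison)
      show "\<forall>\<^sub>F n in sequentially. norm (L2_inner \<mu> (ck (zs n)) (ck w)) \<le> L2_norm \<mu> (ck (zs n)) * L2_norm \<mu> (ck w)"
        using L2.cauchy_schwarz[OF kL ck_L2[OF w]] by (simp add: L2_nrm)
      show "(\<lambda>n. L2_norm \<mu> (ck (zs n)) * L2_norm \<mu> (ck w)) \<longlonglongrightarrow> 0" by (rule tendsto_mult_left_zero[OF ck_zs_norm])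
    qed
    then have "(\<lambda>n. of_real hc + of_real (1 / pi) * L2_inner \<mu> (ck (zs n)) (ck w)) \<longlonglongrightarrow> of_real hc + of_real (1 / pi) * 0"
      by (intro tendsto_intros)
    then show "(\<lambda>n. hinner Ham (psi (zs n)) (psi w)) \<longlonglongrightarrow> of_real hc"
      by (simp add: psi_ip_hc[OF zs_nr w] cI_inner)
  qed
  note cL = H_space_D(1)[OF \<xi>]
  have rH: "rz \<i> \<xi> \<in> H_space Ham" by (rule rz_H[OF cL i_not_Reals])
  \<comment> \<open>By \<open>rz_inner\<close> the product, multiplied by i - cnj w, is a difference
    of two values of the constant function w to <xi, psi w>.\<close>
  have r0: "hinner Ham (rz \<i> \<xi>) (psi w) = 0" if w: "w \<notin> \<real>" "\<i> \<noteq> cnj w" for w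
    using rz_inner[OF cL i_not_Reals w(1)] ip[OF cnj_not_Reals[OF i_not_Reals]] ip[OF w(1)] w(2) by simp
  have "hinner Ham (rz \<i> \<xi>) (psi w) = 0" if w: "w \<notin> \<real>" for w
  proof (cases "\<i> = cnj w")
    case True
    have "hinner Ham (rz \<i> \<xi>) (psi (nb w n)) = 0" for n
    proof (rule r0)
      show "nb w n \<notin> \<real>" using w by (simp add: nb_simps)
      show "\<i> \<noteq> cnj (nb w n)" unfolding True using nb_simps(3)[of w n] by (metis complex_cnj_cancel_iff)
    qed
    then show ?thesis using psi_tendsto_right[OF w rH] by (simp add: LIMSEQ_const_iff)
  qed (use r0 w in blast)
  then have "hnorm Ham (rz \<i> \<xi>) = 0" by (rule psi_total[OF rH])
  then have n0: "hnorm Ham \<xi> = 0" by (rule resolvent_null[OF \<xi> i_not_Reals])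
  have "hinner Ham \<xi> (psi \<i>) = 0"
    by (rule HH.null_ip[OF \<xi> psi_H[OF i_not_Reals]]) (simp add: HH_nrm n0)
  then show ?thesis using ip[OF i_not_Reals] by simp
qed

theorem psi_ip:
  "z \<notin> \<real> \<Longrightarrow> w \<notin> \<real> \<Longrightarrow> hinner Ham (psi z) (psi w) = of_real (1 / pi) * L2_inner \<mu> (ck z) (ck w)"
  by (simp add: psi_ip_hc hc_zero cI_inner)

end

section \<open>The unitary map and the transform\<close>

lemma L2_ck_mult:
  assumes F: "F \<in> L2 M" and z: "z \<notin> \<real>" and m: "ck z \<in> borel_measurable M"
  shows "(\<lambda>t. ck z t * F t) \<in> L2 M"
proof (rule L2_I)
  show "(\<lambda>t. ck z t * F t) \<in> borel_measurable M" using m L2_measurable[OF F] by (rule borel_measurable_times)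
  then have m2: "(\<lambda>t. (cmod (ck z t * F t))\<^sup>2) \<in> borel_measurable M" by measurable
  show "integrable M (\<lambda>t. (cmod (ck z t * F t))\<^sup>2)"
  proof (rule Bochner_Integration.integrable_bound[OF _ m2])
    show "integrable M (\<lambda>t. (1 / \<bar>Im z\<bar>)\<^sup>2 * (cmod (F t))\<^sup>2)" by (intro integrable_mult_right L2_integrable F)
    have "(cmod (ck z t * F t))\<^sup>2 \<le> (1 / \<bar>Im z\<bar>)\<^sup>2 * (cmod (F t))\<^sup>2" for t
      unfolding norm_mult power_mult_distrib by (intro mult_right_mono power_mono cmod_ck_le z) auto
    then show "AE t in M. norm ((cmod (ck z t * F t))\<^sup>2) \<le> norm ((1 / \<bar>Im z\<bar>)\<^sup>2 * (cmod (F t))\<^sup>2)"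
      by (intro AE_I2) simp
  qed
qed

context herg
begin

text \<open>The sign makes the extended map the transform itself rather than its negative; see the
  boundary term in \<open>UW_ode\<close>.\<close>

definition kz :: "complex \<Rightarrow> real \<Rightarrow> complex" where "kz z t = of_real (- 1 / sqrt pi) * ck z t"

lemma kz_L2: "z \<notin> \<real> \<Longrightarrow> kz z \<in> L2 \<mu>"
  unfolding kz_def[abs_def] by (intro L2_cmult ck_L2)

lemma kz_inner: "L2_inner \<mu> F (kz z) = of_real (- 1 / sqrt pi) * L2_inner \<mu> F (ck z)"
  unfolding L2_inner_def kz_def by (simp add: mult.left_commute)

lemma psi_kz: assumes "z \<notin> \<real>" "w \<notin> \<real>" shows "hinner Ham (psi z) (psi w) = L2_inner \<mu> (kz z) (kz w)"
proof -
  have "L2_inner \<mu> (kz z) (kz w) = of_real (- 1 / sqrt pi) * (of_real (- 1 / sqrt pi) * L2_inner \<mu> (ck z) (ck w))"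
    unfolding kz_inner unfolding kz_def[abs_def]
    by (subst L2.ip_scl[OF ck_L2[OF assms(1)] ck_L2[OF assms(2)]]) (rule refl)
  also have "\<dots> = of_real ((- 1 / sqrt pi) * (- 1 / sqrt pi)) * L2_inner \<mu> (ck z) (ck w)" by (simp only: of_real_mult mult.assoc)
  also have "(- 1 / sqrt pi) * (- 1 / sqrt pi) = 1 / pi" by simp
  finally show ?thesis using psi_ip[OF assms] by simp
qed

text \<open>The linear span of the pairs, kept as a relation, so that no independence of the Weyl
  solutions has to be discussed.\<close>

inductive_set pT :: "((real \<Rightarrow> complex^2) \<times> (real \<Rightarrow> complex)) set" where
  base: "z \<notin> \<real> \<Longrightarrow> (psi z, kz z) \<in> pT"
| add: "(f, F) \<in> pT \<Longrightarrow> (g, G) \<in> pT \<Longrightarrow> (\<lambda>x. f x + g x, \<lambda>t. F t + G t) \<in> pT"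
| scl: "(f, F) \<in> pT \<Longrightarrow> (\<lambda>x. c *s f x, \<lambda>t. c * F t) \<in> pT"

lemma pT_D: assumes "(f, F) \<in> pT" shows "f \<in> H_space Ham \<and> F \<in> L2 \<mu>"
  using assms by induction (auto intro: psi_H kz_L2 H_space_add H_space_scale L2_add L2_cmult)

lemma pT_test:
  assumes f: "f \<in> H_space Ham" and F: "F \<in> L2 \<mu>" and t: "\<And>z. z \<notin> \<real> \<Longrightarrow> hinner Ham f (psi z) = L2_inner \<mu> F (kz z)"
    and g: "(g, G) \<in> pT"
  shows "hinner Ham f g = L2_inner \<mu> F G"
  using g
proof induction
  case (base z) then show ?case by (rule t)
next
  case (add g G h K)
  then show ?case using pT_D[of g G] pT_D[of h K] HH.ip_add_right[of g h f] L2.ip_add_right[of G \<mu> K F] f F by simp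
next
  case (scl g G c)
  then show ?case using pT_D[of g G] HH.ip_scl_right[of g f c] L2.ip_scl_right[of G \<mu> F c] f F by simp
qed

lemma pT_ip_psi: assumes "(f, F) \<in> pT" "z \<notin> \<real>" shows "hinner Ham f (psi z) = L2_inner \<mu> F (kz z)"
  using assms(1)
proof induction
  case (base w) then show ?case by (rule psi_kz[OF _ assms(2)])
next
  case (add g G h K)
  then show ?case using pT_D[of g G] pT_D[of h K] HH.ip_add[of g h "psi z"] L2.ip_add[of G \<mu> K "kz z"] psi_H kz_L2 assms(2) by simp
next
  case (scl g G c)
  then show ?case using pT_D[of g G] HH.ip_scl[of g "psi z" c] L2.ip_scl[of G \<mu> "kz z" c] psi_H kz_L2 assms(2) by simp
qed

sublocale TT: iso_pair "H_space Ham" "\<lambda>f g x. f x + g x" "\<lambda>c f x. c *s f x" "hinner Ham"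
  "L2 \<mu>" "\<lambda>F G t. F t + G t" "\<lambda>c F t. c * F t" "L2_inner \<mu>" pT
proof (unfold_locales)
  show "pT \<subseteq> H_space Ham \<times> L2 \<mu>" using pT_D by auto
  show "pT \<noteq> {}" using pT.base[OF i_not_Reals] by blast
  show "hinner Ham f g = L2_inner \<mu> F G" if "(f, F) \<in> pT" "(g, G) \<in> pT" for f F g G
    using pT_test[OF _ _ pT_ip_psi[OF that(1)] that(2)] pT_D[OF that(1)] by blast
  show "HH.nrm f = 0" if f: "f \<in> H_space Ham" and o: "\<And>y Y. (y, Y) \<in> pT \<Longrightarrow> hinner Ham f y = 0" for f
    unfolding HH_nrm by (rule psi_total[OF f]) (rule o, rule pT.base)
  show "L2.nrm \<mu> F = 0" if F: "F \<in> L2 \<mu>" and o: "\<And>y Y. (y, Y) \<in> pT \<Longrightarrow> L2_inner \<mu> F Y = 0" for F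
  proof -
    have "L2_inner \<mu> F (ck z) = 0" if "z \<notin> \<real>" for z using o[OF pT.base[OF that]] by (simp add: kz_inner)
    then have "AE t in \<mu>. F t = 0" by (rule ck_total[OF F])
    then show ?thesis using L2_norm_null[OF F] by (simp add: L2_nrm)
  qed
qed (auto intro: pT.add pT.scl)

definition UW :: "((real \<Rightarrow> complex^2) \<times> (real \<Rightarrow> complex)) set" where "UW = TT.W"

lemma UW_iff: "(f, F) \<in> UW \<longleftrightarrow> f \<in> H_space Ham \<and> F \<in> L2 \<mu> \<and> (\<forall>z. z \<notin> \<real> \<longrightarrow> hinner Ham f (psi z) = L2_inner \<mu> F (kz z))"
proof
  assume "(f, F) \<in> UW"
  then show "f \<in> H_space Ham \<and> F \<in> L2 \<mu> \<and> (\<forall>z. z \<notin> \<real> \<longrightarrow> hinner Ham f (psi z) = L2_inner \<mu> F (kz z))"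
    unfolding UW_def using TT.W_D pT.base by blast
next
  assume a: "f \<in> H_space Ham \<and> F \<in> L2 \<mu> \<and> (\<forall>z. z \<notin> \<real> \<longrightarrow> hinner Ham f (psi z) = L2_inner \<mu> F (kz z))"
  then have "hinner Ham f g = L2_inner \<mu> F G" if "(g, G) \<in> pT" for g G
    using pT_test[OF _ _ _ that] by simp
  then show "(f, F) \<in> UW" using a unfolding UW_def TT.W_def by auto
qed

lemma UW_D: "(f, F) \<in> UW \<Longrightarrow> f \<in> H_space Ham" "(f, F) \<in> UW \<Longrightarrow> F \<in> L2 \<mu>"
  by (simp_all add: UW_iff)

lemma UW_add: "(f, F) \<in> UW \<Longrightarrow> (g, G) \<in> UW \<Longrightarrow> (\<lambda>x. f x + g x, \<lambda>t. F t + G t) \<in> UW"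
  unfolding UW_def by (rule TT.W_add)

lemma UW_scale: "(f, F) \<in> UW \<Longrightarrow> (\<lambda>x. c *s f x, \<lambda>t. c * F t) \<in> UW"
  unfolding UW_def by (rule TT.W_scl)

lemma UW_diff: "(f, F) \<in> UW \<Longrightarrow> (g, G) \<in> UW \<Longrightarrow> (\<lambda>x. f x - g x, \<lambda>t. F t - G t) \<in> UW"
  unfolding UW_def using TT.W_sub by (simp only: HH_sub L2_sub)

lemma UW_norm: "(f, F) \<in> UW \<Longrightarrow> hnorm Ham f = L2_norm \<mu> F"
  unfolding UW_def using TT.W_nrm by (simp only: HH_nrm L2_nrm)

lemma UW_ip: "(f, F) \<in> UW \<Longrightarrow> (g, G) \<in> UW \<Longrightarrow> hinner Ham f g = L2_inner \<mu> F G"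
  unfolding UW_def by (rule TT.W_ip)

lemma UW_unique: "(f, F) \<in> UW \<Longrightarrow> (f, G) \<in> UW \<Longrightarrow> AE t in \<mu>. F t = G t"
  using UW_norm[OF UW_diff, of f F f G] L2_norm_null[OF L2_diff[OF UW_D(2) UW_D(2)], of f F f G]
    HH.null_ip UW_D(1) TT.W_unique[of f F G]
  by (simp add: UW_def L2_nrm L2_sub)

lemma UW_unique_dom: "(f, F) \<in> UW \<Longrightarrow> (g, F) \<in> UW \<Longrightarrow> weighted_eq Ham {0<..} f g"
  using TT.W_unique_dom[of f F g] UW_D(1) H_space_D(1)
  by (simp add: UW_def[symmetric] HH_nrm HH_sub weighted_eq_iff_hnorm)

lemma UW_cong:
  assumes fF: "(f, F) \<in> UW" and f': "f' \<in> H_space Ham" "weighted_eq Ham {0<..} f f'"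
    and F': "F' \<in> L2 \<mu>" "AE t in \<mu>. F t = F' t"
  shows "(f', F') \<in> UW"
  unfolding UW_def
proof (rule TT.W_null)
  show "(f, F) \<in> TT.W" using fF by (simp add: UW_def)
  show "HH.nrm (HH.sub f f') = 0"
    using f'(2) weighted_eq_iff_hnorm[OF H_space_D(1)[OF UW_D(1)[OF fF]] H_space_D(1)[OF f'(1)]] by (simp add: HH_nrm HH_sub)
  show "L2.nrm \<mu> (L2.sub F F') = 0"
    using F'(2) L2_norm_null[OF L2_diff[OF UW_D(2)[OF fF] F'(1)]] by (simp add: L2_nrm L2_sub)
qed (use f' F' in auto)

lemma weighted_eq_refl: "weighted_eq Ham S f f"
  by (simp add: weighted_eq_def mact_def)

lemma UW_exists: "f \<in> H_space Ham \<Longrightarrow> \<exists>F. (f, F) \<in> UW" and UW_exists': "F \<in> L2 \<mu> \<Longrightarrow> \<exists>f. (f, F) \<in> UW"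
  unfolding UW_def using TT.W_exists TT.W_exists' by auto

lemma UW_psi: "z \<notin> \<real> \<Longrightarrow> (psi z, kz z) \<in> UW"
  unfolding UW_def using TT.T_sub_W pT.base by blast

text \<open>Weak continuity of the kernels is pulled back through the unitary map to that of the
  Weyl solutions.\<close>

lemma kz_tendsto_right:
  assumes v: "v \<notin> \<real>" and F: "F \<in> L2 \<mu>"
  shows "(\<lambda>n. L2_inner \<mu> F (kz (nb v n))) \<longlonglongrightarrow> L2_inner \<mu> F (kz v)"
proof -
  obtain f where f: "(f, F) \<in> UW" using UW_exists'[OF F] by blast
  have nr: "nb v n \<notin> \<real>" for n using v by (simp add: nb_simps)
  show ?thesis using psi_tendsto_right[OF v UW_D(1)[OF f]] f nr v by (simp add: UW_iff)
qed

text \<open>Both sides are tested on Weyl solutions: after multiplication by z - cnj w,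
  \<open>rz_inner\<close> matches the partial fractions of the kernels. The parameter w = cnj z is
  reached as a limit.\<close>

lemma UW_resolvent:
  assumes fF: "(f, F) \<in> UW" and z: "z \<notin> \<real>"
  shows "(rz z f, \<lambda>t. ck z t * F t) \<in> UW"
proof -
  note fH = UW_D(1)[OF fF] and FL = UW_D(2)[OF fF]
  note fL = H_space_D(1)[OF fH]
  have rH: "rz z f \<in> H_space Ham" by (rule rz_H[OF fL z])
  have cL: "(\<lambda>t. ck z t * F t) \<in> L2 \<mu>" by (rule L2_ck_mult[OF FL z measurable_mu[OF ck_measurable]])
  have ne: "hinner Ham (rz z f) (psi w) = L2_inner \<mu> (\<lambda>t. ck z t * F t) (kz w)" if w: "w \<notin> \<real>" "w \<noteq> cnj z" for w
  proof -
    have zc: "cnj z \<notin> \<real>" by (rule cnj_not_Reals[OF z])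
    have "(z - cnj w) * L2_inner \<mu> (\<lambda>t. ck z t * F t) (kz w) = (LINT t|\<mu>. (z - cnj w) * (ck z t * F t * cnj (kz w t)))"
      unfolding L2_inner_def by simp
    also have "\<dots> = (LINT t|\<mu>. F t * cnj (kz (cnj z) t) - F t * cnj (kz w t))"
    proof (rule Bochner_Integration.integral_cong[OF refl])
      fix t
      have "(cnj z - w) * (ck (cnj z) t * kz w t) = kz (cnj z) t - kz w t"
        using ck_diff[OF zc w(1), of t] unfolding kz_def by (simp only: right_diff_distrib[symmetric] mult.left_commute mult.assoc)
      then have "cnj ((cnj z - w) * (ck (cnj z) t * kz w t)) = cnj (kz (cnj z) t) - cnj (kz w t)" by simp
      then have e: "(z - cnj w) * (ck z t * cnj (kz w t)) = cnj (kz (cnj z) t) - cnj (kz w t)" by (simp add: ck_cnj)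
      have "(z - cnj w) * (ck z t * F t * cnj (kz w t)) = F t * ((z - cnj w) * (ck z t * cnj (kz w t)))" by (simp only: mult_ac)
      then show "(z - cnj w) * (ck z t * F t * cnj (kz w t)) = F t * cnj (kz (cnj z) t) - F t * cnj (kz w t)"
        unfolding e by (simp only: right_diff_distrib)
    qed
    also have "\<dots> = L2_inner \<mu> F (kz (cnj z)) - L2_inner \<mu> F (kz w)"
      unfolding L2_inner_def by (intro Bochner_Integration.integral_diff L2_integrable_mult FL kz_L2 zc w)
    also have "\<dots> = hinner Ham f (psi (cnj z)) - hinner Ham f (psi w)" using fF zc w(1) by (simp add: UW_iff)
    also have "\<dots> = (z - cnj w) * hinner Ham (rz z f) (psi w)" by (rule rz_inner[OF fL z w(1), symmetric])
    finally have "(z - cnj w) * L2_inner \<mu> (\<lambda>t. ck z t * F t) (kz w) = (z - cnj w) * hinner Ham (rz z f) (psi w)" .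
    moreover have "z - cnj w \<noteq> 0" using w(2) by auto
    ultimately show ?thesis by simp
  qed
  have "hinner Ham (rz z f) (psi w) = L2_inner \<mu> (\<lambda>t. ck z t * F t) (kz w)" if w: "w \<notin> \<real>" for w
  proof (cases "w = cnj z")
    case True
    have "hinner Ham (rz z f) (psi (nb w n)) = L2_inner \<mu> (\<lambda>t. ck z t * F t) (kz (nb w n))" for n
      by (rule ne) (use w nb_simps(3)[of w n] True in \<open>auto simp: nb_simps(4)\<close>)
    then have "(\<lambda>n. hinner Ham (rz z f) (psi (nb w n))) \<longlonglongrightarrow> L2_inner \<mu> (\<lambda>t. ck z t * F t) (kz w)"
      using kz_tendsto_right[OF w cL] by simp
    then show ?thesis by (rule LIMSEQ_unique[OF psi_tendsto_right[OF w rH]])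
  qed (rule ne[OF w])
  then show ?thesis using rH cL by (simp add: UW_iff)
qed

text \<open>The image of the maximal relation. Writing u as the resolvent at i of h - i u plus a
  multiple of psi at i shows that a nonzero boundary value adds a constant function to t F; this
  constant need not itself lie in L2.\<close>

lemma UW_ode:
  assumes u: "(u, F) \<in> UW" and h: "(h, G) \<in> UW" and o: "ode u h"
  shows "AE t in \<mu>. G t = of_real t * F t + of_real (1 / sqrt pi) * u 0 $ 2"
proof -
  define f where "f = (\<lambda>x. h x - \<i> *s u x)"
  define c where "c = u 0 $ 2"
  have fW: "(f, \<lambda>t. G t - \<i> * F t) \<in> UW" unfolding f_def by (intro UW_diff h UW_scale u)
  have o': "ode u (\<lambda>x. \<i> *s u x + f x)" using o by (simp add: f_def)
  have eq: "u x = rz \<i> f x + c *s psi \<i> x" if "0 \<le> x" for x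
    unfolding c_def by (rule rz_unique[OF H_space_D(1)[OF UW_D(1)[OF u]] H_space_D(1)[OF UW_D(1)[OF fW]] o' i_not_Reals that])
  have W: "(\<lambda>x. rz \<i> f x + c *s psi \<i> x, \<lambda>t. ck \<i> t * (G t - \<i> * F t) + c * kz \<i> t) \<in> UW"
    by (intro UW_add UW_scale UW_psi i_not_Reals UW_resolvent fW)
  have "(u, \<lambda>t. ck \<i> t * (G t - \<i> * F t) + c * kz \<i> t) \<in> UW"
  proof (rule UW_cong[OF W UW_D(1)[OF u] _ UW_D(2)[OF W]])
    show "weighted_eq Ham {0<..} (\<lambda>x. rz \<i> f x + c *s psi \<i> x) u"
      unfolding weighted_eq_def by (rule AE_I2) (simp add: eq mact_def space_restrict_space)
  qed simp
  then have "AE t in \<mu>. F t = ck \<i> t * (G t - \<i> * F t) + c * kz \<i> t" by (rule UW_unique[OF u])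
  then show ?thesis
  proof eventually_elim
    case (elim t)
    have nz: "of_real t - \<i> \<noteq> 0" by (rule ck_nz[OF i_not_Reals])
    have "(of_real t - \<i>) * F t = (of_real t - \<i>) * (ck \<i> t * (G t - \<i> * F t) + c * kz \<i> t)" using elim by simp
    also have "\<dots> = ((of_real t - \<i>) * ck \<i> t) * (G t - \<i> * F t - of_real (1 / sqrt pi) * c)"
      unfolding kz_def by (simp add: algebra_simps diff_divide_distrib)
    also have "(of_real t - \<i>) * ck \<i> t = 1" using nz by (simp add: ck_def)
    finally show ?case unfolding c_def by algebra
  qed
qed

section \<open>The transform of compactly supported functions\<close>

lemma hinner_vanishing:
  assumes f: "f \<in> weighted_L2 Ham" "weighted_eq Ham {b<..} f (\<lambda>x. 0)" and g: "hloc g" and b: "0 \<le> b"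
  shows "hinner Ham f g = hin 0 b f g"
proof -
  have t: "trunc b g \<in> weighted_L2 Ham" by (rule trunc_wL2[OF g b])
  have "AE x in hline. hq x (f x) (g x) = hq x (f x) (trunc b g x)"
  proof -
    have "AE x in lebesgue. x \<in> {b<..} \<longrightarrow> mact (Ham x) (f x) = 0"
      using f(2) by (simp add: weighted_eq_def AE_lebesgue_on_iff)
    then have "AE x in lebesgue. x \<in> {0<..} \<longrightarrow> hq x (f x) (g x) = hq x (f x) (trunc b g x)"
      by eventually_elim (auto simp: trunc_def hq_left)
    then show ?thesis by (simp add: AE_lebesgue_on_iff)
  qed
  then have "hinner Ham f g = hinner Ham f (trunc b g)"
    unfolding hinner_hq using hq_measurable[OF wL2_measurable[OF f(1)] hloc_measurable[OF g]]
      hq_measurable[OF wL2_measurable[OF f(1)] wL2_measurable[OF t]]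
    by (intro integral_cong_AE)
  also have "\<dots> = hin 0 b f (trunc b g)" by (rule hinner_vanishing_tendsto[OF f t b])
  also have "\<dots> = hin 0 b f g" by (rule hin_cong) (simp_all add: trunc_def)
  finally show ?thesis .
qed

lemma transform_cQ:
  assumes f: "f \<in> weighted_L2 Ham" "weighted_eq Ham {b<..} f (\<lambda>x. 0)" and b: "0 \<le> b"
  shows "transform Ham \<Theta> f w = of_real (1 / sqrt pi) * cQ w f b"
proof -
  have "hinner Ham f (\<lambda>x. \<Theta> x (cnj w)) = hin 0 b f (\<lambda>x. \<Theta> x (cnj w))"
    by (rule hinner_vanishing[OF f ode_hloc[OF Theta_ode] b])
  also have "\<dots> = cQ w f b" unfolding cQ_def by (rule hin_cong) (simp_all add: Theta_cnj)
  finally show ?thesis by (simp add: transform_def)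
qed

lemma Theta_diff: "0 \<le> x \<Longrightarrow> \<Theta> x z - \<Theta> x w = (z - w) *s cz z (\<lambda>t. \<Theta> t w) x"
proof -
  assume x: "0 \<le> x"
  have hT: "hloc (\<lambda>t. \<Theta> t w)" by (rule ode_hloc[OF Theta_ode])
  have "ode (\<lambda>x. \<Theta> x z - \<Theta> x w - (z - w) *s cz z (\<lambda>t. \<Theta> t w) x)
     (\<lambda>x. z *s \<Theta> x z - w *s \<Theta> x w - (z - w) *s (z *s cz z (\<lambda>t. \<Theta> t w) x + \<Theta> x w))"
    by (intro ode_diff ode_scale Theta_ode cz_ode hT)
  moreover have "(\<lambda>x. z *s \<Theta> x z - w *s \<Theta> x w - (z - w) *s (z *s cz z (\<lambda>t. \<Theta> t w) x + \<Theta> x w))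
    = (\<lambda>x. z *s (\<Theta> x z - \<Theta> x w - (z - w) *s cz z (\<lambda>t. \<Theta> t w) x))"
    by (simp add: fun_eq_iff vec2_eq_iff algebra_simps)
  ultimately have "ode (\<lambda>x. \<Theta> x z - \<Theta> x w - (z - w) *s cz z (\<lambda>t. \<Theta> t w) x)
     (\<lambda>x. z *s (\<Theta> x z - \<Theta> x w - (z - w) *s cz z (\<lambda>t. \<Theta> t w) x))" by (simp only:)
  from homogeneous_eq[OF this x] have "\<Theta> x z - \<Theta> x w - (z - w) *s cz z (\<lambda>t. \<Theta> t w) x = 0"
    by (simp add: vec2_eq_iff)
  then show ?thesis by simp
qed

definition cR :: "real \<Rightarrow> real \<Rightarrow> real" where "cR R b = 2 * b * exp (4 * R * b)"

lemma cbound_le: "0 \<le> b \<Longrightarrow> cmod z \<le> R \<Longrightarrow> cbound z b \<le> cR R b"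
  unfolding cbound_def cR_def by (intro mult_left_mono) (auto intro: mult_right_mono)

lemma cR_nonneg: "0 \<le> b \<Longrightarrow> 0 \<le> cR R b"
  unfolding cR_def by simp

text \<open>A Lipschitz constant for the transform on |z| <= R. It is needed to compare its value at
  t with that at a nearby sample point.\<close>

lemma cQ_lipschitz:
  assumes f: "hloc f" and b: "0 \<le> b" and z: "cmod z \<le> R" "cmod w \<le> R"
  shows "cmod (cQ z f b - cQ w f b) \<le> cmod (z - w) * (sqrt (hsn 0 b f) * (cR R b * sqrt (b * (exp (2 * R * b))\<^sup>2)))"
proof -
  define k where "k = cz z (\<lambda>t. \<Theta> t w)"
  have hT: "hloc (\<lambda>t. \<Theta> t w)" for w by (rule ode_hloc[OF Theta_ode])
  have hk: "hloc k" unfolding k_def by (rule ode_hloc[OF cz_ode[OF hT]])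
  have "cQ z f b - cQ w f b = hin 0 b f (\<lambda>t. vcnj (\<Theta> t z) - vcnj (\<Theta> t w))"
    unfolding cQ_def hin_def hq_diff_right
    by (rule integral_diff[symmetric]) (intro absolutely_integrable_imp hq_loc_integrable f hloc_vcnj hT order_refl)+
  also have "\<dots> = hin 0 b f (\<lambda>t. cnj (z - w) *s vcnj (k t))"
  proof (rule hin_cong)
    fix x :: real assume x: "0 \<le> x"
    have "vcnj (\<Theta> x z) - vcnj (\<Theta> x w) = vcnj (\<Theta> x z - \<Theta> x w)" by (simp add: vec2_eq_iff)
    then show "vcnj (\<Theta> x z) - vcnj (\<Theta> x w) = cnj (z - w) *s vcnj (k x)"
      unfolding Theta_diff[OF x] k_def vcnj_scale .
  qed (rule refl)
  also have "\<dots> = (z - w) * hin 0 b f (\<lambda>t. vcnj (k t))"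
    unfolding hin_scale_right by simp
  finally have "cmod (cQ z f b - cQ w f b) = cmod (z - w) * cmod (hin 0 b f (\<lambda>t. vcnj (k t)))" by (simp only: norm_mult)
  also have "\<dots> \<le> cmod (z - w) * (sqrt (hsn 0 b f) * (cR R b * sqrt (b * (exp (2 * R * b))\<^sup>2)))"
  proof (rule mult_left_mono)
    have "hsn 0 b (\<lambda>t. \<Theta> t w) \<le> b * (exp (2 * R * b))\<^sup>2"
    proof (rule hsn_bound[OF hT b])
      fix x assume x: "0 \<le> x" "x \<le> b"
      have "n1 (\<Theta> x w) \<le> exp (2 * cmod w * x)" by (rule Theta_bound[OF x(1)])
      also have "\<dots> \<le> exp (2 * R * b)" using mult_mono[OF z(2) x(2) order_trans[OF norm_ge_zero z(2)] x(1)] by simp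
      finally show "n1 (\<Theta> x w) \<le> exp (2 * R * b)" .
    qed
    then have "cbound z b * sqrt (hsn 0 b (\<lambda>t. \<Theta> t w)) \<le> cR R b * sqrt (b * (exp (2 * R * b))\<^sup>2)"
      by (intro mult_mono cbound_le b z cR_nonneg real_sqrt_le_mono) (simp_all add: hsn_nonneg)
    then have k: "sqrt (hsn 0 b k) \<le> cR R b * sqrt (b * (exp (2 * R * b))\<^sup>2)"
      using cz_bound[OF hT b, of z w] unfolding k_def by linarith
    have "cmod (hin 0 b f (\<lambda>t. vcnj (k t))) \<le> sqrt (hsn 0 b f) * sqrt (hsn 0 b (\<lambda>t. vcnj (k t)))"
      by (intro hin_cauchy_schwarz f hloc_vcnj hk order_refl)
    also have "\<dots> \<le> sqrt (hsn 0 b f) * (cR R b * sqrt (b * (exp (2 * R * b))\<^sup>2))"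
      unfolding hsn_vcnj by (intro mult_left_mono k) (simp add: hsn_nonneg)
    finally show "cmod (hin 0 b f (\<lambda>t. vcnj (k t))) \<le> sqrt (hsn 0 b f) * (cR R b * sqrt (b * (exp (2 * R * b))\<^sup>2))" .
  qed simp
  finally show ?thesis .
qed

text \<open>For real z there is no resolvent, so the equation is solved with value 0 at b instead.
  The solution vanishes beyond b and therefore lies in H; by \<open>UW_ode\<close> its lower
  component at 0 produces the transform. The bound on K is uniform in |z| <= R.\<close>

lemma compact_solution:
  assumes fF: "(f, F) \<in> UW" and van: "weighted_eq Ham {b<..} f (\<lambda>x. 0)" and b: "0 \<le> b" and z: "cmod z \<le> R"
  shows "\<exists>w K. (w, K) \<in> UW \<and> L2_norm \<mu> K \<le> cR R b * (2 * sqrt (hsn 0 b f)) \<and>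
     (AE t in \<mu>. F t - transform Ham \<Theta> f z = (of_real t - z) * K t)"
proof -
  note fL = H_space_D(1)[OF UW_D(1)[OF fF]]
  note hf = wL2_hloc[OF fL]
  define w where "w = trunc b (\<lambda>x. cz z f x - cP z f b *s \<Theta> x z + cQ z f b *s \<Phi> x z)"
  \<comment> \<open>Subtracting the full coefficients at b turns the integrals over [0, x] into
    negatives of those over [x, b], which vanish for x >= b.\<close>
  define v where "v x = cz z f x - cP z f b *s \<Theta> x z + cQ z f b *s \<Phi> x z" for x
  have ve: "v x = (cP z f x - cP z f b) *s \<Theta> x z - (cQ z f x - cQ z f b) *s \<Phi> x z" for x
    by (simp add: v_def cz_def vec2_eq_iff algebra_simps)
  have v0: "v x = 0" if "b \<le> x" for x
  proof -
    have "cP z f x = cP z f b" "cQ z f x = cQ z f b"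
      unfolding cP_def cQ_def
      by (rule hin_vanishing(1)[OF hf van hloc_vcnj[OF Phi_hloc] b that] hin_vanishing(1)[OF hf van hloc_vcnj[OF Theta_hloc] b that])+
    then show ?thesis by (simp add: ve)
  qed
  have "ode v (\<lambda>x. (z *s cz z f x + f x) - cP z f b *s (z *s \<Theta> x z) + cQ z f b *s (z *s \<Phi> x z))"
    unfolding v_def[abs_def] by (intro ode_add ode_diff ode_scale Theta_ode Phi_ode cz_ode hf)
  moreover have "(\<lambda>x. (z *s cz z f x + f x) - cP z f b *s (z *s \<Theta> x z) + cQ z f b *s (z *s \<Phi> x z)) = (\<lambda>x. z *s v x + f x)"
    by (simp add: fun_eq_iff v_def vec2_eq_iff algebra_simps)
  ultimately have o: "ode v (\<lambda>x. z *s v x + f x)" by (simp only:)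
  have hv: "hloc v" by (rule ode_hloc[OF o])
  have tr: "trunc b v = v" using v0 by (auto simp: fun_eq_iff trunc_def)
  have vL: "v \<in> weighted_L2 Ham" using trunc_wL2[OF hv b] by (simp only: tr)
  have vH: "v \<in> H_space Ham" by (rule ode_H_space[OF o vL])
  obtain K where K: "(v, K) \<in> UW" using UW_exists[OF vH] by blast
  have "hnorm Ham v \<le> cR R b * (2 * sqrt (hsn 0 b f))"
  proof (rule hnorm_le[OF vL])
    show nn: "0 \<le> cR R b * (2 * sqrt (hsn 0 b f))" by (simp add: cR_nonneg b hsn_nonneg)
    fix B :: real
    have "hsn 0 B v \<le> hsn 0 b v" using hsn_trunc_le[OF hv b, of B] by (simp only: tr)
    moreover have "sqrt (hsn 0 b v) \<le> cbound z b * (2 * sqrt (hsn 0 b f))"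
    proof (rule hsn_comb_bound[OF hv b])
      fix x assume x: "0 \<le> x" "x \<le> b"
      show "n1 (v x) \<le> 2 * (2 * sqrt (hsn 0 b f)) * sqrt b * exp (4 * cmod z * b)"
        unfolding ve
      proof (rule comb_bound[OF x])
        have "cmod (p - q) \<le> 2 * S" if "cmod p \<le> S" "cmod q \<le> S" for p q S
          using norm_triangle_ineq4[of p q] that by linarith
        from this[OF cPQ_bound(1)[OF hf x, of z] cPQ_bound(1)[OF hf b order_refl, of z]]
          this[OF cPQ_bound(2)[OF hf x, of z] cPQ_bound(2)[OF hf b order_refl, of z]]
        show "cmod (cP z f x - cP z f b) \<le> 2 * sqrt (hsn 0 b f) * (sqrt b * exp (2 * cmod z * b))"
          "cmod (cQ z f x - cQ z f b) \<le> 2 * sqrt (hsn 0 b f) * (sqrt b * exp (2 * cmod z * b))"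
          by (simp_all only: mult.assoc)
      qed (simp add: hsn_nonneg)
    qed (simp add: hsn_nonneg)
    moreover have "cbound z b * (2 * sqrt (hsn 0 b f)) \<le> cR R b * (2 * sqrt (hsn 0 b f))"
      by (intro mult_right_mono cbound_le b z) (simp add: hsn_nonneg)
    ultimately have "sqrt (hsn 0 B v) \<le> cR R b * (2 * sqrt (hsn 0 b f))"
      using real_sqrt_le_mono[of "hsn 0 B v" "hsn 0 b v"] by linarith
    then show "hsn 0 B v \<le> (cR R b * (2 * sqrt (hsn 0 b f)))\<^sup>2" by (rule sqrt_le_D)
  qed
  then have n: "L2_norm \<mu> K \<le> cR R b * (2 * sqrt (hsn 0 b f))" using UW_norm[OF K] by simp
  have "AE t in \<mu>. z * K t + F t = of_real t * K t + of_real (1 / sqrt pi) * v 0 $ 2"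
    by (rule UW_ode[OF K UW_add[OF UW_scale[OF K] fF] o])
  moreover have "v 0 $ 2 = cQ z f b" by (simp add: v_def init)
  ultimately have "AE t in \<mu>. F t - transform Ham \<Theta> f z = (of_real t - z) * K t"
    unfolding transform_cQ[OF fL van b] by (auto elim!: eventually_mono simp: algebra_simps)
  then show ?thesis using K n by blast
qed

lemma transform_lipschitz:
  assumes f: "f \<in> weighted_L2 Ham" "weighted_eq Ham {b<..} f (\<lambda>x. 0)" and b: "0 \<le> b"
  obtains L where "0 \<le> L" "\<And>z w. cmod z \<le> R \<Longrightarrow> cmod w \<le> R \<Longrightarrow> cmod (transform Ham \<Theta> f z - transform Ham \<Theta> f w) \<le> L * cmod (z - w)"
proof
  define S where "S = sqrt (hsn 0 b f) * (cR R b * sqrt (b * (exp (2 * R * b))\<^sup>2))"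
  show "0 \<le> 1 / sqrt pi * S" unfolding S_def using b by (intro mult_nonneg_nonneg cR_nonneg) (auto simp: hsn_nonneg)
  fix z w assume "cmod z \<le> R" "cmod w \<le> R"
  from cQ_lipschitz[OF wL2_hloc[OF f(1)] b this]
  have "1 / sqrt pi * cmod (cQ z f b - cQ w f b) \<le> 1 / sqrt pi * (cmod (z - w) * S)"
    unfolding S_def by (rule mult_left_mono) simp
  then show "cmod (transform Ham \<Theta> f z - transform Ham \<Theta> f w) \<le> 1 / sqrt pi * S * cmod (z - w)"
    unfolding transform_cQ[OF f b] right_diff_distrib[symmetric] norm_mult norm_of_real by (simp add: mult_ac)
qed

lemma transform_measurable:
  assumes f: "f \<in> weighted_L2 Ham" "weighted_eq Ham {b<..} f (\<lambda>x. 0)" and b: "0 \<le> b"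
  shows "(\<lambda>t. transform Ham \<Theta> f (complex_of_real t)) \<in> borel_measurable \<mu>"
proof (rule measurable_mu, rule borel_measurable_continuous_onI)
  show "continuous_on UNIV (\<lambda>t. transform Ham \<Theta> f (complex_of_real t))"
    unfolding continuous_on_eq_continuous_at[OF open_UNIV]
  proof
    fix s :: real
    obtain L where L: "0 \<le> L" "\<And>z w. cmod z \<le> \<bar>s\<bar> + 1 \<Longrightarrow> cmod w \<le> \<bar>s\<bar> + 1 \<Longrightarrow> cmod (transform Ham \<Theta> f z - transform Ham \<Theta> f w) \<le> L * cmod (z - w)"
      by (rule transform_lipschitz[OF f b, of "\<bar>s\<bar> + 1"]) blast
    have "((\<lambda>t. transform Ham \<Theta> f (complex_of_real t) - transform Ham \<Theta> f (complex_of_real s)) \<longlongrightarrow> 0) (at s)"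
    proof (rule Lim_null_comparison)
      have "\<forall>\<^sub>F t in at s. dist t s < 1" unfolding eventually_at by (intro exI[of _ 1]) auto
      then show "\<forall>\<^sub>F t in at s. norm (transform Ham \<Theta> f (complex_of_real t) - transform Ham \<Theta> f (complex_of_real s)) \<le> L * \<bar>t - s\<bar>"
      proof eventually_elim
        case (elim t)
        then have "\<bar>t\<bar> \<le> \<bar>s\<bar> + 1" by (simp add: dist_real_def)
        then show ?case using L(2)[of "complex_of_real t" "complex_of_real s"] by (simp flip: of_real_diff)
      qed
      have "((\<lambda>t. L * \<bar>t - s\<bar>) \<longlongrightarrow> L * \<bar>s - s\<bar>) (at s)" by (intro tendsto_intros)
      then show "((\<lambda>t. L * \<bar>t - s\<bar>) \<longlongrightarrow> 0) (at s)" by simp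
    qed
    then show "isCont (\<lambda>t. transform Ham \<Theta> f (complex_of_real t)) s" unfolding isCont_def by (rule LIM_zero_cancel)
  qed
qed

text \<open>Sample points k / n in [-R, R]. For t within 1 / n of p k, the image F differs from the
  transform at p k by at most |K k t| / n, and the transform at p k from that at t by at most L /
  n.\<close>

lemma transform_AE:
  assumes fF: "(f, F) \<in> UW" and van: "weighted_eq Ham {b<..} f (\<lambda>x. 0)" and b: "0 \<le> b"
  shows "AE t in \<mu>. F t = transform Ham \<Theta> f (complex_of_real t)"
proof -
  note fL = H_space_D(1)[OF UW_D(1)[OF fF]] and FL = UW_D(2)[OF fF]
  define u where "u t = transform Ham \<Theta> f (complex_of_real t)" for t
  have mu: "u \<in> borel_measurable \<mu>" unfolding u_def[abs_def] by (rule transform_measurable[OF fL van b])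
  note [measurable] = mu L2_measurable[OF FL]
  have "AE t in \<mu>. t \<in> {-real r..real r} \<longrightarrow> F t = u t" for r :: nat
  proof -
    define R where "R = real r"
    define C where "C = cR R b * (2 * sqrt (hsn 0 b f))"
    have C0: "0 \<le> C" unfolding C_def by (simp add: cR_nonneg b hsn_nonneg)
    define q where "q t = indicat_real {-R..R} t * (cmod (F t - u t))\<^sup>2" for t
    have mq: "q \<in> borel_measurable \<mu>" unfolding q_def[abs_def]
      by (intro borel_measurable_times borel_measurable_indicator) (simp_all add: sets_mu)
    have R0: "0 \<le> R" by (simp add: R_def)
    obtain L where L: "0 \<le> L" "\<And>z w. cmod z \<le> R \<Longrightarrow> cmod w \<le> R \<Longrightarrow> cmod (transform Ham \<Theta> f z - transform Ham \<Theta> f w) \<le> L * cmod (z - w)"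
      by (rule transform_lipschitz[OF fL van b, of R]) blast
    define M where "M = measure \<mu> {-R..R}"
    have fi: "integrable \<mu> (\<lambda>t. indicat_real {-R..R} t)"
      using finite_interval[of R] by (intro integrable_real_indicator) (auto simp: sets_mu)
    \<comment> \<open>There are 2 R n + 1 sample points, each contributing at most 2 C^2 / n^2, and
      the Lipschitz error adds 2 L^2 M / n^2, with n = N + 1. Everything tends to 0.\<close>
    have bound: "integrable \<mu> q \<and> (LINT t|\<mu>. q t) \<le> 4 * R * C\<^sup>2 * (1 / real (Suc N)) + (2 * C\<^sup>2 + 2 * L\<^sup>2 * M) * (1 / real (Suc N))\<^sup>2" for N
    proof -
      define n where "n = real (Suc N)"
      have n0: "n > 0" by (simp add: n_def)
      define m' where "m' = r * Suc N"
      have m': "real m' = R * n" by (simp add: m'_def R_def n_def algebra_simps)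
      define J :: "int set" where "J = {- int m'..int m'}"
      have fJ: "finite J" by (simp add: J_def)
      have cJ: "real (card J) = 2 * (R * n) + 1" by (simp add: J_def m'[symmetric])
      define p where "p k = complex_of_real (real_of_int k / n)" for k :: int
      have pR: "cmod (p k) \<le> R" if "k \<in> J" for k
      proof -
        have "real_of_int (- int m') \<le> real_of_int k" "real_of_int k \<le> real_of_int (int m')"
          using that unfolding J_def of_int_le_iff by auto
        then have "\<bar>real_of_int k\<bar> \<le> R * n" unfolding m'[symmetric] by simp
        then have "\<bar>real_of_int k / n\<bar> \<le> R" using n0 by (simp add: abs_divide divide_le_eq)
        then show ?thesis unfolding p_def norm_of_real .
      qed
      have "\<forall>k\<in>J. \<exists>K. K \<in> L2 \<mu> \<and> L2_norm \<mu> K \<le> C \<and> (AE t in \<mu>. F t - transform Ham \<Theta> f (p k) = (of_real t - p k) * K t)"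
        using compact_solution[OF fF van b pR] UW_D(2) unfolding C_def by blast
      from bchoice[OF this] obtain K where K: "\<And>k. k \<in> J \<Longrightarrow> K k \<in> L2 \<mu>" "\<And>k. k \<in> J \<Longrightarrow> L2_norm \<mu> (K k) \<le> C"
        "\<And>k. k \<in> J \<Longrightarrow> AE t in \<mu>. F t - transform Ham \<Theta> f (p k) = (of_real t - p k) * K k t"
        by blast
      \<comment> \<open>The sum over all k replaces the one K k belonging to the cell of t. This
        avoids partitioning the interval and costs only the factor O(n), which 1 / n^2
        beats.\<close>
      define B where "B t = 2 * ((1 / n)\<^sup>2 * (\<Sum>k\<in>J. (cmod (K k t))\<^sup>2)) + 2 * ((L / n)\<^sup>2 * indicat_real {-R..R} t)" for t
      have iB: "integrable \<mu> B" unfolding B_def[abs_def]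
        by (intro Bochner_Integration.integrable_add integrable_mult_right Bochner_Integration.integrable_sum L2_integrable K fi)
      have "(LINT t|\<mu>. B t) = 2 * ((1 / n)\<^sup>2 * (\<Sum>k\<in>J. (LINT t|\<mu>. (cmod (K k t))\<^sup>2))) + 2 * ((L / n)\<^sup>2 * M)"
      proof -
        have i1: "integrable \<mu> (\<lambda>t. \<Sum>k\<in>J. (cmod (K k t))\<^sup>2)" by (intro Bochner_Integration.integrable_sum L2_integrable K)
        have "(LINT t|\<mu>. indicat_real {-R..R} t) = M" unfolding M_def by (simp add: space_mu)
        moreover have "(LINT t|\<mu>. (\<Sum>k\<in>J. (cmod (K k t))\<^sup>2)) = (\<Sum>k\<in>J. (LINT t|\<mu>. (cmod (K k t))\<^sup>2))"
          by (intro Bochner_Integration.integral_sum L2_integrable K)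
        ultimately show ?thesis unfolding B_def using i1 fi
          by (subst Bochner_Integration.integral_add) (auto intro!: integrable_mult_right)
      qed
      also have "\<dots> \<le> 2 * ((1 / n)\<^sup>2 * (real (card J) * C\<^sup>2)) + 2 * ((L / n)\<^sup>2 * M)"
      proof -
        have "(LINT t|\<mu>. (cmod (K k t))\<^sup>2) \<le> C\<^sup>2" if "k \<in> J" for k
          unfolding L2_norm_sq[symmetric] by (intro power_mono K(2) that) (simp add: L2_norm_def)
        from sum_bounded_above[of J _ "C\<^sup>2", OF this] have "(\<Sum>k\<in>J. (LINT t|\<mu>. (cmod (K k t))\<^sup>2)) \<le> real (card J) * C\<^sup>2" by simp
        then show ?thesis by (intro add_right_mono mult_left_mono) auto
      qed
      also have "\<dots> = 4 * R * C\<^sup>2 * (1 / n) + (2 * C\<^sup>2 + 2 * L\<^sup>2 * M) * (1 / n)\<^sup>2"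
        unfolding cJ using n0 by (simp add: field_simps power2_eq_square)
      finally have B_le: "(LINT t|\<mu>. B t) \<le> 4 * R * C\<^sup>2 * (1 / n) + (2 * C\<^sup>2 + 2 * L\<^sup>2 * M) * (1 / n)\<^sup>2" .
      have "AE t in \<mu>. \<forall>k\<in>J. F t - transform Ham \<Theta> f (p k) = (of_real t - p k) * K k t"
        using K(3) by (intro AE_finite_allI fJ)
      then have qB: "AE t in \<mu>. q t \<le> B t"
      proof eventually_elim
        case (elim t)
        show ?case
        proof (cases "t \<in> {-R..R}")
          case False
          then show ?thesis by (simp add: q_def B_def sum_nonneg)
        next
          case True
          define k where "k = \<lfloor>t * n\<rfloor>"
          have "- R * n \<le> t * n" "t * n \<le> R * n" using True n0 by (intro mult_right_mono; simp)+
          then have "- real m' \<le> t * n" "t * n \<le> real m'" unfolding m' by simp_all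
          then have kJ: "k \<in> J" unfolding k_def J_def by (simp add: le_floor_iff floor_le_iff)
          have "real_of_int k \<le> t * n" "t * n \<le> real_of_int k + 1" unfolding k_def by linarith+
          then have "\<bar>t * n - real_of_int k\<bar> \<le> 1" by linarith
          then have "\<bar>t - real_of_int k / n\<bar> \<le> 1 / n" using n0 by (simp add: abs_le_iff field_simps)
          then have tp: "cmod (of_real t - p k) \<le> 1 / n" unfolding p_def of_real_diff[symmetric] norm_of_real .
          have "cmod (F t - transform Ham \<Theta> f (p k)) \<le> 1 / n * cmod (K k t)"
            using elim kJ by (simp only: norm_mult) (intro mult_right_mono tp norm_ge_zero)
          then have a: "(cmod (F t - transform Ham \<Theta> f (p k)))\<^sup>2 \<le> (1 / n)\<^sup>2 * (cmod (K k t))\<^sup>2"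
            unfolding power_mult_distrib[symmetric] by (intro power_mono) auto
          also have "\<dots> \<le> (1 / n)\<^sup>2 * (\<Sum>k\<in>J. (cmod (K k t))\<^sup>2)"
            by (intro mult_left_mono member_le_sum kJ fJ) auto
          finally have a: "(cmod (F t - transform Ham \<Theta> f (p k)))\<^sup>2 \<le> (1 / n)\<^sup>2 * (\<Sum>k\<in>J. (cmod (K k t))\<^sup>2)" .
          have "cmod (transform Ham \<Theta> f (p k) - u t) \<le> L * cmod (p k - of_real t)"
            unfolding u_def using True by (intro L(2) pR kJ) auto
          also have "\<dots> \<le> L * (1 / n)" using tp by (intro mult_left_mono L(1)) (simp add: norm_minus_commute)
          finally have "(cmod (transform Ham \<Theta> f (p k) - u t))\<^sup>2 \<le> (L / n)\<^sup>2" by (intro power_mono) auto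
          with a cmod_add_sq_le[of "F t - transform Ham \<Theta> f (p k)" "transform Ham \<Theta> f (p k) - u t"]
          have "(cmod (F t - u t))\<^sup>2 \<le> 2 * ((1 / n)\<^sup>2 * (\<Sum>k\<in>J. (cmod (K k t))\<^sup>2)) + 2 * (L / n)\<^sup>2" by simp
          then show ?thesis using True by (simp add: q_def B_def)
        qed
      qed
      have q0: "0 \<le> q t" for t by (simp add: q_def)
      have iq: "integrable \<mu> q"
      proof (rule Bochner_Integration.integrable_bound[OF iB mq])
        show "AE t in \<mu>. norm (q t) \<le> norm (B t)" using qB by eventually_elim (use q0 in \<open>simp add: abs_of_nonneg\<close>)
      qed
      moreover have "(LINT t|\<mu>. q t) \<le> (LINT t|\<mu>. B t)" by (rule integral_mono_AE[OF iq iB qB])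
      ultimately show ?thesis using B_le unfolding n_def by linarith
    qed
    have x0: "(\<lambda>N. 1 / real (Suc N)) \<longlonglongrightarrow> 0" by (rule LIMSEQ_Suc[OF lim_1_over_n])
    have "(\<lambda>N. 4 * R * C\<^sup>2 * (1 / real (Suc N)) + (2 * C\<^sup>2 + 2 * L\<^sup>2 * M) * (1 / real (Suc N))\<^sup>2)
       \<longlonglongrightarrow> 4 * R * C\<^sup>2 * 0 + (2 * C\<^sup>2 + 2 * L\<^sup>2 * M) * 0\<^sup>2" by (intro tendsto_intros x0)
    then have "(\<lambda>N. 4 * R * C\<^sup>2 * (1 / real (Suc N)) + (2 * C\<^sup>2 + 2 * L\<^sup>2 * M) * (1 / real (Suc N))\<^sup>2) \<longlonglongrightarrow> 0"
      by (simp del: of_nat_Suc)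
    then have "(LINT t|\<mu>. q t) \<le> 0"
      by (rule LIMSEQ_le_const) (use bound in blast)
    moreover have "0 \<le> (LINT t|\<mu>. q t)" by (simp add: q_def)
    ultimately have q0: "(LINT t|\<mu>. q t) = 0" by simp
    have iq: "integrable \<mu> q" using bound by blast
    have "AE t in \<mu>. 0 \<le> q t" by (simp add: q_def)
    then have "AE t in \<mu>. q t = 0" using integral_nonneg_eq_0_iff_AE[OF iq] q0 by blast
    then show ?thesis unfolding R_def[symmetric] by eventually_elim (auto simp: q_def indicator_def split: if_splits)
  qed
  then have "AE t in \<mu>. \<forall>r::nat. t \<in> {-real r..real r} \<longrightarrow> F t = u t" by (subst AE_all_countable) blast
  then show ?thesis
  proof eventually_elim
    fix t assume h: "\<forall>r::nat. t \<in> {-real r..real r} \<longrightarrow> F t = u t"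
    obtain r :: nat where "\<bar>t\<bar> < real r" using reals_Archimedean2 by blast
    then have "t \<in> {-real r..real r}" by auto
    then show "F t = transform Ham \<Theta> f (complex_of_real t)" using h unfolding u_def by blast
  qed
qed

lemma transform_UW:
  assumes "f \<in> H_compact Ham"
  shows "(f, \<lambda>t. transform Ham \<Theta> f (complex_of_real t)) \<in> UW"
proof -
  obtain b where f: "f \<in> H_space Ham" and b: "0 < b" "weighted_eq Ham {b<..} f (\<lambda>x. 0)"
    using assms by (auto simp: H_compact_def)
  obtain F where F: "(f, F) \<in> UW" using UW_exists[OF f] by blast
  have ae: "AE t in \<mu>. F t = transform Ham \<Theta> f (complex_of_real t)" by (rule transform_AE[OF F b(2)]) (use b in simp)
  have "(\<lambda>t. transform Ham \<Theta> f (complex_of_real t)) \<in> borel_measurable \<mu>"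
    by (rule transform_measurable[OF H_space_D(1)[OF f] b(2)]) (use b in simp)
  then show ?thesis by (intro UW_cong[OF F f weighted_eq_refl _ ae] L2_cong_AE[OF UW_D(2)[OF F] _ ae])
qed

text \<open>Truncations at regular points stay in H, and the isometry turns their convergence in H
  into that of their transforms.\<close>

lemma compact_approx:
  assumes fF: "(f, F) \<in> UW"
  obtains g where "\<And>n::nat. g n \<in> H_compact Ham" "(\<lambda>n. hnorm Ham (\<lambda>x. g n x - f x)) \<longlonglongrightarrow> 0"
    "(\<lambda>n. L2_norm \<mu> (\<lambda>t. transform Ham \<Theta> (g n) (complex_of_real t) - F t)) \<longlonglongrightarrow> 0"
proof -
  note fH = UW_D(1)[OF fF]
  note fL = H_space_D(1)[OF fH]
  obtain b where b: "\<And>n::nat. regular_point (b n)" "filterlim b at_top sequentially" "\<And>n. 0 \<le> b n"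
    by (rule regular_sequence) blast
  define g where "g n = trunc (b n) f" for n
  have gH: "g n \<in> H_space Ham" for n
    unfolding g_def by (rule trunc_H_space[OF wL2_hloc[OF fL] H_space_D(2)[OF fH] b(1)])
  have gc: "g n \<in> H_compact Ham" for n
  proof -
    have "weighted_eq Ham {b n<..} (g n) (\<lambda>x. 0)"
      unfolding weighted_eq_def g_def by (rule AE_I2) (simp add: trunc_def mact_def space_restrict_space)
    moreover have "0 < b n" using b(1) by (simp add: regular_point_def)
    ultimately show ?thesis using gH by (auto simp: H_compact_def)
  qed
  have l: "(\<lambda>n. hnorm Ham (\<lambda>x. g n x - f x)) \<longlonglongrightarrow> 0"
    unfolding g_def by (rule trunc_tendsto[OF fL b(2,3)])
  have "L2_norm \<mu> (\<lambda>t. transform Ham \<Theta> (g n) (complex_of_real t) - F t) = hnorm Ham (\<lambda>x. g n x - f x)" for n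
    using UW_norm[OF UW_diff[OF transform_UW[OF gc] fF]] by simp
  then show ?thesis using that[OF gc l] l by simp
qed

section \<open>Closure, adjoint and the operator D\<close>

lemma transform_graph_UW: "transform_graph Ham \<Theta> \<mu> \<subseteq> UW"
proof
  fix p assume "p \<in> transform_graph Ham \<Theta> \<mu>"
  then obtain f F where p: "p = (f, F)" "f \<in> H_compact Ham" "F \<in> L2 \<mu>" "AE t in \<mu>. F t = transform Ham \<Theta> f (complex_of_real t)"
    by (auto simp: transform_graph_def)
  have "f \<in> H_space Ham" using p(2) by (simp add: H_compact_def)
  moreover have "AE t in \<mu>. transform Ham \<Theta> f (complex_of_real t) = F t" using p(4) by eventually_elim simp
  ultimately show "p \<in> UW" unfolding p(1) by (intro UW_cong[OF transform_UW[OF p(2)] _ weighted_eq_refl p(3)])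
qed

lemma closure_UW: "graph_closure Ham \<mu> (transform_graph Ham \<Theta> \<mu>) = UW"
proof (intro equalityI subrelI)
  fix f F assume "(f, F) \<in> graph_closure Ham \<mu> (transform_graph Ham \<Theta> \<mu>)"
  then obtain g G where h: "f \<in> H_space Ham" "F \<in> L2 \<mu>" "\<And>n::nat. (g n, G n) \<in> transform_graph Ham \<Theta> \<mu>"
      "(\<lambda>n. hnorm Ham (\<lambda>x. g n x - f x)) \<longlonglongrightarrow> 0" "(\<lambda>n. L2_norm \<mu> (\<lambda>t. G n t - F t)) \<longlonglongrightarrow> 0"
    by (auto simp: graph_closure_def)
  show "(f, F) \<in> UW" unfolding UW_def
  proof (rule TT.W_closed[OF _ h(1,2)])
    show "(g n, G n) \<in> TT.W" for n using h(3) transform_graph_UW unfolding UW_def by blast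
  qed (use h(4,5) in \<open>simp_all only: HH_nrm HH_sub L2_nrm L2_sub\<close>)
next
  fix f F assume fF: "(f, F) \<in> UW"
  obtain g where g: "\<And>n::nat. g n \<in> H_compact Ham" "(\<lambda>n. hnorm Ham (\<lambda>x. g n x - f x)) \<longlonglongrightarrow> 0"
    "(\<lambda>n. L2_norm \<mu> (\<lambda>t. transform Ham \<Theta> (g n) (complex_of_real t) - F t)) \<longlonglongrightarrow> 0"
    by (rule compact_approx[OF fF]) blast
  have "(g n, \<lambda>t. transform Ham \<Theta> (g n) (complex_of_real t)) \<in> transform_graph Ham \<Theta> \<mu>" for n
    using g(1) UW_D(2)[OF transform_UW[OF g(1)]] by (simp add: transform_graph_def)
  then show "(f, F) \<in> graph_closure Ham \<mu> (transform_graph Ham \<Theta> \<mu>)"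
    using g(2,3) UW_D[OF fF] unfolding graph_closure_def
    by (auto intro!: exI[of _ g] exI[of _ "\<lambda>n t. transform Ham \<Theta> (g n) (complex_of_real t)"])
qed

lemma UW_isomorphism: "hilbert_isomorphism Ham \<mu> UW"
  unfolding hilbert_isomorphism_def
proof (intro conjI)
  show "UW \<subseteq> H_space Ham \<times> L2 \<mu>" using UW_D by auto
  show "\<forall>f\<in>H_space Ham. \<exists>F. (f, F) \<in> UW" "\<forall>F\<in>L2 \<mu>. \<exists>f. (f, F) \<in> UW" using UW_exists UW_exists' by auto
  show "\<forall>f F G. (f, F) \<in> UW \<and> (f, G) \<in> UW \<longrightarrow> (AE t in \<mu>. F t = G t)" using UW_unique by blast
  show "\<forall>f F g G. (f, F) \<in> UW \<and> (g, G) \<in> UW \<longrightarrow> (\<lambda>x. f x + g x, \<lambda>t. F t + G t) \<in> UW" using UW_add by blast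
  show "\<forall>f F c. (f, F) \<in> UW \<longrightarrow> (\<lambda>x. c *s f x, \<lambda>t. c * F t) \<in> UW" using UW_scale by blast
  show "\<forall>(f, F)\<in>UW. hnorm Ham f = L2_norm \<mu> F" using UW_norm by blast
qed

text \<open>For a unitary map the adjoint is the inverse; testing against the Weyl solutions already
  identifies the pair.\<close>

lemma adjoint_UW: "graph_adjoint Ham \<mu> UW = UW\<inverse>"
proof (intro equalityI subrelI)
  fix F f assume "(F, f) \<in> graph_adjoint Ham \<mu> UW"
  then have h: "F \<in> L2 \<mu>" "f \<in> H_space Ham" "\<And>g G. (g, G) \<in> UW \<Longrightarrow> L2_inner \<mu> G F = hinner Ham g f"
    by (auto simp: graph_adjoint_def)
  have "hinner Ham f (psi z) = L2_inner \<mu> F (kz z)" if z: "z \<notin> \<real>" for z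
    using h(3)[OF UW_psi[OF z]] HH.ip_cnj[OF psi_H[OF z] h(2)] L2.ip_cnj[OF kz_L2[OF z] h(1)] by simp
  then show "(F, f) \<in> UW\<inverse>" using h(1,2) by (simp add: UW_iff)
next
  fix F f assume "(F, f) \<in> UW\<inverse>"
  then have fF: "(f, F) \<in> UW" by simp
  show "(F, f) \<in> graph_adjoint Ham \<mu> UW"
    using UW_D[OF fF] UW_ip[OF _ fF] by (auto simp: graph_adjoint_def)
qed

text \<open>Relations compose from left to right, so the right-hand side is first the unitary map,
  then multiplication, then its inverse. One inclusion is \<open>UW_ode\<close> with boundary value
  0. For the other, the resolvent at i of g - i f has the same image as f and is thus the
  representative of f that solves the equation.\<close>

lemma operator_UW: "canonical_operator Ham = UW O multiplication_operator \<mu> O UW\<inverse>"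
proof (intro equalityI subrelI)
  fix f g assume "(f, g) \<in> canonical_operator Ham"
  then obtain f0 where h: "f \<in> H_space Ham" "g \<in> H_space Ham" "weighted_eq Ham {0<..} f f0" "f0 0 $ 2 = 0"
    "solves_J f0 (\<lambda>x. mact (Ham x) (g x))" by (auto simp: canonical_operator_def)
  have o: "ode f0 g" using h(5) solves_J_iff_ode[OF wL2_hloc[OF H_space_D(1)[OF h(2)]]] by simp
  have f0: "f0 \<in> H_space Ham" by (rule H_space_cong[OF h(1) hloc_measurable[OF ode_hloc[OF o]] h(3)])
  obtain F where F: "(f0, F) \<in> UW" using UW_exists[OF f0] by blast
  obtain G where G: "(g, G) \<in> UW" using UW_exists[OF h(2)] by blast
  have "(f, F) \<in> UW" by (rule UW_cong[OF F h(1) weighted_eq_sym[OF h(3)] UW_D(2)[OF F]]) simp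
  moreover have "AE t in \<mu>. G t = of_real t * F t" using UW_ode[OF F G o] h(4) by simp
  then have "(F, G) \<in> multiplication_operator \<mu>" using UW_D(2)[OF F] UW_D(2)[OF G] by (simp add: multiplication_operator_def)
  ultimately show "(f, g) \<in> UW O multiplication_operator \<mu> O UW\<inverse>" using G by blast
next
  fix f g assume "(f, g) \<in> UW O multiplication_operator \<mu> O UW\<inverse>"
  then obtain F G where h: "(f, F) \<in> UW" "(g, G) \<in> UW" "AE t in \<mu>. G t = of_real t * F t"
    by (auto simp: multiplication_operator_def)
  define k where "k x = g x - \<i> *s f x" for x
  have kW: "(k, \<lambda>t. G t - \<i> * F t) \<in> UW" unfolding k_def[abs_def] by (intro UW_diff h UW_scale)
  define f0 where "f0 = rz \<i> k"
  have "(f0, \<lambda>t. ck \<i> t * (G t - \<i> * F t)) \<in> UW" unfolding f0_def by (rule UW_resolvent[OF kW i_not_Reals])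
  note f0W = this
  have "AE t in \<mu>. ck \<i> t * (G t - \<i> * F t) = F t" using h(3)
  proof eventually_elim
    case (elim t)
    have "of_real t - \<i> \<noteq> 0" by (rule ck_nz[OF i_not_Reals])
    then have "ck \<i> t * (of_real t - \<i>) = 1" by (simp add: ck_def)
    then show ?case unfolding elim by algebra
  qed
  then have "(f0, F) \<in> UW" by (rule UW_cong[OF f0W UW_D(1)[OF f0W] weighted_eq_refl UW_D(2)[OF h(1)]])
  then have w: "weighted_eq Ham {0<..} f0 f" by (rule UW_unique_dom) (rule h(1))
  have "ode f0 (\<lambda>x. \<i> *s f0 x + k x)" unfolding f0_def by (rule rz_ode[OF wL2_hloc[OF H_space_D(1)[OF UW_D(1)[OF kW]]]])
  moreover have "weighted_eq Ham {0<..} (\<lambda>x. \<i> *s f0 x + k x) g"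
  proof -
    have "weighted_eq Ham {0<..} (\<lambda>x. \<i> *s f0 x + k x) (\<lambda>x. \<i> *s f x + k x)"
      by (intro weighted_eq_add weighted_eq_scale w weighted_eq_refl)
    then show ?thesis by (simp add: k_def)
  qed
  ultimately have o: "ode f0 g" by (rule ode_cong) simp
  have "solves_J f0 (\<lambda>x. mact (Ham x) (g x))"
    using o solves_J_iff_ode[OF wL2_hloc[OF H_space_D(1)[OF UW_D(1)[OF h(2)]]]] by simp
  moreover have "f0 0 $ 2 = 0" by (simp add: f0_def)
  ultimately show "(f, g) \<in> canonical_operator Ham"
    using UW_D(1)[OF h(1)] UW_D(1)[OF h(2)] weighted_eq_sym[OF w] unfolding canonical_operator_def by blast
qed

theorem spectral_theorem:
  shows "(\<forall>f\<in>H_compact Ham. (\<lambda>t. transform Ham \<Theta> f (complex_of_real t)) \<in> L2 \<mu> \<and>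
           hnorm Ham f = L2_norm \<mu> (\<lambda>t. transform Ham \<Theta> f (complex_of_real t))) \<and>
         (\<forall>F\<in>L2 \<mu>. \<forall>\<epsilon>>0. \<exists>f\<in>H_compact Ham. L2_norm \<mu> (\<lambda>t. transform Ham \<Theta> f (complex_of_real t) - F t) < \<epsilon>) \<and>
         hilbert_isomorphism Ham \<mu> (graph_closure Ham \<mu> (transform_graph Ham \<Theta> \<mu>)) \<and>
         canonical_operator Ham = graph_closure Ham \<mu> (transform_graph Ham \<Theta> \<mu>) O multiplication_operator \<mu> O
           graph_adjoint Ham \<mu> (graph_closure Ham \<mu> (transform_graph Ham \<Theta> \<mu>))"
  unfolding closure_UW adjoint_UW
proof (intro conjI ballI allI impI UW_isomorphism operator_UW)
  fix f assume "f \<in> H_compact Ham"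
  from transform_UW[OF this] show "(\<lambda>t. transform Ham \<Theta> f (complex_of_real t)) \<in> L2 \<mu>"
    "hnorm Ham f = L2_norm \<mu> (\<lambda>t. transform Ham \<Theta> f (complex_of_real t))"
    by (rule UW_D(2), rule UW_norm)
next
  fix F and \<epsilon> :: real assume F: "F \<in> L2 \<mu>" and \<epsilon>: "\<epsilon> > 0"
  obtain f where fF: "(f, F) \<in> UW" using UW_exists'[OF F] by blast
  obtain g where g: "\<And>n::nat. g n \<in> H_compact Ham" "(\<lambda>n. hnorm Ham (\<lambda>x. g n x - f x)) \<longlonglongrightarrow> 0"
    "(\<lambda>n. L2_norm \<mu> (\<lambda>t. transform Ham \<Theta> (g n) (complex_of_real t) - F t)) \<longlonglongrightarrow> 0"
    by (rule compact_approx[OF fF]) blast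
  from order_tendstoD(2)[OF g(3) \<epsilon>] obtain N where "\<And>n. n \<ge> N \<Longrightarrow> L2_norm \<mu> (\<lambda>t. transform Ham \<Theta> (g n) (complex_of_real t) - F t) < \<epsilon>"
    unfolding eventually_sequentially by blast
  from this[OF order_refl]
  show "\<exists>f\<in>H_compact Ham. L2_norm \<mu> (\<lambda>t. transform Ham \<Theta> f (complex_of_real t) - F t) < \<epsilon>" using g(1) by blast
qed

end

section \<open>Null modifications of the Hamiltonian\<close>

text \<open>Measurability is not assumed, because the notions below are compared for arbitrary
  functions. Gauge integrals ignore null sets, and if neither function is integrable both integrals
  have the default value 0.\<close>

lemma lint_cong_AE:
  fixes f g :: "real \<Rightarrow> complex"
  assumes ae: "AE x in lebesgue_on S. f x = g x" and S: "S \<in> sets lebesgue"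
  shows "(LINT x|lebesgue_on S. f x) = (LINT x|lebesgue_on S. g x)"
    and "integrable (lebesgue_on S) f \<longleftrightarrow> integrable (lebesgue_on S) g"
proof -
  have N: "negligible {x \<in> S. f x \<noteq> g x}" by (rule AE_on_negligible[OF ae S])
  show i: "integrable (lebesgue_on S) f \<longleftrightarrow> integrable (lebesgue_on S) g"
    unfolding integrable_lebesgue_on_iff[OF S] by (rule absolutely_integrable_spike_eq[OF N]) auto
  show "(LINT x|lebesgue_on S. f x) = (LINT x|lebesgue_on S. g x)"
  proof (cases "integrable (lebesgue_on S) f")
    case True
    have "(LINT x|lebesgue_on S. f x) = integral S f" by (rule lebesgue_integral_eq_integral[OF True S])
    also have "\<dots> = integral S g" by (rule integral_spike[OF N]) auto
    also have "\<dots> = (LINT x|lebesgue_on S. g x)" using True i by (intro lebesgue_integral_eq_integral[OF _ S, symmetric]) simp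
    finally show ?thesis .
  qed (use i in \<open>simp add: not_integrable_integral_eq\<close>)
qed

locale ae_equal =
  fixes A B :: "real \<Rightarrow> real^2^2"
  assumes ae: "AE x in lebesgue_on {0<..}. A x = B x"
begin

lemma ae_on: "I \<subseteq> {0<..} \<Longrightarrow> I \<in> sets lebesgue \<Longrightarrow> AE x in lebesgue_on I. A x = B x"
  by (rule AE_lebesgue_on_subset[OF ae]) simp_all

lemma AE_cong_Ham:
  assumes "I \<subseteq> {0<..}" "I \<in> sets lebesgue" "\<And>x. A x = B x \<Longrightarrow> P x \<longleftrightarrow> Q x"
  shows "(AE x in lebesgue_on I. P x) \<longleftrightarrow> (AE x in lebesgue_on I. Q x)"
  by (intro iffI; rule AE_mp[OF ae_on[OF assms(1,2)]]) (auto elim!: eventually_mono simp: assms(3))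

lemma hinner_eq: "hinner A = hinner B"
proof (intro ext)
  fix f g
  have "AE x in lebesgue_on {0<..}. cdot (f x) (mact (A x) (g x)) = cdot (f x) (mact (B x) (g x))"
    using ae by eventually_elim simp
  then show "hinner A f g = hinner B f g" unfolding hinner_def by (rule lint_cong_AE) simp
qed

lemma hnorm_eq: "hnorm A = hnorm B"
  by (simp add: hnorm_def fun_eq_iff hinner_eq)

lemma wL2_eq: "weighted_L2 A = weighted_L2 B"
proof -
  have "integrable (lebesgue_on {0<..}) (\<lambda>x. cdot (f x) (mact (A x) (f x))) \<longleftrightarrow>
     integrable (lebesgue_on {0<..}) (\<lambda>x. cdot (f x) (mact (B x) (f x)))" for f
    by (rule lint_cong_AE(2)) (use ae in \<open>auto elim!: eventually_mono\<close>)
  then show ?thesis by (simp add: weighted_L2_def)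
qed

lemma weighted_eq_eq: "I \<subseteq> {0<..} \<Longrightarrow> I \<in> sets lebesgue \<Longrightarrow> weighted_eq A I = weighted_eq B I"
  unfolding weighted_eq_def fun_eq_iff by (intro allI AE_cong_Ham) simp_all

lemma indivisible_eq: "indivisible_on A I \<longleftrightarrow> indivisible_on B I"
proof -
  have "(AE x in lebesgue_on I. \<forall>v. A x *v v = (v \<bullet> e) *\<^sub>R e) \<longleftrightarrow> (AE x in lebesgue_on I. \<forall>v. B x *v v = (v \<bullet> e) *\<^sub>R e)"
    if "open I" "I \<subseteq> {0<..}" for e
    using that by (intro AE_cong_Ham) (auto intro: lmeasurable_iff_integrable)
  then show ?thesis unfolding indivisible_on_def by blast
qed

lemma singular_eq: "singular_interval A = singular_interval B"
  unfolding singular_interval_def fun_eq_iff indivisible_eq by simp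

lemma singular_sub: "singular_interval A I \<Longrightarrow> I \<subseteq> {0<..} \<and> I \<in> sets lebesgue"
  by (auto simp: singular_interval_def indivisible_on_def)

lemma H_space_eq: "H_space A = H_space B"
proof -
  have "weighted_eq A I = weighted_eq B I" if "singular_interval A I" for I
    using weighted_eq_eq[of I] singular_sub[OF that] by blast
  then show ?thesis unfolding H_space_def wL2_eq using singular_eq by auto
qed

lemma H_compact_eq: "H_compact A = H_compact B"
proof -
  have "weighted_eq A {b<..} = weighted_eq B {b<..}" if "b > 0" for b :: real
    using that by (intro weighted_eq_eq) auto
  then show ?thesis unfolding H_compact_def H_space_eq by auto
qed

lemma condition_L_eq: "condition_L A \<longleftrightarrow> condition_L B"
proof -
  have "(AE x in lebesgue_on {0<..<e}. A x = D) \<longleftrightarrow> (AE x in lebesgue_on {0<..<e}. B x = D)" for e :: real and D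
    by (intro AE_cong_Ham) auto
  then show ?thesis by (simp add: condition_L_def)
qed

lemma solves_J_eq: "solves_J Y (\<lambda>x. h x (A x)) \<longleftrightarrow> solves_J Y (\<lambda>x. h x (B x))"
  unfolding solves_J_def by (intro conj_cong refl AE_cong_Ham) simp_all

lemma canonical_solution_eq: "canonical_solution A = canonical_solution B"
  unfolding canonical_solution_def fun_eq_iff
  using solves_J_eq[of _ "\<lambda>x M. _ *s mact M (_ x)"] by blast

lemma canonical_operator_eq: "canonical_operator A = canonical_operator B"
  unfolding canonical_operator_def H_space_eq
  using solves_J_eq[of _ "\<lambda>x M. mact M (_ x)"] weighted_eq_eq[of "{0<..}"] by simp

lemma transform_eq: "transform A = transform B"
  by (simp add: transform_def fun_eq_iff hinner_eq)

lemma weyl_titchmarsh_eq: "weyl_titchmarsh A = weyl_titchmarsh B"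
  by (simp add: weyl_titchmarsh_def fun_eq_iff H_space_eq)

lemma transform_graph_eq: "transform_graph A = transform_graph B"
  by (simp add: transform_graph_def fun_eq_iff H_compact_eq transform_eq)

lemma graph_closure_eq: "graph_closure A = graph_closure B"
  by (simp add: graph_closure_def fun_eq_iff H_space_eq hnorm_eq)

lemma graph_adjoint_eq: "graph_adjoint A = graph_adjoint B"
  by (simp add: graph_adjoint_def fun_eq_iff H_space_eq hinner_eq)

lemma hilbert_isomorphism_eq: "hilbert_isomorphism A = hilbert_isomorphism B"
  by (simp add: hilbert_isomorphism_def fun_eq_iff H_space_eq hnorm_eq)

end

text \<open>On the exceptional null set and outside the half-line the value is half the identity
  matrix, which is symmetric, positive and of trace 1.\<close>

lemma hamiltonian_modification:
  assumes "hamiltonian A"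
  obtains B where "ham B" "AE x in lebesgue_on {0<..}. A x = B x"
proof
  define ok where "ok x \<longleftrightarrow> transpose (A x) = A x \<and> (\<forall>v. v \<bullet> (A x *v v) \<ge> 0) \<and> trace (A x) = 1" for x
  define S where "S = {x \<in> {0<..}. ok x}"
  define B where "B x = (if x \<in> S then A x else mat (1/2))" for x
  have ok: "AE x in lebesgue_on {0<..}. ok x"
    using assms unfolding hamiltonian_def ok_def by (auto elim!: eventually_elim2)
  have N: "negligible {x \<in> {0<..}. \<not> ok x}" by (rule AE_on_negligible[OF ok]) simp
  have "S = {0<..} - {x \<in> {0<..}. \<not> ok x}" by (auto simp: S_def)
  also have "\<dots> \<in> sets lebesgue" by (intro sets.Diff negligible_imp_sets[OF N]) simp
  finally have S: "S \<in> sets lebesgue" .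
  have mA: "A \<in> borel_measurable (lebesgue_on S)"
    using assms unfolding hamiltonian_def by (auto intro: measurable_restrict_mono simp: S_def)
  show "AE x in lebesgue_on {0<..}. A x = B x"
    using ok AE_space[of "lebesgue_on {0<..}"] by eventually_elim (simp add: B_def S_def space_restrict_space)
  show "ham B"
  proof
    have "(\<lambda>x. (if x \<in> S then A x else 0) + (if x \<in> S then 0 else mat (1/2))) \<in> borel_measurable lebesgue"
      by (intro borel_measurable_add borel_measurable_if_I mA S measurable_If_set) (simp_all add: S)
    moreover have "(\<lambda>x. (if x \<in> S then A x else 0) + (if x \<in> S then 0 else mat (1/2))) = B" by (auto simp: B_def)
    ultimately show "B \<in> borel_measurable lebesgue" by simp
    fix x and v :: "real^2"
    have d: "transpose (mat (1/2) :: real^2^2) = mat (1/2)" "trace (mat (1/2) :: real^2^2) = 1"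
      "0 \<le> v \<bullet> ((mat (1/2) :: real^2^2) *v v)"
      by (simp_all add: transpose_def mat_def vec_eq_iff trace_def sum_2 matrix_vector_mult_def inner_vec_def forall_2)
    show "transpose (B x) = B x" using d by (simp add: B_def S_def ok_def)
    show "0 \<le> v \<bullet> (B x *v v)" using d by (simp add: B_def S_def ok_def)
    show "trace (B x) = 1" using d by (simp add: B_def S_def ok_def)
  qed
qed

theorem theorem16:
  fixes Ham :: "real \<Rightarrow> real^2^2"
    and \<Theta> \<Phi> :: "real \<Rightarrow> complex \<Rightarrow> complex^2"
    and m :: "complex \<Rightarrow> complex"
    and \<mu> :: "real measure"
  assumes "hamiltonian Ham"
    and "condition_L Ham"
    and "\<forall>b>0. \<not> (\<exists>I. singular_interval Ham I \<and> {b<..} \<subseteq> I)"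
    and "\<forall>z. canonical_solution Ham z (vector [1, 0]) (\<lambda>x. \<Theta> x z)"
    and "\<forall>z. canonical_solution Ham z (vector [0, 1]) (\<lambda>x. \<Phi> x z)"
    and "weyl_titchmarsh Ham \<Theta> \<Phi> m"
    and "herglotz_measure m \<mu>"
  defines "U \<equiv> \<lambda>f t. transform Ham \<Theta> f (complex_of_real t)"
    and "Ubar \<equiv> graph_closure Ham \<mu> (transform_graph Ham \<Theta> \<mu>)"
  shows "(\<forall>f\<in>H_compact Ham. U f \<in> L2 \<mu> \<and> hnorm Ham f = L2_norm \<mu> (U f)) \<and>
         (\<forall>F\<in>L2 \<mu>. \<forall>\<epsilon>>0. \<exists>f\<in>H_compact Ham. L2_norm \<mu> (\<lambda>t. U f t - F t) < \<epsilon>) \<and>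
         hilbert_isomorphism Ham \<mu> Ubar \<and>
         canonical_operator Ham =
           Ubar O multiplication_operator \<mu> O graph_adjoint Ham \<mu> Ubar"
proof -
  obtain B where B: "ham B" "AE x in lebesgue_on {0<..}. Ham x = B x"
    by (rule hamiltonian_modification[OF assms(1)]) blast
  interpret ae_equal Ham B by unfold_locales (rule B(2))
  interpret ham B by (rule B(1))
  interpret herg B \<Theta> \<Phi> m \<mu>
  proof
    show "condition_L B" using assms(2) by (simp add: condition_L_eq)
    show "\<not> (\<exists>I. singular_interval B I \<and> {b<..} \<subseteq> I)" if "b > 0" for b
      using assms(3) that by (simp add: singular_eq)
    show "canonical_solution B z (vector [1, 0]) (\<lambda>x. \<Theta> x z)" "canonical_solution B z (vector [0, 1]) (\<lambda>x. \<Phi> x z)" for z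
      using assms(4,5) by (simp_all add: canonical_solution_eq)
    show "weyl_titchmarsh B \<Theta> \<Phi> m" using assms(6) by (simp add: weyl_titchmarsh_eq)
    show "herglotz_measure m \<mu>" by (rule assms(7))
  qed
  show ?thesis
    unfolding U_def Ubar_def H_compact_eq transform_eq hnorm_eq hilbert_isomorphism_eq canonical_operator_eq
      graph_closure_eq transform_graph_eq graph_adjoint_eq
    by (rule spectral_theorem)
qed

end
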